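(* For any constant $\kappa$ and any $\beta\le \kappa^{n^{\kappa}}$ (where $n$ is the number of input points), and for any dimension $d\ge 1$, unless $\mathsf{NP}=\mathsf{RP}$, there is no polynomial-time algorithm that approximates NUkC restricted to $\beta$-perturbation-resilient instances whose points lie in $d$-dimensional Euclidean space (with the Euclidean metric) within a factor of $\beta$.
   Context: NUkC with $t$ radii classes: given a finite set $P$ of $n$ points with a metric, distinct radii $r_1>r_2>\dots>r_t\ge 0$ and non-negative integers $k_1,\dots,k_t$ with $\sum_i k_i=k$, find the minimum dilation $\alpha$ such that one can choose, for each $i$, $k_i$ balls of radius $\alpha r_i$ centered at points of $P$ (balls consisting of points of $P$ within that distance) whose union is $P$ (a feasible placement with dilation $\alpha$). A clustering is a partition $\{C_1,\dots,C_k\}$ of $P$ such that some feasible placement has each $C_i$ contained in one of its balls; an optimal clustering is one induced by a minimum-dilation placement. A metric $d_1$ on $P$ is a $\psi$-perturbation of the metric $d$ if $d(p,q)/\psi\le d_1(p,q)\le d(p,q)$ for all $p,q$. The instance is $\psi$-perturbation-resilient ($\psi$-PR) if for every metric $\psi$-perturbation $d_1$ of $d$, the perturbed instance has a unique optimal clustering and it is identical to the unique optimal clustering of the original instance. *)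

theory Defs
  imports
    "HOL-Analysis.Analysis"
    "HOL-Library.Disjoint_Sets"
    "HOL-Computational_Algebra.Polynomial"
begin

section \<open>Deterministic multi-tape Turing machines\<close>

text \<open>
  States are \<open>0, \<dots>, tm_states - 1\<close>, the initial state is \<open>0\<close>, and the single halting state is
  \<open>tm_states\<close>. Tape symbols are \<open>0, \<dots>, tm_symbols - 1\<close>, where \<open>0\<close> is the blank and \<open>1\<close>, \<open>2\<close>
  stand for the bits \<open>False\<close>, \<open>True\<close>. Tapes are infinite in both directions. The transition
  function receives the state and the list of scanned symbols and returns the new state and, for
  every tape, the symbol to be written and the head movement.
\<close>

record tm =
  tm_tapes :: nat
  tm_states :: nat
  tm_symbols :: nat
  tm_delta :: "nat \<Rightarrow> nat list \<Rightarrow> nat \<times> (nat \<times> int) list"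

definition turing_machine :: "tm \<Rightarrow> bool" where
  "turing_machine M \<longleftrightarrow>
     1 \<le> tm_tapes M \<and> 3 \<le> tm_symbols M \<and>
     (\<forall>q ss. q < tm_states M \<and> length ss = tm_tapes M \<and> set ss \<subseteq> {..<tm_symbols M} \<longrightarrow>
       fst (tm_delta M q ss) \<le> tm_states M \<and>
       length (snd (tm_delta M q ss)) = tm_tapes M \<and>
       set (snd (tm_delta M q ss)) \<subseteq> {..<tm_symbols M} \<times> {- 1, 0, 1})"

type_synonym tape = "int \<times> (int \<Rightarrow> nat)"  \<comment> \<open>head position and contents\<close>

definition tm_step :: "tm \<Rightarrow> nat \<times> tape list \<Rightarrow> nat \<times> tape list" where
  "tm_step M = (\<lambda>(q, ts).
     if tm_states M \<le> q then (q, ts)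
     else let (q', as) = tm_delta M q (map (\<lambda>(h, t). t h) ts)
          in (q', map2 (\<lambda>(h, t) (s, m). (h + m, t(h := s))) ts as))"

definition bit_tape :: "bool list \<Rightarrow> int \<Rightarrow> nat" where
  "bit_tape x = (\<lambda>z. if 0 \<le> z \<and> nat z < length x then (if x ! nat z then 2 else 1) else 0)"

definition tm_init :: "tm \<Rightarrow> bool list \<Rightarrow> nat \<times> tape list" where
  "tm_init M x = (0, (0, bit_tape x) # replicate (tm_tapes M - 1) (0, bit_tape []))"

text \<open>The input is on the first tape, the output on the last one, both starting at cell \<open>0\<close>.\<close>

definition tm_outputs_within :: "tm \<Rightarrow> bool list \<Rightarrow> nat \<Rightarrow> bool list \<Rightarrow> bool" where
  "tm_outputs_within M x T y \<longleftrightarrow>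
     (\<exists>T'\<le>T. \<exists>ts. (tm_step M ^^ T') (tm_init M x) = (tm_states M, ts) \<and> snd (last ts) = bit_tape y)"


section \<open>The classes NP and RP\<close>

definition PTIME :: "bool list set set" where
  "PTIME = {A. \<exists>M (p :: nat poly). turing_machine M \<and>
     (\<forall>x. tm_outputs_within M x (poly p (length x)) [x \<in> A])}"

text \<open>Self-delimiting copy of a bit string, used to encode pairs of strings.\<close>

definition delim :: "bool list \<Rightarrow> bool list" where
  "delim x = concat (map (\<lambda>b. [True, b]) x) @ [False]"

definition pair_code :: "bool list \<Rightarrow> bool list \<Rightarrow> bool list" where
  "pair_code x w = delim x @ w"

definition NP :: "bool list set set" where
  "NP = {L. \<exists>A (p :: nat poly). A \<in> PTIME \<and>
     (\<forall>x. x \<in> L \<longleftrightarrow> (\<exists>w. length w = poly p (length x) \<and> pair_code x w \<in> A))}"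

text \<open>One-sided error: the random string \<open>w\<close> is uniform among those of length \<open>p(|x|)\<close>.\<close>

definition RP :: "bool list set set" where
  "RP = {L. \<exists>A (p :: nat poly). A \<in> PTIME \<and>
     (\<forall>x. let m = poly p (length x);
              prob = real (card {w. length w = m \<and> pair_code x w \<in> A}) / 2 ^ m
          in (x \<in> L \<longrightarrow> 1 / 2 \<le> prob) \<and> (x \<notin> L \<longrightarrow> prob = 0))}"


section \<open>Non-uniform k-center with t radii classes\<close>

text \<open>
  An instance consists of a finite metric space \<open>(P, d)\<close>, the list \<open>rs\<close> of radii
  \<open>r\<^sub>1 > \<dots> > r\<^sub>t\<close> and the list \<open>ks\<close> of the numbers \<open>k\<^sub>1, \<dots>, k\<^sub>t\<close>, with \<open>k = sum_list ks\<close>.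
\<close>

definition nukc_instance ::
  "'a set \<Rightarrow> ('a \<Rightarrow> 'a \<Rightarrow> real) \<Rightarrow> real list \<Rightarrow> nat list \<Rightarrow> bool" where
  "nukc_instance P d rs ks \<longleftrightarrow>
     finite P \<and> P \<noteq> {} \<and> Metric_space P d \<and>
     rs \<noteq> [] \<and> sorted_wrt (>) rs \<and> (\<forall>r\<in>set rs. 0 \<le> r) \<and> length ks = length rs"

text \<open>
  A placement is a list \<open>cs\<close> of lists of centers: \<open>cs ! i\<close> holds the centers, possibly with
  repetitions, of the balls of the \<open>i\<close>-th radius class.
\<close>

definition placement :: "'a set \<Rightarrow> nat list \<Rightarrow> 'a list list \<Rightarrow> bool" where
  "placement P ks cs \<longleftrightarrow> map length cs = ks \<and> (\<forall>c\<in>set cs. set c \<subseteq> P)"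

definition placed_balls ::
  "'a set \<Rightarrow> ('a \<Rightarrow> 'a \<Rightarrow> real) \<Rightarrow> real list \<Rightarrow> 'a list list \<Rightarrow> real \<Rightarrow> 'a set set" where
  "placed_balls P d rs cs \<alpha> =
     {Metric_space.mcball P d c (\<alpha> * rs ! i) | i c. i < length rs \<and> c \<in> set (cs ! i)}"

definition feasible ::
  "'a set \<Rightarrow> ('a \<Rightarrow> 'a \<Rightarrow> real) \<Rightarrow> real list \<Rightarrow> nat list \<Rightarrow> 'a list list \<Rightarrow> real \<Rightarrow> bool" where
  "feasible P d rs ks cs \<alpha> \<longleftrightarrow>
     0 \<le> \<alpha> \<and> placement P ks cs \<and> \<Union> (placed_balls P d rs cs \<alpha>) = P"

definition optimal ::
  "'a set \<Rightarrow> ('a \<Rightarrow> 'a \<Rightarrow> real) \<Rightarrow> real list \<Rightarrow> nat list \<Rightarrow> 'a list list \<Rightarrow> real \<Rightarrow> bool" where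
  "optimal P d rs ks cs \<alpha> \<longleftrightarrow>
     feasible P d rs ks cs \<alpha> \<and> (\<forall>cs' \<alpha>'. feasible P d rs ks cs' \<alpha>' \<longrightarrow> \<alpha> \<le> \<alpha>')"

definition induced_clustering ::
  "'a set \<Rightarrow> ('a \<Rightarrow> 'a \<Rightarrow> real) \<Rightarrow> real list \<Rightarrow> nat list \<Rightarrow> 'a list list \<Rightarrow> real \<Rightarrow>
   'a set set \<Rightarrow> bool" where
  "induced_clustering P d rs ks cs \<alpha> \<C> \<longleftrightarrow>
     partition_on P \<C> \<and> card \<C> = sum_list ks \<and>
     (\<forall>C\<in>\<C>. \<exists>B\<in>placed_balls P d rs cs \<alpha>. C \<subseteq> B)"

definition optimal_clusterings ::
  "'a set \<Rightarrow> ('a \<Rightarrow> 'a \<Rightarrow> real) \<Rightarrow> real list \<Rightarrow> nat list \<Rightarrow> 'a set set set" where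
  "optimal_clusterings P d rs ks =
     {\<C>. \<exists>cs \<alpha>. optimal P d rs ks cs \<alpha> \<and> induced_clustering P d rs ks cs \<alpha> \<C>}"

definition metric_perturbation ::
  "real \<Rightarrow> 'a set \<Rightarrow> ('a \<Rightarrow> 'a \<Rightarrow> real) \<Rightarrow> ('a \<Rightarrow> 'a \<Rightarrow> real) \<Rightarrow> bool" where
  "metric_perturbation \<psi> P d d1 \<longleftrightarrow>
     Metric_space P d1 \<and> (\<forall>p\<in>P. \<forall>q\<in>P. d p q / \<psi> \<le> d1 p q \<and> d1 p q \<le> d p q)"

definition perturbation_resilient ::
  "real \<Rightarrow> 'a set \<Rightarrow> ('a \<Rightarrow> 'a \<Rightarrow> real) \<Rightarrow> real list \<Rightarrow> nat list \<Rightarrow> bool" where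
  "perturbation_resilient \<psi> P d rs ks \<longleftrightarrow>
     (\<exists>\<C>. optimal_clusterings P d rs ks = {\<C>} \<and>
       (\<forall>d1. metric_perturbation \<psi> P d d1 \<longrightarrow> optimal_clusterings P d1 rs ks = {\<C>}))"


section \<open>Euclidean instances and their encoding\<close>

text \<open>
  Inputs of algorithms are finite objects, so coordinates and radii are rational. A point of
  \<open>D\<close>-dimensional space is the list of its \<open>D\<close> coordinates.
\<close>

definition euclid_dist :: "nat \<Rightarrow> rat list \<Rightarrow> rat list \<Rightarrow> real" where
  "euclid_dist D p q = L2_set (\<lambda>i. of_rat (p ! i) - of_rat (q ! i)) {..<D}"

definition euclidean_nukc_instance ::
  "nat \<Rightarrow> rat list list \<Rightarrow> rat list \<Rightarrow> nat list \<Rightarrow> bool" where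
  "euclidean_nukc_instance D ps rs ks \<longleftrightarrow>
     distinct ps \<and> (\<forall>p\<in>set ps. length p = D) \<and>
     nukc_instance (set ps) (euclid_dist D) (map of_rat rs) ks"

lemma Metric_space_euclid_dist:
  assumes "\<And>p. p \<in> P \<Longrightarrow> length p = D"
  shows "Metric_space P (euclid_dist D)"
proof
  fix p q :: "rat list"
  show "0 \<le> euclid_dist D p q"
    by (simp add: euclid_dist_def)
  show "euclid_dist D p q = euclid_dist D q p"
    by (simp add: euclid_dist_def L2_set_def power2_commute)
next
  fix p q assume "p \<in> P" "q \<in> P"
  then have "length p = D" "length q = D"
    using assms by auto
  then show "euclid_dist D p q = 0 \<longleftrightarrow> p = q"
    by (auto simp: euclid_dist_def L2_set_eq_0_iff list_eq_iff_nth_eq)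
next
  fix p q r :: "rat list"
  have "euclid_dist D p r =
      L2_set (\<lambda>i. (of_rat (p ! i) - of_rat (q ! i)) + (of_rat (q ! i) - of_rat (r ! i))) {..<D}"
    by (simp add: euclid_dist_def)
  also have "\<dots> \<le> euclid_dist D p q + euclid_dist D q r"
    unfolding euclid_dist_def by (rule L2_set_triangle_ineq)
  finally show "euclid_dist D p r \<le> euclid_dist D p q + euclid_dist D q r" .
qed

text \<open>Numbers are written in binary, least significant bit first; all codes are prefix-free.\<close>

fun binary_digits :: "nat \<Rightarrow> bool list" where
  "binary_digits n = (if n = 0 then [] else odd n # binary_digits (n div 2))"

declare binary_digits.simps [simp del]

definition enc_nat :: "nat \<Rightarrow> bool list" where
  "enc_nat n = delim (binary_digits n)"

definition enc_int :: "int \<Rightarrow> bool list" where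
  "enc_int z = (z < 0) # enc_nat (nat \<bar>z\<bar>)"

definition enc_rat :: "rat \<Rightarrow> bool list" where
  "enc_rat x = (case quotient_of x of (a, b) \<Rightarrow> enc_int a @ enc_int b)"

definition enc_list :: "('a \<Rightarrow> bool list) \<Rightarrow> 'a list \<Rightarrow> bool list" where
  "enc_list e xs = enc_nat (length xs) @ concat (map e xs)"

definition enc_instance :: "rat list list \<Rightarrow> rat list \<Rightarrow> nat list \<Rightarrow> bool list" where
  "enc_instance ps rs ks = enc_list (enc_list enc_rat) ps @ enc_list enc_rat rs @ enc_list enc_nat ks"

definition enc_placement :: "rat list list list \<Rightarrow> bool list" where
  "enc_placement cs = enc_list (enc_list (enc_list enc_rat)) cs"

definition prefix_free :: "('a \<Rightarrow> bool list) \<Rightarrow> bool" where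
  "prefix_free e \<longleftrightarrow> (\<forall>a b u v. e a @ u = e b @ v \<longrightarrow> a = b \<and> u = v)"

lemma prefix_freeD: "prefix_free e \<Longrightarrow> e a @ u = e b @ v \<Longrightarrow> a = b \<and> u = v"
  by (simp add: prefix_free_def)

lemma prefix_freeI:
  "(\<And>a b u v. e a @ u = e b @ v \<Longrightarrow> a = b \<and> u = v) \<Longrightarrow> prefix_free e"
  unfolding prefix_free_def by blast

lemma prefix_free_delim: "prefix_free delim"
proof -
  have "delim a @ u = delim b @ v \<Longrightarrow> a = b \<and> u = v" for a b u v
  proof (induction a arbitrary: b)
    case Nil
    then show ?case by (cases b) (auto simp: delim_def)
  next
    case (Cons x a)
    then show ?case by (cases b) (auto simp: delim_def)
  qed
  then show ?thesis by (rule prefix_freeI)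
qed

lemma binary_inject: "binary_digits m = binary_digits n \<Longrightarrow> m = n"
proof (induction m arbitrary: n rule: less_induct)
  case (less m)
  show ?case
  proof (cases "m = 0 \<or> n = 0")
    case True
    then show ?thesis
      using less.prems by (auto simp: binary_digits.simps[of m] binary_digits.simps[of n] split: if_splits)
  next
    case False
    then have "odd m = odd n" "binary_digits (m div 2) = binary_digits (n div 2)"
      using less.prems by (auto simp: binary_digits.simps[of m] binary_digits.simps[of n])
    moreover from this have "m div 2 = n div 2"
      using less.IH[of "m div 2"] False by auto
    ultimately show ?thesis by (metis bit_eq_rec)
  qed
qed

lemma prefix_free_enc_nat: "prefix_free enc_nat"
proof (rule prefix_freeI)
  fix a b u v
  assume "enc_nat a @ u = enc_nat b @ v"
  then have "binary_digits a = binary_digits b \<and> u = v"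
    unfolding enc_nat_def by (rule prefix_freeD[OF prefix_free_delim])
  then show "a = b \<and> u = v"
    using binary_inject by simp
qed

lemma prefix_free_enc_int: "prefix_free enc_int"
proof (rule prefix_freeI)
  fix a b u v
  assume *: "enc_int a @ u = enc_int b @ v"
  then have "enc_nat (nat \<bar>a\<bar>) @ u = enc_nat (nat \<bar>b\<bar>) @ v"
    by (simp add: enc_int_def)
  then have "nat \<bar>a\<bar> = nat \<bar>b\<bar> \<and> u = v"
    by (rule prefix_freeD[OF prefix_free_enc_nat])
  moreover have "a < 0 \<longleftrightarrow> b < 0"
    using * by (simp add: enc_int_def)
  ultimately show "a = b \<and> u = v"
    by linarith
qed

lemma prefix_free_enc_rat: "prefix_free enc_rat"
proof -
  have "a = b \<and> u = v" if "enc_rat a @ u = enc_rat b @ v" for a b u v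
  proof -
    obtain m n where a: "quotient_of a = (m, n)" by fastforce
    obtain m' n' where b: "quotient_of b = (m', n')" by fastforce
    from that have "enc_int m @ enc_int n @ u = enc_int m' @ enc_int n' @ v"
      by (simp add: enc_rat_def a b)
    then have "m = m'" "enc_int n @ u = enc_int n' @ v"
      using prefix_freeD[OF prefix_free_enc_int, of m "enc_int n @ u" m' "enc_int n' @ v"] by simp_all
    then have "quotient_of a = quotient_of b" "u = v"
      using prefix_freeD[OF prefix_free_enc_int, of n u n' v] a b by simp_all
    then show ?thesis by (metis quotient_of_inject)
  qed
  then show ?thesis by (rule prefix_freeI)
qed

lemma prefix_free_enc_list:
  assumes e: "prefix_free e"
  shows "prefix_free (enc_list e)"
proof -
  have *: "length xs = length ys \<Longrightarrow> concat (map e xs) @ u = concat (map e ys) @ v \<Longrightarrow>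
      xs = ys \<and> u = v" for xs ys u v
  proof (induction xs ys rule: list_induct2)
    case Nil
    then show ?case by simp
  next
    case (Cons x xs y ys)
    then show ?case using prefix_freeD[OF e, of x _ y] by auto
  qed
  have "xs = ys \<and> u = v" if "enc_list e xs @ u = enc_list e ys @ v" for xs ys u v
  proof -
    have "length xs = length ys \<and> concat (map e xs) @ u = concat (map e ys) @ v"
      using that prefix_freeD[OF prefix_free_enc_nat] unfolding enc_list_def append_assoc by blast
    with * show ?thesis by blast
  qed
  then show ?thesis by (rule prefix_freeI)
qed

lemma enc_instance_inject:
  assumes "enc_instance ps rs ks = enc_instance ps' rs' ks'"
  shows "ps = ps' \<and> rs = rs' \<and> ks = ks'"
proof -
  note rats = prefix_free_enc_list[OF prefix_free_enc_rat]
  have 1: "ps = ps' \<and> enc_list enc_rat rs @ enc_list enc_nat ks = enc_list enc_rat rs' @ enc_list enc_nat ks'"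
    using assms unfolding enc_instance_def by (rule prefix_freeD[OF prefix_free_enc_list[OF rats]])
  then have 2: "rs = rs' \<and> enc_list enc_nat ks = enc_list enc_nat ks'"
    by (intro prefix_freeD[OF rats]) simp
  then have "ks = ks'"
    using prefix_freeD[OF prefix_free_enc_list[OF prefix_free_enc_nat], of ks "[]" ks' "[]"] by simp
  with 1 2 show ?thesis by simp
qed

lemma inj_enc_placement: "inj enc_placement"
proof (rule injI)
  fix cs cs'
  assume "enc_placement cs = enc_placement cs'"
  then have "enc_placement cs @ [] = enc_placement cs' @ []"
    by simp
  then show "cs = cs'"
    unfolding enc_placement_def
    using prefix_freeD[OF prefix_free_enc_list[OF prefix_free_enc_list[OF
          prefix_free_enc_list[OF prefix_free_enc_rat]]]] by blast
qed


section \<open>Approximation algorithms\<close>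

text \<open>
  \<open>M\<close> has to run in polynomial time and be correct only on the instances in the restricted class;
  its behaviour on other inputs is arbitrary. It outputs a placement whose balls cover all points
  at some dilation of at most \<open>\<beta>(n)\<close> times the minimum one, \<open>n\<close> being the number of points.
\<close>

definition poly_time_approximates_euclidean_PR_nukc :: "tm \<Rightarrow> nat \<Rightarrow> (nat \<Rightarrow> real) \<Rightarrow> bool" where
  "poly_time_approximates_euclidean_PR_nukc M D \<beta> \<longleftrightarrow>
     turing_machine M \<and>
     (\<exists>p :: nat poly. \<forall>ps rs ks.
       euclidean_nukc_instance D ps rs ks \<and>
       perturbation_resilient (\<beta> (length ps)) (set ps) (euclid_dist D) (map of_rat rs) ks \<longrightarrow>
       (\<exists>cs \<alpha>.
         tm_outputs_within M (enc_instance ps rs ks)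
           (poly p (length (enc_instance ps rs ks))) (enc_placement cs) \<and>
         feasible (set ps) (euclid_dist D) (map of_rat rs) ks cs \<alpha> \<and>
         (\<forall>cs\<^sub>0 \<alpha>\<^sub>0. optimal (set ps) (euclid_dist D) (map of_rat rs) ks cs\<^sub>0 \<alpha>\<^sub>0 \<longrightarrow>
           \<alpha> \<le> \<beta> (length ps) * \<alpha>\<^sub>0)))"

end

theory Submission
  imports Defs
begin

text \<open>
  An approximation algorithm is turned into a one-sided error algorithm for a verifier \<open>A\<close> that accepts
  witnesses of length \<open>m\<close>. Random weights of polynomial size isolate, with probability at least one half,
  a unique lightest witness \<open>u\<close> of weight at most some \<open>W\<close>. The computation of \<open>A\<close> is a tableau; choosing
  one option per cell without local conflicts and with total weight at most \<open>W\<close> is a packing problem whose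
  only solution comes from \<open>u\<close>.

  A packing problem becomes a set of points on a line: every slot of every constraint is a cluster of \<open>K\<close>
  points, the clusters of an item form a group, and the scales of points, clusters and groups differ by
  more than the approximation factor. The large balls cover the groups of the unselected items. For
  each constraint, the slots that count towards it and the other slots have radius classes of their own;
  the numbers of balls are the budget of the constraint and its complement. As \<open>K\<close> exceeds the total
  number of small balls, every cover within the factor selects a solution of the packing problem. Hence
  a unique solution makes the instance perturbation-resilient, and any approximate placement reveals \<open>u\<close>,
  which \<open>A\<close> then verifies.
  The values \<open>W\<close> are tried one after another, and since every answer is verified, wrong outputs on
  instances outside the class do no harm.

  The factor may be exponential in a polynomial of the number of points because the coordinates
  \<open>2\<^sup>a + 2\<^sup>b + 2\<^sup>c + 2\<^sup>e\<close> may have polynomially many binary digits; the exponent \<open>c\<close> names the item of the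
  point and is read off the output placement at a fixed offset.
\<close>

section \<open>Structured programs on tapes\<close>

text \<open>Resilience entails a unique optimal clustering, so hardness must be transferred from
  instances with a single solution. Randomness serves only to create such instances, hence RP, and
  every later step has to keep the number of solutions; tableaux qualify because the witness fixes
  every cell. The random weights stay outside the verifier: bounding the total weight is one more
  packing constraint. This is why a weight is a count of random bits, which the slots of an item can
  express, and why polynomially many thresholds suffice. A ball can stand in for a smaller one but
  not for a larger one. A single radius class per constraint would therefore not bound anything; the
  complementary class makes the total number of small balls tight, and tightness turns the number of
  larger balls into an upper bound. \<open>PTIME\<close> speaks of concrete machines, so the
  reduction is itself programmed, in expressions whose loops run over unary numbers, compiled to
  while programs on tapes. A foreign machine can be called as a subroutine because its run is
  recorded and then undone, which clears tapes whose contents are unknown.\<close>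

type_synonym store = "nat \<Rightarrow> tape"

datatype com =
    Act "(nat \<Rightarrow> nat) \<Rightarrow> nat \<Rightarrow> nat \<times> int"
  | Seq com com (infixr ";;" 60)
  | Cond "(nat \<Rightarrow> nat) \<Rightarrow> bool" com com
  | While "(nat \<Rightarrow> nat) \<Rightarrow> bool" com

definition view :: "nat \<Rightarrow> store \<Rightarrow> nat \<Rightarrow> nat" where
  "view K \<sigma> r = (if r < K then snd (\<sigma> r) (fst (\<sigma> r)) else 0)"

definition upd_tape :: "tape \<Rightarrow> nat \<times> int \<Rightarrow> tape" where
  "upd_tape tp a = (fst tp + snd a, (snd tp)(fst tp := fst a))"

definition act :: "nat \<Rightarrow> ((nat \<Rightarrow> nat) \<Rightarrow> nat \<Rightarrow> nat \<times> int) \<Rightarrow> store \<Rightarrow> store" where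
  "act K F \<sigma> r = (if r < K then upd_tape (\<sigma> r) (F (view K \<sigma>) r) else \<sigma> r)"

inductive runs :: "nat \<Rightarrow> com \<Rightarrow> store \<Rightarrow> nat \<Rightarrow> store \<Rightarrow> bool" for K where
  Act: "runs K (Act F) \<sigma> 1 (act K F \<sigma>)"
| Seq: "runs K c1 \<sigma> t1 \<sigma>1 \<Longrightarrow> runs K c2 \<sigma>1 t2 \<sigma>2 \<Longrightarrow> runs K (c1 ;; c2) \<sigma> (t1 + t2) \<sigma>2"
| CondT: "b (view K \<sigma>) \<Longrightarrow> runs K c1 \<sigma> t \<sigma>1 \<Longrightarrow> runs K (Cond b c1 c2) \<sigma> (1 + t) \<sigma>1"
| CondF: "\<not> b (view K \<sigma>) \<Longrightarrow> runs K c2 \<sigma> t \<sigma>1 \<Longrightarrow> runs K (Cond b c1 c2) \<sigma> (1 + t) \<sigma>1"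
| WhileF: "\<not> b (view K \<sigma>) \<Longrightarrow> runs K (While b c) \<sigma> 1 \<sigma>"
| WhileT: "b (view K \<sigma>) \<Longrightarrow> runs K c \<sigma> t \<sigma>1 \<Longrightarrow> runs K (While b c) \<sigma>1 t' \<sigma>2 \<Longrightarrow>
    runs K (While b c) \<sigma> (1 + t + t') \<sigma>2"

fun csize :: "com \<Rightarrow> nat" where
  "csize (Act F) = 1"
| "csize (c1 ;; c2) = csize c1 + csize c2"
| "csize (Cond b c1 c2) = 1 + csize c1 + csize c2"
| "csize (While b c) = 1 + csize c"

text \<open>Transition table of a program that occupies the states from \<open>s\<close> on and exits to \<open>e\<close>.\<close>

fun code :: "com \<Rightarrow> nat \<Rightarrow> nat \<Rightarrow> nat \<Rightarrow> (nat \<Rightarrow> nat) \<Rightarrow> nat \<times> (nat \<Rightarrow> nat \<times> int)" where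
  "code (Act F) s e q v = (e, F v)"
| "code (c1 ;; c2) s e q v =
     (if q < s + csize c1 then code c1 s (s + csize c1) q v else code c2 (s + csize c1) e q v)"
| "code (Cond b c1 c2) s e q v =
     (if q = s then (if b v then s + 1 else s + 1 + csize c1, \<lambda>r. (v r, 0))
      else if q < s + 1 + csize c1 then code c1 (s + 1) e q v
      else code c2 (s + 1 + csize c1) e q v)"
| "code (While b c) s e q v =
     (if q = s then (if b v then s + 1 else e, \<lambda>r. (v r, 0)) else code c (s + 1) s q v)"

lemma csize_pos [simp]: "0 < csize c"
  by (induction c) auto

text \<open>The table and the number of states are arbitrary, so that a program fragment can be
  analysed inside the table of a larger program.\<close>

definition gstep :: "nat \<Rightarrow> nat \<Rightarrow> (nat \<Rightarrow> (nat \<Rightarrow> nat) \<Rightarrow> nat \<times> (nat \<Rightarrow> nat \<times> int)) \<Rightarrow>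
    nat \<times> store \<Rightarrow> nat \<times> store" where
  "gstep K n \<delta> = (\<lambda>(q, \<sigma>). if n \<le> q then (q, \<sigma>)
     else (fst (\<delta> q (view K \<sigma>)), act K (\<lambda>v. snd (\<delta> q v)) \<sigma>))"

lemma act_stay: "act K (\<lambda>v r. (v r, 0)) \<sigma> = \<sigma>"
  by (auto simp: act_def upd_tape_def view_def fun_eq_iff prod_eq_iff)

lemma funpow_trans: "(f ^^ a) x = y \<Longrightarrow> (f ^^ b) y = z \<Longrightarrow> (f ^^ (a + b)) x = z"
  by (subst add.commute) (simp add: funpow_add)

text \<open>Entry and exit are arbitrary, and the table is prescribed only between \<open>s\<close>
  and \<open>s + csize c\<close>: the body of a loop exits backwards to its test, and the first
  branch of a conditional exits beyond the second one.\<close>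

lemma gstep_runs:
  assumes "runs K c \<sigma> t \<sigma>'" "s + csize c \<le> n"
    "\<And>q v. s \<le> q \<Longrightarrow> q < s + csize c \<Longrightarrow> \<delta> q v = code c s e q v"
  shows "(gstep K n \<delta> ^^ t) (s, \<sigma>) = (e, \<sigma>')"
  using assms
proof (induction arbitrary: s e rule: runs.induct)
  case (Act F \<sigma>)
  then show ?case by (simp add: gstep_def)
next
  case (Seq c1 \<sigma> t1 \<sigma>1 c2 t2 \<sigma>2)
  have "(gstep K n \<delta> ^^ t1) (s, \<sigma>) = (s + csize c1, \<sigma>1)"
    using Seq.prems by (intro Seq.IH(1)) auto
  moreover have "(gstep K n \<delta> ^^ t2) (s + csize c1, \<sigma>1) = (e, \<sigma>2)"
    using Seq.prems by (intro Seq.IH(2)) auto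
  ultimately show ?case by (rule funpow_trans)
next
  case (CondT b \<sigma> c1 t \<sigma>1 c2)
  have "(gstep K n \<delta> ^^ 1) (s, \<sigma>) = (s + 1, \<sigma>)"
    using CondT.prems CondT.hyps by (simp add: gstep_def act_stay)
  moreover have "(gstep K n \<delta> ^^ t) (s + 1, \<sigma>) = (e, \<sigma>1)"
    using CondT.prems by (intro CondT.IH) auto
  ultimately show ?case by (rule funpow_trans)
next
  case (CondF b \<sigma> c2 t \<sigma>1 c1)
  have "(gstep K n \<delta> ^^ 1) (s, \<sigma>) = (s + 1 + csize c1, \<sigma>)"
    using CondF.prems CondF.hyps by (simp add: gstep_def act_stay)
  moreover have "(gstep K n \<delta> ^^ t) (s + 1 + csize c1, \<sigma>) = (e, \<sigma>1)"
    using CondF.prems by (intro CondF.IH) auto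
  ultimately show ?case by (rule funpow_trans)
next
  case (WhileF b \<sigma> c)
  then show ?case by (simp add: gstep_def act_stay)
next
  case (WhileT b \<sigma> c t \<sigma>1 t' \<sigma>2)
  have "(gstep K n \<delta> ^^ 1) (s, \<sigma>) = (s + 1, \<sigma>)"
    using WhileT.prems WhileT.hyps by (simp add: gstep_def act_stay)
  moreover have "(gstep K n \<delta> ^^ t) (s + 1, \<sigma>) = (s, \<sigma>1)"
    using WhileT.prems by (intro WhileT.IH(1)) auto
  moreover have "(gstep K n \<delta> ^^ t') (s, \<sigma>1) = (e, \<sigma>2)"
    using WhileT.prems by (intro WhileT.IH(2)) auto
  ultimately show ?case by (rule funpow_trans[OF funpow_trans])
qed

section \<open>Well-formed programs and their Turing machines\<close>

definition valid_act :: "nat \<Rightarrow> (nat \<Rightarrow> nat \<times> int) \<Rightarrow> bool" where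
  "valid_act S a \<longleftrightarrow> (\<forall>r. fst (a r) < S \<and> snd (a r) \<in> {- 1, 0, 1})"

fun wfc :: "nat \<Rightarrow> com \<Rightarrow> bool" where
  "wfc S (Act F) \<longleftrightarrow> (\<forall>v. (\<forall>r. v r < S) \<longrightarrow> valid_act S (F v))"
| "wfc S (c1 ;; c2) \<longleftrightarrow> wfc S c1 \<and> wfc S c2"
| "wfc S (Cond b c1 c2) \<longleftrightarrow> wfc S c1 \<and> wfc S c2"
| "wfc S (While b c) \<longleftrightarrow> wfc S c"

lemma code_valid:
  assumes "wfc S c" "s \<le> q" "q < s + csize c" "\<And>r. v r < S"
  shows "fst (code c s e q v) \<le> max e (s + csize c)" "valid_act S (snd (code c s e q v))"
proof -
  have "fst (code c s e q v) \<le> max e (s + csize c) \<and> valid_act S (snd (code c s e q v))"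
    using assms
  proof (induction c arbitrary: s e)
    case (Seq c1 c2)
    show ?case
    proof (cases "q < s + csize c1")
      case True
      then show ?thesis using Seq.IH(1)[of s "s + csize c1"] Seq.prems by auto
    next
      case False
      then show ?thesis using Seq.IH(2)[of "s + csize c1" e] Seq.prems by (auto simp: add.assoc)
    qed
  next
    case (Cond b c1 c2)
    show ?case
    proof (cases "q = s")
      case True
      then show ?thesis using Cond.prems by (auto simp: valid_act_def)
    next
      case False
      then show ?thesis
        using Cond.IH(1)[of "Suc s" e] Cond.IH(2)[of "Suc s + csize c1" e] Cond.prems
        by (cases "q < s + 1 + csize c1") (auto simp: add_ac)
    qed
  next
    case (While b c)
    show ?case
    proof (cases "q = s")
      case True
      then show ?thesis using While.prems by (auto simp: valid_act_def)
    next
      case False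
      then show ?thesis using While.IH[of "Suc s" s] While.prems by auto
    qed
  qed auto
  then show "fst (code c s e q v) \<le> max e (s + csize c)" "valid_act S (snd (code c s e q v))" by auto
qed

definition tm_of :: "nat \<Rightarrow> nat \<Rightarrow> com \<Rightarrow> tm" where
  "tm_of K S c = \<lparr> tm_tapes = K, tm_states = csize c, tm_symbols = S,
     tm_delta = (\<lambda>q ss. let d = code c 0 (csize c) q (\<lambda>r. if r < K then ss ! r else 0)
       in (fst d, map (snd d) [0..<K])) \<rparr>"

lemma turing_machine_tm_of:
  assumes "wfc S c" "1 \<le> K" "3 \<le> S"
  shows "turing_machine (tm_of K S c)"
proof -
  have "fst (tm_delta (tm_of K S c) q ss) \<le> csize c \<and>
      set (snd (tm_delta (tm_of K S c) q ss)) \<subseteq> {..<S} \<times> {- 1, 0, 1}"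
    if "q < csize c" "length ss = K" "set ss \<subseteq> {..<S}" for q ss
  proof -
    let ?v = "\<lambda>r. if r < K then ss ! r else 0"
    have v: "?v r < S" for r
      using that assms(3) by (auto simp: subset_iff)
    from code_valid[OF assms(1), of 0 q ?v "csize c"] v that show ?thesis
      by (auto simp: tm_of_def Let_def valid_act_def image_subset_iff mem_Times_iff)
  qed
  then show ?thesis
    using assms by (auto simp: turing_machine_def tm_of_def Let_def)
qed

lemma tm_step_tm_of:
  "tm_step (tm_of K S c) (q, map \<sigma> [0..<K]) =
   (let (q', \<sigma>') = gstep K (csize c) (code c 0 (csize c)) (q, \<sigma>) in (q', map \<sigma>' [0..<K]))"
proof -
  have "(\<lambda>r. if r < K then map ((\<lambda>(h, t). t h) \<circ> \<sigma>) [0..<K] ! r else 0) = view K \<sigma>"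
    by (auto simp: view_def fun_eq_iff split: prod.splits)
  moreover have "map2 (\<lambda>(h, t) (s, m). (h + m, t(h := s))) (map \<sigma> [0..<K]) (map f [0..<K]) =
      map (\<lambda>r. upd_tape (\<sigma> r) (f r)) [0..<K]" for f
    by (rule nth_equalityI) (auto simp: upd_tape_def split: prod.splits)
  ultimately show ?thesis
    by (auto simp: tm_step_def tm_of_def gstep_def Let_def act_def)
qed

lemma tm_steps_tm_of:
  "(tm_step (tm_of K S c) ^^ t) (q, map \<sigma> [0..<K]) =
   (let (q', \<sigma>') = (gstep K (csize c) (code c 0 (csize c)) ^^ t) (q, \<sigma>) in (q', map \<sigma>' [0..<K]))"
proof (induction t)
  case (Suc t)
  then show ?case
    by (cases "(gstep K (csize c) (code c 0 (csize c)) ^^ t) (q, \<sigma>)") (simp add: tm_step_tm_of)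
qed simp

text \<open>The machine has no tapes from \<open>K\<close> on. With their heads at
  \<open>- 1\<close> they count as empty stacks, so that the whole store, and not only its first
  \<open>K\<close> tapes, can be brought into the form \<open>bits\<close>.\<close>

definition init_store :: "nat \<Rightarrow> bool list \<Rightarrow> store" where
  "init_store K x r = (if r < K then 0 else - 1, bit_tape (if r = 0 then x else []))"

lemma PTIME_I:
  fixes p :: "nat poly"
  assumes "wfc S c" "1 \<le> K" "3 \<le> S"
    and "\<And>x. \<exists>t \<sigma>. t \<le> poly p (length x) \<and> runs K c (init_store K x) t \<sigma> \<and>
           snd (\<sigma> (K - 1)) = bit_tape [x \<in> A]"
  shows "A \<in> PTIME"
proof -
  have "tm_outputs_within (tm_of K S c) x (poly p (length x)) [x \<in> A]" for x
  proof -
    obtain t \<sigma> where t: "t \<le> poly p (length x)" "runs K c (init_store K x) t \<sigma>"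
      "snd (\<sigma> (K - 1)) = bit_tape [x \<in> A]"
      using assms(4) by blast
    have "tm_init (tm_of K S c) x = (0, map (init_store K x) [0..<K])"
    proof -
      have "(0, bit_tape x) # replicate (K - 1) (0, bit_tape []) = map (init_store K x) [0..<K]"
      proof (rule nth_equalityI)
        fix i assume i: "i < length ((0 :: int, bit_tape x) # replicate (K - 1) (0, bit_tape []))"
        then show "((0, bit_tape x) # replicate (K - 1) (0, bit_tape [])) ! i =
            map (init_store K x) [0..<K] ! i"
          using assms(2) by (cases i) (auto simp: init_store_def)
      qed (use assms(2) in simp)
      then show ?thesis by (simp add: tm_init_def tm_of_def)
    qed
    moreover have "(gstep K (csize c) (code c 0 (csize c)) ^^ t) (0, init_store K x) = (csize c, \<sigma>)"
      using t(2) by (rule gstep_runs) auto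
    ultimately have "(tm_step (tm_of K S c) ^^ t) (tm_init (tm_of K S c) x) = (csize c, map \<sigma> [0..<K])"
      by (simp add: tm_steps_tm_of)
    moreover have "last (map \<sigma> [0..<K]) = \<sigma> (K - 1)"
      using assms(2) by (simp add: last_map)
    ultimately show ?thesis
      using t unfolding tm_outputs_within_def
      by (intro exI[of _ t] conjI exI[of _ "map \<sigma> [0..<K]"]) (simp_all add: tm_of_def)
  qed
  then show ?thesis
    using turing_machine_tm_of[OF assms(1-3)] unfolding PTIME_def by blast
qed

section \<open>Tapes as stacks\<close>

text \<open>The head scans the top element, or cell \<open>-1\<close> if the stack is empty.\<close>

definition stack_tape :: "nat list \<Rightarrow> tape" where
  "stack_tape xs = (int (length xs) - 1, \<lambda>z. if 0 \<le> z \<and> nat z < length xs then rev xs ! nat z else 0)"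

definition peek :: "nat list \<Rightarrow> nat" where
  "peek xs = (case xs of [] \<Rightarrow> 0 | x # _ \<Rightarrow> x)"

lemma peek_simps [simp]: "peek [] = 0" "peek (x # xs) = x"
  by (simp_all add: peek_def)

lemma scan_stack [simp]: "snd (stack_tape xs) (fst (stack_tape xs)) = peek xs"
  by (cases xs) (auto simp: stack_tape_def nth_append)

lemma upd_stack_same [simp]: "upd_tape (stack_tape xs) (peek xs, 0) = stack_tape xs"
  using scan_stack[of xs] by (auto simp: upd_tape_def prod_eq_iff)

lemma upd_stack_same_Nil [simp]: "upd_tape (stack_tape []) (0, 0) = stack_tape []"
  using upd_stack_same[of "[]"] by simp

lemma upd_stack_push [simp]:
  "upd_tape (upd_tape (stack_tape xs) (peek xs, 1)) (a, 0) = stack_tape (a # xs)"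
proof -
  have "upd_tape (stack_tape xs) (peek xs, 1) = (int (length xs), snd (stack_tape xs))"
    using scan_stack[of xs] by (auto simp: upd_tape_def prod_eq_iff) (simp add: stack_tape_def)
  moreover have "(snd (stack_tape xs))(int (length xs) := a) = snd (stack_tape (a # xs))"
    by (auto simp: stack_tape_def fun_eq_iff nth_append)
  ultimately show ?thesis by (auto simp: upd_tape_def prod_eq_iff) (simp add: stack_tape_def)
qed

lemma upd_stack_pop [simp]: "upd_tape (stack_tape (x # xs)) (0, - 1) = stack_tape xs"
  by (auto simp: upd_tape_def stack_tape_def prod_eq_iff fun_eq_iff nth_append)

lemma upd_stack_replace [simp]: "upd_tape (stack_tape (x # xs)) (a, 0) = stack_tape (a # xs)"
  by (auto simp: upd_tape_def stack_tape_def prod_eq_iff fun_eq_iff nth_append)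

lemma upd_stack_same_Cons [simp]: "upd_tape (stack_tape (x # xs)) (x, 0) = stack_tape (x # xs)"
  using upd_stack_same[of "x # xs"] by simp

definition stacks :: "(nat \<Rightarrow> nat list) \<Rightarrow> store" where
  "stacks \<rho> r = stack_tape (\<rho> r)"

lemma view_stacks [simp]: "view K (stacks \<rho>) r = (if r < K then peek (\<rho> r) else 0)"
  by (simp add: view_def stacks_def)

text \<open>The stores at the loop head are given as an explicit sequence instead of an invariant.
  This fixes the number of rounds, and the time bound follows from one bound for the body.\<close>

lemma runs_While:
  assumes "\<And>i. i < n \<Longrightarrow> b (view K (\<sigma> i))"
    and "\<And>i. i < n \<Longrightarrow> \<exists>t\<le>B. runs K c (\<sigma> i) t (\<sigma> (Suc i))"
    and "\<not> b (view K (\<sigma> n))"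
  shows "\<exists>t\<le>n * (B + 1) + 1. runs K (While b c) (\<sigma> 0) t (\<sigma> n)"
proof -
  have "\<exists>t\<le>(n - i) * (B + 1) + 1. runs K (While b c) (\<sigma> i) t (\<sigma> n)" if "i \<le> n" for i
    using that
  proof (induction "n - i" arbitrary: i)
    case 0
    then show ?case using WhileF[where b = b and c = c, OF assms(3)] by auto
  next
    case (Suc m)
    then have i: "i < n" "m = n - Suc i" by auto
    obtain t where t: "t \<le> B" "runs K c (\<sigma> i) t (\<sigma> (Suc i))"
      using assms(2) i by blast
    obtain t' where t': "t' \<le> (n - Suc i) * (B + 1) + 1" "runs K (While b c) (\<sigma> (Suc i)) t' (\<sigma> n)"
      using Suc.hyps(1)[OF i(2)] i by auto
    have "runs K (While b c) (\<sigma> i) (1 + t + t') (\<sigma> n)"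
      using WhileT[where b = b and c = c, OF assms(1)[OF i(1)] t(2) t'(2)] .
    moreover have "1 + t + t' \<le> (n - i) * (B + 1) + 1"
    proof -
      have "n - i = Suc (n - Suc i)" using i by simp
      then show ?thesis using t t' by simp
    qed
    ultimately show ?case by blast
  qed
  from this[of 0] show ?thesis by simp
qed

lemma runs_Seq_le:
  "\<exists>t\<le>a. runs K c1 \<sigma> t \<sigma>1 \<Longrightarrow> \<exists>t\<le>b. runs K c2 \<sigma>1 t \<sigma>2 \<Longrightarrow> \<exists>t\<le>a + b. runs K (c1 ;; c2) \<sigma> t \<sigma>2"
  by (meson Seq add_mono)

lemma runs_Act_le: "act K F \<sigma> = \<sigma>' \<Longrightarrow> \<exists>t\<le>1. runs K (Act F) \<sigma> t \<sigma>'"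
  using Act by blast

lemma runs_Act2_le:
  "act K G (act K F \<sigma>) = \<sigma>' \<Longrightarrow> \<exists>t\<le>2. runs K (Act F ;; Act G) \<sigma> t \<sigma>'"
  using runs_Seq_le[OF runs_Act_le[OF refl] runs_Act_le] by (metis one_add_one)

lemma runs_le_mono: "\<exists>t\<le>a. runs K c \<sigma> t \<sigma>' \<Longrightarrow> a \<le> b \<Longrightarrow> \<exists>t\<le>b. runs K c \<sigma> t \<sigma>'"
  by (meson le_trans)

text \<open>Moves the stack \<open>s\<close>, in reversed order and mapped by \<open>g\<close>, onto all stacks in \<open>ds\<close>.\<close>

definition xfer :: "(nat \<Rightarrow> nat) \<Rightarrow> nat \<Rightarrow> nat set \<Rightarrow> com" where
  "xfer g s ds = While (\<lambda>v. v s \<noteq> 0)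
     (Act (\<lambda>v r. (v r, if r \<in> ds then 1 else 0)) ;;
      Act (\<lambda>v r. if r \<in> ds then (g (v s), 0) else if r = s then (0, - 1) else (v r, 0)))"

lemma wfc_xfer: "(\<And>a. a < S \<Longrightarrow> g a < S) \<Longrightarrow> 0 < S \<Longrightarrow> wfc S (xfer g s ds)"
  by (auto simp: xfer_def valid_act_def)

text \<open>A push takes two actions, as the head has to step onto the free cell before it can write
  there. The store in between is not of the form \<open>stacks\<close>, so what is written is
  described through the view of that store.\<close>

lemma act_push:
  assumes "\<And>r. r \<in> ds \<Longrightarrow> r < K" "\<And>v r. r \<in> ds \<Longrightarrow> G v r = (x v, 0)"
    "\<And>r. r \<notin> ds \<Longrightarrow> r < K \<Longrightarrow> upd_tape (stack_tape (\<rho> r)) (G (view K (act K (\<lambda>v r. (v r, if r \<in> ds then 1 else 0)) (stacks \<rho>))) r) = stack_tape (\<rho>' r)"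
    "\<And>r. r \<notin> ds \<Longrightarrow> K \<le> r \<Longrightarrow> \<rho>' r = \<rho> r"
    "\<And>r. r \<in> ds \<Longrightarrow> \<rho>' r = x (view K (act K (\<lambda>v r. (v r, if r \<in> ds then 1 else 0)) (stacks \<rho>))) # \<rho> r"
  shows "act K G (act K (\<lambda>v r. (v r, if r \<in> ds then 1 else 0)) (stacks \<rho>)) = stacks \<rho>'"
proof
  fix r
  show "act K G (act K (\<lambda>v r. (v r, if r \<in> ds then 1 else 0)) (stacks \<rho>)) r = stacks \<rho>' r"
  proof (cases "r \<in> ds")
    case True
    then show ?thesis
      using assms(1,2)[of r] assms(5)[of r]
      by (simp add: act_def[of _ G] act_def[of K "\<lambda>v r. (v r, if r \<in> ds then 1 else 0)" _ r] stacks_def)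
  next
    case False
    then show ?thesis
      using assms(3)[of r] assms(4)[of r]
      by (cases "r < K") (simp_all add: act_def[of _ G] act_def[of K "\<lambda>v r. (v r, if r \<in> ds then 1 else 0)" _ r] stacks_def)
  qed
qed

lemma view_act_push: "r \<notin> ds \<Longrightarrow> view K (act K (\<lambda>v r. (v r, if r \<in> ds then 1 else 0)) (stacks \<rho>)) r =
    (if r < K then peek (\<rho> r) else 0)"
  by (simp add: view_def act_def stacks_def)

lemma runs_xfer:
  assumes "s \<notin> ds" "s < K" "\<And>r. r \<in> ds \<Longrightarrow> r < K" "0 \<notin> set (\<rho> s)"
  shows "\<exists>t\<le>3 * length (\<rho> s) + 1. runs K (xfer g s ds) (stacks \<rho>) t
    (stacks (\<lambda>r. if r = s then [] else if r \<in> ds then rev (map g (\<rho> s)) @ \<rho> r else \<rho> r))"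
proof -
  define \<sigma> where "\<sigma> i = (\<lambda>r. if r = s then drop i (\<rho> s)
      else if r \<in> ds then rev (map g (take i (\<rho> s))) @ \<rho> r else \<rho> r)" for i
  have "\<exists>t\<le>length (\<rho> s) * (2 + 1) + 1. runs K (xfer g s ds) (stacks (\<sigma> 0)) t (stacks (\<sigma> (length (\<rho> s))))"
    unfolding xfer_def
  proof (rule runs_While)
    fix i assume i: "i < length (\<rho> s)"
    then have *: "drop i (\<rho> s) = (\<rho> s ! i) # drop (Suc i) (\<rho> s)" by (simp add: Cons_nth_drop_Suc)
    have "\<rho> s ! i \<noteq> 0" using assms(4) i by (metis nth_mem)
    then show "view K (stacks (\<sigma> i)) s \<noteq> 0"
      using assms by (simp add: \<sigma>_def *)
    show "\<exists>t\<le>2. runs K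
          (Act (\<lambda>v r. (v r, if r \<in> ds then 1 else 0)) ;;
           Act (\<lambda>v r. if r \<in> ds then (g (v s), 0) else if r = s then (0, - 1) else (v r, 0)))
          (stacks (\<sigma> i)) t (stacks (\<sigma> (Suc i)))"
      by (intro runs_Act2_le act_push[where x = "\<lambda>v. g (v s)"])
         (use assms i in \<open>auto simp: view_act_push \<sigma>_def * take_Suc_conv_app_nth\<close>)
  next
    show "\<not> view K (stacks (\<sigma> (length (\<rho> s)))) s \<noteq> 0"
      by (simp add: \<sigma>_def)
  qed
  moreover have "\<sigma> 0 = \<rho>" by (auto simp: \<sigma>_def)
  moreover have "\<sigma> (length (\<rho> s)) = (\<lambda>r. if r = s then [] else if r \<in> ds then rev (map g (\<rho> s)) @ \<rho> r else \<rho> r)"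
    by (auto simp: \<sigma>_def)
  ultimately show ?thesis by (simp add: mult.commute)
qed

definition bsym :: "bool \<Rightarrow> nat" where "bsym b = (if b then 2 else 1)"

lemma bsym_simps [simp]: "bsym b \<noteq> 0" "0 < bsym b" "bsym b = 2 \<longleftrightarrow> b" "bsym b = 1 \<longleftrightarrow> \<not> b" "bsym b = Suc 0 \<longleftrightarrow> \<not> b"
  by (auto simp: bsym_def)

lemma bsym_notin [simp]: "0 \<notin> bsym ` A" by (auto simp: bsym_def)

lemma snd_stack_bits: "snd (stack_tape (map bsym xs)) = bit_tape (rev xs)"
  by (auto simp: stack_tape_def bit_tape_def fun_eq_iff bsym_def rev_nth)

definition bits :: "(nat \<Rightarrow> bool list) \<Rightarrow> store" where
  "bits \<rho> = stacks (\<lambda>r. map bsym (\<rho> r))"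

lemma view_bits [simp]: "view K (bits \<rho>) r = (if r < K then peek (map bsym (\<rho> r)) else 0)"
  by (simp add: bits_def)

abbreviation "mv \<equiv> xfer (\<lambda>x. x)"
abbreviation "ones s d \<equiv> xfer (\<lambda>_. 2) s {d}"
abbreviation "falses s d \<equiv> xfer (\<lambda>_. 1) s {d}"

lemma runs_mv:
  assumes "s \<notin> ds" "s < K" "\<And>r. r \<in> ds \<Longrightarrow> r < K"
    "\<rho>' = (\<lambda>r. if r = s then [] else if r \<in> ds then rev (\<rho> s) @ \<rho> r else \<rho> r)"
  shows "\<exists>t\<le>3 * length (\<rho> s) + 1. runs K (mv s ds) (bits \<rho>) t (bits \<rho>')"
  using runs_xfer[of s ds K "\<lambda>r. map bsym (\<rho> r)" "\<lambda>x. x"] assms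
  unfolding bits_def by (simp add: if_distrib[of "map bsym"] rev_map cong: if_cong)

lemma runs_const:
  assumes "s \<noteq> d" "s < K" "d < K"
    "\<rho>' = \<rho>(s := [], d := replicate (length (\<rho> s)) b @ \<rho> d)"
  shows "\<exists>t\<le>3 * length (\<rho> s) + 1. runs K (xfer (\<lambda>_. bsym b) s {d}) (bits \<rho>) t (bits \<rho>')"
proof -
  have "(\<lambda>r. if r = s then [] else if r \<in> {d} then rev (map (\<lambda>_. bsym b) (map bsym (\<rho> s))) @ map bsym (\<rho> r)
      else map bsym (\<rho> r)) = (\<lambda>r. map bsym (\<rho>' r))"
    using assms by (auto simp: fun_eq_iff map_replicate_const comp_def)
  then show ?thesis
    using runs_xfer[of s "{d}" K "\<lambda>r. map bsym (\<rho> r)" "\<lambda>_. bsym b"] assms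
    unfolding bits_def by simp
qed

definition push :: "bool \<Rightarrow> nat \<Rightarrow> com" where
  "push b d = (Act (\<lambda>v r. (v r, if r \<in> {d} then 1 else 0)) ;; Act (\<lambda>v r. (if r = d then bsym b else v r, 0)))"

lemma runs_push: "d < K \<Longrightarrow> \<exists>t\<le>2. runs K (push b d) (bits \<rho>) t (bits (\<rho>(d := b # \<rho> d)))"
  unfolding push_def bits_def
  by (intro runs_Act2_le act_push[where x = "\<lambda>v. bsym b"])
    (auto simp: view_act_push[of _ "{d}", simplified])

text \<open>An empty stack is left alone, in accordance with \<open>tl [] = []\<close>.\<close>

definition pops :: "nat set \<Rightarrow> com" where
  "pops ds = Act (\<lambda>v r. if r \<in> ds \<and> v r \<noteq> 0 then (0, - 1) else (v r, 0))"

lemma runs_pops: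
  assumes "\<And>r. r \<in> ds \<Longrightarrow> r < K"
  shows "\<exists>t\<le>1. runs K (pops ds) (bits \<rho>) t (bits (\<lambda>r. if r \<in> ds then tl (\<rho> r) else \<rho> r))"
proof -
  have "act K (\<lambda>v r. if r \<in> ds \<and> v r \<noteq> 0 then (0, - 1) else (v r, 0)) (bits \<rho>) r =
      bits (\<lambda>r. if r \<in> ds then tl (\<rho> r) else \<rho> r) r" for r
    using assms[of r] by (cases "\<rho> r") (auto simp: bits_def act_def stacks_def)
  then show ?thesis
    unfolding pops_def by (intro runs_Act_le) blast
qed

lemma wfc_push: "3 \<le> S \<Longrightarrow> wfc S (push b d)"
  by (auto simp: push_def valid_act_def bsym_def)

lemma wfc_pops: "3 \<le> S \<Longrightarrow> wfc S (pops d)"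
  by (auto simp: pops_def valid_act_def)

section \<open>Simulating a Turing machine for a bounded number of steps\<close>

definition cfg :: "tm \<Rightarrow> bool list \<Rightarrow> nat \<Rightarrow> nat \<times> tape list" where
  "cfg M y j = (tm_step M ^^ j) (tm_init M y)"

definition scans :: "tape list \<Rightarrow> nat list" where
  "scans ts = map (\<lambda>(h, t). t h) ts"

definition valid_scan :: "tm \<Rightarrow> nat \<Rightarrow> nat list \<Rightarrow> bool" where
  "valid_scan M q ss \<longleftrightarrow> q < tm_states M \<and> length ss = tm_tapes M \<and> set ss \<subseteq> {..<tm_symbols M}"

definition good_cfg :: "tm \<Rightarrow> nat \<times> tape list \<Rightarrow> bool" where
  "good_cfg M c \<longleftrightarrow> fst c \<le> tm_states M \<and> length (snd c) = tm_tapes M \<and>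
     (\<forall>i<tm_tapes M. \<forall>z. snd (snd c ! i) z < tm_symbols M)"

lemma length_scans [simp]: "length (scans ts) = length ts"
  by (simp add: scans_def)

lemma nth_scans: "i < length ts \<Longrightarrow> scans ts ! i = snd (ts ! i) (fst (ts ! i))"
  by (simp add: scans_def split: prod.splits)

lemma good_cfg_scan: "good_cfg M c \<Longrightarrow> fst c < tm_states M \<Longrightarrow> valid_scan M (fst c) (scans (snd c))"
  by (auto simp: good_cfg_def valid_scan_def in_set_conv_nth nth_scans)

lemma delta_valid:
  assumes "turing_machine M" "valid_scan M q ss"
  shows "fst (tm_delta M q ss) \<le> tm_states M" "length (snd (tm_delta M q ss)) = tm_tapes M"
    "i < tm_tapes M \<Longrightarrow> fst (snd (tm_delta M q ss) ! i) < tm_symbols M"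
    "i < tm_tapes M \<Longrightarrow> snd (snd (tm_delta M q ss) ! i) \<in> {- 1, 0, 1}"
proof -
  have *: "fst (tm_delta M q ss) \<le> tm_states M" "length (snd (tm_delta M q ss)) = tm_tapes M"
    "set (snd (tm_delta M q ss)) \<subseteq> {..<tm_symbols M} \<times> {- 1, 0, 1}"
    using assms unfolding turing_machine_def valid_scan_def by blast+
  then show "fst (tm_delta M q ss) \<le> tm_states M" "length (snd (tm_delta M q ss)) = tm_tapes M" by auto
  assume "i < tm_tapes M"
  then have "snd (tm_delta M q ss) ! i \<in> {..<tm_symbols M} \<times> {- 1, 0, 1}"
    using * by (metis nth_mem subsetD)
  then show "fst (snd (tm_delta M q ss) ! i) < tm_symbols M" "snd (snd (tm_delta M q ss) ! i) \<in> {- 1, 0, 1}"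
    by auto
qed

lemma tm_step_halted: "tm_states M \<le> fst c \<Longrightarrow> tm_step M c = c"
  by (cases c) (simp add: tm_step_def)

lemma tm_step_running:
  assumes "turing_machine M" "good_cfg M c" "fst c < tm_states M"
  shows "fst (tm_step M c) = fst (tm_delta M (fst c) (scans (snd c)))"
    "length (snd (tm_step M c)) = tm_tapes M"
    "i < tm_tapes M \<Longrightarrow>
      snd (tm_step M c) ! i = upd_tape (snd c ! i) (snd (tm_delta M (fst c) (scans (snd c))) ! i)"
  using assms delta_valid(2)[OF assms(1) good_cfg_scan[OF assms(2,3)]]
  by (auto simp: tm_step_def scans_def good_cfg_def upd_tape_def split: prod.splits)

lemma good_cfg_step:
  assumes "turing_machine M" "good_cfg M c"
  shows "good_cfg M (tm_step M c)"
proof (cases "fst c < tm_states M")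
  case True
  note d = delta_valid[OF assms(1) good_cfg_scan[OF assms(2) True]]
  show ?thesis
    using d tm_step_running[OF assms True] assms(2)
    by (auto simp: good_cfg_def upd_tape_def)
next
  case False
  then show ?thesis using assms(2) by (simp add: tm_step_halted)
qed

lemma bit_tape_less: "3 \<le> S \<Longrightarrow> bit_tape x z < S"
  by (auto simp: bit_tape_def)

lemma good_cfg:
  assumes "turing_machine M"
  shows "good_cfg M (cfg M y j)"
proof (induction j)
  case 0
  show ?case
    using assms bit_tape_less
    by (auto simp: cfg_def good_cfg_def tm_init_def turing_machine_def nth_Cons split: nat.splits)
next
  case (Suc j)
  then show ?case using good_cfg_step[OF assms] by (simp add: cfg_def)
qed

lemma cfg_Suc: "cfg M y (Suc j) = tm_step M (cfg M y j)"
  by (simp add: cfg_def)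

lemma cfg_halted: "tm_states M \<le> fst (cfg M y j) \<Longrightarrow> j \<le> l \<Longrightarrow> cfg M y l = cfg M y j"
proof (induction l)
  case (Suc l)
  then show ?case by (cases "j = Suc l") (auto simp: cfg_Suc tm_step_halted)
qed auto

lemma cfg_0: "fst (cfg M y 0) = 0" "snd (cfg M y 0) = (0, bit_tape y) # replicate (tm_tapes M - 1) (0, bit_tape [])"
  by (simp_all add: cfg_def tm_init_def)

text \<open>A head moves by at most one cell per step, so nothing outside this window has been
  written. The bound makes the output finite and gives the tableau its width.\<close>

lemma cfg_range:
  assumes "turing_machine M" "i < tm_tapes M"
  shows "\<bar>fst (snd (cfg M y j) ! i)\<bar> \<le> int j \<and>
    (\<forall>z. z < - int j \<or> (int j \<le> z \<and> int (length y) \<le> z) \<longrightarrow> snd (snd (cfg M y j) ! i) z = 0)"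
proof (induction j)
  case 0
  then show ?case
    using assms by (auto simp: cfg_0 nth_Cons bit_tape_def turing_machine_def split: nat.splits)
next
  case (Suc j)
  note g = good_cfg[OF assms(1), of y j]
  show ?case
  proof (cases "fst (cfg M y j) < tm_states M")
    case True
    note * = tm_step_running(3)[OF assms(1) g True assms(2)]
    have m: "snd (snd (tm_delta M (fst (cfg M y j)) (scans (snd (cfg M y j)))) ! i) \<in> {- 1, 0, 1}"
      using delta_valid(4)[OF assms(1) good_cfg_scan[OF g True] assms(2)] .
    have "\<bar>fst (snd (cfg M y (Suc j)) ! i)\<bar> \<le> int (Suc j)"
      using Suc m by (auto simp: cfg_Suc * upd_tape_def)
    moreover have "snd (snd (cfg M y (Suc j)) ! i) z = 0"
      if "z < - int (Suc j) \<or> (int (Suc j) \<le> z \<and> int (length y) \<le> z)" for z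
      using Suc m that by (auto simp: cfg_Suc * upd_tape_def)
    ultimately show ?thesis by blast
  next
    case False
    then show ?thesis using Suc by (auto simp: cfg_Suc tm_step_halted)
  qed
qed

text \<open>The output tape of an arbitrary configuration is read up to the first non-bit.\<close>

definition out_cell :: "tm \<Rightarrow> nat \<Rightarrow> bool list \<Rightarrow> nat \<Rightarrow> nat" where
  "out_cell M L y i = snd (snd (cfg M y L) ! (tm_tapes M - 1)) (int i)"

definition out_len :: "tm \<Rightarrow> nat \<Rightarrow> bool list \<Rightarrow> nat" where
  "out_len M L y = (LEAST i. out_cell M L y i \<notin> {1, 2})"

definition run_out :: "tm \<Rightarrow> nat \<Rightarrow> bool list \<Rightarrow> bool list" where
  "run_out M L y = map (\<lambda>i. out_cell M L y i = 2) [0..<out_len M L y]"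

lemma out_len:
  assumes "turing_machine M"
  shows "out_len M L y \<le> max (length y) L" "out_cell M L y (out_len M L y) \<notin> {1, 2}"
    "i < out_len M L y \<Longrightarrow> out_cell M L y i \<in> {1, 2}"
proof -
  have "tm_tapes M - 1 < tm_tapes M" using assms by (auto simp: turing_machine_def)
  from cfg_range[OF assms this, of y L]
  have *: "out_cell M L y (max (length y) L) \<notin> {1, 2}" by (simp add: out_cell_def)
  show "out_len M L y \<le> max (length y) L" unfolding out_len_def using * by (rule Least_le)
  show "out_cell M L y (out_len M L y) \<notin> {1, 2}" unfolding out_len_def using * by (rule LeastI)
  show "i < out_len M L y \<Longrightarrow> out_cell M L y i \<in> {1, 2}"
    unfolding out_len_def using not_less_Least by blast
qed

text \<open>A halted machine repeats its configuration, so the configuration at the time bound shows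
  the output even if the machine stopped earlier.\<close>

lemma run_out_eq:
  assumes "turing_machine M" "tm_outputs_within M y L out"
  shows "run_out M L y = out"
proof -
  obtain T ts where T: "T \<le> L" "cfg M y T = (tm_states M, ts)" "snd (last ts) = bit_tape out"
    using assms(2) by (auto simp: tm_outputs_within_def cfg_def)
  have L: "cfg M y L = (tm_states M, ts)"
    using cfg_halted[of M y T L] T by simp
  have "length ts = tm_tapes M"
    using good_cfg[OF assms(1), of y L] by (simp add: good_cfg_def L)
  moreover have "1 \<le> tm_tapes M" using assms(1) by (simp add: turing_machine_def)
  ultimately have "last ts = ts ! (tm_tapes M - 1)"
    by (metis last_conv_nth list.size(3) not_one_le_zero)
  then have c: "out_cell M L y i = bit_tape out (int i)" for i
    using T by (simp add: out_cell_def L)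
  have "out_len M L y = length out"
    unfolding out_len_def c by (rule Least_equality) (auto simp: bit_tape_def not_less split: if_splits)
  then show ?thesis
    unfolding run_out_def by (intro nth_equalityI) (auto simp: c bit_tape_def)
qed

text \<open>A whole scan becomes one tape symbol of the simulating machine. The successor keeps it
  different from the blank, by which the end of a stack is recognised.\<close>

definition hist_code :: "nat \<times> nat list \<Rightarrow> nat" where "hist_code x = Suc (to_nat x)"
definition hist_decode :: "nat \<Rightarrow> nat \<times> nat list" where "hist_decode h = from_nat (h - 1)"

lemma hist_decode [simp]: "hist_decode (hist_code x) = x"
  by (simp add: hist_code_def hist_decode_def)

lemma hist_code_pos [simp]: "hist_code x \<noteq> 0" "0 < hist_code x"
  by (simp_all add: hist_code_def)

lemma hist_code_bound: "\<exists>B. \<forall>q ss. valid_scan M q ss \<longrightarrow> hist_code (q, ss) < B"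
proof -
  let ?A = "{..<tm_states M} \<times> {ss. set ss \<subseteq> {..<tm_symbols M} \<and> length ss = tm_tapes M}"
  have "finite (hist_code ` ?A)"
    by (intro finite_imageI finite_cartesian_product finite_lists_length_eq) auto
  then obtain B where "\<forall>x\<in>hist_code ` ?A. x < B"
    using finite_nat_set_iff_bounded by blast
  then show ?thesis by (intro exI[of _ B]) (auto simp: valid_scan_def)
qed

section \<open>Simulation with a recorded history, and its reversal\<close>

locale tm_sim =
  fixes M :: tm and b K :: nat
  assumes M: "turing_machine M" and K: "b + 7 + tm_tapes M \<le> K"
begin

abbreviation "k \<equiv> tm_tapes M"
abbreviation "on_tape r \<equiv> b + 6 \<le> r \<and> r < b + 6 + k"

lemma k_pos: "0 < k" using M by (simp add: turing_machine_def)

text \<open>Tape \<open>b + 4\<close> holds the state in cell \<open>-1\<close>, tapes \<open>b + 6 + i\<close> are those of \<open>M\<close>, all other tapes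
  are stacks: \<open>b + 1\<close> the clock, \<open>b + 2\<close> and \<open>b + 3\<close> the history, \<open>b + 5\<close> a counter.\<close>

definition sim :: "(nat \<Rightarrow> nat list) \<Rightarrow> nat \<Rightarrow> tape list \<Rightarrow> store" where
  "sim R q ts r = (if r = b + 4 then (- 1, (\<lambda>_. 0)(- 1 := q))
     else if on_tape r then ts ! (r - (b + 6)) else stack_tape (R r))"

lemma view_sim:
  "view K (sim R q ts) r = (if r < K then if r = b + 4 then q
     else if on_tape r then snd (ts ! (r - (b + 6))) (fst (ts ! (r - (b + 6)))) else peek (R r) else 0)"
  by (simp add: view_def sim_def)

lemma scans_view:
  assumes "length ts = k" "\<And>r. on_tape r \<Longrightarrow> v r = view K (sim R q ts) r"
  shows "map v [b + 6..<b + 6 + k] = scans ts"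
proof (rule nth_equalityI)
  fix i assume "i < length (map v [b + 6..<b + 6 + k])"
  then show "map v [b + 6..<b + 6 + k] ! i = scans ts ! i"
    using assms K by (simp add: nth_scans view_sim)
qed (use assms in simp)

lemma act_sim:
  assumes "\<And>r. r < K \<Longrightarrow> r \<noteq> b + 4 \<Longrightarrow> \<not> on_tape r \<Longrightarrow>
      upd_tape (stack_tape (R r)) (F (view K (sim R q ts)) r) = stack_tape (R' r)"
    and "\<And>r. K \<le> r \<Longrightarrow> R' r = R r"
    and "F (view K (sim R q ts)) (b + 4) = (q', 0)"
    and "\<And>i. i < k \<Longrightarrow> upd_tape (ts ! i) (F (view K (sim R q ts)) (b + 6 + i)) = ts' ! i"
  shows "act K F (sim R q ts) = sim R' q' ts'"
proof
  fix r
  show "act K F (sim R q ts) r = sim R' q' ts' r"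
  proof (cases "r < K")
    case True
    consider "r = b + 4" | "on_tape r" | "r \<noteq> b + 4" "\<not> on_tape r" by blast
    then show ?thesis
    proof cases
      case 2
      then obtain i where "i < k" "r = b + 6 + i" by (auto simp: le_iff_add)
      then show ?thesis using assms(4)[of i] True by (simp add: act_def sim_def)
    qed (use assms(1,3) True in \<open>auto simp: act_def sim_def upd_tape_def\<close>)
  qed (use assms(2) K in \<open>auto simp: act_def sim_def\<close>)
qed

text \<open>Counterpart of \<open>act_push\<close> whose second action may also carry out a step of
  \<open>M\<close>. That action sees the original symbols only outside \<open>ds\<close>, which
  explains the hypotheses on \<open>v\<close>.\<close>

lemma act_push_sim:
  assumes ds: "\<And>r. r \<in> ds \<Longrightarrow> r < K \<and> r \<noteq> b + 4 \<and> \<not> on_tape r"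
    and "\<And>v r. (\<And>r. r \<notin> ds \<Longrightarrow> v r = view K (sim R q ts) r) \<Longrightarrow> r < K \<Longrightarrow> r \<noteq> b + 4 \<Longrightarrow> \<not> on_tape r \<Longrightarrow>
      if r \<in> ds then \<exists>x. G v r = (x, 0) \<and> R' r = x # R r
      else upd_tape (stack_tape (R r)) (G v r) = stack_tape (R' r)"
    and "\<And>r. K \<le> r \<Longrightarrow> R' r = R r"
    and "\<And>v. (\<And>r. r \<notin> ds \<Longrightarrow> v r = view K (sim R q ts) r) \<Longrightarrow> G v (b + 4) = (q', 0)"
    and "\<And>v i. (\<And>r. r \<notin> ds \<Longrightarrow> v r = view K (sim R q ts) r) \<Longrightarrow> i < k \<Longrightarrow>
      upd_tape (ts ! i) (G v (b + 6 + i)) = ts' ! i"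
  shows "act K G (act K (\<lambda>v r. (v r, if r \<in> ds then 1 else 0)) (sim R q ts)) = sim R' q' ts'"
proof
  fix r
  let ?\<sigma> = "act K (\<lambda>v r. (v r, if r \<in> ds then 1 else 0)) (sim R q ts)"
  have \<sigma>: "?\<sigma> r = (if r \<in> ds then upd_tape (stack_tape (R r)) (peek (R r), 1) else sim R q ts r)" for r
    using ds[of r] by (auto simp: act_def view_def upd_tape_def sim_def prod_eq_iff)
  have v: "view K ?\<sigma> r = view K (sim R q ts) r" if "r \<notin> ds" for r
    using that by (simp add: view_def \<sigma>)
  show "act K G ?\<sigma> r = sim R' q' ts' r"
  proof (cases "r < K")
    case True
    consider "r = b + 4" | "on_tape r" | "r \<noteq> b + 4" "\<not> on_tape r" by blast
    then show ?thesis
    proof cases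
      case 1
      then show ?thesis using assms(4)[OF v] True ds[of r] by (auto simp: act_def[of K G] \<sigma> sim_def upd_tape_def)
    next
      case 2
      then have "r \<notin> ds" using ds by blast
      moreover obtain i where "i < k" "r = b + 6 + i" using 2 by (auto simp: le_iff_add)
      ultimately show ?thesis
        using assms(5)[OF v, of i] True by (simp add: act_def[of K G] \<sigma> sim_def)
    next
      case 3
      then show ?thesis
        using assms(2)[OF v, of r] True by (auto simp: act_def[of K G] \<sigma> sim_def split: if_splits)
    qed
  next
    case False
    then have "r \<notin> ds" using ds by blast
    then show ?thesis using assms(3)[of r] False K by (auto simp: act_def[of K G] \<sigma> sim_def)
  qed
qed

definition hist :: "bool list \<Rightarrow> nat \<Rightarrow> nat" where
  "hist y j = hist_code (fst (cfg M y j), scans (snd (cfg M y j)))"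

lemma hist_pos [simp]: "hist y j \<noteq> 0" "0 < hist y j"
  by (simp_all add: hist_def)

definition vs :: "nat \<times> nat list \<Rightarrow> bool" where "vs x = valid_scan M (fst x) (snd x)"

abbreviation "dlt x i \<equiv> snd (tm_delta M (fst x) (snd x)) ! i"

definition regs :: "(nat \<Rightarrow> nat list) \<Rightarrow> nat list \<Rightarrow> nat list \<Rightarrow> nat list \<Rightarrow> nat list \<Rightarrow> nat list \<Rightarrow> nat \<Rightarrow> nat list" where
  "regs R c h g n X = R(b + 1 := c, b + 2 := h, b + 3 := g, b + 5 := n, b + 6 + k := X)"

lemma regs_simps [simp]:
  "regs R c h g n X (b + 1) = c" "regs R c h g n X (Suc b) = c"
  "regs R c h g n X (b + 2) = h" "regs R c h g n X (Suc (Suc b)) = h"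
  "regs R c h g n X (b + 3) = g" "regs R c h g n X (b + 5) = n" "regs R c h g n X (b + 6 + k) = X"
  "r \<notin> {b + 1, b + 2, b + 3, b + 5, b + 6 + k} \<Longrightarrow> regs R c h g n X r = R r"
  by (simp_all add: regs_def k_pos)

text \<open>The guard \<open>vs\<close> serves \<open>wfc\<close>, which quantifies over everything
  that the simulating machine might scan, such as history symbols on a tape of
  \<open>M\<close>.\<close>

definition "prog_fwd = While (\<lambda>v. v (b + 4) \<noteq> tm_states M \<and> v (b + 1) \<noteq> 0)
  (Act (\<lambda>v r. (v r, if r \<in> {b + 2} then 1 else 0)) ;;
   Act (\<lambda>v r. let x = (v (b + 4), map v [b + 6..<b + 6 + k]) in
     if \<not> vs x then (v r, 0) else if r = b + 2 then (hist_code x, 0) else if r = b + 1 then (0, - 1)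
     else if r = b + 4 then (fst (tm_delta M (fst x) (snd x)), 0)
     else if on_tape r then dlt x (r - (b + 6)) else (v r, 0)))"

text \<open>The output starts at cell \<open>0\<close>, which bears no mark, while the head of the
  last tape may be anywhere. Replaying only the movements of this head, latest step first and with
  \<open>m = - 1\<close>, leads it to cell \<open>0\<close>. The replay reverses the history onto
  the other stack, ready for the way back with \<open>m = 1\<close>.\<close>

definition "prog_head s d m = While (\<lambda>v. v s \<noteq> 0)
  (Act (\<lambda>v r. (v r, if r \<in> {d} then 1 else 0)) ;;
   Act (\<lambda>v r. let x = hist_decode (v s) in
     if r = d then (v s, 0) else if r = s then (0, - 1)
     else if r = b + 5 + k \<and> vs x then (v r, m * snd (dlt x (k - 1))) else (v r, 0)))"

text \<open>The unary counter in \<open>b + 5\<close> records how far the head has gone, so that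
  \<open>prog_back\<close> can return it to cell \<open>0\<close>.\<close>

definition "prog_copy = While (\<lambda>v. v (b + 5 + k) \<in> {1, 2})
  (Act (\<lambda>v r. (v r, if r \<in> {b + 5, b + 6 + k} then 1 else 0)) ;;
   Act (\<lambda>v r. if r = b + 6 + k then (v (b + 5 + k), 0) else if r = b + 5 then (1, 0)
     else if r = b + 5 + k then (v r, 1) else (v r, 0)))"

definition "prog_back = While (\<lambda>v. v (b + 5) \<noteq> 0)
  (Act (\<lambda>v r. if r = b + 5 then (0, - 1) else if r = b + 5 + k then (v r, - 1) else (v r, 0)))"

text \<open>\<open>M\<close> may leave symbols separated by blanks, so its tapes cannot be erased by
  scanning up to a blank. Undoing all steps leaves just the input, which can be erased. The first
  action takes the heads back, the second restores the symbols scanned there and the state.\<close>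

definition "prog_undo = While (\<lambda>v. v (b + 2) \<noteq> 0)
  (Act (\<lambda>v r. let x = hist_decode (v (b + 2)) in
     if on_tape r \<and> vs x then (v r, - snd (dlt x (r - (b + 6)))) else (v r, 0)) ;;
   Act (\<lambda>v r. let x = hist_decode (v (b + 2)) in
     if \<not> vs x then (v r, 0) else if on_tape r then (snd x ! (r - (b + 6)), 0)
     else if r = b + 4 then (fst x, 0) else if r = b + 2 then (0, - 1) else (v r, 0)))"

definition "prog_seek d = While (\<lambda>v. v (b + 6) \<noteq> 0) (Act (\<lambda>v r. (v r, if r = b + 6 then d else 0)))"

text \<open>The head of an empty stack is at cell \<open>- 1\<close>, that of a fresh tape of
  \<open>M\<close> at cell \<open>0\<close>; the shift passes from one convention to the
  other.\<close>

definition "prog_shift d = Act (\<lambda>v r. (v r, if on_tape r then d else 0))"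

context
  fixes y :: "bool list" and J :: nat and R :: "nat \<Rightarrow> nat list"
  assumes J: "\<And>i. i < J \<Longrightarrow> fst (cfg M y i) < tm_states M"
begin

abbreviation "q j \<equiv> fst (cfg M y j)"
abbreviation "ts j \<equiv> snd (cfg M y j)"

lemma len_ts [simp]: "length (ts j) = k"
  using good_cfg[OF M, of y j] by (simp add: good_cfg_def)

lemma vs_cfg: "i < J \<Longrightarrow> vs (q i, scans (ts i))"
  using good_cfg_scan[OF good_cfg[OF M] J] by (simp add: vs_def)

lemma ts_Suc: "j < J \<Longrightarrow> i < k \<Longrightarrow>
    ts (Suc j) ! i = upd_tape (ts j ! i) (dlt (q j, scans (ts j)) i)"
  using tm_step_running(3)[OF M good_cfg[OF M] J] by (simp add: cfg_Suc)

lemma q_Suc: "j < J \<Longrightarrow> q (Suc j) = fst (tm_delta M (q j) (scans (ts j)))"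
  using tm_step_running(1)[OF M good_cfg[OF M] J] by (simp add: cfg_Suc)

lemma runs_fwd:
  assumes "J \<le> length c" "0 \<notin> set c" "q J = tm_states M \<or> J = length c"
  shows "\<exists>t\<le>J * 3 + 1. runs K prog_fwd (sim (regs R c [] [] [] X) (q 0) (ts 0)) t
    (sim (regs R (drop J c) (rev (map (hist y) [0..<J])) [] [] X) (q J) (ts J))"
proof -
  define \<sigma> where "\<sigma> j = sim (regs R (drop j c) (rev (map (hist y) [0..<j])) [] [] X) (q j) (ts j)" for j
  have "\<exists>t\<le>J * (2 + 1) + 1. runs K prog_fwd (\<sigma> 0) t (\<sigma> J)"
    unfolding prog_fwd_def
  proof (rule runs_While)
    fix j assume j: "j < J"
    have c: "drop j c = c ! j # drop (Suc j) c" using j assms(1) by (simp add: Cons_nth_drop_Suc)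
    have "c ! j \<noteq> 0" using assms(1,2) j by (metis less_le_trans nth_mem)
    then show "view K (\<sigma> j) (b + 4) \<noteq> tm_states M \<and> view K (\<sigma> j) (b + 1) \<noteq> 0"
      using J[OF j] K by (simp add: \<sigma>_def view_sim c)
    have sc: "map v [b + 6..<b + 6 + k] = scans (ts j)" if "\<And>r. r \<notin> {b + 2} \<Longrightarrow>
        v r = view K (sim (regs R (drop j c) (rev (map (hist y) [0..<j])) [] [] X) (q j) (ts j)) r" for v
      by (rule scans_view) (use that in auto)
    have q4: "v (b + 4) = q j" if "\<And>r. r \<notin> {b + 2} \<Longrightarrow>
        v r = view K (sim (regs R (drop j c) (rev (map (hist y) [0..<j])) [] [] X) (q j) (ts j)) r" for v
      using that[of "b + 4"] K by (simp add: view_sim)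
    show "\<exists>t\<le>2. runs K (Act (\<lambda>v r. (v r, if r \<in> {b + 2} then 1 else 0)) ;;
       Act (\<lambda>v r. let x = (v (b + 4), map v [b + 6..<b + 6 + k]) in
         if \<not> vs x then (v r, 0) else if r = b + 2 then (hist_code x, 0) else if r = b + 1 then (0, - 1)
         else if r = b + 4 then (fst (tm_delta M (fst x) (snd x)), 0)
         else if on_tape r then dlt x (r - (b + 6)) else (v r, 0))) (\<sigma> j) t (\<sigma> (Suc j))"
      unfolding \<sigma>_def
    proof (intro runs_Act2_le act_push_sim, goal_cases)
      case (2 v r)
      then show ?case
        using vs_cfg[OF j] sc[OF 2(1)] q4[OF 2(1)] 2(1)[of r]
        by (auto simp: Let_def regs_def view_sim c hist_def)
    qed (use K sc q4 vs_cfg[OF j] q_Suc[OF j] ts_Suc[OF j] j in \<open>auto simp: regs_def Let_def\<close>)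
  next
    show "\<not> (view K (\<sigma> J) (b + 4) \<noteq> tm_states M \<and> view K (\<sigma> J) (b + 1) \<noteq> 0)"
      using assms(3) K by (auto simp: \<sigma>_def view_sim)
  qed
  then show ?thesis by (simp add: \<sigma>_def)
qed

definition head :: "nat \<Rightarrow> int" where "head j = fst (ts j ! (k - 1))"

text \<open>While the output is read, the tapes are those of configuration \<open>J\<close> except
  for the position of the last head.\<close>

definition put_head :: "int \<Rightarrow> tape list" where
  "put_head p = (ts J)[k - 1 := (p, snd (ts J ! (k - 1)))]"

lemma put_head_J: "put_head (head J) = ts J"
  using k_pos by (simp add: put_head_def head_def)

lemma length_put_head [simp]: "length (put_head p) = k"
  by (simp add: put_head_def)

lemma upd_put_head:
  assumes "i < k"
  shows "upd_tape (put_head p ! i) (if i = k - 1 then snd (ts J ! (k - 1)) p else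
      snd (ts J ! i) (fst (ts J ! i)), if i = k - 1 then d else 0) = put_head (p + d) ! i"
  using assms k_pos by (auto simp: put_head_def upd_tape_def nth_list_update prod_eq_iff)

lemma view_put_head:
  assumes "i < k"
  shows "view K (sim R' q' (put_head p)) (b + 6 + i) =
    (if i = k - 1 then snd (ts J ! (k - 1)) p else snd (ts J ! i) (fst (ts J ! i)))"
  using assms K k_pos by (auto simp: view_sim put_head_def nth_list_update)

lemma head_Suc: "j < J \<Longrightarrow> head (Suc j) = head j + snd (dlt (q j, scans (ts j)) (k - 1))"
  using ts_Suc[of j "k - 1"] k_pos by (simp add: head_def upd_tape_def)

text \<open>\<open>h i\<close> is the step replayed in round \<open>i\<close> and \<open>p i\<close>
  the head position before that round; both directions of the replay are instances.\<close>

lemma runs_head: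
  assumes sd: "s \<in> {b + 2, b + 3}" "d \<in> {b + 2, b + 3}" "s \<noteq> d"
    and hs: "\<And>i. i < J \<Longrightarrow> h i < J"
      "\<And>i. i < J \<Longrightarrow> p (Suc i) = p i + m * snd (dlt (q (h i), scans (ts (h i))) (k - 1))"
    and R: "R s = map (\<lambda>i. hist y (h i)) [0..<J]"
  shows "\<exists>t\<le>J * 3 + 1. runs K (prog_head s d m) (sim R qq (put_head (p 0))) t
    (sim (R(s := [], d := rev (map (\<lambda>i. hist y (h i)) [0..<J]) @ R d)) qq (put_head (p J)))"
proof -
  define Rs where "Rs i = R(s := map (\<lambda>i. hist y (h i)) [i..<J],
      d := rev (map (\<lambda>i. hist y (h i)) [0..<i]) @ R d)" for i
  define \<sigma> where "\<sigma> i = sim (Rs i) qq (put_head (p i))" for i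
  have "\<exists>t\<le>J * (2 + 1) + 1. runs K (prog_head s d m) (\<sigma> 0) t (\<sigma> J)"
    unfolding prog_head_def
  proof (rule runs_While)
    fix i assume i: "i < J"
    have s: "[i..<J] = i # [Suc i..<J]" using i by (simp add: upt_conv_Cons)
    have vi: "v s = hist y (h i)" if "\<And>r. r \<notin> {d} \<Longrightarrow> v r = view K (sim (Rs i) qq (put_head (p i))) r" for v
      using that[of s] sd K by (auto simp: view_sim Rs_def s)
    have vt: "v (b + 6 + j) = (if j = k - 1 then snd (ts J ! (k - 1)) (p i) else snd (ts J ! j) (fst (ts J ! j)))"
      if "\<And>r. r \<notin> {d} \<Longrightarrow> v r = view K (sim (Rs i) qq (put_head (p i))) r" "j < k" for v j
      using that(1)[of "b + 6 + j"] sd that(2) by (auto simp: view_put_head)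
    show "view K (\<sigma> i) s \<noteq> 0"
      using sd K by (auto simp: \<sigma>_def view_sim Rs_def s)
    show "\<exists>t\<le>2. runs K (Act (\<lambda>v r. (v r, if r \<in> {d} then 1 else 0)) ;;
       Act (\<lambda>v r. let x = hist_decode (v s) in
         if r = d then (v s, 0) else if r = s then (0, - 1)
         else if r = b + 5 + k \<and> vs x then (v r, m * snd (dlt x (k - 1))) else (v r, 0))) (\<sigma> i) t (\<sigma> (Suc i))"
      unfolding \<sigma>_def
    proof (intro runs_Act2_le act_push_sim, goal_cases)
      case (1 r)
      then show ?case using sd K by auto
    next
      case (2 v r)
      then show ?case
        using sd vi[OF 2(1)] 2(1)[of r] 2(4) k_pos
        by (auto simp: Let_def Rs_def view_sim s)
    next
      case (3 r)
      then show ?case using sd K by (auto simp: Rs_def)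
    next
      case (4 v)
      then show ?case using sd 4[of "b + 4"] K k_pos by (auto simp: view_sim)
    next
      case (5 v j)
      have r: "b + 6 + j \<noteq> d" "b + 6 + j \<noteq> s" "b + 6 + j = b + 5 + k \<longleftrightarrow> j = k - 1"
        using sd 5(2) by auto
      have "(let x = hist_decode (v s) in
         if b + 6 + j = d then (v s, 0) else if b + 6 + j = s then (0, - 1)
         else if b + 6 + j = b + 5 + k \<and> vs x then (v (b + 6 + j), m * snd (dlt x (k - 1))) else (v (b + 6 + j), 0)) =
        (if j = k - 1 then snd (ts J ! (k - 1)) (p i) else snd (ts J ! j) (fst (ts J ! j)),
         if j = k - 1 then m * snd (dlt (q (h i), scans (ts (h i))) (k - 1)) else 0)"
        using r vi[OF 5(1)] vt[OF 5(1) 5(2)] vs_cfg[OF hs(1)[OF i]] by (auto simp: Let_def hist_def)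
      then show ?case
        using upd_put_head[OF 5(2)] hs(2)[OF i] by simp
    qed
  next
    show "\<not> view K (\<sigma> J) s \<noteq> 0" using sd by (auto simp: \<sigma>_def view_sim Rs_def)
  qed
  moreover have "Rs 0 = R" using R sd by (auto simp: Rs_def)
  ultimately show ?thesis by (simp add: \<sigma>_def Rs_def)
qed

definition "cell i = snd (ts J ! (k - 1)) (int i)"

lemma runs_copy:
  assumes "\<And>i. i < n \<Longrightarrow> cell i \<in> {1, 2}" "cell n \<notin> {1, 2}"
  shows "\<exists>t\<le>n * 3 + 1. runs K prog_copy (sim (regs R c h g [] []) qq (put_head 0)) t
    (sim (regs R c h g (replicate n 1) (rev (map cell [0..<n]))) qq (put_head (int n)))"
proof -
  define \<sigma> where "\<sigma> i = sim (regs R c h g (replicate i 1) (rev (map cell [0..<i]))) qq (put_head (int i))" for i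
  have b5: "b + 5 + k = b + 6 + (k - 1)" using k_pos by simp
  have vc: "view K (\<sigma> i) (b + 5 + k) = cell i" for i
    unfolding b5 \<sigma>_def using k_pos by (subst view_put_head) (simp_all add: cell_def)
  have "\<exists>t\<le>n * (2 + 1) + 1. runs K prog_copy (\<sigma> 0) t (\<sigma> n)"
    unfolding prog_copy_def
  proof (rule runs_While)
    show "\<not> view K (\<sigma> n) (b + 5 + k) \<in> {1, 2}" using assms(2) vc by simp
  next
    fix i assume i: "i < n"
    then show "view K (\<sigma> i) (b + 5 + k) \<in> {1, 2}" using assms(1)[OF i] vc by simp
    show "\<exists>t\<le>2. runs K (Act (\<lambda>v r. (v r, if r \<in> {b + 5, b + 6 + k} then 1 else 0)) ;;
       Act (\<lambda>v r. if r = b + 6 + k then (v (b + 5 + k), 0) else if r = b + 5 then (1, 0)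
         else if r = b + 5 + k then (v r, 1) else (v r, 0))) (\<sigma> i) t (\<sigma> (Suc i))"
      unfolding \<sigma>_def
    proof (intro runs_Act2_le act_push_sim, goal_cases)
      case (1 r)
      then show ?case using K by auto
    next
      case (2 v r)
      then show ?case
        using 2(1)[of r] 2(1)[of "b + 5 + k"] vc[of i] k_pos
        by (auto simp: regs_def view_sim \<sigma>_def)
    next
      case (3 r)
      then show ?case using K by (auto simp: regs_def)
    next
      case (4 v)
      then show ?case using 4[of "b + 4"] K k_pos by (auto simp: view_sim)
    next
      case (5 v j)
      have *: "(if b + 6 + j = b + 6 + k then (v (b + 5 + k), 0) else if b + 6 + j = b + 5 then (1, 0)
         else if b + 6 + j = b + 5 + k then (v (b + 6 + j), 1) else (v (b + 6 + j), 0)) =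
        (if j = k - 1 then snd (ts J ! (k - 1)) (int i) else snd (ts J ! j) (fst (ts J ! j)),
         if j = k - 1 then 1 else 0)"
        using 5(1)[of "b + 6 + j"] view_put_head[OF 5(2)] 5(2) by auto
      have "int i + 1 = int (Suc i)" by simp
      then show ?case
        using upd_put_head[OF 5(2), of "int i" 1] by (simp only: *)
    qed
  qed
  then show ?thesis by (simp add: \<sigma>_def)
qed

lemma runs_back:
  "\<exists>t\<le>n * 2 + 1. runs K prog_back (sim (regs R c h g (replicate n 1) X) qq (put_head (int n))) t
    (sim (regs R c h g [] X) qq (put_head 0))"
proof -
  define \<sigma> where "\<sigma> i = sim (regs R c h g (replicate (n - i) 1) X) qq (put_head (int (n - i)))" for i
  have "\<exists>t\<le>n * (1 + 1) + 1. runs K prog_back (\<sigma> 0) t (\<sigma> n)"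
    unfolding prog_back_def
  proof (rule runs_While)
    fix i assume i: "i < n"
    then have n: "n - i = Suc (n - Suc i)" by simp
    show "view K (\<sigma> i) (b + 5) \<noteq> 0" using K by (simp add: \<sigma>_def view_sim n)
    show "\<exists>t\<le>1. runs K (Act (\<lambda>v r. if r = b + 5 then (0, - 1) else if r = b + 5 + k then (v r, - 1) else (v r, 0)))
        (\<sigma> i) t (\<sigma> (Suc i))"
      unfolding \<sigma>_def
    proof (intro runs_Act_le act_sim, goal_cases)
      case (1 r)
      then show ?case using k_pos by (auto simp: regs_def view_sim n)
    next
      case (2 r)
      then show ?case using K by (simp add: regs_def)
    next
      case 3
      then show ?case using K k_pos by (simp add: view_sim)
    next
      case (4 j)
      have *: "(if b + 6 + j = b + 5 then (0, - 1) else if b + 6 + j = b + 5 + k then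
          (view K (sim (regs R c h g (replicate (n - i) 1) X) qq (put_head (int (n - i)))) (b + 6 + j), - 1)
          else (view K (sim (regs R c h g (replicate (n - i) 1) X) qq (put_head (int (n - i)))) (b + 6 + j), 0)) =
        (if j = k - 1 then snd (ts J ! (k - 1)) (int (n - i)) else snd (ts J ! j) (fst (ts J ! j)),
         if j = k - 1 then - 1 else 0)"
        using view_put_head[OF 4] 4 by auto
      have "int (n - i) + - 1 = int (n - Suc i)" using i by simp
      then show ?case
        using upd_put_head[OF 4, of "int (n - i)" "- 1"] by (simp only: *)
    qed
  qed (use K in \<open>simp add: \<sigma>_def view_sim\<close>)
  then show ?thesis by (simp add: \<sigma>_def mult_2_right)
qed

lemma runs_undo:
  "\<exists>t\<le>J * 3 + 1. runs K prog_undo (sim (regs R c (rev (map (hist y) [0..<J])) g n X) (q J) (ts J)) t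
    (sim (regs R c [] g n X) (q 0) (ts 0))"
proof -
  define \<sigma> where "\<sigma> i = sim (regs R c (rev (map (hist y) [0..<J - i])) g n X) (q (J - i)) (ts (J - i))" for i
  have "\<exists>t\<le>J * (2 + 1) + 1. runs K prog_undo (\<sigma> 0) t (\<sigma> J)"
    unfolding prog_undo_def
  proof (rule runs_While)
    fix i assume i: "i < J"
    define j where "j = J - Suc i"
    have n: "J - i = Suc j" "J - Suc i = j" "j < J" using i by (auto simp: j_def)
    let ?R = "regs R c (rev (map (hist y) [0..<Suc j])) g n X"
    define tm where "tm = map (\<lambda>l. (fst (ts j ! l), snd (ts (Suc j) ! l))) [0..<k]"
    show "view K (\<sigma> i) (b + 2) \<noteq> 0" using K by (simp add: \<sigma>_def view_sim n)
    have v2: "view K (sim ?R qq tt) (b + 2) = hist y j" for qq tt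
      using K by (simp add: view_sim)
    show "\<exists>t\<le>2. runs K (Act (\<lambda>v r. let x = hist_decode (v (b + 2)) in
       if on_tape r \<and> vs x then (v r, - snd (dlt x (r - (b + 6)))) else (v r, 0)) ;;
      Act (\<lambda>v r. let x = hist_decode (v (b + 2)) in
       if \<not> vs x then (v r, 0) else if on_tape r then (snd x ! (r - (b + 6)), 0)
       else if r = b + 4 then (fst x, 0) else if r = b + 2 then (0, - 1) else (v r, 0))) (\<sigma> i) t (\<sigma> (Suc i))"
      unfolding \<sigma>_def n
    proof (intro runs_Act2_le)
      have 1: "act K (\<lambda>v r. let x = hist_decode (v (b + 2)) in
          if on_tape r \<and> vs x then (v r, - snd (dlt x (r - (b + 6)))) else (v r, 0)) (sim ?R (q (Suc j)) (ts (Suc j))) =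
        sim ?R (q (Suc j)) tm"
      proof (rule act_sim, goal_cases)
        case (4 l)
        then show ?case
          using v2 K vs_cfg[OF n(3)] ts_Suc[OF n(3) 4]
          by (auto simp: Let_def hist_def view_sim tm_def upd_tape_def prod_eq_iff)
      qed (use K in \<open>auto simp: Let_def view_sim\<close>)
      have 2: "act K (\<lambda>v r. let x = hist_decode (v (b + 2)) in
         if \<not> vs x then (v r, 0) else if on_tape r then (snd x ! (r - (b + 6)), 0)
         else if r = b + 4 then (fst x, 0) else if r = b + 2 then (0, - 1) else (v r, 0)) (sim ?R (q (Suc j)) tm) =
        sim (regs R c (rev (map (hist y) [0..<j])) g n X) (q j) (ts j)"
      proof (rule act_sim, goal_cases)
        case (1 r)
        then show ?case using v2 K vs_cfg[OF n(3)] by (auto simp: Let_def hist_def view_sim regs_def)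
      next
        case (4 l)
        then show ?case
          using v2 K vs_cfg[OF n(3)] ts_Suc[OF n(3) 4]
          by (auto simp: Let_def hist_def view_sim tm_def upd_tape_def prod_eq_iff nth_scans)
      qed (use v2 K vs_cfg[OF n(3)] in \<open>auto simp: Let_def view_sim regs_def hist_def\<close>)
      show "act K (\<lambda>v r. let x = hist_decode (v (b + 2)) in
         if \<not> vs x then (v r, 0) else if on_tape r then (snd x ! (r - (b + 6)), 0)
         else if r = b + 4 then (fst x, 0) else if r = b + 2 then (0, - 1) else (v r, 0))
        (act K (\<lambda>v r. let x = hist_decode (v (b + 2)) in
          if on_tape r \<and> vs x then (v r, - snd (dlt x (r - (b + 6)))) else (v r, 0)) (sim ?R (q (Suc j)) (ts (Suc j)))) =
        sim (regs R c (rev (map (hist y) [0..<j])) g n X) (q j) (ts j)"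
        unfolding 1 2 ..
    qed
  qed (use K in \<open>simp add: \<sigma>_def view_sim\<close>)
  then show ?thesis by (simp add: \<sigma>_def)
qed

end

lemma runs_seek:
  assumes "length tt = k" "tt ! 0 = (p, f)" "\<And>i. i < n \<Longrightarrow> f (p + int i * d) \<noteq> 0" "f (p + int n * d) = 0"
  shows "\<exists>t\<le>n * 2 + 1. runs K (prog_seek d) (sim R qq tt) t (sim R qq (tt[0 := (p + int n * d, f)]))"
proof -
  define \<sigma> where "\<sigma> i = sim R qq (tt[0 := (p + int i * d, f)])" for i
  have v: "view K (\<sigma> i) (b + 6) = f (p + int i * d)" for i
    using K k_pos assms(1) by (simp add: \<sigma>_def view_sim)
  have "\<exists>t\<le>n * (1 + 1) + 1. runs K (prog_seek d) (\<sigma> 0) t (\<sigma> n)"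
    unfolding prog_seek_def
  proof (rule runs_While)
    fix i assume i: "i < n"
    show "view K (\<sigma> i) (b + 6) \<noteq> 0" using assms(3)[OF i] v by simp
    show "\<exists>t\<le>1. runs K (Act (\<lambda>v r. (v r, if r = b + 6 then d else 0))) (\<sigma> i) t (\<sigma> (Suc i))"
      unfolding \<sigma>_def
      by (intro runs_Act_le act_sim)
        (use K k_pos assms(1) in \<open>auto simp: view_sim upd_tape_def nth_list_update prod_eq_iff algebra_simps\<close>)
  qed (use assms(4) v in simp)
  moreover have "tt[0 := (p, f)] = tt" using assms(2) by (metis list_update_id)
  ultimately show ?thesis by (simp add: \<sigma>_def mult_2_right)
qed

lemma runs_shift:
  assumes "length tt = k"
  shows "\<exists>t\<le>1. runs K (prog_shift d) (sim R qq tt) t (sim R qq (map (\<lambda>(h, t). (h + d, t)) tt))"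
  unfolding prog_shift_def
  by (intro runs_Act_le act_sim)
    (use K k_pos assms in \<open>auto simp: view_sim upd_tape_def prod_eq_iff split: prod.splits\<close>)

text \<open>The same store seen from outside, as registers, and from inside, as tapes of
  \<open>M\<close>: an empty register is a blank tape with its head at \<open>- 1\<close>.\<close>

lemma bits_sim:
  assumes "\<rho> (b + 4) = []" "\<And>r. on_tape r \<Longrightarrow> r \<noteq> b + 6 \<Longrightarrow> \<rho> r = []"
  shows "bits \<rho> = sim (\<lambda>r. map bsym (\<rho> r)) 0
    ((int (length (\<rho> (b + 6))) - 1, bit_tape (rev (\<rho> (b + 6)))) # replicate (k - 1) (- 1, bit_tape []))"
proof
  fix r
  have e: "stack_tape (map bsym []) = (- 1, bit_tape [])" "stack_tape [] = (- 1, bit_tape [])"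
    by (auto simp: stack_tape_def bit_tape_def)
  have e0: "bit_tape [] = (\<lambda>_. 0)(- 1 := 0)" by (auto simp: bit_tape_def)
  have f: "stack_tape (map bsym xs) = (int (length xs) - 1, bit_tape (rev xs))" for xs
    using snd_stack_bits[of xs] by (auto simp: prod_eq_iff) (simp add: stack_tape_def)
  consider "r = b + 4" | "r = b + 6" | "on_tape r" "r \<noteq> b + 6" | "r \<noteq> b + 4" "\<not> on_tape r" by blast
  then show "bits \<rho> r = sim (\<lambda>r. map bsym (\<rho> r)) 0
    ((int (length (\<rho> (b + 6))) - 1, bit_tape (rev (\<rho> (b + 6)))) # replicate (k - 1) (- 1, bit_tape [])) r"
  proof cases
    case 1
    then show ?thesis using assms e e0 by (simp add: bits_def stacks_def sim_def)
  next
    case 3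
    then show ?thesis using assms(2)[of r] e by (auto simp: bits_def stacks_def sim_def nth_Cons')
  qed (use k_pos in \<open>auto simp: bits_def stacks_def sim_def f\<close>)
qed

text \<open>Both transfers of register \<open>b + 6 + k\<close> reverse it: the first makes the
  input readable from left to right, the last one turns around the output, which was pushed bit by
  bit.\<close>

definition "run_prog = mv (b + 6 + k) {b + 6} ;; prog_seek (- 1) ;; prog_shift 1 ;; prog_fwd ;;
  prog_head (b + 2) (b + 3) (- 1) ;; prog_copy ;; prog_back ;; prog_head (b + 3) (b + 2) 1 ;; prog_undo ;;
  prog_seek 1 ;; prog_shift (- 1) ;; mv (b + 6) {} ;; mv (b + 1) {} ;; mv (b + 6 + k) {b}"

text \<open>Compute, copy the output, uncompute. Each phase takes time linear in the number of
  steps, the input and the output, and the output is bounded by the other two through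
  \<open>out_len\<close>.\<close>

lemma runs_run_prog:
  assumes "\<And>r. r \<in> {b, b + 2, b + 3, b + 4, b + 5} \<Longrightarrow> \<rho> r = []" "\<And>r. on_tape r \<Longrightarrow> \<rho> r = []"
  defines "y \<equiv> \<rho> (b + 6 + k)" and "L \<equiv> length (\<rho> (b + 1))"
  shows "\<exists>t\<le>23 * (L + length y) + 14. runs K run_prog (bits \<rho>) t
    (bits (\<rho>(b + 1 := [], b + 6 + k := [], b := run_out M L y)))"
proof -
  \<comment> \<open>The number of steps really made: \<open>M\<close> halts or the clock runs out.
    Either way configuration \<open>J\<close> equals configuration \<open>L\<close>.\<close>
  define J where "J = (LEAST j. fst (cfg M y j) = tm_states M \<or> j = L)"
  have J1: "fst (cfg M y J) = tm_states M \<or> J = L" unfolding J_def by (rule LeastI[of _ L]) simp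
  have JL: "J \<le> L" unfolding J_def by (rule Least_le) simp
  have J2: "fst (cfg M y i) < tm_states M" if "i < J" for i
    using not_less_Least[OF that[unfolded J_def]] good_cfg[OF M, of y i] by (auto simp: good_cfg_def)
  have cJ: "cfg M y L = cfg M y J" using J1 JL cfg_halted[of M y J L] by auto
  define n where "n = out_len M L y"
  have n: "n \<le> length y + L" using out_len(1)[OF M, of L y] by (simp add: n_def)
  have cell: "cell y J i = out_cell M L y i" for i
    by (simp add: cell_def[OF J2] out_cell_def cJ)
  define c where "c = map bsym (\<rho> (b + 1))"
  define \<rho>1 where "\<rho>1 = \<rho>(b + 6 + k := [], b + 6 := rev y)"
  define R where "R = (\<lambda>r. map bsym (\<rho>1 r))"
  have R: "regs R c [] [] [] [] = R"
    using assms(1,2) k_pos by (auto simp: regs_def R_def \<rho>1_def c_def)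
  define T where "T p = (p, bit_tape y) # replicate (k - 1) (- 1, bit_tape [])" for p :: int
  have lT: "length (T p) = k" for p using k_pos by (simp add: T_def)
  have s1: "\<exists>t\<le>3 * length y + 1. runs K (mv (b + 6 + k) {b + 6}) (bits \<rho>) t (sim R 0 (T (int (length y) - 1)))"
  proof -
    have "bits \<rho>1 = sim R 0 (T (int (length y) - 1))"
      unfolding R_def T_def
      by (subst bits_sim) (use assms(1,2) k_pos in \<open>auto simp: \<rho>1_def\<close>)
    note this[symmetric]
    moreover have "\<exists>t\<le>3 * length (\<rho> (b + 6 + k)) + 1. runs K (mv (b + 6 + k) {b + 6}) (bits \<rho>) t (bits \<rho>1)"
      by (rule runs_mv) (use assms(2)[of "b + 6"] K k_pos in \<open>auto simp: \<rho>1_def y_def fun_eq_iff\<close>)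
    ultimately show ?thesis by (simp only: y_def)
  qed
  have s2: "\<exists>t\<le>length y * 2 + 1. runs K (prog_seek (- 1)) (sim R 0 (T (int (length y) - 1))) t (sim R 0 (T (- 1)))"
    using runs_seek[of "T (int (length y) - 1)" "int (length y) - 1" "bit_tape y" "length y" "- 1" R 0] lT
    by (auto simp: T_def bit_tape_def)
  have s3: "\<exists>t\<le>1. runs K (prog_shift 1) (sim R 0 (T (- 1))) t (sim R (fst (cfg M y 0)) (snd (cfg M y 0)))"
    using runs_shift[of "T (- 1)" 1 R 0] lT by (simp add: T_def cfg_0)
  have s4: "\<exists>t\<le>J * 3 + 1. runs K prog_fwd (sim R (fst (cfg M y 0)) (snd (cfg M y 0))) t
      (sim (regs R (drop J c) (rev (map (hist y) [0..<J])) [] [] []) (fst (cfg M y J)) (put_head y J (head y J)))"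
  proof -
    have ph: "put_head y J (head y J) = snd (cfg M y J)" by (rule put_head_J[OF J2])
    have "\<exists>t\<le>J * 3 + 1. runs K prog_fwd (sim (regs R c [] [] [] []) (fst (cfg M y 0)) (snd (cfg M y 0))) t
      (sim (regs R (drop J c) (rev (map (hist y) [0..<J])) [] [] []) (fst (cfg M y J)) (snd (cfg M y J)))"
      by (rule runs_fwd[OF J2]) (use J1 JL in \<open>auto simp: c_def L_def\<close>)
    then show ?thesis by (simp only: ph R)
  qed
  have hs: "head y (J - i) = head y (J - Suc i) +
      snd (dlt (fst (cfg M y (J - Suc i)), scans (snd (cfg M y (J - Suc i)))) (k - 1))" if "i < J" for i
  proof -
    have "J - i = Suc (J - Suc i)" "J - Suc i < J" using that by auto
    then show ?thesis using head_Suc[OF J2 \<open>J - Suc i < J\<close>] by simp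
  qed
  let ?c = "drop J c" and ?q = "fst (cfg M y J)"
  have s5: "\<exists>t\<le>J * 3 + 1. runs K (prog_head (b + 2) (b + 3) (- 1))
      (sim (regs R ?c (rev (map (hist y) [0..<J])) [] [] []) ?q (put_head y J (head y J))) t
      (sim (regs R ?c [] (map (hist y) [0..<J]) [] []) ?q (put_head y J 0))"
  proof -
    have r: "rev (map (hist y) [0..<J]) = map (\<lambda>i. hist y (J - Suc i)) [0..<J]"
      by (intro nth_equalityI) (auto simp: rev_nth)
    have h0: "head y 0 = 0" using k_pos by (auto simp: head_def[OF J2] cfg_0 nth_Cons')
    have "\<exists>t\<le>J * 3 + 1. runs K (prog_head (b + 2) (b + 3) (- 1))
      (sim (regs R ?c (rev (map (hist y) [0..<J])) [] [] []) ?q (put_head y J (head y (J - 0)))) t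
      (sim ((regs R ?c (rev (map (hist y) [0..<J])) [] [] [])(b + 2 := [], b + 3 :=
         rev (map (\<lambda>i. hist y (J - Suc i)) [0..<J]) @ regs R ?c (rev (map (hist y) [0..<J])) [] [] [] (b + 3)))
        ?q (put_head y J (head y (J - J))))"
      by (rule runs_head[OF J2, where p = "\<lambda>i. head y (J - i)" and h = "\<lambda>i. J - Suc i"])
        (use hs r in \<open>auto simp: Suc_diff_Suc\<close>)
    moreover have "(regs R ?c (rev (map (hist y) [0..<J])) [] [] [])(b + 2 := [], b + 3 := map (hist y) [0..<J]) =
        regs R ?c [] (map (hist y) [0..<J]) [] []"
      by (auto simp: regs_def)
    ultimately show ?thesis by (simp add: r[symmetric] h0)
  qed
  have s6: "\<exists>t\<le>n * 3 + 1. runs K prog_copy (sim (regs R ?c [] (map (hist y) [0..<J]) [] []) ?q (put_head y J 0)) t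
      (sim (regs R ?c [] (map (hist y) [0..<J]) (replicate n 1) (rev (map (cell y J) [0..<n]))) ?q (put_head y J (int n)))"
    by (rule runs_copy[OF J2]) (use out_len(2,3)[OF M] in \<open>auto simp: cell n_def\<close>)
  let ?X = "rev (map (cell y J) [0..<n])"
  have s7: "\<exists>t\<le>n * 2 + 1. runs K prog_back
      (sim (regs R ?c [] (map (hist y) [0..<J]) (replicate n 1) ?X) ?q (put_head y J (int n))) t
      (sim (regs R ?c [] (map (hist y) [0..<J]) [] ?X) ?q (put_head y J 0))"
    by (rule runs_back[OF J2])
  have s8: "\<exists>t\<le>J * 3 + 1. runs K (prog_head (b + 3) (b + 2) 1)
      (sim (regs R ?c [] (map (hist y) [0..<J]) [] ?X) ?q (put_head y J 0)) t
      (sim (regs R ?c (rev (map (hist y) [0..<J])) [] [] ?X) ?q (snd (cfg M y J)))"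
  proof -
    have h0: "head y 0 = 0" using k_pos by (auto simp: head_def[OF J2] cfg_0 nth_Cons')
    have "\<exists>t\<le>J * 3 + 1. runs K (prog_head (b + 3) (b + 2) 1)
      (sim (regs R ?c [] (map (hist y) [0..<J]) [] ?X) ?q (put_head y J (head y 0))) t
      (sim ((regs R ?c [] (map (hist y) [0..<J]) [] ?X)(b + 3 := [], b + 2 :=
         rev (map (\<lambda>i. hist y i) [0..<J]) @ regs R ?c [] (map (hist y) [0..<J]) [] ?X (b + 2)))
        ?q (put_head y J (head y J)))"
      by (rule runs_head[OF J2]) (use head_Suc[OF J2] in auto)
    moreover have "(regs R ?c [] (map (hist y) [0..<J]) [] ?X)(b + 3 := [], b + 2 := rev (map (hist y) [0..<J])) =
        regs R ?c (rev (map (hist y) [0..<J])) [] [] ?X"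
      by (auto simp: regs_def)
    ultimately show ?thesis by (simp add: h0 put_head_J[OF J2])
  qed
  have s9: "\<exists>t\<le>J * 3 + 1. runs K prog_undo
      (sim (regs R ?c (rev (map (hist y) [0..<J])) [] [] ?X) ?q (snd (cfg M y J))) t
      (sim (regs R ?c [] [] [] ?X) (fst (cfg M y 0)) (snd (cfg M y 0)))"
    by (rule runs_undo[OF J2])
  let ?R = "regs R ?c [] [] [] ?X"
  have s10: "\<exists>t\<le>length y * 2 + 1. runs K (prog_seek 1) (sim ?R (fst (cfg M y 0)) (snd (cfg M y 0))) t
      (sim ?R 0 ((int (length y), bit_tape y) # replicate (k - 1) (0, bit_tape [])))"
    using runs_seek[of "snd (cfg M y 0)" 0 "bit_tape y" "length y" 1 ?R 0] k_pos
    by (auto simp: cfg_0 bit_tape_def)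
  have s11: "\<exists>t\<le>1. runs K (prog_shift (- 1)) (sim ?R 0 ((int (length y), bit_tape y) # replicate (k - 1) (0, bit_tape []))) t
      (sim ?R 0 (T (int (length y) - 1)))"
    using runs_shift[of "(int (length y), bit_tape y) # replicate (k - 1) (0, bit_tape [])" "- 1" ?R 0] k_pos
    by (simp add: T_def)
  define out where "out = run_out M L y"
  have X: "?X = map bsym (rev out)"
  proof -
    have "map (cell y J) [0..<n] = map bsym out"
      unfolding out_def run_out_def map_map n_def[symmetric]
    proof (rule map_cong[OF refl])
      fix i assume "i \<in> set [0..<n]"
      then show "cell y J i = (bsym \<circ> (\<lambda>i. out_cell M L y i = 2)) i"
        using out_len(3)[OF M, of i L y] by (auto simp: cell n_def bsym_def)
    qed
    then show ?thesis by (simp add: rev_map)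
  qed
  define \<rho>2 where "\<rho>2 = \<rho>1(b + 1 := drop J (\<rho> (b + 1)), b + 6 + k := rev out)"
  have sim2: "sim ?R 0 (T (int (length y) - 1)) = bits \<rho>2"
  proof -
    have "?R = (\<lambda>r. map bsym (\<rho>2 r))"
      using assms(1) k_pos by (auto simp: fun_eq_iff regs_def \<rho>2_def R_def \<rho>1_def c_def X drop_map)
    then show ?thesis
      using assms(1,2) k_pos by (subst bits_sim) (auto simp: \<rho>2_def \<rho>1_def T_def)
  qed
  have out: "length out = n" by (simp add: out_def run_out_def n_def)
  have s12: "\<exists>t\<le>3 * length y + 1. runs K (mv (b + 6) {}) (bits \<rho>2) t (bits (\<rho>2(b + 6 := [])))"
    by (rule runs_le_mono[OF runs_mv]) (use K k_pos in \<open>auto simp: fun_eq_iff \<rho>2_def \<rho>1_def L_def\<close>)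
  have s13: "\<exists>t\<le>3 * L + 1. runs K (mv (b + 1) {}) (bits (\<rho>2(b + 6 := []))) t
      (bits (\<rho>2(b + 6 := [], b + 1 := [])))"
    by (rule runs_le_mono[OF runs_mv]) (use K k_pos in \<open>auto simp: fun_eq_iff \<rho>2_def \<rho>1_def L_def\<close>)
  have s14: "\<exists>t\<le>3 * n + 1.
      runs K (mv (b + 6 + k) {b}) (bits (\<rho>2(b + 6 := [], b + 1 := []))) t
      (bits (\<rho>(b + 1 := [], b + 6 + k := [], b := out)))"
    by (rule runs_le_mono[OF runs_mv]) (use K k_pos assms(1,2) out in \<open>auto simp: fun_eq_iff \<rho>2_def \<rho>1_def\<close>)
  have "\<exists>t\<le>(3 * length y + 1) + ((length y * 2 + 1) + (1 + ((J * 3 + 1) + ((J * 3 + 1) + ((n * 3 + 1) +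
      ((n * 2 + 1) + ((J * 3 + 1) + ((J * 3 + 1) + ((length y * 2 + 1) + (1 + ((3 * length y + 1) +
      ((3 * L + 1) + (3 * n + 1))))))))))))).
      runs K run_prog (bits \<rho>) t (bits (\<rho>(b + 1 := [], b + 6 + k := [], b := out)))"
    unfolding run_prog_def
    by (intro runs_Seq_le[OF s1] runs_Seq_le[OF s2] runs_Seq_le[OF s3] runs_Seq_le[OF s4] runs_Seq_le[OF s5]
        runs_Seq_le[OF s6] runs_Seq_le[OF s7] runs_Seq_le[OF s8] runs_Seq_le[OF s9] runs_Seq_le[OF s10]
        runs_Seq_le[OF s11[unfolded sim2]] runs_Seq_le[OF s12] runs_Seq_le[OF s13] s14)
  then show ?thesis
    unfolding out_def
  proof (rule runs_le_mono)
    show "(3 * length y + 1) + ((length y * 2 + 1) + (1 + ((J * 3 + 1) + ((J * 3 + 1) + ((n * 3 + 1) +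
      ((n * 2 + 1) + ((J * 3 + 1) + ((J * 3 + 1) + ((length y * 2 + 1) + (1 + ((3 * length y + 1) +
      ((3 * L + 1) + (3 * n + 1)))))))))))))
      \<le> 23 * (L + length y) + 14" (is "?l \<le> _")
    proof -
      have "?l = 10 * length y + 12 * J + 8 * n + 3 * L + 14" by simp
      also have "\<dots> \<le> 10 * length y + 12 * L + 8 * (length y + L) + 3 * L + 14"
        using n JL by (intro add_mono mult_left_mono) auto
      also have "\<dots> \<le> 23 * (L + length y) + 14" by simp
      finally show ?thesis .
    qed
  qed
qed

lemma wfc_run_prog: "\<exists>S0. \<forall>S\<ge>S0. wfc S run_prog"
proof -
  obtain B where B: "\<And>q ss. valid_scan M q ss \<Longrightarrow> hist_code (q, ss) < B"
    using hist_code_bound by blast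
  have "wfc S run_prog" if S: "S \<ge> max (max B 3) (max (tm_symbols M) (Suc (tm_states M)))" for S
  proof -
    have d: "fst (tm_delta M (fst x) (snd x)) < S" "i < k \<Longrightarrow> fst (dlt x i) < S"
      "i < k \<Longrightarrow> snd (dlt x i) \<in> {- 1, 0, 1}" if "vs x" for x i
      using delta_valid[OF M that[unfolded vs_def]] S
      by (force, metis less_le_trans max.bounded_iff, blast)
    have m: "- snd (dlt x i) \<in> {- 1, 0, 1}" if "vs x" "i < k" for x i
      using d(3)[OF that(1,2)] by auto
    have h: "hist_code x < S" "fst x < S" "i < k \<Longrightarrow> snd x ! i < S" if "vs x" for x i
    proof -
      show "hist_code x < S" "fst x < S"
        using B[of "fst x" "snd x"] that S by (auto simp: vs_def valid_scan_def)
      assume "i < k"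
      then have "snd x ! i < tm_symbols M" using that by (force simp: vs_def valid_scan_def)
      then show "snd x ! i < S" using S by simp
    qed
    have i: "r - (b + 6) < k" if "on_tape r" for r using that by auto
    have S3: "0 < S" "1 < S" "2 < S" using S by auto
    have "wfc S prog_fwd"
      using d h i S3 by (auto simp: prog_fwd_def valid_act_def Let_def) blast+
    moreover have "wfc S (prog_head s e z)" if "z \<in> {- 1, 1}" for s e z
    proof -
      have *: "snd (dlt x (k - Suc 0)) = 0"
        if "vs x" "snd (dlt x (k - Suc 0)) \<noteq> - 1" "snd (dlt x (k - Suc 0)) \<noteq> 1" for x
        using d(3)[OF that(1), of "k - Suc 0"] k_pos that(2,3) by auto
      then show ?thesis
        using S3 that by (auto simp: prog_head_def valid_act_def Let_def intro: *)
    qed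
    moreover have "wfc S prog_copy" "wfc S prog_back" "wfc S (prog_seek 1)" "wfc S (prog_seek (- 1))"
       "wfc S (prog_shift 1)" "wfc S (prog_shift (- 1))"
      using S3 by (auto simp: prog_copy_def prog_back_def prog_seek_def prog_shift_def valid_act_def)
    moreover have "wfc S prog_undo"
      using m h i S3 by (auto simp: prog_undo_def valid_act_def Let_def)
    moreover have "wfc S (mv s ds)" for s ds using S3 by (intro wfc_xfer) auto
    ultimately show ?thesis by (simp add: run_prog_def)
  qed
  then show ?thesis by blast
qed

end

section \<open>Expressions that are evaluated in polynomial time\<close>

definition pbounded :: "(nat \<Rightarrow> nat) \<Rightarrow> bool" where
  "pbounded f \<longleftrightarrow> (\<exists>p :: nat poly. \<forall>n. f n \<le> poly p n)"

lemma poly_nat_mono: "m \<le> n \<Longrightarrow> poly p m \<le> poly (p :: nat poly) n"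
  by (induction p) (auto intro!: add_mono mult_mono)

lemma pbounded_const: "pbounded (\<lambda>_. c)"
  unfolding pbounded_def by (rule exI[of _ "[:c:]"]) simp

lemma pbounded_id: "pbounded (\<lambda>n. n)"
  unfolding pbounded_def by (rule exI[of _ "[:0, 1:]"]) simp

lemma pbounded_add: "pbounded f \<Longrightarrow> pbounded g \<Longrightarrow> pbounded (\<lambda>n. f n + g n)"
  unfolding pbounded_def by (metis add_mono poly_add)

lemma pbounded_mult: "pbounded f \<Longrightarrow> pbounded g \<Longrightarrow> pbounded (\<lambda>n. f n * g n)"
  unfolding pbounded_def by (metis mult_le_mono poly_mult)

lemma pbounded_mono: "pbounded g \<Longrightarrow> (\<And>n. f n \<le> g n) \<Longrightarrow> pbounded f"
  unfolding pbounded_def by (meson le_trans)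

lemma pbounded_max: "pbounded f \<Longrightarrow> pbounded g \<Longrightarrow> pbounded (\<lambda>n. max (f n) (g n))"
  by (rule pbounded_mono[OF pbounded_add, of f g]) auto

text \<open>The bound for the inner function may be inserted into the outer polynomial, as
  polynomials with natural coefficients are monotone.\<close>

lemma pbounded_comp: "pbounded f \<Longrightarrow> pbounded g \<Longrightarrow> pbounded (\<lambda>n. f (g n))"
proof -
  assume "pbounded f" "pbounded g"
  then obtain p q :: "nat poly" where "\<And>n. f n \<le> poly p n" "\<And>n. g n \<le> poly q n"
    unfolding pbounded_def by blast
  then have "f (g n) \<le> poly (pcompose p q) n" for n
    by (metis le_trans poly_nat_mono poly_pcompose)
  then show ?thesis unfolding pbounded_def by blast
qed

lemmas pbounded_intros = pbounded_const pbounded_id pbounded_add pbounded_mult pbounded_max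

text \<open>A loop runs over the length of a value computed beforehand and thus cannot leave
  polynomial time. Its index enters in unary as variable \<open>0\<close>, the other variables
  moving up by one.\<close>

datatype exp =
    EVar nat
  | EConst "bool list"
  | ECat exp exp
  | EIf exp exp exp
  | EDrop exp exp
  | EFor exp exp
  | EBin exp
  | ERun tm exp exp

definition first :: "bool list \<Rightarrow> bool" where
  "first xs = (case xs of [] \<Rightarrow> False | b # _ \<Rightarrow> b)"

fun eval :: "exp \<Rightarrow> bool list list \<Rightarrow> bool list" where
  "eval (EVar n) \<rho> = (if n < length \<rho> then \<rho> ! n else [])"
| "eval (EConst xs) \<rho> = xs"
| "eval (ECat a c) \<rho> = eval a \<rho> @ eval c \<rho>"
| "eval (EIf c a d) \<rho> = (if first (eval c \<rho>) then eval a \<rho> else eval d \<rho>)"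
| "eval (EDrop a c) \<rho> = drop (length (eval a \<rho>)) (eval c \<rho>)"
| "eval (EFor a c) \<rho> = concat (map (\<lambda>i. eval c (replicate i True # \<rho>)) [0..<length (eval a \<rho>)])"
| "eval (EBin a) \<rho> = binary_digits (length (eval a \<rho>))"
| "eval (ERun M a c) \<rho> = run_out M (length (eval a \<rho>)) (eval c \<rho>)"

fun wfe :: "exp \<Rightarrow> bool" where
  "wfe (EVar n) = True"
| "wfe (EConst xs) = True"
| "wfe (ECat a c) = (wfe a \<and> wfe c)"
| "wfe (EIf c a d) = (wfe c \<and> wfe a \<and> wfe d)"
| "wfe (EDrop a c) = (wfe a \<and> wfe c)"
| "wfe (EFor a c) = (wfe a \<and> wfe c)"
| "wfe (EBin a) = wfe a"
| "wfe (ERun M a c) = (turing_machine M \<and> wfe a \<and> wfe c)"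

lemma length_binary_digits: "length (binary_digits n) \<le> n"
proof (induction n rule: less_induct)
  case (less n)
  show ?case
  proof (cases "n = 0")
    case True then show ?thesis by (simp add: binary_digits.simps)
  next
    case False
    then have "length (binary_digits (n div 2)) \<le> n div 2" by (intro less) auto
    moreover have "n div 2 < n" using False by simp
    ultimately show ?thesis using False by (subst binary_digits.simps) simp
  qed
qed

definition size_bounded :: "exp \<Rightarrow> (nat \<Rightarrow> nat) \<Rightarrow> bool" where
  "size_bounded e h \<longleftrightarrow> (\<forall>\<rho> n. (\<forall>v\<in>set \<rho>. length v \<le> n) \<longrightarrow> length (eval e \<rho>) \<le> h n)"

text \<open>In a loop the index is a new variable of length up to \<open>h1 n\<close>, so the bound
  for the body is taken at \<open>max n (h1 n)\<close>.\<close>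

lemma ex_size_bounded: "wfe e \<Longrightarrow> \<exists>h. pbounded h \<and> size_bounded e h"
proof (induction e)
  case (EVar n)
  show ?case by (rule exI[of _ "\<lambda>n. n"]) (auto simp: size_bounded_def pbounded_intros)
next
  case (EConst xs)
  show ?case by (rule exI[of _ "\<lambda>_. length xs"]) (auto simp: size_bounded_def pbounded_intros)
next
  case (ECat a c)
  then obtain h1 h2 where "pbounded h1" "size_bounded a h1" "pbounded h2" "size_bounded c h2" by auto
  then show ?case
    by (intro exI[of _ "\<lambda>n. h1 n + h2 n"]) (auto simp: size_bounded_def intro!: pbounded_intros add_mono)
next
  case (EIf c a d)
  then obtain h1 h2 where "pbounded h1" "size_bounded a h1" "pbounded h2" "size_bounded d h2" by auto
  then show ?case
    by (intro exI[of _ "\<lambda>n. h1 n + h2 n"])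
      (auto simp: size_bounded_def intro!: pbounded_intros intro: le_trans trans_le_add1 trans_le_add2)
next
  case (EDrop a c)
  then obtain h1 where "pbounded h1" "size_bounded c h1" by auto
  then show ?case by (intro exI[of _ h1]) (auto simp: size_bounded_def intro: le_trans diff_le_self)
next
  case (EFor a c)
  then obtain h1 h2 where h: "pbounded h1" "size_bounded a h1" "pbounded h2" "size_bounded c h2" by auto
  have "length (eval (EFor a c) \<rho>) \<le> h1 n * h2 (max n (h1 n))" if "\<forall>v\<in>set \<rho>. length v \<le> n" for \<rho> n
  proof -
    have L: "length (eval a \<rho>) \<le> h1 n" using h(2) that by (auto simp: size_bounded_def)
    have "length (eval (EFor a c) \<rho>) = (\<Sum>i\<leftarrow>[0..<length (eval a \<rho>)]. length (eval c (replicate i True # \<rho>)))"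
      by (simp add: length_concat comp_def)
    also have "\<dots> \<le> (\<Sum>i\<leftarrow>[0..<length (eval a \<rho>)]. h2 (max n (h1 n)))"
    proof (rule sum_list_mono)
      fix i assume "i \<in> set [0..<length (eval a \<rho>)]"
      then have "i \<le> h1 n" using L by auto
      then have "\<forall>v\<in>set (replicate i True # \<rho>). length v \<le> max n (h1 n)"
        using that by auto
      then show "length (eval c (replicate i True # \<rho>)) \<le> h2 (max n (h1 n))"
        using h(4) unfolding size_bounded_def by blast
    qed
    also have "\<dots> \<le> h1 n * h2 (max n (h1 n))" using L by (simp add: sum_list_triv)
    finally show ?thesis .
  qed
  then show ?case
    using h by (intro exI[of _ "\<lambda>n. h1 n * h2 (max n (h1 n))"])
      (auto simp: size_bounded_def intro!: pbounded_intros pbounded_comp[of h2])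
next
  case (EBin a)
  then obtain h1 where "pbounded h1" "size_bounded a h1" by auto
  then show ?case
    by (intro exI[of _ h1]) (auto simp: size_bounded_def intro: le_trans length_binary_digits)
next
  case (ERun M a c)
  then obtain h1 h2 where "pbounded h1" "size_bounded a h1" "pbounded h2" "size_bounded c h2" by auto
  moreover have "length (run_out M L y) \<le> max (length y) L" for L y
    using out_len(1)[of M L y] ERun.prems by (simp add: run_out_def)
  ultimately show ?case
    by (intro exI[of _ "\<lambda>n. max (h2 n) (h1 n)"])
      (auto simp: size_bounded_def intro!: pbounded_intros, meson le_trans max.mono)
qed

section \<open>Compilation of expressions\<close>

definition env_ok :: "nat list \<Rightarrow> nat \<Rightarrow> nat \<Rightarrow> (nat \<Rightarrow> bool list) \<Rightarrow> bool" where
  "env_ok vs b n \<rho> \<longleftrightarrow> (\<forall>v\<in>set vs. v < b \<and> length (\<rho> v) \<le> n) \<and> (\<forall>r\<ge>b. \<rho> r = [])"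

lemma env_ok_upd:
  assumes "env_ok vs b n \<rho>" "\<And>r. r < b \<Longrightarrow> \<rho>' r = \<rho> r" "\<And>r. b' \<le> r \<Longrightarrow> \<rho>' r = []" "b \<le> b'"
  shows "env_ok vs b' n \<rho>'" "map \<rho>' vs = map \<rho> vs"
  using assms by (force simp: env_ok_def)+

text \<open>Program \<open>P\<close> writes the value of \<open>e\<close> in the environment given by the registers \<open>vs\<close> to register \<open>b\<close>,
  using only registers from \<open>b\<close> on as scratch space.\<close>

definition implements :: "(nat \<Rightarrow> nat) \<Rightarrow> exp \<Rightarrow> nat list \<Rightarrow> nat \<Rightarrow> com \<Rightarrow> nat \<Rightarrow> nat \<Rightarrow> bool" where
  "implements f e vs b P K0 S0 \<longleftrightarrow> (\<forall>S\<ge>S0. wfc S P) \<and>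
     (\<forall>K\<ge>K0. \<forall>\<rho> n. env_ok vs b n \<rho> \<longrightarrow>
        (\<exists>t\<le>f n. runs K P (bits \<rho>) t (bits (\<rho>(b := eval e (map \<rho> vs))))))"

text \<open>The time bound is chosen before the registers: an enclosing construct may evaluate the
  expression at any registers at the same cost.\<close>

definition implementable :: "exp \<Rightarrow> bool" where
  "implementable e \<longleftrightarrow> (\<exists>f. pbounded f \<and>
     (\<forall>vs b. (\<forall>v\<in>set vs. v < b) \<longrightarrow> (\<exists>P K0 S0. implements f e vs b P K0 S0)))"

lemma implementsD:
  assumes "implements f e vs b P K0 S0" "K0 \<le> K" "env_ok vs b n \<rho>"
    "map \<rho> vs = xs" "\<rho>' = \<rho>(b := eval e xs)"
  shows "\<exists>t\<le>f n. runs K P (bits \<rho>) t (bits \<rho>')"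
  using assms by (auto simp: implements_def)

lemma implementsD_wfc: "implements f e vs b P K0 S0 \<Longrightarrow> S0 \<le> S \<Longrightarrow> wfc S P"
  by (simp add: implements_def)

lemma wfc_mv: "3 \<le> S \<Longrightarrow> wfc S (mv s ds)" "3 \<le> S \<Longrightarrow> wfc S (ones s d)" "3 \<le> S \<Longrightarrow> wfc S (falses s d)"
  by (auto intro!: wfc_xfer)

lemma implementable_EVar: "implementable (EVar n)"
  unfolding implementable_def
proof (intro exI[of _ "\<lambda>n. 6 * n + 2"] conjI allI impI)
  show "pbounded (\<lambda>n. 6 * n + 2)" by (intro pbounded_intros)
  fix vs b assume vs: "\<forall>v\<in>set vs. v < (b :: nat)"
  show "\<exists>P K0 S0. implements (\<lambda>n. 6 * n + 2) (EVar n) vs b P K0 S0"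
  proof (cases "n < length vs")
    case True
    define v where "v = vs ! n"
    have v: "v \<in> set vs" "v < b" using True vs by (auto simp: v_def)
    \<comment> \<open>A move empties its source. The value therefore goes to \<open>b + 1\<close>
      and from there, in its original order again, both back to the variable and to the
      result.\<close>
    have "implements (\<lambda>n. 6 * n + 2) (EVar n) vs b (mv v {b + 1} ;; mv (b + 1) {v, b}) (b + 2) 3"
      unfolding implements_def
    proof (intro conjI allI impI)
      fix K \<rho> m assume K: "b + 2 \<le> K" and ok: "env_ok vs b m \<rho>"
      define \<rho>1 where "\<rho>1 = \<rho>(v := [], b + 1 := rev (\<rho> v))"
      have e: "\<rho> b = []" "\<rho> (b + 1) = []" "length (\<rho> v) \<le> m" using ok v by (auto simp: env_ok_def)
      have "\<exists>t\<le>3 * length (\<rho> v) + 1. runs K (mv v {b + 1}) (bits \<rho>) t (bits \<rho>1)"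
        by (rule runs_mv) (use v K e in \<open>auto simp: \<rho>1_def\<close>)
      moreover have "\<exists>t\<le>3 * length (\<rho>1 (b + 1)) + 1. runs K (mv (b + 1) {v, b}) (bits \<rho>1) t
          (bits (\<rho>(b := eval (EVar n) (map \<rho> vs))))"
        by (rule runs_mv) (use v K e True in \<open>auto simp: \<rho>1_def v_def[symmetric] fun_eq_iff\<close>)
      ultimately show "\<exists>t\<le>6 * m + 2. runs K (mv v {b + 1} ;; mv (b + 1) {v, b}) (bits \<rho>) t
          (bits (\<rho>(b := eval (EVar n) (map \<rho> vs))))"
        by (rule runs_le_mono[OF runs_Seq_le]) (use e in \<open>auto simp: \<rho>1_def\<close>)
    qed (auto simp: wfc_mv)
    then show ?thesis by blast
  next
    case False
    have "implements (\<lambda>n. 6 * n + 2) (EVar n) vs b (mv b {}) (b + 1) 3"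
      unfolding implements_def
    proof (intro conjI allI impI)
      fix K \<rho> m assume K: "b + 1 \<le> K" and ok: "env_ok vs b m \<rho>"
      then have e: "\<rho> b = []" by (auto simp: env_ok_def)
      have "\<exists>t\<le>3 * length (\<rho> b) + 1. runs K (mv b {}) (bits \<rho>) t (bits (\<rho>(b := eval (EVar n) (map \<rho> vs))))"
        by (rule runs_mv) (use K e False in auto)
      then show "\<exists>t\<le>6 * m + 2. runs K (mv b {}) (bits \<rho>) t (bits (\<rho>(b := eval (EVar n) (map \<rho> vs))))"
        by (rule runs_le_mono) (use e in auto)
    qed (auto simp: wfc_mv)
    then show ?thesis by blast
  qed
qed

fun push_all :: "bool list \<Rightarrow> nat \<Rightarrow> com" where
  "push_all [] d = pops {}"
| "push_all (x # xs) d = (push_all xs d ;; push x d)"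

lemma runs_push_all: "d < K \<Longrightarrow>
    \<exists>t\<le>2 * length xs + 1. runs K (push_all xs d) (bits \<rho>) t (bits (\<rho>(d := xs @ \<rho> d)))"
proof (induction xs)
  case Nil
  then show ?case using runs_pops[of "{}" K \<rho>] by simp
next
  case (Cons x xs)
  have 1: "\<exists>t\<le>2 * length xs + 1 + 2. runs K (push_all xs d ;; push x d) (bits \<rho>) t
      (bits ((\<rho>(d := xs @ \<rho> d))(d := x # (\<rho>(d := xs @ \<rho> d)) d)))"
    by (rule runs_Seq_le[OF Cons.IH[OF Cons.prems] runs_push[OF Cons.prems]])
  have 2: "(\<rho>(d := xs @ \<rho> d))(d := x # (\<rho>(d := xs @ \<rho> d)) d) = \<rho>(d := (x # xs) @ \<rho> d)" by auto
  show ?case by (rule runs_le_mono[OF 1[unfolded 2], folded push_all.simps]) simp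
qed

lemma wfc_push_all: "3 \<le> S \<Longrightarrow> wfc S (push_all xs d)"
  by (induction xs) (auto simp: wfc_push wfc_pops)

lemma implementable_EConst: "implementable (EConst xs)"
  unfolding implementable_def
proof (intro exI[of _ "\<lambda>n. 2 * length xs + 1"] conjI allI impI)
  fix vs b assume vs: "\<forall>v\<in>set vs. v < (b :: nat)"
  have "implements (\<lambda>n. 2 * length xs + 1) (EConst xs) vs b (push_all xs b) (b + 1) 3"
    unfolding implements_def
  proof (intro conjI allI impI)
    fix K \<rho> m assume K: "b + 1 \<le> K" and ok: "env_ok vs b m \<rho>"
    then have "\<rho> b = []" by (auto simp: env_ok_def)
    then show "\<exists>t\<le>2 * length xs + 1. runs K (push_all xs b) (bits \<rho>) t (bits (\<rho>(b := eval (EConst xs) (map \<rho> vs))))"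
      using runs_push_all[of b K xs \<rho>] K by simp
  qed (auto simp: wfc_push_all)
  then show "\<exists>P K0 S0. implements (\<lambda>n. 2 * length xs + 1) (EConst xs) vs b P K0 S0" by blast
qed (intro pbounded_intros)

lemma vars_less: "\<forall>v\<in>set vs. v < b \<Longrightarrow> b \<le> b' \<Longrightarrow> \<forall>v\<in>set vs. v < (b' :: nat)"
  by auto

lemma implementable_ECat:
  assumes "wfe a" "implementable a" "implementable c"
  shows "implementable (ECat a c)"
proof -
  obtain h1 where h1: "pbounded h1" "size_bounded a h1" using ex_size_bounded[OF assms(1)] by blast
  obtain f1 where f1: "pbounded f1" "\<And>vs b. \<forall>v\<in>set vs. v < b \<Longrightarrow> \<exists>P K0 S0. implements f1 a vs b P K0 S0"
    using assms(2) unfolding implementable_def by blast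
  obtain f2 where f2: "pbounded f2" "\<And>vs b. \<forall>v\<in>set vs. v < b \<Longrightarrow> \<exists>P K0 S0. implements f2 c vs b P K0 S0"
    using assms(3) unfolding implementable_def by blast
  let ?f = "\<lambda>n. f2 n + (f1 n + ((3 * h1 n + 1) + (3 * h1 n + 1)))"
  show ?thesis
    unfolding implementable_def
  proof (intro exI[of _ ?f] conjI allI impI)
    show "pbounded ?f" by (intro pbounded_intros h1 f1 f2)
    fix vs b assume vs: "\<forall>v\<in>set vs. v < (b :: nat)"
    obtain P2 K2 S2 where P2: "implements f2 c vs b P2 K2 S2" using f2(2)[OF vs] by blast
    obtain P1 K1 S1 where P1: "implements f1 a vs (b + 1) P1 K1 S1" using f1(2)[OF vars_less[OF vs, of "b + 1"]] by auto
    \<comment> \<open>The right part comes first because a stack grows at its front; the left part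
      passes through \<open>b + 2\<close> so that it is pushed in the right order.\<close>
    have "implements ?f (ECat a c) vs b (P2 ;; P1 ;; mv (b + 1) {b + 2} ;; mv (b + 2) {b})
        (max (b + 3) (max K1 K2)) (max 3 (max S1 S2))"
      unfolding implements_def
    proof (intro conjI allI impI)
      fix K \<rho> m assume K: "max (b + 3) (max K1 K2) \<le> K" and ok: "env_ok vs b m \<rho>"
      define \<rho>1 where "\<rho>1 = \<rho>(b := eval c (map \<rho> vs))"
      have e: "\<rho> r = []" if "b \<le> r" for r using ok that by (auto simp: env_ok_def)
      have ok1: "env_ok vs (b + 1) m \<rho>1" "map \<rho>1 vs = map \<rho> vs"
        using env_ok_upd[OF ok, of \<rho>1 "b + 1"] e by (auto simp: \<rho>1_def)
      define \<rho>2 where "\<rho>2 = \<rho>1(b + 1 := eval a (map \<rho> vs))"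
      define \<rho>3 where "\<rho>3 = \<rho>1(b + 2 := rev (eval a (map \<rho> vs)))"
      have l: "length (eval a (map \<rho> vs)) \<le> h1 m"
        using h1(2) ok by (auto simp: size_bounded_def env_ok_def)
      have "\<exists>t\<le>f2 m. runs K P2 (bits \<rho>) t (bits \<rho>1)"
        by (rule implementsD[OF P2]) (use K ok in \<open>auto simp: \<rho>1_def\<close>)
      moreover have "\<exists>t\<le>f1 m. runs K P1 (bits \<rho>1) t (bits \<rho>2)"
        by (rule implementsD[OF P1 _ ok1]) (use K in \<open>auto simp: \<rho>2_def\<close>)
      moreover have "\<exists>t\<le>3 * h1 m + 1. runs K (mv (b + 1) {b + 2}) (bits \<rho>2) t (bits \<rho>3)"
        by (rule runs_le_mono[OF runs_mv]) (use K e l in \<open>auto simp: \<rho>3_def \<rho>2_def \<rho>1_def fun_eq_iff\<close>)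
      moreover have "\<exists>t\<le>3 * h1 m + 1. runs K (mv (b + 2) {b}) (bits \<rho>3) t (bits (\<rho>(b := eval (ECat a c) (map \<rho> vs))))"
        by (rule runs_le_mono[OF runs_mv]) (use K e l in \<open>auto simp: \<rho>3_def \<rho>2_def \<rho>1_def fun_eq_iff\<close>)
      ultimately show "\<exists>t\<le>?f m. runs K (P2 ;; P1 ;; mv (b + 1) {b + 2} ;; mv (b + 2) {b}) (bits \<rho>) t
          (bits (\<rho>(b := eval (ECat a c) (map \<rho> vs))))"
        by (intro runs_Seq_le)
    qed (use implementsD_wfc[OF P1] implementsD_wfc[OF P2] in \<open>auto simp: wfc_mv\<close>)
    then show "\<exists>P K0 S0. implements ?f (ECat a c) vs b P K0 S0" by blast
  qed
qed

lemma implementableE: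
  assumes "implementable e" "wfe e"
  obtains f h where "pbounded f" "\<And>vs b. \<forall>v\<in>set vs. v < b \<Longrightarrow> \<exists>P K0 S0. implements f e vs b P K0 S0"
    "pbounded h" "\<And>\<rho> n. \<forall>v\<in>set \<rho>. length v \<le> n \<Longrightarrow> length (eval e \<rho>) \<le> h n"
proof -
  obtain f where f: "pbounded f" "\<forall>vs b. (\<forall>v\<in>set vs. v < b) \<longrightarrow> (\<exists>P K0 S0. implements f e vs b P K0 S0)"
    using assms(1) unfolding implementable_def by blast
  obtain h where h: "pbounded h" "size_bounded e h" using ex_size_bounded[OF assms(2)] by blast
  show ?thesis
    by (rule that[OF f(1) _ h(1)]) (use f(2) h(2) in \<open>simp_all add: size_bounded_def\<close>)
qed

lemma env_ok_len: "env_ok vs b n \<rho> \<Longrightarrow> \<forall>v\<in>set (map \<rho> vs). length v \<le> n"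
  by (auto simp: env_ok_def)

lemma implementable_EIf:
  assumes "wfe c" "implementable c" "implementable a" "implementable d"
  shows "implementable (EIf c a d)"
proof -
  obtain f1 h1 where f1: "pbounded f1" "\<And>vs b. \<forall>v\<in>set vs. v < b \<Longrightarrow> \<exists>P K0 S0. implements f1 c vs b P K0 S0"
    and h1: "pbounded h1" "\<And>\<rho> n. \<forall>v\<in>set \<rho>. length v \<le> n \<Longrightarrow> length (eval c \<rho>) \<le> h1 n"
    using implementableE[OF assms(2,1)] by metis
  obtain f2 where f2: "pbounded f2" "\<And>vs b. \<forall>v\<in>set vs. v < b \<Longrightarrow> \<exists>P K0 S0. implements f2 a vs b P K0 S0"
    using assms(3) unfolding implementable_def by blast
  obtain f3 where f3: "pbounded f3" "\<And>vs b. \<forall>v\<in>set vs. v < b \<Longrightarrow> \<exists>P K0 S0. implements f3 d vs b P K0 S0"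
    using assms(4) unfolding implementable_def by blast
  let ?f = "\<lambda>n. f1 n + (1 + ((3 * h1 n + 1) + (f2 n + f3 n)))"
  show ?thesis
    unfolding implementable_def
  proof (intro exI[of _ ?f] conjI allI impI)
    show "pbounded ?f" by (intro pbounded_intros h1 f1 f2 f3)
    fix vs b assume vs: "\<forall>v\<in>set vs. v < (b :: nat)"
    obtain P1 K1 S1 where P1: "implements f1 c vs b P1 K1 S1" using f1(2)[OF vs] by blast
    obtain P2 K2 S2 where P2: "implements f2 a vs b P2 K2 S2" using f2(2)[OF vs] by blast
    obtain P3 K3 S3 where P3: "implements f3 d vs b P3 K3 S3" using f3(2)[OF vs] by blast
    let ?P = "P1 ;; Cond (\<lambda>v. v b = 2) (mv b {} ;; P2) (mv b {} ;; P3)"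
    have "implements ?f (EIf c a d) vs b ?P
        (max (max (b + 1) K3) (max K1 K2)) (max (max 3 S3) (max S1 S2))"
      unfolding implements_def
    proof (intro conjI allI impI)
      fix K \<rho> m assume K: "max (max (b + 1) K3) (max K1 K2) \<le> K" and ok: "env_ok vs b m \<rho>"
      define x where "x = eval c (map \<rho> vs)"
      define \<rho>1 where "\<rho>1 = \<rho>(b := x)"
      have e: "\<rho> b = []" using ok by (auto simp: env_ok_def)
      have l: "length x \<le> h1 m" using h1(2) env_ok_len[OF ok] by (simp add: x_def)
      have 1: "\<exists>t\<le>f1 m. runs K P1 (bits \<rho>) t (bits \<rho>1)"
        by (rule implementsD[OF P1]) (use K ok in \<open>auto simp: \<rho>1_def x_def\<close>)
      have "\<exists>t\<le>3 * h1 m + 1. runs K (mv b {}) (bits \<rho>1) t (bits \<rho>)"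
        by (rule runs_le_mono[OF runs_mv]) (use K e l in \<open>auto simp: \<rho>1_def fun_eq_iff\<close>)
      note seq = runs_Seq_le[OF this]
      have 2: "\<exists>t\<le>f2 m. runs K P2 (bits \<rho>) t (bits (\<rho>(b := eval a (map \<rho> vs))))"
        by (rule implementsD[OF P2]) (use K ok in auto)
      have 3: "\<exists>t\<le>f3 m. runs K P3 (bits \<rho>) t (bits (\<rho>(b := eval d (map \<rho> vs))))"
        by (rule implementsD[OF P3]) (use K ok in auto)
      have v: "view K (bits \<rho>1) b = 2 \<longleftrightarrow> first x"
        using K by (cases x) (auto simp: \<rho>1_def first_def)
      have "\<exists>t\<le>1 + ((3 * h1 m + 1) + (f2 m + f3 m)). runs K (Cond (\<lambda>v. v b = 2) (mv b {} ;; P2) (mv b {} ;; P3))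
          (bits \<rho>1) t (bits (\<rho>(b := eval (EIf c a d) (map \<rho> vs))))"
      proof (cases "first x")
        case True
        obtain t where t: "t \<le> 3 * h1 m + 1 + f2 m"
          "runs K (mv b {} ;; P2) (bits \<rho>1) t (bits (\<rho>(b := eval a (map \<rho> vs))))" using seq[OF 2] by blast
        then have "runs K (Cond (\<lambda>v. v b = 2) (mv b {} ;; P2) (mv b {} ;; P3)) (bits \<rho>1) (1 + t)
            (bits (\<rho>(b := eval a (map \<rho> vs))))"
          using v True by (intro CondT) auto
        moreover have "eval (EIf c a d) (map \<rho> vs) = eval a (map \<rho> vs)" using True by (simp add: x_def)
        ultimately show ?thesis using t(1) by (intro exI[of _ "1 + t"]) auto
      next
        case False
        obtain t where t: "t \<le> 3 * h1 m + 1 + f3 m"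
          "runs K (mv b {} ;; P3) (bits \<rho>1) t (bits (\<rho>(b := eval d (map \<rho> vs))))" using seq[OF 3] by blast
        then have "runs K (Cond (\<lambda>v. v b = 2) (mv b {} ;; P2) (mv b {} ;; P3)) (bits \<rho>1) (1 + t)
            (bits (\<rho>(b := eval d (map \<rho> vs))))"
          using v False by (intro CondF) auto
        moreover have "eval (EIf c a d) (map \<rho> vs) = eval d (map \<rho> vs)" using False by (simp add: x_def)
        ultimately show ?thesis using t(1) by (intro exI[of _ "1 + t"]) auto
      qed
      with 1 show "\<exists>t\<le>?f m. runs K ?P (bits \<rho>) t (bits (\<rho>(b := eval (EIf c a d) (map \<rho> vs))))"
        by (rule runs_Seq_le)
    qed (use implementsD_wfc[OF P1] implementsD_wfc[OF P2] implementsD_wfc[OF P3] in \<open>auto simp: wfc_mv\<close>)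
    then show "\<exists>P K0 S0. implements ?f (EIf c a d) vs b P K0 S0" by blast
  qed
qed

lemma implementable_EDrop:
  assumes "wfe a" "implementable a" "wfe c" "implementable c"
  shows "implementable (EDrop a c)"
proof -
  obtain f1 h1 where f1: "pbounded f1" "\<And>vs b. \<forall>v\<in>set vs. v < b \<Longrightarrow> \<exists>P K0 S0. implements f1 a vs b P K0 S0"
    and h1: "pbounded h1" "\<And>\<rho> n. \<forall>v\<in>set \<rho>. length v \<le> n \<Longrightarrow> length (eval a \<rho>) \<le> h1 n"
    using implementableE[OF assms(2,1)] by metis
  obtain f2 h2 where f2: "pbounded f2" "\<And>vs b. \<forall>v\<in>set vs. v < b \<Longrightarrow> \<exists>P K0 S0. implements f2 c vs b P K0 S0"
    and h2: "pbounded h2" "\<And>\<rho> n. \<forall>v\<in>set \<rho>. length v \<le> n \<Longrightarrow> length (eval c \<rho>) \<le> h2 n"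
    using implementableE[OF assms(4,3)] by metis
  let ?f = "\<lambda>n. f2 n + (f1 n + (h1 n * 2 + 1))"
  show ?thesis
    unfolding implementable_def
  proof (intro exI[of _ ?f] conjI allI impI)
    show "pbounded ?f" by (intro pbounded_intros h1 f1 f2)
    fix vs b assume vs: "\<forall>v\<in>set vs. v < (b :: nat)"
    obtain P2 K2 S2 where P2: "implements f2 c vs b P2 K2 S2" using f2(2)[OF vs] by blast
    obtain P1 K1 S1 where P1: "implements f1 a vs (b + 1) P1 K1 S1" using f1(2)[OF vars_less[OF vs, of "b + 1"]] by auto
    let ?W = "While (\<lambda>v. v (b + 1) \<noteq> 0) (pops {b, b + 1})"
    have "implements ?f (EDrop a c) vs b (P2 ;; P1 ;; ?W) (max (b + 2) (max K1 K2)) (max 3 (max S1 S2))"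
      unfolding implements_def
    proof (intro conjI allI impI)
      fix K \<rho> m assume K: "max (b + 2) (max K1 K2) \<le> K" and ok: "env_ok vs b m \<rho>"
      define x y where "x = eval a (map \<rho> vs)" and "y = eval c (map \<rho> vs)"
      define \<rho>1 where "\<rho>1 = \<rho>(b := y)"
      have e: "\<rho> r = []" if "b \<le> r" for r using ok that by (auto simp: env_ok_def)
      have ok1: "env_ok vs (b + 1) m \<rho>1" "map \<rho>1 vs = map \<rho> vs"
        using env_ok_upd[OF ok, of \<rho>1 "b + 1"] e by (auto simp: \<rho>1_def)
      define \<sigma> where "\<sigma> i = \<rho>(b := drop i y, b + 1 := drop i x)" for i
      have l: "length x \<le> h1 m" using h1(2) env_ok_len[OF ok] by (simp add: x_def)
      have 1: "\<exists>t\<le>f2 m. runs K P2 (bits \<rho>) t (bits \<rho>1)"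
        by (rule implementsD[OF P2]) (use K ok in \<open>auto simp: \<rho>1_def y_def\<close>)
      have 2: "\<exists>t\<le>f1 m. runs K P1 (bits \<rho>1) t (bits (\<sigma> 0))"
        by (rule implementsD[OF P1 _ ok1]) (use K in \<open>auto simp: \<sigma>_def \<rho>1_def x_def\<close>)
      have "\<exists>t\<le>length x * (1 + 1) + 1. runs K ?W (bits (\<sigma> 0)) t (bits (\<sigma> (length x)))"
      proof (rule runs_While)
        fix i assume i: "i < length x"
        have *: "drop i x = (x ! i) # drop (Suc i) x" using i by (simp add: Cons_nth_drop_Suc)
        show "view K (bits (\<sigma> i)) (b + 1) \<noteq> 0" using K by (simp add: \<sigma>_def *)
        have p: "(\<lambda>r. if r \<in> {b, b + 1} then tl (\<sigma> i r) else \<sigma> i r) = \<sigma> (Suc i)"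
          by (auto simp: \<sigma>_def fun_eq_iff tl_drop drop_Suc)
        show "\<exists>t\<le>1. runs K (pops {b, b + 1}) (bits (\<sigma> i)) t (bits (\<sigma> (Suc i)))"
          unfolding p[symmetric] by (rule runs_pops) (use K in auto)
      qed (use K in \<open>auto simp: \<sigma>_def\<close>)
      then have 3: "\<exists>t\<le>h1 m * 2 + 1. runs K ?W (bits (\<sigma> 0)) t (bits (\<sigma> (length x)))"
        by (rule runs_le_mono) (use l in auto)
      have eq: "\<sigma> (length x) = \<rho>(b := eval (EDrop a c) (map \<rho> vs))"
        using e by (auto simp: \<sigma>_def x_def y_def)
      show "\<exists>t\<le>?f m. runs K (P2 ;; P1 ;; ?W) (bits \<rho>) t (bits (\<rho>(b := eval (EDrop a c) (map \<rho> vs))))"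
        using runs_Seq_le[OF 1 runs_Seq_le[OF 2 3]] unfolding eq .
    qed (use implementsD_wfc[OF P1] implementsD_wfc[OF P2] in \<open>auto simp: wfc_pops\<close>)
    then show "\<exists>P K0 S0. implements ?f (EDrop a c) vs b P K0 S0" by blast
  qed
qed

lemma implementable_EFor:
  assumes "wfe a" "implementable a" "wfe c" "implementable c"
  shows "implementable (EFor a c)"
proof -
  obtain f1 h1 where f1: "pbounded f1" "\<And>vs b. \<forall>v\<in>set vs. v < b \<Longrightarrow> \<exists>P K0 S0. implements f1 a vs b P K0 S0"
    and h1: "pbounded h1" "\<And>\<rho> n. \<forall>v\<in>set \<rho>. length v \<le> n \<Longrightarrow> length (eval a \<rho>) \<le> h1 n"
    using implementableE[OF assms(2,1)] by metis
  obtain f2 h2 where f2: "pbounded f2" "\<And>vs b. \<forall>v\<in>set vs. v < b \<Longrightarrow> \<exists>P K0 S0. implements f2 c vs b P K0 S0"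
    and h2: "pbounded h2" "\<And>\<rho> n. \<forall>v\<in>set \<rho>. length v \<le> n \<Longrightarrow> length (eval c \<rho>) \<le> h2 n"
    using implementableE[OF assms(4,3)] by metis
  define B where "B n = 1 + (f2 (max n (h1 n)) + ((3 * h2 (max n (h1 n)) + 1) + (3 * h2 (max n (h1 n)) + 1)))" for n
  have B: "pbounded B"
  proof -
    have "pbounded (\<lambda>n. max n (h1 n))" by (intro pbounded_intros h1)
    note pbounded_comp[OF f2(1) this] pbounded_comp[OF h2(1) this]
    then show ?thesis unfolding B_def by (intro pbounded_intros)
  qed
  let ?f = "\<lambda>n. f1 n + ((3 * h1 n + 1) + (h1 n * (B n + 1) + 1))"
  show ?thesis
    unfolding implementable_def
  proof (intro exI[of _ ?f] conjI allI impI)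
    show "pbounded ?f" by (intro pbounded_intros h1 f1 B)
    fix vs b assume vs: "\<forall>v\<in>set vs. v < (b :: nat)"
    obtain P1 K1 S1 where P1: "implements f1 a vs (b + 1) P1 K1 S1" using f1(2)[OF vars_less[OF vs, of "b + 1"]] by auto
    obtain P2 K2 S2 where P2: "implements f2 c ((b + 2) # vs) (b + 3) P2 K2 S2"
    proof -
      have "\<forall>v\<in>set ((b + 2) # vs). v < b + 3" using vs by auto
      from f2(2)[OF this] that show thesis by blast
    qed
    let ?body = "pops {b + 2} ;; P2 ;; mv (b + 3) {b + 4} ;; mv (b + 4) {b}"
    let ?W = "While (\<lambda>v. v (b + 2) \<noteq> 0) ?body"
    have "implements ?f (EFor a c) vs b (P1 ;; ones (b + 1) (b + 2) ;; ?W) (max (b + 5) (max K1 K2)) (max 3 (max S1 S2))"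
      unfolding implements_def
    proof (intro conjI allI impI)
      fix K \<rho> m assume K: "max (b + 5) (max K1 K2) \<le> K" and ok: "env_ok vs b m \<rho>"
      define x where "x = eval a (map \<rho> vs)"
      define L where "L = length x"
      define y where "y j = eval c (replicate j True # map \<rho> vs)" for j
      have e: "\<rho> r = []" if "b \<le> r" for r using ok that by (auto simp: env_ok_def)
      have l: "L \<le> h1 m" using h1(2) env_ok_len[OF ok] by (simp add: x_def L_def)
      have ok0: "env_ok vs (b + 1) m \<rho>"
        using env_ok_upd(1)[OF ok, of \<rho> "b + 1"] e by auto
      have 1: "\<exists>t\<le>f1 m. runs K P1 (bits \<rho>) t (bits (\<rho>(b + 1 := x)))"
        by (rule implementsD[OF P1]) (use K ok0 in \<open>auto simp: x_def\<close>)
      \<comment> \<open>The index descends, since each new value is put in front of the later ones.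
        After the pop, register \<open>b + 2\<close> is exactly the current index in unary and
        serves as the loop variable.\<close>
      define \<sigma> where "\<sigma> i = \<rho>(b := concat (map y [L - i..<L]), b + 2 := replicate (L - i) True)" for i
      have 2: "\<exists>t\<le>3 * h1 m + 1. runs K (ones (b + 1) (b + 2)) (bits (\<rho>(b + 1 := x))) t (bits (\<sigma> 0))"
        using runs_const[of "b + 1" "b + 2" K "\<sigma> 0" "\<rho>(b + 1 := x)" True] K e l
        by (intro runs_le_mono[OF _ add_right_mono[OF mult_le_mono2[OF l]]])
          (auto simp: bsym_def \<sigma>_def L_def fun_eq_iff)
      have 3: "\<exists>t\<le>L * (B m + 1) + 1. runs K ?W (bits (\<sigma> 0)) t (bits (\<sigma> L))"
      proof (rule runs_While)
        fix i assume i: "i < L"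
        define j where "j = L - Suc i"
        have j: "L - i = Suc j" "L - Suc i = j" "j < L" using i by (auto simp: j_def)
        have up: "[j..<L] = j # [Suc j..<L]" using j(3) by (simp add: upt_conv_Cons)
        show "view K (bits (\<sigma> i)) (b + 2) \<noteq> 0" using K by (simp add: \<sigma>_def j)
        define \<rho>1 where "\<rho>1 = \<rho>(b := concat (map y [Suc j..<L]), b + 2 := replicate j True)"
        define \<rho>2 where "\<rho>2 = \<rho>1(b + 3 := y j)"
        define \<rho>3 where "\<rho>3 = \<rho>1(b + 4 := rev (y j))"
        have p: "(\<lambda>r. if r \<in> {b + 2} then tl (\<sigma> i r) else \<sigma> i r) = \<rho>1"
          by (auto simp: \<sigma>_def j \<rho>1_def fun_eq_iff)
        have ok1: "env_ok vs (b + 3) m \<rho>1" "map \<rho>1 vs = map \<rho> vs"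
          using env_ok_upd[OF ok, of \<rho>1 "b + 3"] e by (auto simp: \<rho>1_def)
        have r2: "\<rho>1 (b + 2) = replicate j True" by (simp add: \<rho>1_def)
        have ok2: "env_ok ((b + 2) # vs) (b + 3) (max m (h1 m)) \<rho>1"
          using ok1(1) j(3) l r2 by (auto simp: env_ok_def)
        have mp: "map \<rho>1 ((b + 2) # vs) = replicate j True # map \<rho> vs" using ok1(2) r2 by simp
        have ly: "length (y j) \<le> h2 (max m (h1 m))"
          unfolding y_def using env_ok_len[OF ok] j(3) l by (intro h2) auto
        have "\<exists>t\<le>1. runs K (pops {b + 2}) (bits (\<sigma> i)) t (bits \<rho>1)"
          unfolding p[symmetric] by (rule runs_pops) (use K in auto)
        moreover have "\<exists>t\<le>f2 (max m (h1 m)). runs K P2 (bits \<rho>1) t (bits \<rho>2)"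
          by (rule implementsD[OF P2 _ ok2 mp]) (use K in \<open>auto simp: \<rho>2_def y_def\<close>)
        moreover have "\<exists>t\<le>3 * h2 (max m (h1 m)) + 1. runs K (mv (b + 3) {b + 4}) (bits \<rho>2) t (bits \<rho>3)"
          by (rule runs_le_mono[OF runs_mv]) (use K e ly in \<open>auto simp: \<rho>3_def \<rho>2_def \<rho>1_def fun_eq_iff\<close>)
        moreover have "\<exists>t\<le>3 * h2 (max m (h1 m)) + 1. runs K (mv (b + 4) {b}) (bits \<rho>3) t (bits (\<sigma> (Suc i)))"
          by (rule runs_le_mono[OF runs_mv])
            (use K e ly up in \<open>auto simp: \<sigma>_def j \<rho>3_def \<rho>1_def fun_eq_iff\<close>)
        ultimately show "\<exists>t\<le>B m. runs K ?body (bits (\<sigma> i)) t (bits (\<sigma> (Suc i)))"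
          unfolding B_def by (intro runs_Seq_le)
      qed (use K in \<open>auto simp: \<sigma>_def\<close>)
      have eq: "\<sigma> L = \<rho>(b := eval (EFor a c) (map \<rho> vs))"
        using e by (auto simp: \<sigma>_def x_def y_def[abs_def] L_def fun_eq_iff)
      have "L * (B m + 1) + 1 \<le> h1 m * (B m + 1) + 1" using l by (intro add_right_mono mult_le_mono1)
      from runs_le_mono[OF 3 this] have "\<exists>t\<le>h1 m * (B m + 1) + 1. runs K ?W (bits (\<sigma> 0)) t
          (bits (\<rho>(b := eval (EFor a c) (map \<rho> vs))))"
        unfolding eq .
      with 1 2 show "\<exists>t\<le>?f m. runs K (P1 ;; ones (b + 1) (b + 2) ;; ?W) (bits \<rho>) t
          (bits (\<rho>(b := eval (EFor a c) (map \<rho> vs))))"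
        by (intro runs_Seq_le)
    qed (use implementsD_wfc[OF P1] implementsD_wfc[OF P2] in \<open>auto simp: wfc_pops wfc_mv\<close>)
    then show "\<exists>P K0 S0. implements ?f (EFor a c) vs b P K0 S0" by blast
  qed
qed

text \<open>Binary increment, least significant bit first. By \<open>tl [] = []\<close> the carry
  beyond the last digit needs no separate case.\<close>

definition incr :: "bool list \<Rightarrow> bool list" where
  "incr xs = replicate (length (takeWhile id xs)) False @ True # tl (dropWhile id xs)"

lemma incr_binary_digits: "incr (binary_digits n) = binary_digits (Suc n)"
proof (induction n rule: less_induct)
  case (less n)
  show ?case
  proof (cases "n = 0")
    case True
    then show ?thesis
      by (subst (2) binary_digits.simps) (simp add: binary_digits.simps[of 0] incr_def)
  next
    case False
    note bd = binary_digits.simps[of n] binary_digits.simps[of "Suc n"]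
    show ?thesis
    proof (cases "odd n")
      case True
      then have "Suc n div 2 = Suc (n div 2)" by presburger
      moreover have "incr (binary_digits (n div 2)) = binary_digits (Suc (n div 2))"
        using False by (intro less) auto
      ultimately show ?thesis using False True bd by (simp add: incr_def)
    next
      case even: False
      then have "Suc n div 2 = n div 2" by presburger
      then show ?thesis using False even bd by (simp add: incr_def)
    qed
  qed
qed

definition incr_prog :: "nat \<Rightarrow> nat \<Rightarrow> com" where
  "incr_prog s d = While (\<lambda>v. v s = 2) (pops {s} ;; push True d) ;; pops {s} ;; push True s ;; falses d s"

lemma runs_incr:
  assumes "s \<noteq> d" "s < K" "d < K" "\<rho> d = []"
  shows "\<exists>t\<le>7 * length (\<rho> s) + 5. runs K (incr_prog s d) (bits \<rho>) t (bits (\<rho>(s := incr (\<rho> s))))"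
proof -
  define xs where "xs = \<rho> s"
  define k where "k = length (takeWhile id xs)"
  have k: "k \<le> length xs" by (simp add: k_def length_takeWhile_le)
  define \<sigma> where "\<sigma> i = \<rho>(s := drop i xs, d := replicate i True)" for i
  have 1: "\<exists>t\<le>k * ((1 + 2) + 1) + 1. runs K (While (\<lambda>v. v s = 2) (pops {s} ;; push True d)) (bits (\<sigma> 0)) t (bits (\<sigma> k))"
  proof (rule runs_While)
    fix i assume i: "i < k"
    then have *: "drop i xs = (xs ! i) # drop (Suc i) xs" using k by (simp add: Cons_nth_drop_Suc)
    have "xs ! i" using i nth_mem[of i "takeWhile id xs"] set_takeWhileD[of _ id xs]
      by (metis id_apply k_def takeWhile_nth)
    then show "view K (bits (\<sigma> i)) s = 2" using assms by (simp add: \<sigma>_def * bsym_def)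
    define \<rho>1 where "\<rho>1 = \<rho>(s := drop (Suc i) xs, d := replicate i True)"
    have p: "(\<lambda>r. if r \<in> {s} then tl (\<sigma> i r) else \<sigma> i r) = \<rho>1"
      using assms by (auto simp: \<sigma>_def * \<rho>1_def fun_eq_iff)
    have "\<exists>t\<le>1. runs K (pops {s}) (bits (\<sigma> i)) t (bits \<rho>1)"
      unfolding p[symmetric] by (rule runs_pops) (use assms in auto)
    moreover have "\<rho>1(d := True # \<rho>1 d) = \<sigma> (Suc i)"
      using assms by (auto simp: \<sigma>_def \<rho>1_def fun_eq_iff)
    then have "\<exists>t\<le>2. runs K (push True d) (bits \<rho>1) t (bits (\<sigma> (Suc i)))"
      using runs_push[of d K True \<rho>1] assms by simp
    ultimately show "\<exists>t\<le>1 + 2. runs K (pops {s} ;; push True d) (bits (\<sigma> i)) t (bits (\<sigma> (Suc i)))"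
      by (rule runs_Seq_le)
  next
    have "drop k xs = dropWhile id xs"
      by (simp add: k_def dropWhile_eq_drop)
    moreover have "\<not> first (dropWhile id xs)"
      by (induction xs) (auto simp: first_def)
    ultimately show "\<not> view K (bits (\<sigma> k)) s = 2"
      using assms by (cases "dropWhile id xs") (auto simp: \<sigma>_def first_def)
  qed
  have dr: "drop k xs = dropWhile id xs" by (simp add: k_def dropWhile_eq_drop)
  define \<rho>1 where "\<rho>1 = \<rho>(s := tl (drop k xs), d := replicate k True)"
  define \<rho>2 where "\<rho>2 = \<rho>(s := True # tl (drop k xs), d := replicate k True)"
  have p: "(\<lambda>r. if r \<in> {s} then tl (\<sigma> k r) else \<sigma> k r) = \<rho>1"
    using assms by (auto simp: \<sigma>_def \<rho>1_def fun_eq_iff)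
  have 2: "\<exists>t\<le>1. runs K (pops {s}) (bits (\<sigma> k)) t (bits \<rho>1)"
    unfolding p[symmetric] by (rule runs_pops) (use assms in auto)
  have "\<rho>1(s := True # \<rho>1 s) = \<rho>2" using assms by (auto simp: \<rho>1_def \<rho>2_def fun_eq_iff)
  then have 3: "\<exists>t\<le>2. runs K (push True s) (bits \<rho>1) t (bits \<rho>2)"
    using runs_push[of s K True \<rho>1] assms by simp
  have 4: "\<exists>t\<le>3 * length (\<rho>2 d) + 1. runs K (falses d s) (bits \<rho>2) t (bits (\<rho>(s := incr (\<rho> s))))"
    using runs_const[of d s K _ \<rho>2 False] assms
    by (auto simp: bsym_def \<rho>2_def fun_eq_iff incr_def xs_def[symmetric] k_def[symmetric] dr)
  have "\<sigma> 0 = \<rho>" using assms by (auto simp: \<sigma>_def xs_def fun_eq_iff)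
  then have 5: "\<exists>t\<le>k * ((1 + 2) + 1) + 1 + (1 + (2 + (3 * length (\<rho>2 d) + 1))).
     runs K (incr_prog s d) (bits \<rho>) t (bits (\<rho>(s := incr (\<rho> s))))"
    unfolding incr_prog_def using runs_Seq_le[OF 1 runs_Seq_le[OF 2 runs_Seq_le[OF 3 4]]] by simp
  show ?thesis
    by (rule runs_le_mono[OF 5]) (use k assms in \<open>simp add: \<rho>2_def xs_def\<close>)
qed

lemma implementable_EBin:
  assumes "wfe a" "implementable a"
  shows "implementable (EBin a)"
proof -
  obtain f1 h1 where f1: "pbounded f1" "\<And>vs b. \<forall>v\<in>set vs. v < b \<Longrightarrow> \<exists>P K0 S0. implements f1 a vs b P K0 S0"
    and h1: "pbounded h1" "\<And>\<rho> n. \<forall>v\<in>set \<rho>. length v \<le> n \<Longrightarrow> length (eval a \<rho>) \<le> h1 n"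
    using implementableE[OF assms(2,1)] by metis
  define B where "B n = 1 + (7 * h1 n + 5)" for n
  let ?f = "\<lambda>n. f1 n + (h1 n * (B n + 1) + 1)"
  show ?thesis
    unfolding implementable_def
  proof (intro exI[of _ ?f] conjI allI impI)
    show "pbounded ?f" unfolding B_def by (intro pbounded_intros f1 h1)
    fix vs b assume vs: "\<forall>v\<in>set vs. v < (b :: nat)"
    obtain P1 K1 S1 where P1: "implements f1 a vs (b + 1) P1 K1 S1" using f1(2)[OF vars_less[OF vs, of "b + 1"]] by auto
    let ?W = "While (\<lambda>v. v (b + 1) \<noteq> 0) (pops {b + 1} ;; incr_prog b (b + 2))"
    have "implements ?f (EBin a) vs b (P1 ;; ?W) (max (b + 3) K1) (max 3 S1)"
      unfolding implements_def
    proof (intro conjI allI impI)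
      fix K \<rho> m assume K: "max (b + 3) K1 \<le> K" and ok: "env_ok vs b m \<rho>"
      define x where "x = eval a (map \<rho> vs)"
      define L where "L = length x"
      have e: "\<rho> r = []" if "b \<le> r" for r using ok that by (auto simp: env_ok_def)
      have l: "L \<le> h1 m" using h1(2) env_ok_len[OF ok] by (simp add: x_def L_def)
      have ok0: "env_ok vs (b + 1) m \<rho>"
        using env_ok_upd(1)[OF ok, of \<rho> "b + 1"] e by auto
      define \<sigma> where "\<sigma> i = \<rho>(b := binary_digits i, b + 1 := drop i x)" for i
      have 1: "\<exists>t\<le>f1 m. runs K P1 (bits \<rho>) t (bits (\<sigma> 0))"
        by (rule implementsD[OF P1 _ ok0 refl])
          (use K e in \<open>auto simp: x_def \<sigma>_def fun_eq_iff binary_digits.simps[of 0]\<close>)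
      have 2: "\<exists>t\<le>L * (B m + 1) + 1. runs K ?W (bits (\<sigma> 0)) t (bits (\<sigma> L))"
      proof (rule runs_While)
        fix i assume i: "i < L"
        have *: "drop i x = (x ! i) # drop (Suc i) x" using i by (simp add: Cons_nth_drop_Suc L_def)
        show "view K (bits (\<sigma> i)) (b + 1) \<noteq> 0" using K by (simp add: \<sigma>_def *)
        define \<rho>1 where "\<rho>1 = \<rho>(b := binary_digits i, b + 1 := drop (Suc i) x)"
        have p: "(\<lambda>r. if r \<in> {b + 1} then tl (\<sigma> i r) else \<sigma> i r) = \<rho>1"
          by (auto simp: \<sigma>_def * \<rho>1_def fun_eq_iff)
        have q1: "\<exists>t\<le>1. runs K (pops {b + 1}) (bits (\<sigma> i)) t (bits \<rho>1)"
          unfolding p[symmetric] by (rule runs_pops) (use K in auto)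
        have q2: "\<exists>t\<le>7 * length (\<rho>1 b) + 5. runs K (incr_prog b (b + 2)) (bits \<rho>1) t (bits (\<rho>1(b := incr (\<rho>1 b))))"
          by (rule runs_incr) (use K e in \<open>auto simp: \<rho>1_def\<close>)
        have q3: "\<rho>1(b := incr (\<rho>1 b)) = \<sigma> (Suc i)"
          by (auto simp: \<rho>1_def \<sigma>_def incr_binary_digits fun_eq_iff)
        have *: "\<exists>t\<le>1 + (7 * length (\<rho>1 b) + 5). runs K (pops {b + 1} ;; incr_prog b (b + 2)) (bits (\<sigma> i)) t
            (bits (\<sigma> (Suc i)))"
          using runs_Seq_le[OF q1 q2] unfolding q3 .
        have "length (\<rho>1 b) \<le> h1 m"
          using length_binary_digits[of i] i l by (simp add: \<rho>1_def)
        then show "\<exists>t\<le>B m. runs K (pops {b + 1} ;; incr_prog b (b + 2)) (bits (\<sigma> i)) t (bits (\<sigma> (Suc i)))"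
          unfolding B_def by (intro runs_le_mono[OF *]) simp
      qed (use K in \<open>auto simp: \<sigma>_def L_def\<close>)
      have eq: "\<sigma> L = \<rho>(b := eval (EBin a) (map \<rho> vs))"
        using e by (auto simp: \<sigma>_def x_def L_def fun_eq_iff)
      have "L * (B m + 1) + 1 \<le> h1 m * (B m + 1) + 1" using l by (intro add_right_mono mult_le_mono1)
      from runs_le_mono[OF 2 this] have "\<exists>t\<le>h1 m * (B m + 1) + 1. runs K ?W (bits (\<sigma> 0)) t
          (bits (\<rho>(b := eval (EBin a) (map \<rho> vs))))"
        unfolding eq .
      with 1 show "\<exists>t\<le>?f m. runs K (P1 ;; ?W) (bits \<rho>) t (bits (\<rho>(b := eval (EBin a) (map \<rho> vs))))"
        by (rule runs_Seq_le)
    qed (use implementsD_wfc[OF P1] in \<open>auto simp: wfc_pops wfc_push incr_prog_def intro!: wfc_xfer\<close>)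
    then show "\<exists>P K0 S0. implements ?f (EBin a) vs b P K0 S0" by blast
  qed
qed

lemma implementable_ERun:
  assumes M: "turing_machine M" and "wfe a" "implementable a" "wfe c" "implementable c"
  shows "implementable (ERun M a c)"
proof -
  obtain f1 h1 where f1: "pbounded f1" "\<And>vs b. \<forall>v\<in>set vs. v < b \<Longrightarrow> \<exists>P K0 S0. implements f1 a vs b P K0 S0"
    and h1: "pbounded h1" "\<And>\<rho> n. \<forall>v\<in>set \<rho>. length v \<le> n \<Longrightarrow> length (eval a \<rho>) \<le> h1 n"
    using implementableE[OF assms(3,2)] by metis
  obtain f2 h2 where f2: "pbounded f2" "\<And>vs b. \<forall>v\<in>set vs. v < b \<Longrightarrow> \<exists>P K0 S0. implements f2 c vs b P K0 S0"
    and h2: "pbounded h2" "\<And>\<rho> n. \<forall>v\<in>set \<rho>. length v \<le> n \<Longrightarrow> length (eval c \<rho>) \<le> h2 n"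
    using implementableE[OF assms(5,4)] by metis
  let ?f = "\<lambda>n. f1 n + (f2 n + (23 * (h1 n + h2 n) + 14))"
  show ?thesis
    unfolding implementable_def
  proof (intro exI[of _ ?f] conjI allI impI)
    show "pbounded ?f" by (intro pbounded_intros f1 f2 h1 h2)
    fix vs b assume vs: "\<forall>v\<in>set vs. v < (b :: nat)"
    \<comment> \<open>The input of \<open>M\<close> is evaluated above the registers and tapes used
      by the simulation, where \<open>run_prog\<close> expects it.\<close>
    define X where "X = b + 6 + tm_tapes M"
    obtain P1 K1 S1 where P1: "implements f1 a vs (b + 1) P1 K1 S1" using f1(2)[OF vars_less[OF vs, of "b + 1"]] by auto
    obtain P2 K2 S2 where P2: "implements f2 c vs X P2 K2 S2"
      using f2(2)[OF vars_less[OF vs, of X]] by (auto simp: X_def)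
    define P3 where "P3 = tm_sim.run_prog M b"
    obtain S3 where S3: "\<forall>S\<ge>S3. wfc S P3"
      using tm_sim.wfc_run_prog[of M b "b + 7 + tm_tapes M"] M by (auto simp: tm_sim_def P3_def)
    have "implements ?f (ERun M a c) vs b (P1 ;; P2 ;; P3) (max (X + 1) (max K1 K2)) (max S3 (max S1 S2))"
      unfolding implements_def
    proof (intro conjI allI impI)
      fix K \<rho> m assume K: "max (X + 1) (max K1 K2) \<le> K" and ok: "env_ok vs b m \<rho>"
      define x where "x = eval a (map \<rho> vs)"
      define y where "y = eval c (map \<rho> vs)"
      have e: "\<rho> r = []" if "b \<le> r" for r using ok that by (auto simp: env_ok_def)
      have lx: "length x \<le> h1 m" using h1(2) env_ok_len[OF ok] by (simp add: x_def)
      have ly: "length y \<le> h2 m" using h2(2) env_ok_len[OF ok] by (simp add: y_def)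
      define \<rho>1 where "\<rho>1 = \<rho>(b + 1 := x)"
      define \<rho>2 where "\<rho>2 = \<rho>1(X := y)"
      have ok0: "env_ok vs (b + 1) m \<rho>"
        using env_ok_upd(1)[OF ok, of \<rho> "b + 1"] e by auto
      have ok1: "env_ok vs X m \<rho>1" "map \<rho>1 vs = map \<rho> vs"
        using env_ok_upd[OF ok, of \<rho>1 X] e by (auto simp: \<rho>1_def X_def)
      have 1: "\<exists>t\<le>f1 m. runs K P1 (bits \<rho>) t (bits \<rho>1)"
        by (rule implementsD[OF P1 _ ok0 refl]) (use K in \<open>auto simp: x_def \<rho>1_def\<close>)
      have 2: "\<exists>t\<le>f2 m. runs K P2 (bits \<rho>1) t (bits \<rho>2)"
        by (rule implementsD[OF P2 _ ok1]) (use K in \<open>auto simp: y_def \<rho>2_def\<close>)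
      have sim: "tm_sim M b K" using M K by (simp add: tm_sim_def X_def)
      have v: "\<rho>2 (b + 6 + tm_tapes M) = y" "\<rho>2 (b + 1) = x" by (simp_all add: \<rho>2_def X_def \<rho>1_def)
      have "\<exists>t\<le>23 * (length (\<rho>2 (b + 1)) + length (\<rho>2 (b + 6 + tm_tapes M))) + 14. runs K P3 (bits \<rho>2) t
          (bits (\<rho>2(b + 1 := [], b + 6 + tm_tapes M := [],
            b := run_out M (length (\<rho>2 (b + 1))) (\<rho>2 (b + 6 + tm_tapes M)))))"
        unfolding P3_def
        by (rule tm_sim.runs_run_prog[OF sim]) (use e in \<open>auto simp: \<rho>2_def \<rho>1_def X_def\<close>)
      moreover have "\<rho>2(b + 1 := [], b + 6 + tm_tapes M := [], b := run_out M (length x) y) =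
          \<rho>(b := eval (ERun M a c) (map \<rho> vs))"
        using e by (auto simp: \<rho>2_def \<rho>1_def X_def x_def y_def fun_eq_iff)
      ultimately have 3: "\<exists>t\<le>23 * (length x + length y) + 14. runs K P3 (bits \<rho>2) t
          (bits (\<rho>(b := eval (ERun M a c) (map \<rho> vs))))"
        unfolding v by simp
      have "\<exists>t\<le>23 * (h1 m + h2 m) + 14. runs K P3 (bits \<rho>2) t
          (bits (\<rho>(b := eval (ERun M a c) (map \<rho> vs))))"
        by (rule runs_le_mono[OF 3]) (use lx ly in simp)
      with 1 2 show "\<exists>t\<le>?f m. runs K (P1 ;; P2 ;; P3) (bits \<rho>) t (bits (\<rho>(b := eval (ERun M a c) (map \<rho> vs))))"
        by (intro runs_Seq_le)
    qed (use implementsD_wfc[OF P1] implementsD_wfc[OF P2] S3 in auto)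
    then show "\<exists>P K0 S0. implements ?f (ERun M a c) vs b P K0 S0" by blast
  qed
qed

theorem implementable: "wfe e \<Longrightarrow> implementable e"
  by (induction e) (simp_all add: implementable_EVar implementable_EConst implementable_ECat implementable_EIf
      implementable_EDrop implementable_EFor implementable_EBin implementable_ERun)

section \<open>From expressions to membership in PTIME\<close>

definition "seek_end = While (\<lambda>v. v 0 \<noteq> 0) (Act (\<lambda>v r. (v r, if r = 0 then 1 else 0)))"
definition "step_back = Act (\<lambda>v r. (v r, - 1))"

lemma runs_prepare:
  assumes "0 < K"
  shows "\<exists>t\<le>length x * 2 + 2. runs K (seek_end ;; step_back) (init_store K x) t
    (bits (\<lambda>r. if r = 0 then rev x else []))"
proof -
  define \<sigma> where "\<sigma> i = (init_store K x)(0 := (int i, bit_tape x))" for i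
  have 1: "\<exists>t\<le>length x * (1 + 1) + 1. runs K seek_end (\<sigma> 0) t (\<sigma> (length x))"
    unfolding seek_end_def
  proof (rule runs_While)
    fix i assume i: "i < length x"
    then show "view K (\<sigma> i) 0 \<noteq> 0" using assms by (simp add: view_def \<sigma>_def bit_tape_def)
    have "act K (\<lambda>v r. (v r, if r = 0 then 1 else 0)) (\<sigma> i) r = \<sigma> (Suc i) r" for r
      using assms by (auto simp: act_def \<sigma>_def view_def upd_tape_def prod_eq_iff)
    then show "\<exists>t\<le>1. runs K (Act (\<lambda>v r. (v r, if r = 0 then 1 else 0))) (\<sigma> i) t (\<sigma> (Suc i))"
      by (intro runs_Act_le) blast
  next
    show "\<not> view K (\<sigma> (length x)) 0 \<noteq> 0" by (simp add: view_def \<sigma>_def bit_tape_def)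
  qed
  have z: "\<sigma> 0 = init_store K x" using assms by (auto simp: \<sigma>_def init_store_def fun_eq_iff)
  have f: "stack_tape (map bsym xs) = (int (length xs) - 1, bit_tape (rev xs))" for xs
    using snd_stack_bits[of xs] by (auto simp: prod_eq_iff) (simp add: stack_tape_def)
  from f[of "[]"] have f0: "stack_tape [] = (- 1, bit_tape [])" by simp
  have "act K (\<lambda>v r. (v r, - 1)) (\<sigma> (length x)) r = bits (\<lambda>r. if r = 0 then rev x else []) r" for r
    using assms by (auto simp: act_def \<sigma>_def view_def upd_tape_def prod_eq_iff bits_def stacks_def f f0 init_store_def)
  then have 2: "\<exists>t\<le>1. runs K step_back (\<sigma> (length x)) t (bits (\<lambda>r. if r = 0 then rev x else []))"
    unfolding step_back_def by (intro runs_Act_le) blast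
  show ?thesis
    by (rule runs_le_mono[OF runs_Seq_le[OF 1 2], unfolded z]) simp
qed

lemma PTIME_exp:
  assumes "wfe E" "\<And>x. eval E [x] = [x \<in> A]"
  shows "A \<in> PTIME"
proof -
  obtain f where f: "pbounded f" "\<forall>vs b. (\<forall>v\<in>set vs. v < b) \<longrightarrow> (\<exists>P K0 S0. implements f E vs b P K0 S0)"
    using implementable[OF assms(1)] unfolding implementable_def by blast
  obtain P K0 S0 where P: "implements f E [1] 2 P K0 S0" using f(2)[rule_format, of "[1]" 2] by auto
  \<comment> \<open>Four tapes at least keep the output tape \<open>K - 1\<close> apart from
    registers \<open>0\<close>, \<open>1\<close> and \<open>2\<close>.\<close>
  define K where "K = max 4 K0"
  define S where "S = max 3 S0"
  \<comment> \<open>Read as a stack, the input tape has its last bit on top; the move to register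
    \<open>1\<close> turns it around.\<close>
  define c where "c = (seek_end ;; step_back) ;; (mv 0 {1} ;; P ;; mv 2 {K - 1})"
  have KK: "4 \<le> K" "K0 \<le> K" by (auto simp: K_def)
  have wf: "wfc S c"
    using implementsD_wfc[OF P, of S]
    by (auto simp: c_def S_def seek_end_def step_back_def valid_act_def intro!: wfc_mv)
  have run: "\<exists>t\<le>(length x * 2 + 2) + ((3 * length x + 1) + (f (length x) + 4)). \<exists>\<sigma>.
      runs K c (init_store K x) t \<sigma> \<and> snd (\<sigma> (K - 1)) = bit_tape [x \<in> A]" for x
  proof -
    define \<rho>1 where "\<rho>1 = (\<lambda>r :: nat. if r = 0 then rev x else [])"
    define \<rho>2 where "\<rho>2 = (\<lambda>r :: nat. if r = 1 then x else [])"
    define \<rho>3 where "\<rho>3 = \<rho>2(2 := [x \<in> A])"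
    define \<rho>4 where "\<rho>4 = \<rho>2(K - 1 := [x \<in> A])"
    have 1: "\<exists>t\<le>length x * 2 + 2. runs K (seek_end ;; step_back) (init_store K x) t (bits \<rho>1)"
      unfolding \<rho>1_def by (rule runs_prepare) (use KK in simp)
    have 2: "\<exists>t\<le>3 * length x + 1. runs K (mv 0 {1}) (bits \<rho>1) t (bits \<rho>2)"
      by (rule runs_le_mono[OF runs_mv]) (use KK in \<open>auto simp: \<rho>1_def \<rho>2_def fun_eq_iff\<close>)
    have ok: "env_ok [1] 2 (length x) \<rho>2" by (auto simp: env_ok_def \<rho>2_def)
    have 3: "\<exists>t\<le>f (length x). runs K P (bits \<rho>2) t (bits \<rho>3)"
      by (rule implementsD[OF P KK(2) ok refl]) (simp add: \<rho>3_def assms(2) \<rho>2_def)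
    have 4: "\<exists>t\<le>4. runs K (mv 2 {K - 1}) (bits \<rho>3) t (bits \<rho>4)"
      by (rule runs_le_mono[OF runs_mv]) (use KK in \<open>auto simp: \<rho>2_def \<rho>3_def \<rho>4_def fun_eq_iff\<close>)
    obtain t where "t\<le>(length x * 2 + 2) + ((3 * length x + 1) + (f (length x) + 4))" "runs K c (init_store K x) t (bits \<rho>4)"
      using runs_Seq_le[OF 1 runs_Seq_le[OF 2 runs_Seq_le[OF 3 4]]] unfolding c_def by blast
    moreover have "snd (bits \<rho>4 (K - 1)) = bit_tape [x \<in> A]"
      using snd_stack_bits[of "[x \<in> A]"] by (simp add: bits_def stacks_def \<rho>4_def)
    ultimately show ?thesis by blast
  qed
  have "pbounded (\<lambda>n. (n * 2 + 2) + ((3 * n + 1) + (f n + 4)))" by (intro pbounded_intros f)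
  then obtain p :: "nat poly" where p: "\<And>n. (n * 2 + 2) + ((3 * n + 1) + (f n + 4)) \<le> poly p n"
    unfolding pbounded_def by blast
  show ?thesis
  proof (rule PTIME_I[OF wf])
    fix x
    from run[of x] obtain t \<sigma> where "t \<le> (length x * 2 + 2) + ((3 * length x + 1) + (f (length x) + 4))"
      "runs K c (init_store K x) t \<sigma>" "snd (\<sigma> (K - 1)) = bit_tape [x \<in> A]" by blast
    then show "\<exists>t \<sigma>. t \<le> poly p (length x) \<and> runs K c (init_store K x) t \<sigma> \<and> snd (\<sigma> (K - 1)) = bit_tape [x \<in> A]"
      using p[of "length x"] le_trans by blast
  qed (use KK in \<open>auto simp: S_def\<close>)
qed

section \<open>Definable functions\<close>

text \<open>An environment \<open>e\<close> enters a function only through the strings \<open>v e\<close> for \<open>v\<close> in \<open>vs\<close>; numbers are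
  represented in unary.\<close>

definition definable :: "('e \<Rightarrow> bool list) list \<Rightarrow> ('e \<Rightarrow> bool list) \<Rightarrow> bool" where
  "definable vs f \<longleftrightarrow> (\<exists>E. wfe E \<and> (\<forall>e. eval E (map (\<lambda>v. v e) vs) = f e))"

definition defb :: "('e \<Rightarrow> bool list) list \<Rightarrow> ('e \<Rightarrow> bool) \<Rightarrow> bool" where
  "defb vs P \<longleftrightarrow> definable vs (\<lambda>e. [P e])"

definition defn :: "('e \<Rightarrow> bool list) list \<Rightarrow> ('e \<Rightarrow> nat) \<Rightarrow> bool" where
  "defn vs f \<longleftrightarrow> definable vs (\<lambda>e. replicate (f e) True)"

definition extn :: "('e \<Rightarrow> bool list) list \<Rightarrow> ('e \<times> nat \<Rightarrow> bool list) list" where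
  "extn vs = (\<lambda>p. replicate (snd p) True) # map (\<lambda>v p. v (fst p)) vs"

text \<open>De Bruijn lifting: room is made for one more variable at position
  \<open>k\<close>.\<close>

fun lift :: "nat \<Rightarrow> exp \<Rightarrow> exp" where
  "lift k (EVar n) = EVar (if n < k then n else Suc n)"
| "lift k (EConst xs) = EConst xs"
| "lift k (ECat a c) = ECat (lift k a) (lift k c)"
| "lift k (EIf c a d) = EIf (lift k c) (lift k a) (lift k d)"
| "lift k (EDrop a c) = EDrop (lift k a) (lift k c)"
| "lift k (EFor a c) = EFor (lift k a) (lift (Suc k) c)"
| "lift k (EBin a) = EBin (lift k a)"
| "lift k (ERun M a c) = ERun M (lift k a) (lift k c)"

lemma eval_lift: "k = length \<rho>1 \<Longrightarrow> eval (lift k E) (\<rho>1 @ w # \<rho>2) = eval E (\<rho>1 @ \<rho>2)"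
proof (induction E arbitrary: k \<rho>1)
  case (EFor a c)
  then show ?case using EFor.IH(2)[of "Suc k" "_ # \<rho>1"] by simp
qed (auto simp: nth_append Suc_diff_le)

lemma wfe_lift [simp]: "wfe (lift k E) = wfe E"
  by (induction E arbitrary: k) auto

lemma D_var: "v \<in> set vs \<Longrightarrow> definable vs v"
proof -
  assume "v \<in> set vs"
  then obtain i where "i < length vs" "vs ! i = v" by (auto simp: in_set_conv_nth)
  then show ?thesis unfolding definable_def by (intro exI[of _ "EVar i"]) auto
qed

lemma definable_lift:
  assumes "definable vs f" "\<And>p. map (\<lambda>v. v p) ws = w p # map (\<lambda>v. v (g p)) vs"
  shows "definable ws (\<lambda>p. f (g p))"
proof -
  obtain E where "wfe E" "\<And>e. eval E (map (\<lambda>v. v e) vs) = f e" using assms(1) by (auto simp: definable_def)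
  then show ?thesis
    unfolding definable_def using eval_lift[of 0 "[]" E]
    by (intro exI[of _ "lift 0 E"]) (simp add: assms(2))
qed

lemma map_extn: "map (\<lambda>v. v p) (extn vs) = replicate (snd p) True # map (\<lambda>v. v (fst p)) vs"
  by (simp add: extn_def comp_def)

lemma D_lift:
  "definable vs f \<Longrightarrow> definable (extn vs) (\<lambda>p. f (fst p))"
  "defb vs P \<Longrightarrow> defb (extn vs) (\<lambda>p. P (fst p))"
  "defn vs n \<Longrightarrow> defn (extn vs) (\<lambda>p. n (fst p))"
  using definable_lift[OF _ map_extn, of vs] by (auto simp: defb_def defn_def)

lemma D_new: "defn (extn vs) (\<lambda>p. snd p)"
  unfolding defn_def by (rule D_var) (simp add: extn_def)

lemma D_const: "definable vs (\<lambda>_. xs)"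
  unfolding definable_def by (intro exI[of _ "EConst xs"]) auto

lemma D_append: "definable vs f \<Longrightarrow> definable vs g \<Longrightarrow> definable vs (\<lambda>e. f e @ g e)"
proof -
  assume "definable vs f" "definable vs g"
  then obtain A B where "wfe A" "\<And>e. eval A (map (\<lambda>v. v e) vs) = f e" "wfe B"
    "\<And>e. eval B (map (\<lambda>v. v e) vs) = g e"
    by (auto simp: definable_def)
  then show ?thesis unfolding definable_def by (intro exI[of _ "ECat A B"]) auto
qed

lemma D_if: "defb vs P \<Longrightarrow> definable vs f \<Longrightarrow> definable vs g \<Longrightarrow> definable vs (\<lambda>e. if P e then f e else g e)"
proof -
  assume "defb vs P" "definable vs f" "definable vs g"
  then obtain A B C where "wfe A" "\<And>e. eval A (map (\<lambda>v. v e) vs) = [P e]" "wfe B"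
    "\<And>e. eval B (map (\<lambda>v. v e) vs) = f e" "wfe C" "\<And>e. eval C (map (\<lambda>v. v e) vs) = g e"
    by (auto simp: definable_def defb_def)
  then show ?thesis unfolding definable_def by (intro exI[of _ "EIf A B C"]) (auto simp: first_def)
qed

lemma D_first: "definable vs f \<Longrightarrow> defb vs (\<lambda>e. first (f e))"
proof -
  assume "definable vs f"
  then obtain A where "wfe A" "\<And>e. eval A (map (\<lambda>v. v e) vs) = f e" by (auto simp: definable_def)
  then show ?thesis
    unfolding definable_def defb_def by (intro exI[of _ "EIf A (EConst [True]) (EConst [False])"]) auto
qed

lemma D_drop_list: "definable vs f \<Longrightarrow> definable vs g \<Longrightarrow> definable vs (\<lambda>e. drop (length (f e)) (g e))"
proof -
  assume "definable vs f" "definable vs g"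
  then obtain A B where "wfe A" "\<And>e. eval A (map (\<lambda>v. v e) vs) = f e" "wfe B"
    "\<And>e. eval B (map (\<lambda>v. v e) vs) = g e"
    by (auto simp: definable_def)
  then show ?thesis unfolding definable_def by (intro exI[of _ "EDrop A B"]) auto
qed

lemma D_for_list:
  assumes "definable vs g" "definable (extn vs) (\<lambda>p. f (fst p) (snd p))"
  shows "definable vs (\<lambda>e. concat (map (f e) [0..<length (g e)]))"
proof -
  obtain A where A: "wfe A" "\<And>e. eval A (map (\<lambda>v. v e) vs) = g e" using assms(1) by (auto simp: definable_def)
  obtain B where B: "wfe B" "\<And>p. eval B (replicate (snd p) True # map (\<lambda>v. v (fst p)) vs) = f (fst p) (snd p)"
    using assms(2) unfolding definable_def map_extn by blast
  have "eval B (replicate i True # map (\<lambda>v. v e) vs) = f e i" for e i using B(2)[of "(e, i)"] by simp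
  then show ?thesis
    unfolding definable_def using A B(1) by (intro exI[of _ "EFor A B"]) simp
qed

lemma D_length: "definable vs f \<Longrightarrow> defn vs (\<lambda>e. length (f e))"
  unfolding defn_def using D_for_list[of vs f "\<lambda>_ _. [True]", OF _ D_const]
  by (simp add: concat_map_singleton map_replicate_trivial map_replicate_const)

lemma D_for: "defn vs g \<Longrightarrow> definable (extn vs) (\<lambda>p. f (fst p) (snd p)) \<Longrightarrow>
    definable vs (\<lambda>e. concat (map (f e) [0..<g e]))"
  using D_for_list[of vs "\<lambda>e. replicate (g e) True" f] by (simp add: defn_def)

lemma D_map: "defn vs g \<Longrightarrow> defb (extn vs) (\<lambda>p. P (fst p) (snd p)) \<Longrightarrow> definable vs (\<lambda>e. map (P e) [0..<g e])"
  using D_for[of vs g "\<lambda>e i. [P e i]"] by (simp add: defb_def concat_map_singleton)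

lemma D_drop: "defn vs f \<Longrightarrow> definable vs g \<Longrightarrow> definable vs (\<lambda>e. drop (f e) (g e))"
  using D_drop_list[of vs "\<lambda>e. replicate (f e) True" g] by (simp add: defn_def)

lemma D_true_false: "defb vs (\<lambda>_. b)" unfolding defb_def by (rule D_const)

lemma D_ifb: "defb vs P \<Longrightarrow> defb vs Q \<Longrightarrow> defb vs R \<Longrightarrow> defb vs (\<lambda>e. if P e then Q e else R e)"
  using D_if[of vs P "\<lambda>e. [Q e]" "\<lambda>e. [R e]"] by (simp add: defb_def if_distrib[of "\<lambda>x. [x]"])

lemma D_not: "defb vs P \<Longrightarrow> defb vs (\<lambda>e. \<not> P e)"
proof -
  assume "defb vs P"
  then have "defb vs (\<lambda>e. if P e then False else True)" by (intro D_ifb D_true_false)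
  moreover have "(\<lambda>e. if P e then False else True) = (\<lambda>e. \<not> P e)" by auto
  ultimately show ?thesis by simp
qed

lemma D_and: "defb vs P \<Longrightarrow> defb vs Q \<Longrightarrow> defb vs (\<lambda>e. P e \<and> Q e)"
proof -
  assume "defb vs P" "defb vs Q"
  then have "defb vs (\<lambda>e. if P e then Q e else False)" by (intro D_ifb D_true_false)
  moreover have "(\<lambda>e. if P e then Q e else False) = (\<lambda>e. P e \<and> Q e)" by auto
  ultimately show ?thesis by simp
qed

lemma D_or: "defb vs P \<Longrightarrow> defb vs Q \<Longrightarrow> defb vs (\<lambda>e. P e \<or> Q e)"
proof -
  assume "defb vs P" "defb vs Q"
  then have "defb vs (\<lambda>e. if P e then True else Q e)" by (intro D_ifb D_true_false)
  moreover have "(\<lambda>e. if P e then True else Q e) = (\<lambda>e. P e \<or> Q e)" by auto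
  ultimately show ?thesis by simp
qed

lemma D_imp: "defb vs P \<Longrightarrow> defb vs Q \<Longrightarrow> defb vs (\<lambda>e. P e \<longrightarrow> Q e)"
proof -
  assume "defb vs P" "defb vs Q"
  then have "defb vs (\<lambda>e. if P e then Q e else True)" by (intro D_ifb D_true_false)
  moreover have "(\<lambda>e. if P e then Q e else True) = (\<lambda>e. P e \<longrightarrow> Q e)" by auto
  ultimately show ?thesis by simp
qed

lemma D_less: "defn vs f \<Longrightarrow> defn vs g \<Longrightarrow> defb vs (\<lambda>e. f e < g e)"
proof -
  assume "defn vs f" "defn vs g"
  then have "defb vs (\<lambda>e. first (drop (f e) (replicate (g e) True)))"
    by (intro D_first D_drop) (auto simp: defn_def)
  moreover have "first (drop a (replicate b True)) \<longleftrightarrow> a < b" for a b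
    by (cases "b - a") (auto simp: first_def)
  ultimately show ?thesis by simp
qed

lemma D_le: "defn vs f \<Longrightarrow> defn vs g \<Longrightarrow> defb vs (\<lambda>e. f e \<le> g e)"
proof -
  assume "defn vs f" "defn vs g"
  then have "defb vs (\<lambda>e. \<not> g e < f e)" by (intro D_not D_less)
  then show ?thesis by (simp only: not_less)
qed

lemma D_eq: "defn vs f \<Longrightarrow> defn vs g \<Longrightarrow> defb vs (\<lambda>e. f e = g e)"
proof -
  assume "defn vs f" "defn vs g"
  then have "defb vs (\<lambda>e. f e \<le> g e \<and> g e \<le> f e)" by (intro D_and D_le)
  moreover have "(\<lambda>e. f e \<le> g e \<and> g e \<le> f e) = (\<lambda>e. f e = g e)" by auto
  ultimately show ?thesis by simp
qed

lemma D_num: "defn vs (\<lambda>_. n)" unfolding defn_def by (rule D_const)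

lemma D_add: "defn vs f \<Longrightarrow> defn vs g \<Longrightarrow> defn vs (\<lambda>e. f e + g e)"
  using D_append[of vs "\<lambda>e. replicate (f e) True" "\<lambda>e. replicate (g e) True"]
  by (simp add: defn_def replicate_add)

lemma D_Suc: "defn vs f \<Longrightarrow> defn vs (\<lambda>e. Suc (f e))"
  using D_add[OF _ D_num[of vs 1], of f] by simp

lemma D_diff: "defn vs f \<Longrightarrow> defn vs g \<Longrightarrow> defn vs (\<lambda>e. f e - g e)"
  using D_drop[of vs g "\<lambda>e. replicate (f e) True"] by (simp add: defn_def)

lemma D_mult: "defn vs f \<Longrightarrow> defn vs g \<Longrightarrow> defn vs (\<lambda>e. f e * g e)"
proof -
  assume "defn vs f" "defn vs g"
  then have "definable vs (\<lambda>e. concat (map (\<lambda>i. replicate (g e) True) [0..<f e]))"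
    using D_lift(3)[of vs g] by (intro D_for) (auto simp: defn_def)
  moreover have "concat (map (\<lambda>i. replicate b True) [0..<a]) = replicate (a * b) True" for a b :: nat
    by (induction a) (auto simp: replicate_add[symmetric] add.commute)
  ultimately show ?thesis by (simp add: defn_def)
qed

lemma D_ifn: "defb vs P \<Longrightarrow> defn vs f \<Longrightarrow> defn vs g \<Longrightarrow> defn vs (\<lambda>e. if P e then f e else g e)"
  using D_if[of vs P "\<lambda>e. replicate (f e) True" "\<lambda>e. replicate (g e) True"]
  by (simp add: defn_def if_distrib[of "\<lambda>x. replicate x True"])

lemma D_poly: "defn vs f \<Longrightarrow> defn vs (\<lambda>e. poly p (f e))"
  by (induction p) (auto intro!: D_num D_add D_mult)

lemma D_power: "defn vs f \<Longrightarrow> defn vs (\<lambda>e. f e ^ k)"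
  by (induction k) (auto intro!: D_num D_mult)

lemma D_count: "defn vs g \<Longrightarrow> defb (extn vs) (\<lambda>p. P (fst p) (snd p)) \<Longrightarrow>
    defn vs (\<lambda>e. length (filter (P e) [0..<g e]))"
proof -
  assume a: "defn vs g" "defb (extn vs) (\<lambda>p. P (fst p) (snd p))"
  have "definable vs (\<lambda>e. concat (map (\<lambda>i. if P e i then [True] else []) [0..<g e]))"
    by (intro D_for D_if D_const a)
  note D_length[OF this]
  moreover have "length (concat (map (\<lambda>i. if Q i then [True] else []) xs)) = length (filter Q xs)"
    for Q and xs :: "nat list"
    by (induction xs) auto
  ultimately show ?thesis by simp
qed

lemma D_ex: "defn vs g \<Longrightarrow> defb (extn vs) (\<lambda>p. P (fst p) (snd p)) \<Longrightarrow> defb vs (\<lambda>e. \<exists>i<g e. P e i)"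
proof -
  assume "defn vs g" "defb (extn vs) (\<lambda>p. P (fst p) (snd p))"
  then have "defb vs (\<lambda>e. 0 < length (filter (P e) [0..<g e]))"
    by (intro D_less D_num D_count)
  moreover have "0 < length (filter Q [0..<n]) \<longleftrightarrow> (\<exists>i<n. Q i)" for Q and n :: nat
    by (auto simp: filter_empty_conv)
  ultimately show ?thesis by simp
qed

lemma D_all: "defn vs g \<Longrightarrow> defb (extn vs) (\<lambda>p. P (fst p) (snd p)) \<Longrightarrow> defb vs (\<lambda>e. \<forall>i<g e. P e i)"
proof -
  assume "defn vs g" "defb (extn vs) (\<lambda>p. P (fst p) (snd p))"
  then have "defb vs (\<lambda>e. \<not> (\<exists>i<g e. \<not> P e i))" by (intro D_not D_ex)
  moreover have "(\<lambda>e. \<not> (\<exists>i<g e. \<not> P e i)) = (\<lambda>e. \<forall>i<g e. P e i)" by auto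
  ultimately show ?thesis by simp
qed

text \<open>Loops and comparisons are available, division is not; the quotient is therefore obtained
  by counting the positive multiples of \<open>k\<close> up to \<open>n\<close>.\<close>

lemma div_count: "0 < k \<Longrightarrow> n div k = length (filter (\<lambda>i. Suc i * k \<le> n) [0..<n])"
proof -
  assume k: "0 < k"
  have "{i. i < n \<and> Suc i * k \<le> n} = {..<n div k}"
  proof -
    have "Suc i \<le> n" if "Suc i * k \<le> n" for i
      using that mult_le_mono2[of 1 k "Suc i"] k by simp
    then show ?thesis using k by (auto simp: less_eq_div_iff_mult_less_eq Suc_le_eq[symmetric])
  qed
  then have "card {i. i < n \<and> Suc i * k \<le> n} = n div k" by simp
  then show ?thesis by (simp add: length_filter_conv_card cong: conj_cong)
qed

lemma D_div: "defn vs f \<Longrightarrow> defn vs g \<Longrightarrow> defn vs (\<lambda>e. f e div g e)"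
proof -
  assume a: "defn vs f" "defn vs g"
  have "defn vs (\<lambda>e. if 0 < g e then length (filter (\<lambda>i. Suc i * g e \<le> f e) [0..<f e]) else 0)"
    by (intro D_ifn D_less D_num D_count D_le D_mult D_Suc D_new D_lift a)
  moreover have "(if 0 < b then length (filter (\<lambda>i. Suc i * b \<le> a) [0..<a]) else 0) = a div b" for a b :: nat
    using div_count[of b a] by simp
  ultimately show ?thesis by simp
qed

lemma D_mod: "defn vs f \<Longrightarrow> defn vs g \<Longrightarrow> defn vs (\<lambda>e. f e mod g e)"
proof -
  assume a: "defn vs f" "defn vs g"
  have "defn vs (\<lambda>e. f e - f e div g e * g e)" by (intro D_diff D_mult D_div a)
  then show ?thesis by (simp add: minus_div_mult_eq_mod)
qed

definition look :: "bool list \<Rightarrow> nat \<Rightarrow> bool" where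
  "look xs i \<longleftrightarrow> i < length xs \<and> xs ! i"

lemma D_look: "definable vs f \<Longrightarrow> defn vs g \<Longrightarrow> defb vs (\<lambda>e. look (f e) (g e))"
proof -
  assume "definable vs f" "defn vs g"
  then have "defb vs (\<lambda>e. first (drop (g e) (f e)))" by (intro D_first D_drop)
  moreover have "first (drop i xs) = look xs i" for i xs
    by (cases "i < length xs") (auto simp: first_def look_def Cons_nth_drop_Suc[symmetric])
  ultimately show ?thesis by simp
qed

text \<open>In each of the finitely many cases the argument of \<open>P\<close> is a constant. In
  this way properties of cell options, which are not strings, become definable in terms of the index
  of the option.\<close>

lemma D_case:
  assumes "defn vs n" "\<And>a. a < S \<Longrightarrow> defb vs (\<lambda>e. P a e)"
  shows "defb vs (\<lambda>e. n e < S \<and> P (n e) e)"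
  using assms(2)
proof (induction S)
  case 0
  then show ?case using D_true_false[of vs False] by simp
next
  case (Suc S)
  have "defb vs (\<lambda>e. n e = S \<and> P S e \<or> n e < S \<and> P (n e) e)"
    by (intro D_or D_and[of vs "\<lambda>e. n e = S"] D_eq D_num assms(1) Suc) auto
  moreover have "(\<lambda>e. n e = S \<and> P S e \<or> n e < S \<and> P (n e) e) = (\<lambda>e. n e < Suc S \<and> P (n e) e)"
    by (auto simp: fun_eq_iff less_Suc_eq)
  ultimately show ?case by simp
qed

lemma D_binary: "defn vs f \<Longrightarrow> definable vs (\<lambda>e. binary_digits (f e))"
proof -
  assume "defn vs f"
  then obtain A where "wfe A" "\<And>e. eval A (map (\<lambda>v. v e) vs) = replicate (f e) True"
    by (auto simp: definable_def defn_def)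
  then show ?thesis unfolding definable_def by (intro exI[of _ "EBin A"]) auto
qed

lemma D_run: "turing_machine M \<Longrightarrow> defn vs f \<Longrightarrow> definable vs g \<Longrightarrow> definable vs (\<lambda>e. run_out M (f e) (g e))"
proof -
  assume M: "turing_machine M" and "defn vs f" "definable vs g"
  then obtain A B where "wfe A" "\<And>e. eval A (map (\<lambda>v. v e) vs) = replicate (f e) True"
    "wfe B" "\<And>e. eval B (map (\<lambda>v. v e) vs) = g e"
    by (auto simp: definable_def defn_def)
  with M show ?thesis unfolding definable_def by (intro exI[of _ "ERun M A B"]) auto
qed

lemma D_delim: "definable vs f \<Longrightarrow> definable vs (\<lambda>e. delim (f e))"
proof -
  assume a: "definable vs f"
  have "definable vs (\<lambda>e. concat (map (\<lambda>i. [True] @ [look (f e) i]) [0..<length (f e)]) @ [False])"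
    by (intro D_append D_const D_for D_length a D_look[unfolded defb_def] D_lift D_new)
  moreover have "concat (map (\<lambda>i. [True] @ [look xs i]) [0..<length xs]) = concat (map (\<lambda>b. [True, b]) xs)" for xs
    by (rule arg_cong[of _ _ concat], rule nth_equalityI) (auto simp: look_def)
  ultimately show ?thesis by (simp add: delim_def)
qed

lemma D_enc_nat: "defn vs f \<Longrightarrow> definable vs (\<lambda>e. enc_nat (f e))"
  unfolding enc_nat_def by (intro D_delim D_binary)

lemmas D_intros = D_const D_append D_if D_for D_map D_drop D_true_false D_ifb D_not D_and D_or D_imp D_less D_le D_eq
  D_num D_add D_Suc D_diff D_mult D_ifn D_poly D_power D_count D_ex D_all D_div D_mod D_look D_length D_delim
  D_enc_nat D_binary D_new D_lift

lemma PTIME_definable: "defb [\<lambda>x. x] (\<lambda>x. x \<in> A) \<Longrightarrow> A \<in> PTIME"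
  unfolding defb_def definable_def using PTIME_exp[of _ A] by auto

section \<open>Covering layered point sets\<close>

text \<open>Every class must meet some \<open>B j\<close>, and no \<open>B j\<close> meets two
  classes. By the count each class receives exactly one \<open>B j\<close>, which then has to fill
  it.\<close>

lemma refine_eq:
  assumes "finite J" "disjoint \<C>" "{} \<notin> \<C>" "card J \<le> card \<C>" "finite \<C>"
    and "\<And>j. j \<in> J \<Longrightarrow> B j \<noteq> {} \<and> (\<exists>C\<in>\<C>. B j \<subseteq> C)" "\<Union> \<C> \<subseteq> \<Union> (B ` J)"
  shows "B ` J = \<C>"
proof -
  obtain f where f: "\<And>j. j \<in> J \<Longrightarrow> f j \<in> \<C> \<and> B j \<subseteq> f j" using assms(6) by metis
  have in_f: "f j = C" if "j \<in> J" "x \<in> B j" "x \<in> C" "C \<in> \<C>" for j x C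
    using f[OF that(1)] that(2-4) assms(2) unfolding disjoint_def by blast
  have "f ` J = \<C>"
  proof
    show "\<C> \<subseteq> f ` J"
    proof
      fix C assume C: "C \<in> \<C>"
      then obtain x where x: "x \<in> C" using assms(3) by (metis ex_in_conv)
      then obtain j where "j \<in> J" "x \<in> B j" using assms(7) C by blast
      then show "C \<in> f ` J" using in_f[OF _ _ x C] by blast
    qed
  qed (use f in blast)
  moreover from this have "inj_on f J"
    using assms(1,4) by (metis card_image_le eq_card_imp_inj_on le_antisym)
  moreover have "B j = f j" if j: "j \<in> J" for j
  proof
    show "f j \<subseteq> B j"
    proof
      fix x assume x: "x \<in> f j"
      then obtain j' where j': "j' \<in> J" "x \<in> B j'" using assms(7) f[OF j] by blast
      then have "f j' = f j" using in_f[OF j'(1) j'(2) x] f[OF j] by blast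
      then have "j' = j" using \<open>inj_on f J\<close> j' j by (simp add: inj_on_eq_iff)
      then show "x \<in> B j" using j' by simp
    qed
  qed (use f j in blast)
  ultimately show ?thesis by auto
qed

text \<open>The combinatorial part of the point set. A cluster is a slot: \<open>lev g div 2\<close>
  is the constraint it belongs to, and an odd level says that it counts towards this
  constraint.\<close>

locale layered =
  fixes P :: "'a set" and cl :: "'a \<Rightarrow> nat" and item lev bud :: "nat \<Rightarrow> nat" and I C Q N K G :: nat
  assumes finP: "finite P"
    and cl_less: "\<And>p. p \<in> P \<Longrightarrow> cl p < G"
    and card_cluster: "\<And>g. g < G \<Longrightarrow> card {p \<in> P. cl p = g} = K"
    and item_less: "\<And>g. g < G \<Longrightarrow> item g < I"
    and lev_less: "\<And>g. g < G \<Longrightarrow> lev g < 2 * C"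
    and card_slots: "\<And>a c. a < I \<Longrightarrow> c < C \<Longrightarrow> card {g. g < G \<and> item g = a \<and> lev g div 2 = c} = Q"
    and pos: "0 < C" "0 < Q" "0 < N" "N \<le> I"
    and bud: "\<And>c. c < C \<Longrightarrow> bud c \<le> N * Q"
    and K_large: "C * N * Q < K"
begin

definition quota :: "nat \<Rightarrow> nat" where
  "quota l = (if odd l then bud (l div 2) else N * Q - bud (l div 2))"

text \<open>In the order of decreasing radii: class \<open>0\<close> consists of the large balls and
  class \<open>2 * C - l\<close> of the balls of level \<open>l\<close>.\<close>

definition ks :: "nat list" where
  "ks = (I - N) # map (\<lambda>i. quota (2 * C - Suc i)) [0..<2 * C]"

definition CU :: "nat set \<Rightarrow> nat set" where
  "CU U = {g. g < G \<and> item g \<in> U}"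

definition valid :: "nat set \<Rightarrow> bool" where
  "valid U \<longleftrightarrow> U \<subseteq> {..<I} \<and> card U = N \<and> (\<forall>c<C. card {g \<in> CU U. lev g = 2 * c + 1} \<le> bud c)"

definition item_set :: "nat \<Rightarrow> 'a set" where "item_set a = {p \<in> P. item (cl p) = a}"
definition cluster_set :: "nat \<Rightarrow> 'a set" where "cluster_set g = {p \<in> P. cl p = g}"

definition clustering :: "nat set \<Rightarrow> 'a set set" where
  "clustering U = item_set ` ({..<I} - U) \<union> cluster_set ` CU U"

lemma finite_CU [simp]: "finite (CU U)" by (simp add: CU_def)

lemma card_CU_below:
  assumes "A \<subseteq> {..<I}" "c \<le> C"
  shows "card {g \<in> CU A. lev g div 2 < c} = card A * (c * Q)"
proof -
  let ?S = "\<lambda>x. {g. g < G \<and> item g = fst x \<and> lev g div 2 = snd x}"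
  have "{g \<in> CU A. lev g div 2 < c} = (\<Union>x\<in>A \<times> {..<c}. ?S x)"
    by (auto simp: CU_def)
  moreover have "finite A" using assms(1) finite_subset by blast
  then have "card (\<Union>x\<in>A \<times> {..<c}. ?S x) = (\<Sum>x\<in>A \<times> {..<c}. card (?S x))"
    by (intro card_UN_disjoint) auto
  moreover have "(\<Sum>x\<in>A \<times> {..<c}. card (?S x)) = (\<Sum>x\<in>A \<times> {..<c}. Q)"
    using assms by (intro sum.cong refl card_slots) auto
  ultimately show ?thesis by (simp add: card_cartesian_product)
qed

lemma card_CU: "A \<subseteq> {..<I} \<Longrightarrow> card (CU A) = card A * (C * Q)"
proof -
  assume A: "A \<subseteq> {..<I}"
  have "{g \<in> CU A. lev g div 2 < C} = CU A"
    using lev_less by (auto simp: CU_def less_mult_imp_div_less mult.commute)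
  then show ?thesis using card_CU_below[OF A order_refl] by simp
qed

lemma sum_quota: "c \<le> C \<Longrightarrow> (\<Sum>l<2 * c. quota l) = c * (N * Q)"
proof (induction c)
  case (Suc c)
  then have "bud c \<le> N * Q" using bud by simp
  then show ?case using Suc by (simp add: quota_def)
qed simp

lemma length_ks [simp]: "length ks = 2 * C + 1" by (simp add: ks_def)

lemma ks_0 [simp]: "ks ! 0 = I - N" by (simp add: ks_def)

lemma ks_level: "l < 2 * C \<Longrightarrow> ks ! (2 * C - l) = quota l"
proof -
  assume l: "l < 2 * C"
  then have "2 * C - l = Suc (2 * C - Suc l)" by simp
  then show ?thesis using l by (simp add: ks_def)
qed

lemma sum_list_ks: "sum_list ks = (I - N) + C * (N * Q)"
proof -
  have "(\<Sum>i\<leftarrow>[0..<2 * C]. quota (2 * C - Suc i)) = (\<Sum>i<2 * C. quota (2 * C - Suc i))"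
    by (simp add: interv_sum_list_conv_sum_set_nat atLeast0LessThan)
  also have "\<dots> = (\<Sum>l<2 * C. quota l)" by (rule sum.nat_diff_reindex)
  finally show ?thesis using sum_quota[of C] by (simp add: ks_def)
qed

lemma cluster_set_nonempty: "g < G \<Longrightarrow> cluster_set g \<noteq> {}"
  using card_cluster[of g] K_large by (auto simp: cluster_set_def simp del: Collect_empty_eq)

lemma item_set_nonempty: "a < I \<Longrightarrow> item_set a \<noteq> {}"
proof -
  assume "a < I"
  then have "card {g. g < G \<and> item g = a \<and> lev g div 2 = 0} \<noteq> 0" using card_slots[of a 0] pos by simp
  then have "{g. g < G \<and> item g = a \<and> lev g div 2 = 0} \<noteq> {}" by (metis card.empty)
  then obtain g where g: "g < G" "item g = a" by blast
  then show ?thesis using cluster_set_nonempty[of g] by (auto simp: cluster_set_def item_set_def)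
qed

lemma partition_clustering:
  assumes "U \<subseteq> {..<I}"
  shows "partition_on P (clustering U)"
proof (rule partition_onI)
  show "\<Union> (clustering U) = P"
    using cl_less item_less by (fastforce simp: clustering_def item_set_def cluster_set_def CU_def)
  show "{} \<notin> clustering U"
    using cluster_set_nonempty item_set_nonempty by (auto simp: clustering_def CU_def)
  fix A B assume "A \<in> clustering U" "B \<in> clustering U" "A \<noteq> B"
  then show "disjnt A B"
    by (auto simp: clustering_def item_set_def cluster_set_def CU_def disjnt_def)
qed

lemma finite_clustering: "finite (clustering U)" by (simp add: clustering_def)

lemma card_clustering:
  assumes "U \<subseteq> {..<I}" "card U = N"
  shows "card (clustering U) = sum_list ks"
proof -
  have 1: "inj_on item_set ({..<I} - U)"
  proof (rule inj_onI)
    fix a b assume "a \<in> {..<I} - U" "item_set a = item_set b"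
    then obtain p where "p \<in> item_set a" "p \<in> item_set b" using item_set_nonempty[of a] by blast
    then show "a = b" by (simp add: item_set_def)
  qed
  have 2: "inj_on cluster_set (CU U)"
  proof (rule inj_onI)
    fix a b assume "a \<in> CU U" "cluster_set a = cluster_set b"
    then obtain p where "p \<in> cluster_set a" "p \<in> cluster_set b" using cluster_set_nonempty[of a] by (auto simp: CU_def)
    then show "a = b" by (simp add: cluster_set_def)
  qed
  have 3: "item_set ` ({..<I} - U) \<inter> cluster_set ` CU U = {}"
  proof (rule ccontr)
    assume "item_set ` ({..<I} - U) \<inter> cluster_set ` CU U \<noteq> {}"
    then obtain a g where ag: "a \<notin> U" "g \<in> CU U" "item_set a = cluster_set g" by blast
    then obtain p where "p \<in> cluster_set g" "p \<in> item_set a" using cluster_set_nonempty[of g] by (auto simp: CU_def)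
    then show False using ag by (auto simp: cluster_set_def item_set_def CU_def)
  qed
  have "finite U" using assms(1) finite_subset by blast
  then show ?thesis
    unfolding clustering_def
    by (subst card_Un_disjoint[OF _ _ 3])
      (simp_all add: card_image 1 2 card_CU[OF assms(1)] assms card_Diff_subset sum_list_ks mult.commute)
qed

text \<open>Geometry enters through \<open>S0\<close> to \<open>S2\<close> only: a large ball stays
  within an item, a small one within a cluster, and a ball of level \<open>l\<close> cannot contain
  two points of a cluster of higher level. The large balls miss at least \<open>N\<close> items,
  each cluster of these needs a small ball of its own, and there are just enough small balls for
  \<open>N\<close> items. So all counts are tight.\<close>

lemma covering_structure:
  fixes Bl :: "nat \<Rightarrow> 'a \<Rightarrow> 'a set"
  assumes len: "map length cs = ks" and ctr: "\<And>c. c \<in> set cs \<Longrightarrow> set c \<subseteq> P"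
    and Bl: "\<And>i c. i \<le> 2 * C \<Longrightarrow> c \<in> set (cs ! i) \<Longrightarrow> c \<in> Bl i c \<and> Bl i c \<subseteq> P"
    and cover: "P \<subseteq> \<Union> {Bl i c | i c. i \<le> 2 * C \<and> c \<in> set (cs ! i)}"
    and S0: "\<And>c p q. c \<in> set (cs ! 0) \<Longrightarrow> p \<in> Bl 0 c \<Longrightarrow> q \<in> Bl 0 c \<Longrightarrow> item (cl p) = item (cl q)"
    and S1: "\<And>i c p q. 0 < i \<Longrightarrow> i \<le> 2 * C \<Longrightarrow> c \<in> set (cs ! i) \<Longrightarrow> p \<in> Bl i c \<Longrightarrow> q \<in> Bl i c \<Longrightarrow> cl p = cl q"
    and S2: "\<And>l c p q. l < 2 * C \<Longrightarrow> c \<in> set (cs ! (2 * C - l)) \<Longrightarrow>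
      p \<in> Bl (2 * C - l) c \<Longrightarrow> q \<in> Bl (2 * C - l) c \<Longrightarrow> p \<noteq> q \<Longrightarrow> lev (cl p) \<le> l"
  defines "U \<equiv> {..<I} - (\<lambda>c. item (cl c)) ` set (cs ! 0)"
  shows "valid U" "{Bl i c | i c. i \<le> 2 * C \<and> c \<in> set (cs ! i)} = clustering U"
proof -
  have lcs: "length cs = 2 * C + 1" using len length_ks by (metis length_map)
  have lc: "length (cs ! i) = ks ! i" if "i \<le> 2 * C" for i
    using len lcs that by (metis le_imp_less_Suc nth_map Suc_eq_plus1)
  have ctrP: "c \<in> P" if "i \<le> 2 * C" "c \<in> set (cs ! i)" for i c
    using ctr[of "cs ! i"] that lcs by auto
  define J1 where "J1 = (SIGMA l:{..<2 * C}. {..<quota l})"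
  define ctr1 where "ctr1 x = cs ! (2 * C - fst x) ! snd x" for x :: "nat \<times> nat"
  have fin1: "finite J1" by (simp add: J1_def)
  have card1: "card J1 = C * (N * Q)" using sum_quota[of C] by (simp add: J1_def)
  have ctr1: "ctr1 x \<in> set (cs ! (2 * C - fst x))" if "x \<in> J1" for x
    using that lc[of "2 * C - fst x"] by (auto simp: J1_def ctr1_def ks_level)
  have idx1: "\<exists>x\<in>J1. fst x = l \<and> ctr1 x = c" if l: "l < 2 * C" and c: "c \<in> set (cs ! (2 * C - l))" for l c
  proof -
    obtain j where "j < length (cs ! (2 * C - l))" "cs ! (2 * C - l) ! j = c"
      using c by (auto simp: in_set_conv_nth)
    then show ?thesis using l lc[of "2 * C - l"]
      by (intro bexI[of _ "(l, j)"]) (auto simp: J1_def ctr1_def ks_level)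
  qed
  have U: "U \<subseteq> {..<I}" "finite U" by (auto simp: U_def)
  have card0: "card ((\<lambda>c. item (cl c)) ` set (cs ! 0)) \<le> I - N"
    using card_image_le[of "set (cs ! 0)" "\<lambda>c. item (cl c)"] card_length[of "cs ! 0"] lc[of 0] by simp
  have sub0: "(\<lambda>c. item (cl c)) ` set (cs ! 0) \<subseteq> {..<I}"
    using ctrP[of 0] cl_less item_less by auto
  have NU: "N \<le> card U"
    unfolding U_def using card_Diff_subset[OF finite_subset[OF sub0] sub0] card0 pos(4) by simp
  have hit: "\<exists>x\<in>J1. cl (ctr1 x) = g \<and> lev g \<le> fst x" if g: "g \<in> CU U" for g
  proof -
    have gG: "g < G" using g by (simp add: CU_def)
    have "\<exists>x\<in>J1. p \<in> Bl (2 * C - fst x) (ctr1 x)" if p: "p \<in> cluster_set g" for p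
    proof -
      obtain i c where ic: "i \<le> 2 * C" "c \<in> set (cs ! i)" "p \<in> Bl i c"
        using p cover by (auto simp: cluster_set_def)
      have "i \<noteq> 0"
      proof
        assume i: "i = 0"
        then have "item (cl p) = item (cl c)" using S0[of c p c] ic Bl[of 0 c] by simp
        then have "item g \<in> (\<lambda>c. item (cl c)) ` set (cs ! 0)" using p ic(2) i by (auto simp: cluster_set_def)
        then show False using g by (auto simp: CU_def U_def)
      qed
      then have l: "2 * C - i < 2 * C" "2 * C - (2 * C - i) = i" using ic pos(1) by auto
      then obtain x where "x \<in> J1" "fst x = 2 * C - i" "ctr1 x = c" using idx1[of "2 * C - i" c] ic by auto
      then show ?thesis using ic l by (intro bexI[of _ x]) auto
    qed
    \<comment> \<open>Balls that are too small could still cover a cluster point by point. But a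
      cluster has more points than there are small balls, so some ball contains two of them and has
      sufficient level.\<close>
    then obtain h where h: "\<And>p. p \<in> cluster_set g \<Longrightarrow> h p \<in> J1 \<and> p \<in> Bl (2 * C - fst (h p)) (ctr1 (h p))"
      by metis
    have "card (h ` cluster_set g) \<le> card J1" using h fin1 by (intro card_mono) auto
    also have "\<dots> < card (cluster_set g)"
      using card_cluster[OF gG] K_large card1 by (simp add: cluster_set_def mult.assoc)
    finally have "\<not> inj_on h (cluster_set g)" using card_image by fastforce
    then obtain p q where pq: "p \<in> cluster_set g" "q \<in> cluster_set g" "p \<noteq> q" "h p = h q"
      by (auto simp: inj_on_def)
    define x where "x = h p"
    have x: "x \<in> J1" "p \<in> Bl (2 * C - fst x) (ctr1 x)" "q \<in> Bl (2 * C - fst x) (ctr1 x)"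
      using h[OF pq(1)] h[OF pq(2)] pq(4) by (auto simp: x_def)
    have lx: "fst x < 2 * C" using x(1) by (auto simp: J1_def)
    have "lev (cl p) \<le> fst x" using S2[OF lx ctr1[OF x(1)] x(2,3) pq(3)] .
    moreover have "cl (ctr1 x) = cl p"
      using S1[of "2 * C - fst x" "ctr1 x" "ctr1 x" p] ctr1[OF x(1)] x(2) lx Bl[of "2 * C - fst x" "ctr1 x"] by auto
    ultimately show ?thesis using x(1) pq(1) by (auto simp: cluster_set_def)
  qed
  have sub1: "CU U \<subseteq> (\<lambda>x. cl (ctr1 x)) ` J1" using hit by blast
  have "card (CU U) \<le> card J1"
    using card_mono[OF finite_imageI[OF fin1] sub1] card_image_le[OF fin1, of "\<lambda>x. cl (ctr1 x)"] by linarith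
  moreover have "card J1 = N * (C * Q)" using card1 by simp
  ultimately have "card U * (C * Q) \<le> N * (C * Q)"
    using card_CU[OF U(1)] by simp
  then have "card U \<le> N" using pos by simp
  then have cardU: "card U = N" using NU by simp
  \<comment> \<open>Small balls and clusters of \<open>U\<close> are equally many, so the centers
    hit each of these clusters exactly once and no other cluster.\<close>
  have eq1: "(\<lambda>x. cl (ctr1 x)) ` J1 = CU U"
  proof -
    have "card ((\<lambda>x. cl (ctr1 x)) ` J1) \<le> card (CU U)"
      using card_image_le[OF fin1, of "\<lambda>x. cl (ctr1 x)"] card_CU[OF U(1)] card1 cardU by (simp add: algebra_simps)
    then show ?thesis using card_seteq[OF finite_imageI[OF fin1] sub1] by blast
  qed
  have inj1: "inj_on (\<lambda>x. cl (ctr1 x)) J1"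
  proof (rule eq_card_imp_inj_on[OF fin1])
    show "card ((\<lambda>x. cl (ctr1 x)) ` J1) = card J1"
      unfolding eq1 using card_CU[OF U(1)] card1 cardU by (simp add: algebra_simps)
  qed
  have lev1: "lev (cl (ctr1 x)) \<le> fst x" if x: "x \<in> J1" for x
  proof -
    have "cl (ctr1 x) \<in> CU U" using eq1 x by blast
    from hit[OF this] obtain y where y: "y \<in> J1" "cl (ctr1 y) = cl (ctr1 x)" "lev (cl (ctr1 x)) \<le> fst y" by blast
    then have "y = x" using inj1 x by (auto simp: inj_on_def)
    then show ?thesis using y by simp
  qed
  have "card {g \<in> CU U. lev g = 2 * c + 1} \<le> bud c" if c: "c < C" for c
  proof -
    \<comment> \<open>The balls of level below \<open>2 * c + 1\<close> lie in different clusters of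
      levels below \<open>2 * c + 1\<close>, so there are at least
      \<open>c * (N * Q) + (N * Q - bud c)\<close> such clusters. Of the
      \<open>Suc c * (N * Q)\<close> clusters of the first \<open>Suc c\<close> constraints, at most
      \<open>bud c\<close> remain for level \<open>2 * c + 1\<close>.\<close>
    let ?J = "SIGMA l:{..<2 * c + 1}. {..<quota l}"
    have J: "?J \<subseteq> J1" using c by (auto simp: J1_def)
    have "card ?J = c * (N * Q) + (N * Q - bud c)" using sum_quota[of c] c by (simp add: quota_def)
    moreover have "card ?J = card ((\<lambda>x. cl (ctr1 x)) ` ?J)"
      using card_image[OF inj_on_subset[OF inj1 J]] by simp
    moreover have "(\<lambda>x. cl (ctr1 x)) ` ?J \<subseteq> {g \<in> CU U. lev g < 2 * c + 1}"
      using J eq1 lev1 by fastforce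
    then have "card ((\<lambda>x. cl (ctr1 x)) ` ?J) \<le> card {g \<in> CU U. lev g < 2 * c + 1}"
      by (intro card_mono) auto
    ultimately have 1: "c * (N * Q) + (N * Q - bud c) \<le> card {g \<in> CU U. lev g < 2 * c + 1}" by simp
    have "{g \<in> CU U. lev g div 2 < Suc c} = {g \<in> CU U. lev g < 2 * c + 1} \<union> {g \<in> CU U. lev g = 2 * c + 1}"
      by auto
    then have "card {g \<in> CU U. lev g div 2 < Suc c} =
        card {g \<in> CU U. lev g < 2 * c + 1} + card {g \<in> CU U. lev g = 2 * c + 1}"
      by (simp add: card_Un_disjoint disjoint_iff)
    then have "card {g \<in> CU U. lev g < 2 * c + 1} + card {g \<in> CU U. lev g = 2 * c + 1} = c * (N * Q) + N * Q"
      using card_CU_below[OF U(1), of "Suc c"] c cardU by (simp add: algebra_simps)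
    then show ?thesis using 1 bud[OF c] by linarith
  qed
  then show val: "valid U" using U cardU by (simp add: valid_def)
  \<comment> \<open>All balls of all classes; they are as many as the parts of
    \<open>clustering U\<close>, so \<open>refine_eq\<close> applies.\<close>
  define J where "J = (SIGMA i:{..2 * C}. {..<ks ! i})"
  define B where "B x = Bl (fst x) (cs ! fst x ! snd x)" for x :: "nat \<times> nat"
  have BJ: "B ` J = {Bl i c | i c. i \<le> 2 * C \<and> c \<in> set (cs ! i)}"
  proof
    show "B ` J \<subseteq> {Bl i c | i c. i \<le> 2 * C \<and> c \<in> set (cs ! i)}"
      using lc by (fastforce simp: J_def B_def)
    show "{Bl i c | i c. i \<le> 2 * C \<and> c \<in> set (cs ! i)} \<subseteq> B ` J"
    proof clarify
      fix i c assume "i \<le> 2 * C" "c \<in> set (cs ! i)"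
      moreover from this obtain j where "j < ks ! i" "cs ! i ! j = c" using lc by (auto simp: in_set_conv_nth)
      ultimately show "Bl i c \<in> B ` J" by (intro image_eqI[of _ _ "(i, j)"]) (auto simp: J_def B_def)
    qed
  qed
  have "B ` J = clustering U"
  proof (rule refine_eq)
    show "finite J" by (simp add: J_def)
    show "disjoint (clustering U)" "{} \<notin> clustering U" "finite (clustering U)"
      using partition_clustering[OF U(1)] finite_clustering by (auto simp: partition_on_def)
    have "card J = sum_list ks"
      by (simp add: J_def sum_list_sum_nth atLeast0LessThan lessThan_Suc_atMost)
    then show "card J \<le> card (clustering U)" using card_clustering[OF U(1) cardU] by simp
    have UP: "\<Union> (clustering U) = P" using partition_clustering[OF U(1)] by (simp add: partition_on_def)
    show "\<Union> (clustering U) \<subseteq> \<Union> (B ` J)" unfolding UP BJ by (rule cover)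
    fix x assume x: "x \<in> J"
    define i c where "i = fst x" and "c = cs ! fst x ! snd x"
    have i: "i \<le> 2 * C" and c: "c \<in> set (cs ! i)" using x lc by (auto simp: J_def i_def c_def)
    have Bx: "B x = Bl i c" by (simp add: B_def i_def c_def)
    have cP: "c \<in> P" using ctrP i c by blast
    have "\<exists>D\<in>clustering U. Bl i c \<subseteq> D"
    proof (cases "i = 0")
      case True
      have "Bl i c \<subseteq> item_set (item (cl c))"
      proof
        fix p assume p: "p \<in> Bl i c"
        then have "item (cl p) = item (cl c)"
          using S0[of c p c] c True Bl[OF i c] by blast
        then show "p \<in> item_set (item (cl c))" using p Bl[OF i c] unfolding item_set_def by blast
      qed
      moreover have "item (cl c) \<in> {..<I} - U"
        using c True cP cl_less item_less by (auto simp: U_def)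
      ultimately show ?thesis by (auto simp: clustering_def)
    next
      case False
      have "Bl i c \<subseteq> cluster_set (cl c)"
      proof
        fix p assume p: "p \<in> Bl i c"
        have "cl p = cl c" by (rule S1[of i c p c]) (use c i False p Bl[OF i c] in auto)
        then show "p \<in> cluster_set (cl c)" using p Bl[OF i c] unfolding cluster_set_def by blast
      qed
      moreover have "cl c \<in> CU U"
      proof -
        obtain y where "y \<in> J1" "ctr1 y = c" using idx1[of "2 * C - i" c] c i False pos(1) by auto
        then show ?thesis using eq1 by blast
      qed
      ultimately show ?thesis by (auto simp: clustering_def)
    qed
    then show "B x \<noteq> {} \<and> (\<exists>D\<in>clustering U. B x \<subseteq> D)" using Bx Bl[OF i c] by auto
  qed
  then show "{Bl i c | i c. i \<le> 2 * C \<and> c \<in> set (cs ! i)} = clustering U" unfolding BJ .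
qed

text \<open>An induced clustering has as many parts as there are balls; once the balls are a
  partition themselves, no proper refinement has this number of parts.\<close>

lemma clustering_unique:
  assumes "partition_on P \<D>" "card \<D> = sum_list ks" "\<And>D. D \<in> \<D> \<Longrightarrow> \<exists>B\<in>clustering U. D \<subseteq> B" "valid U"
  shows "\<D> = clustering U"
proof -
  have U: "U \<subseteq> {..<I}" "card U = N" using assms(4) by (auto simp: valid_def)
  have p: "partition_on P (clustering U)" by (rule partition_clustering[OF U(1)])
  have "finite \<D>"
    using assms(1) finP by (metis finite_UnionD partition_on_def)
  then have "(\<lambda>D. D) ` \<D> = clustering U"
    using p assms(1-3) card_clustering[OF U] finite_clustering
    by (intro refine_eq) (auto simp: partition_on_def)
  then show ?thesis by simp
qed

definition rep :: "nat \<Rightarrow> 'a" where "rep g = (SOME p. p \<in> cluster_set g)"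

lemma rep: "g < G \<Longrightarrow> rep g \<in> P \<and> cl (rep g) = g"
  using someI_ex[of "\<lambda>p. p \<in> cluster_set g"] cluster_set_nonempty[of g]
  by (auto simp: rep_def cluster_set_def)

lemma item_rep: "a < I \<Longrightarrow> \<exists>p\<in>P. item (cl p) = a"
  using item_set_nonempty[of a] by (auto simp: item_set_def)

lemma ex_placement:
  assumes "valid U"
  shows "\<exists>cs. map length cs = ks \<and> (\<forall>c\<in>set cs. set c \<subseteq> P) \<and>
    (\<forall>p\<in>P. (\<exists>c\<in>set (cs ! 0). item (cl c) = item (cl p)) \<or>
       (\<exists>l<2 * C. lev (cl p) \<le> l \<and> (\<exists>c\<in>set (cs ! (2 * C - l)). cl c = cl p)))"
proof -
  have U: "U \<subseteq> {..<I}" "card U = N" "\<And>c. c < C \<Longrightarrow> card {g \<in> CU U. lev g = 2 * c + 1} \<le> bud c"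
    using assms by (auto simp: valid_def)
  have finU: "finite U" using U(1) finite_subset by blast
  define irep where "irep a = (SOME p. p \<in> P \<and> item (cl p) = a)" for a
  have irep: "irep a \<in> P \<and> item (cl (irep a)) = a" if "a < I" for a
    unfolding irep_def using someI_ex[of "\<lambda>p. p \<in> P \<and> item (cl p) = a"] item_rep[OF that] by blast
  define M where "M c = sorted_list_of_set {g \<in> CU U. lev g = 2 * c + 1}" for c
  define Z where "Z c = sorted_list_of_set {g \<in> CU U. lev g = 2 * c}" for c
  define L where "L c = M c @ Z c" for c
  have setM: "set (M c) = {g \<in> CU U. lev g = 2 * c + 1}" and setZ: "set (Z c) = {g \<in> CU U. lev g = 2 * c}" for c
    by (simp_all add: M_def Z_def)
  have lenL: "length (L c) = N * Q" if c: "c < C" for c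
  proof -
    have e: "{g \<in> CU U. lev g div 2 < Suc c} = {g \<in> CU U. lev g div 2 < c} \<union> ({g \<in> CU U. lev g = 2 * c + 1} \<union> {g \<in> CU U. lev g = 2 * c})"
      by auto
    have "card {g \<in> CU U. lev g div 2 < Suc c} = card {g \<in> CU U. lev g div 2 < c} +
      (card {g \<in> CU U. lev g = 2 * c + 1} + card {g \<in> CU U. lev g = 2 * c})"
      unfolding e by (subst card_Un_disjoint; (subst card_Un_disjoint)?) (auto simp: disjoint_iff)
    then show ?thesis
      using card_CU_below[OF U(1), of "Suc c"] card_CU_below[OF U(1), of c] c U(2)
      by (simp add: L_def M_def Z_def algebra_simps)
  qed
  \<comment> \<open>The counted slots head the list and number at most \<open>bud c\<close>, so all
    of them get balls of the odd level. The remaining balls of that level go to uncounted slots, for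
    which they are larger than necessary.\<close>
  define part where "part l = (if odd l then take (bud (l div 2)) (L (l div 2)) else drop (bud (l div 2)) (L (l div 2)))" for l
  have len_part: "length (part l) = quota l" if "l < 2 * C" for l
  proof -
    have "l div 2 < C" using that by (simp add: less_mult_imp_div_less mult.commute)
    then show ?thesis using lenL[of "l div 2"] bud[of "l div 2"] by (simp add: part_def quota_def)
  qed
  have set_part: "set (part l) \<subseteq> CU U" for l
    using setM setZ by (auto simp: part_def L_def dest!: in_set_takeD in_set_dropD split: if_splits)
  define cs where "cs = map irep (sorted_list_of_set ({..<I} - U)) #
      map (\<lambda>i. map rep (part (2 * C - Suc i))) [0..<2 * C]"
  have csl: "cs ! (2 * C - l) = map rep (part l)" if "l < 2 * C" for l
  proof -
    have "2 * C - l = Suc (2 * C - Suc l)" using that by simp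
    then show ?thesis using that by (simp add: cs_def)
  qed
  have "map length cs = ks"
    using finU U(1,2) by (auto simp: cs_def ks_def len_part card_Diff_subset)
  moreover have "\<forall>c\<in>set cs. set c \<subseteq> P"
    using irep set_part rep by (auto simp: cs_def CU_def dest!: subsetD)
  moreover have "(\<exists>c\<in>set (cs ! 0). item (cl c) = item (cl p)) \<or>
       (\<exists>l<2 * C. lev (cl p) \<le> l \<and> (\<exists>c\<in>set (cs ! (2 * C - l)). cl c = cl p))" if p: "p \<in> P" for p
  proof (cases "item (cl p) \<in> U")
    case False
    have "item (cl p) < I" using item_less cl_less p by blast
    then show ?thesis using False irep[of "item (cl p)"] by (auto simp: cs_def)
  next
    case True
    define g where "g = cl p"
    have g: "g < G" "g \<in> CU U" "lev g < 2 * C" using True cl_less[OF p] lev_less by (auto simp: g_def CU_def)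
    define c where "c = lev g div 2"
    have c: "c < C" using g(3) by (simp add: c_def less_mult_imp_div_less mult.commute)
    have "\<exists>l<2 * C. lev g \<le> l \<and> g \<in> set (part l)"
    proof (cases "odd (lev g)")
      case True
      have "g \<in> set (M c)" using g True by (auto simp: setM c_def)
      moreover have "length (M c) \<le> bud c" using U(3)[OF c] by (simp add: M_def)
      ultimately have "g \<in> set (part (lev g))" using True by (simp add: part_def L_def c_def[symmetric])
      then show ?thesis using g by blast
    next
      case False
      then have l2: "lev g = 2 * c" by (simp add: c_def)
      then have "g \<in> set (L c)" using g by (auto simp: setZ L_def)
      then have "g \<in> set (take (bud c) (L c)) \<union> set (drop (bud c) (L c))"
        by (metis append_take_drop_id set_append)
      then have "g \<in> set (part (2 * c + 1)) \<or> g \<in> set (part (2 * c))" by (auto simp: part_def)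
      moreover have "2 * c + 1 < 2 * C" "2 * c < 2 * C" using c by auto
      ultimately show ?thesis unfolding l2 by (meson le_add1 order_refl)
    qed
    then obtain l where l: "l < 2 * C" "lev g \<le> l" "g \<in> set (part l)" by blast
    then have "rep g \<in> set (cs ! (2 * C - l))" by (simp add: csl)
    then show ?thesis using l rep[OF g(1)] by (auto simp: g_def)
  qed
  ultimately show ?thesis by blast
qed

end

text \<open>Lowering a dilation to the next ratio of a distance to a radius, or to \<open>0\<close>,
  changes no ball. Hence only finitely many dilations compete and a minimum exists, although there
  are infinitely many dilations to choose from.\<close>

lemma ex_optimal:
  assumes "finite P" "Metric_space P d" "\<forall>r\<in>set rs. 0 \<le> r" "length ks = length rs" "feasible P d rs ks cs0 \<alpha>0"
  shows "\<exists>cs \<alpha>. optimal P d rs ks cs \<alpha>"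
proof -
  interpret Metric_space P d by fact
  define A where "A = insert 0 ((\<lambda>(p, q, r). d p q / r) ` (P \<times> P \<times> set rs))"
  have finA: "finite A" using assms(1) by (simp add: A_def)
  have round: "\<exists>a\<in>A. a \<le> \<alpha> \<and> feasible P d rs ks cs a" if f: "feasible P d rs ks cs \<alpha>" for cs \<alpha>
  proof -
    define S where "S = {a \<in> A. a \<le> \<alpha>}"
    have \<alpha>: "0 \<le> \<alpha>" "placement P ks cs" using f by (auto simp: feasible_def)
    have S: "finite S" "0 \<in> S" using finA \<alpha> by (auto simp: S_def A_def)
    define a where "a = Max S"
    have "S \<noteq> {}" using S(2) by auto
    then have a: "a \<in> S" "0 \<le> a" using S Max_in[of S] Max_ge[of S 0] by (simp_all add: a_def)
    have "mcball c (a * r) = mcball c (\<alpha> * r)" if "c \<in> P" "r \<in> set rs" for c r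
    proof -
      have "d c p \<le> a * r \<longleftrightarrow> d c p \<le> \<alpha> * r" if p: "p \<in> P" for p
      proof (cases "r = 0")
        case False
        then have r: "0 < r" using assms(3) \<open>r \<in> set rs\<close> by (metis order_le_less)
        have "(c, p, r) \<in> P \<times> P \<times> set rs" using p \<open>c \<in> P\<close> \<open>r \<in> set rs\<close> by simp
        then have "(\<lambda>(p, q, r). d p q / r) (c, p, r) \<in> A" unfolding A_def by blast
        then have "d c p / r \<le> a" if "d c p / r \<le> \<alpha>"
          unfolding a_def using S(1) that by (intro Max_ge) (auto simp: S_def)
        moreover have "a * r \<le> \<alpha> * r" using a(1) r by (simp add: S_def)
        ultimately show ?thesis using r by (auto simp: pos_divide_le_eq intro: order_trans)
      qed simp
      then show ?thesis by (auto simp: mcball_def)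
    qed
    note * = this
    have "placed_balls P d rs cs a = placed_balls P d rs cs \<alpha>"
    proof -
      have "mcball c (a * rs ! i) = mcball c (\<alpha> * rs ! i)" if "i < length rs" "c \<in> set (cs ! i)" for i c
      proof -
        have "length cs = length rs" using \<alpha>(2) assms(4) by (auto simp: placement_def)
        then have "set (cs ! i) \<subseteq> P" using \<alpha>(2) that(1) by (simp add: placement_def)
        then show ?thesis using * that by auto
      qed
      then show ?thesis unfolding placed_balls_def by (intro Collect_cong) (rule iffI; blast)
    qed
    then have "feasible P d rs ks cs a" using f a(2) by (simp add: feasible_def)
    then show ?thesis using a(1) by (auto simp: S_def)
  qed
  define F where "F = {a \<in> A. \<exists>cs. feasible P d rs ks cs a}"
  have F: "finite F" "F \<noteq> {}" using finA round[OF assms(5)] by (auto simp: F_def)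
  then have "Min F \<in> F" by simp
  then obtain cs where "feasible P d rs ks cs (Min F)" by (auto simp: F_def)
  moreover have "Min F \<le> \<alpha>'" if f: "feasible P d rs ks cs' \<alpha>'" for cs' \<alpha>'
  proof -
    obtain a where "a \<in> A" "a \<le> \<alpha>'" "feasible P d rs ks cs' a" using round[OF f] by blast
    moreover from this have "Min F \<le> a" using F(1) by (intro Min_le) (auto simp: F_def)
    ultimately show ?thesis by simp
  qed
  ultimately show ?thesis unfolding optimal_def by blast
qed

text \<open>Two points of a ball of radius \<open>\<beta> * R\<close> are at most
  \<open>2 * \<beta> * R\<close> apart; this is the origin of the factor in the three separation
  conditions.\<close>

locale layered_metric = layered P cl item lev bud I C Q N K G + Metric_space P d
  for P :: "'a set" and cl item lev bud I C Q N K G and d :: "'a \<Rightarrow> 'a \<Rightarrow> real" +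
  fixes R0 \<beta> :: real and Rl :: "nat \<Rightarrow> real"
  assumes \<beta>: "1 \<le> \<beta>" and Rl_pos: "\<And>l. 0 < Rl l" and R0_pos: "0 < R0"
    and Rl_mono: "\<And>l l'. l \<le> l' \<Longrightarrow> Rl l \<le> Rl l'"
    and near_item: "\<And>p q. p \<in> P \<Longrightarrow> q \<in> P \<Longrightarrow> item (cl p) = item (cl q) \<Longrightarrow> d p q \<le> R0"
    and far_item: "\<And>p q. p \<in> P \<Longrightarrow> q \<in> P \<Longrightarrow> item (cl p) \<noteq> item (cl q) \<Longrightarrow> 2 * \<beta> * R0 < d p q"
    and near_cluster: "\<And>p q. p \<in> P \<Longrightarrow> q \<in> P \<Longrightarrow> cl p = cl q \<Longrightarrow> d p q \<le> Rl (lev (cl p))"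
    and far_cluster: "\<And>p q l. p \<in> P \<Longrightarrow> q \<in> P \<Longrightarrow> cl p \<noteq> cl q \<Longrightarrow> l < 2 * C \<Longrightarrow> 2 * \<beta> * Rl l < d p q"
    and far_point: "\<And>p q l. p \<in> P \<Longrightarrow> q \<in> P \<Longrightarrow> cl p = cl q \<Longrightarrow> p \<noteq> q \<Longrightarrow> l < lev (cl p) \<Longrightarrow> 2 * \<beta> * Rl l < d p q"
begin

definition rs :: "real list" where "rs = R0 # map (\<lambda>i. Rl (2 * C - Suc i)) [0..<2 * C]"

lemma length_rs [simp]: "length rs = 2 * C + 1" by (simp add: rs_def)

lemma rs_0 [simp]: "rs ! 0 = R0" by (simp add: rs_def)

lemma rs_level: "l < 2 * C \<Longrightarrow> rs ! (2 * C - l) = Rl l"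
proof -
  assume l: "l < 2 * C"
  then have "2 * C - l = Suc (2 * C - Suc l)" by simp
  then show ?thesis using l by (simp add: rs_def)
qed

lemma rs_nonneg: "\<forall>r\<in>set rs. 0 \<le> r" using R0_pos Rl_pos by (auto simp: rs_def less_imp_le)

text \<open>Shrunken distances and a larger dilation are interchangeable, only their product counts.
  With \<open>\<gamma> = \<beta>\<close> and a dilation up to \<open>1\<close> this covers
  perturbations, with \<open>\<gamma> = 1\<close> and a dilation up to \<open>\<beta>\<close> it
  covers approximate placements.\<close>

lemma feasible_structure:
  assumes d1: "Metric_space P d1" and le: "\<And>p q. p \<in> P \<Longrightarrow> q \<in> P \<Longrightarrow> d p q \<le> \<gamma> * d1 p q"
    and f: "feasible P d1 rs ks cs \<alpha>" and \<gamma>: "0 \<le> \<gamma>" "\<gamma> * \<alpha> \<le> \<beta>"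
  defines "U \<equiv> {..<I} - (\<lambda>c. item (cl c)) ` set (cs ! 0)"
  shows "valid U" "placed_balls P d1 rs cs \<alpha> = clustering U"
proof -
  interpret d1: Metric_space P d1 by (rule d1)
  have \<alpha>: "0 \<le> \<alpha>" and len: "map length cs = ks" and ctr: "\<And>c. c \<in> set cs \<Longrightarrow> set c \<subseteq> P"
    using f by (auto simp: feasible_def placement_def)
  have lcs: "length cs = 2 * C + 1" using len length_ks by (metis length_map)
  have ctrP: "c \<in> P" if "i \<le> 2 * C" "c \<in> set (cs ! i)" for i c
    using ctr[of "cs ! i"] that lcs by auto
  define Bl where "Bl i c = d1.mcball c (\<alpha> * rs ! i)" for i c
  have rpos: "0 < rs ! i" if "i \<le> 2 * C" for i
    using that R0_pos Rl_pos by (cases i) (auto simp: rs_def)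
  have pb: "placed_balls P d1 rs cs \<alpha> = {Bl i c | i c. i \<le> 2 * C \<and> c \<in> set (cs ! i)}"
    by (auto simp: placed_balls_def Bl_def less_Suc_eq_le)
  have close: "d p q \<le> 2 * \<beta> * rs ! i" if "i \<le> 2 * C" "c \<in> set (cs ! i)" "p \<in> Bl i c" "q \<in> Bl i c" for i c p q
  proof -
    have p: "p \<in> P" "q \<in> P" "c \<in> P" "d1 c p \<le> \<alpha> * rs ! i" "d1 c q \<le> \<alpha> * rs ! i"
      using that by (auto simp: Bl_def d1.in_mcball)
    then have "d1 p q \<le> 2 * (\<alpha> * rs ! i)" using d1.triangle[of p c q] d1.commute[of p c] by simp
    then have "d p q \<le> \<gamma> * (2 * (\<alpha> * rs ! i))"
      using le[OF p(1,2)] \<gamma>(1) by (meson mult_left_mono order_trans)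
    also have "\<dots> = (\<gamma> * \<alpha>) * (2 * rs ! i)" by simp
    also have "\<dots> \<le> \<beta> * (2 * rs ! i)" using \<gamma>(2) rpos[OF that(1)] by (intro mult_right_mono) auto
    finally show ?thesis by simp
  qed
  have inP: "p \<in> P" if "p \<in> Bl i c" for p i c using that by (auto simp: Bl_def)
  have B1: "\<And>i c. i \<le> 2 * C \<Longrightarrow> c \<in> set (cs ! i) \<Longrightarrow> c \<in> Bl i c \<and> Bl i c \<subseteq> P"
  proof -
    fix i c assume i: "i \<le> 2 * C" and c: "c \<in> set (cs ! i)"
    have "0 \<le> \<alpha> * rs ! i" using \<alpha> rpos[OF i] by simp
    then show "c \<in> Bl i c \<and> Bl i c \<subseteq> P"
      using ctrP[OF i c] unfolding Bl_def by (auto simp: d1.in_mcball)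
  qed
  have B2: "P \<subseteq> \<Union> {Bl i c | i c. i \<le> 2 * C \<and> c \<in> set (cs ! i)}"
    using f pb by (simp add: feasible_def)
  have S0: "item (cl p) = item (cl q)" if c: "c \<in> set (cs ! 0)" "p \<in> Bl 0 c" "q \<in> Bl 0 c" for c p q
  proof (rule ccontr)
    assume ne: "item (cl p) \<noteq> item (cl q)"
    have "d p q \<le> 2 * \<beta> * R0" using close[of 0, OF _ c] by simp
    then show False using far_item[OF inP[OF c(2)] inP[OF c(3)] ne] by simp
  qed
  have lvl: "\<exists>l<2 * C. i = 2 * C - l" if "0 < i" "i \<le> 2 * C" for i
    using that by (intro exI[of _ "2 * C - i"]) auto
  have S1: "cl p = cl q" if i: "0 < i" "i \<le> 2 * C" and c: "c \<in> set (cs ! i)" "p \<in> Bl i c" "q \<in> Bl i c" for i c p q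
  proof (rule ccontr)
    assume ne: "cl p \<noteq> cl q"
    obtain l where l: "l < 2 * C" "i = 2 * C - l" using lvl[OF i] by blast
    have "d p q \<le> 2 * \<beta> * Rl l" using close[OF i(2) c] rs_level[OF l(1)] l(2) by simp
    then show False using far_cluster[OF inP[OF c(2)] inP[OF c(3)] ne l(1)] by simp
  qed
  have S2: "lev (cl p) \<le> l" if l: "l < 2 * C" and c: "c \<in> set (cs ! (2 * C - l))"
      "p \<in> Bl (2 * C - l) c" "q \<in> Bl (2 * C - l) c" "p \<noteq> q" for l c p q
  proof (rule ccontr)
    assume "\<not> lev (cl p) \<le> l"
    then have "2 * \<beta> * Rl l < d p q"
      using far_point[OF inP[OF c(2)] inP[OF c(3)] _ c(4), of l] S1[of "2 * C - l" c p q] l c by simp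
    then show False using close[of "2 * C - l" c p q] c rs_level[OF l] by simp
  qed
  show "valid U" unfolding U_def using len ctr B1 B2 S0 S1 S2 by (rule covering_structure(1))
  show "placed_balls P d1 rs cs \<alpha> = clustering U" unfolding U_def pb
    using len ctr B1 B2 S0 S1 S2 by (rule covering_structure(2))
qed

text \<open>A perturbation never increases a distance, so dilation \<open>1\<close> stays feasible
  and the optimum of every perturbed instance is at most \<open>1\<close>.\<close>

lemma ex_feasible:
  assumes d1: "Metric_space P d1" and le: "\<And>p q. p \<in> P \<Longrightarrow> q \<in> P \<Longrightarrow> d1 p q \<le> d p q" and U: "valid U"
  shows "\<exists>cs. feasible P d1 rs ks cs 1"
proof -
  interpret d1: Metric_space P d1 by (rule d1)
  obtain cs where cs: "map length cs = ks" "\<forall>c\<in>set cs. set c \<subseteq> P"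
    "\<And>p. p \<in> P \<Longrightarrow> (\<exists>c\<in>set (cs ! 0). item (cl c) = item (cl p)) \<or>
       (\<exists>l<2 * C. lev (cl p) \<le> l \<and> (\<exists>c\<in>set (cs ! (2 * C - l)). cl c = cl p))"
    using ex_placement[OF U] by blast
  have lcs: "length cs = 2 * C + 1" using cs(1) length_ks by (metis length_map)
  have ctrP: "c \<in> P" if "i \<le> 2 * C" "c \<in> set (cs ! i)" for i c
    using bspec[OF cs(2), of "cs ! i"] that lcs by auto
  have "p \<in> \<Union> (placed_balls P d1 rs cs 1)" if p: "p \<in> P" for p
  proof -
    have "\<exists>i\<le>2 * C. \<exists>c\<in>set (cs ! i). d c p \<le> rs ! i"
      using cs(3)[OF p]
    proof
      assume "\<exists>c\<in>set (cs ! 0). item (cl c) = item (cl p)"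
      then obtain c where c: "c \<in> set (cs ! 0)" "item (cl c) = item (cl p)" by blast
      have "d c p \<le> rs ! 0" using near_item[OF ctrP[OF _ c(1)] p c(2)] by simp
      then show ?thesis using c(1) by blast
    next
      assume "\<exists>l<2 * C. lev (cl p) \<le> l \<and> (\<exists>c\<in>set (cs ! (2 * C - l)). cl c = cl p)"
      then obtain l c where l: "l < 2 * C" "lev (cl p) \<le> l" "c \<in> set (cs ! (2 * C - l))" "cl c = cl p" by blast
      have "d c p \<le> Rl (lev (cl c))" using near_cluster[OF ctrP[OF _ l(3)] p l(4)] by simp
      also have "\<dots> \<le> rs ! (2 * C - l)" using l Rl_mono by (simp add: rs_level)
      finally show ?thesis using l(3) by (intro exI[of _ "2 * C - l"]) auto
    qed
    then obtain i c where ic: "i \<le> 2 * C" "c \<in> set (cs ! i)" "d c p \<le> rs ! i" by blast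
    have "d1 c p \<le> 1 * rs ! i" using le[OF ctrP[OF ic(1,2)] p] ic(3) by simp
    then have "p \<in> d1.mcball c (1 * rs ! i)" using ctrP[OF ic(1,2)] p by (simp add: d1.in_mcball)
    moreover have "i < length rs" using ic(1) by simp
    ultimately show ?thesis unfolding placed_balls_def using ic(2) by blast
  qed
  moreover have "\<Union> (placed_balls P d1 rs cs 1) \<subseteq> P" by (auto simp: placed_balls_def d1.in_mcball)
  ultimately show ?thesis using cs(1,2) by (intro exI[of _ cs]) (auto simp: feasible_def placement_def)
qed

lemma optimal_clusterings_eq:
  assumes U: "\<And>U'. valid U' \<longleftrightarrow> U' = U" and d1: "metric_perturbation \<beta> P d d1"
  shows "optimal_clusterings P d1 rs ks = {clustering U}"
proof -
  have M: "Metric_space P d1" and le: "\<And>p q. p \<in> P \<Longrightarrow> q \<in> P \<Longrightarrow> d1 p q \<le> d p q"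
    and ge: "\<And>p q. p \<in> P \<Longrightarrow> q \<in> P \<Longrightarrow> d p q \<le> \<beta> * d1 p q"
    using d1 \<beta> by (auto simp: metric_perturbation_def pos_divide_le_eq mult.commute)
  have vU: "valid U" using U by blast
  obtain cs0 where cs0: "feasible P d1 rs ks cs0 1" using ex_feasible[OF M le vU] by blast
  have ind: "induced_clustering P d1 rs ks cs \<alpha> \<D> \<longleftrightarrow> \<D> = clustering U" if "optimal P d1 rs ks cs \<alpha>" for cs \<alpha> \<D>
  proof -
    have f: "feasible P d1 rs ks cs \<alpha>" and "\<alpha> \<le> 1" using that cs0 by (auto simp: optimal_def)
    have pb: "placed_balls P d1 rs cs \<alpha> = clustering U"
    proof -
      have *: "0 \<le> \<beta>" "\<beta> * \<alpha> \<le> \<beta>" using \<beta> \<open>\<alpha> \<le> 1\<close> mult_left_mono[of \<alpha> 1 \<beta>] by simp_all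
      show ?thesis
        using feasible_structure[OF M ge f *] U by metis
    qed
    have VU: "U \<subseteq> {..<I}" "card U = N" using vU by (auto simp: valid_def)
    show ?thesis
    proof
      assume "\<D> = clustering U"
      then show "induced_clustering P d1 rs ks cs \<alpha> \<D>"
        unfolding induced_clustering_def pb
        using partition_clustering[OF VU(1)] card_clustering[OF VU] by blast
    next
      assume "induced_clustering P d1 rs ks cs \<alpha> \<D>"
      then show "\<D> = clustering U"
        unfolding induced_clustering_def pb by (intro clustering_unique[OF _ _ _ vU]) auto
    qed
  qed
  obtain cs \<alpha> where "optimal P d1 rs ks cs \<alpha>"
    using ex_optimal[OF finP M rs_nonneg _ cs0] by auto
  then have "(\<exists>cs \<alpha>. optimal P d1 rs ks cs \<alpha> \<and> induced_clustering P d1 rs ks cs \<alpha> \<D>) \<longleftrightarrow> \<D> = clustering U" for \<D>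
    using ind by metis
  then show ?thesis unfolding optimal_clusterings_def by auto
qed

lemma perturbation_resilient:
  assumes U: "\<And>U'. valid U' \<longleftrightarrow> U' = U"
  shows "perturbation_resilient \<beta> P d rs ks"
proof -
  have "metric_perturbation \<beta> P d d"
  proof -
    have "d p q / \<beta> \<le> d p q" for p q
      using \<beta> mult_left_mono[OF \<beta>, of "d p q"] by (simp add: pos_divide_le_eq)
    then show ?thesis using Metric_space_axioms by (simp add: metric_perturbation_def)
  qed
  then show ?thesis
    unfolding perturbation_resilient_def using optimal_clusterings_eq[OF U] by blast
qed

text \<open>The optimum is at most \<open>1\<close>, so the dilation of the placement is at most
  \<open>\<beta>\<close>, still below the separation of the scales. The items without a large ball
  are then the solution.\<close>

lemma approximate_placement:
  assumes U: "\<And>U'. valid U' \<longleftrightarrow> U' = U" and f: "feasible P d rs ks cs \<alpha>"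
    and opt: "\<And>cs0 \<alpha>0. optimal P d rs ks cs0 \<alpha>0 \<Longrightarrow> \<alpha> \<le> \<beta> * \<alpha>0"
  shows "U = {..<I} - (\<lambda>c. item (cl c)) ` set (cs ! 0)"
proof -
  obtain cs0 where cs0: "feasible P d rs ks cs0 1"
  proof -
    have "valid U" using U by blast
    from ex_feasible[OF Metric_space_axioms order_refl this] that show thesis by blast
  qed
  obtain cs1 \<alpha>1 where o: "optimal P d rs ks cs1 \<alpha>1"
    using ex_optimal[OF finP Metric_space_axioms rs_nonneg _ cs0] by auto
  then have "\<alpha>1 \<le> 1" using cs0 by (auto simp: optimal_def)
  then have "\<beta> * \<alpha>1 \<le> \<beta> * 1" using \<beta> by (intro mult_left_mono) auto
  then have "\<alpha> \<le> \<beta>" using opt[OF o] by simp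
  then show ?thesis
    using feasible_structure(1)[OF Metric_space_axioms _ f, of 1] U by simp
qed

end

section \<open>Isolation by random weights\<close>

definition ones_of :: "bool list \<Rightarrow> nat" where "ones_of b = length (filter id b)"

lemma ones_of_simps [simp]: "ones_of [] = 0" "ones_of (x # b) = (if x then 1 else 0) + ones_of b"
  by (simp_all add: ones_of_def)

lemma finite_bits [simp]: "finite {b :: bool list. length b = n}"
  using finite_lists_length_eq[of "UNIV :: bool set" n] by simp

lemma card_bits: "card {b :: bool list. length b = n} = 2 ^ n"
  using card_lists_length_eq[of "UNIV :: bool set" n] by simp

lemma card_ones_of: "card {b. length b = n \<and> ones_of b = k} = n choose k"
proof (induction n arbitrary: k)
  case 0
  have "{b. length b = 0 \<and> ones_of b = k} = (if k = 0 then {[]} else {})" by auto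
  then show ?case by (cases k) auto
next
  case (Suc n)
  have e: "{b. length b = Suc n \<and> ones_of b = k} =
      (#) False ` {b. length b = n \<and> ones_of b = k} \<union> (#) True ` {b. length b = n \<and> Suc (ones_of b) = k}"
    by (auto simp: length_Suc_conv image_iff split: if_splits)
  have f: "finite {b :: bool list. length b = n \<and> P b}" for P by (rule finite_subset[OF _ finite_bits[of n]]) auto
  have "card {b. length b = Suc n \<and> ones_of b = k} =
      card {b. length b = n \<and> ones_of b = k} + card {b. length b = n \<and> Suc (ones_of b) = k}"
    unfolding e by (subst card_Un_disjoint) (auto simp: card_image f)
  then show ?case using Suc by (cases k) simp_all
qed

text \<open>Says that the central binomial coefficient is at most \<open>4 ^ n\<close> divided by
  the square root of \<open>2 * n + 1\<close>. In the induction step this comes down to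
  \<open>(2 * n + 1) * (2 * n + 3) \<le> 4 * (n + 1)\<^sup>2\<close>, with the exponent as in
  \<open>(n + 1) * (n + 1)\<close>.\<close>

lemma central_binomial_bound: "(2 * n choose n)\<^sup>2 * (2 * n + 1) \<le> 16 ^ n"
proof (induction n)
  case (Suc n)
  define x where "x = 2 * n choose n"
  define y where "y = 2 * Suc n choose Suc n"
  have "Suc n * y = 2 * (2 * n + 1) * x"
  proof -
    have 1: "Suc n * (Suc (2 * n + 1) choose Suc n) = Suc (2 * n + 1) * ((2 * n + 1) choose n)"
      by (rule Suc_times_binomial)
    have "(2 * n + 1) choose n = (2 * n + 1) choose Suc n"
      using binomial_symmetric[of n "2 * n + 1"] by simp
    moreover have "Suc n * (Suc (2 * n) choose Suc n) = Suc (2 * n) * (2 * n choose n)"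
      by (rule Suc_times_binomial)
    ultimately have 2: "Suc n * ((2 * n + 1) choose n) = (2 * n + 1) * x" by (simp add: x_def)
    have "Suc n * (Suc n * y) = Suc n * (2 * (2 * n + 1) * x)"
      using 1 2 by (simp add: y_def algebra_simps)
    then show ?thesis by (simp only: mult_cancel1) simp
  qed
  then have "(Suc n * y)\<^sup>2 = (2 * (2 * n + 1) * x)\<^sup>2" by simp
  then have e: "(Suc n)\<^sup>2 * y\<^sup>2 = 4 * (2 * n + 1)\<^sup>2 * x\<^sup>2" by (simp only: power_mult_distrib) simp
  have "(Suc n)\<^sup>2 * (y\<^sup>2 * (2 * Suc n + 1)) = ((Suc n)\<^sup>2 * y\<^sup>2) * (2 * n + 3)" by (simp add: algebra_simps)
  also have "\<dots> = 4 * (2 * n + 1) * (2 * n + 3) * (x\<^sup>2 * (2 * n + 1))"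
  proof -
    have "4 * z\<^sup>2 * w * v = 4 * z * v * (w * z)" for z w v :: nat by (simp add: power2_eq_square)
    then show ?thesis unfolding e by blast
  qed
  finally have "(Suc n)\<^sup>2 * (y\<^sup>2 * (2 * Suc n + 1)) = 4 * (2 * n + 1) * (2 * n + 3) * (x\<^sup>2 * (2 * n + 1))" .
  also have "\<dots> \<le> 4 * (2 * n + 1) * (2 * n + 3) * 16 ^ n"
    using Suc by (intro mult_left_mono) (simp_all add: x_def)
  also have "\<dots> \<le> (16 * (Suc n)\<^sup>2) * 16 ^ n"
    by (intro mult_right_mono) (simp_all add: power2_eq_square algebra_simps)
  also have "\<dots> = (Suc n)\<^sup>2 * 16 ^ Suc n" by (simp only: power_Suc mult_ac)
  finally have "y\<^sup>2 * (2 * Suc n + 1) \<le> 16 ^ Suc n" by (simp only: mult_le_cancel1) simp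
  then show ?case by (simp only: y_def)
qed simp

text \<open>Chosen such that no number of ones in a block of random bits has probability above
  \<open>1 / (2 * m)\<close>: with \<open>h = 2 * m * m + 1\<close> one has
  \<open>2 * h + 1 \<ge> (2 * m) * (2 * m)\<close> in the bound for the central coefficient.\<close>

definition block_size :: "nat \<Rightarrow> nat" where "block_size m = 2 * (2 * m\<^sup>2 + 1)"

lemma block_size_bound: "2 * m * (block_size m choose k) \<le> 2 ^ block_size m"
proof -
  define h where "h = 2 * m\<^sup>2 + 1"
  define B where "B = 2 * h choose h"
  have 1: "(2 * h choose k) \<le> B" unfolding B_def using binomial_maximum'[of h k] by simp
  have 2: "(2 * m * B)\<^sup>2 \<le> B\<^sup>2 * (2 * h + 1)" by (simp add: h_def power2_eq_square algebra_simps)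
  have "4 * h = 2 * h * 2" by simp
  then have "(2 :: nat) ^ (4 * h) = (2 ^ (2 * h))\<^sup>2" by (simp only: power_mult)
  then have 3: "(16 :: nat) ^ h = (2 ^ (2 * h))\<^sup>2" by (simp only: power_mult[of 2 4]) simp
  have "(2 * m * B)\<^sup>2 \<le> (2 ^ (2 * h))\<^sup>2"
    using le_trans[OF 2] central_binomial_bound[of h] unfolding B_def 3 by blast
  then have "2 * m * B \<le> 2 ^ (2 * h)" by (rule power2_le_imp_le) simp
  with 1 show ?thesis
    unfolding block_size_def h_def[symmetric] by (meson le_trans mult_le_mono2)
qed

text \<open>The random weight of position \<open>j\<close>. Being a count of ones it is not uniform,
  as in the usual isolation argument, but binomially distributed; it suffices that no single value
  is too likely.\<close>

definition block :: "nat \<Rightarrow> bool list \<Rightarrow> nat \<Rightarrow> nat" where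
  "block Q r j = card {q. q < Q \<and> r ! (j * Q + q)}"

definition weight :: "nat \<Rightarrow> bool list \<Rightarrow> bool list \<Rightarrow> nat" where
  "weight Q r u = (\<Sum>j<length u. if u ! j then block Q r j else 0)"

lemma block_le: "block Q r j \<le> Q"
proof -
  have "block Q r j \<le> card {..<Q}" unfolding block_def by (intro card_mono) auto
  then show ?thesis by simp
qed

lemma weight_le: "weight Q r u \<le> length u * Q"
proof -
  have "weight Q r u \<le> (\<Sum>j<length u. Q)" unfolding weight_def by (intro sum_mono) (auto simp: block_le)
  then show ?thesis by simp
qed

lemma ones_of_nth: "ones_of b = card {q. q < length b \<and> b ! q}"
  by (simp add: ones_of_def length_filter_conv_card)

lemma block_append:
  assumes "length a = j * Q" "length b = Q"
  shows "block Q (a @ b @ c) j = ones_of b"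
    "length b' = Q \<Longrightarrow> i \<noteq> j \<Longrightarrow> block Q (a @ b @ c) i = block Q (a @ b' @ c) i"
proof -
  have "block Q (a @ b @ c) j = card {q. q < length b \<and> b ! q}"
    unfolding block_def by (rule arg_cong[of _ _ card]) (use assms in \<open>auto simp: nth_append\<close>)
  then show "block Q (a @ b @ c) j = ones_of b" by (simp add: ones_of_nth)
  assume "length b' = Q" "i \<noteq> j"
  have "(a @ b @ c) ! (i * Q + q) = (a @ b' @ c) ! (i * Q + q)" if q: "q < Q" for q
  proof (cases "i < j")
    case True
    then have "i * Q + q < j * Q" using q mult_le_mono1[of "Suc i" j Q] by simp
    then show ?thesis using assms by (simp add: nth_append)
  next
    case False
    then have "j * Q + Q \<le> i * Q + q" using \<open>i \<noteq> j\<close> mult_le_mono1[of "Suc j" i Q] by simp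
    then have "\<not> i * Q + q < j * Q" "\<not> i * Q + q - j * Q < Q" by linarith+
    then show ?thesis using assms \<open>length b' = Q\<close> by (simp add: nth_append)
  qed
  then show "block Q (a @ b @ c) i = block Q (a @ b' @ c) i"
    unfolding block_def by (intro arg_cong[of _ _ card]) auto
qed

text \<open>A string is bad for \<open>j\<close> if lightest elements of \<open>S\<close> disagree
  at \<open>j\<close>. Once the bits outside block \<open>j\<close> are fixed, such a tie occurs for
  only one value of the weight of position \<open>j\<close>, and at most \<open>B\<close> fillings
  of the block have that value.\<close>

lemma card_bad:
  assumes S: "\<And>u. u \<in> S \<Longrightarrow> length u = m" and j: "j < m" and B: "\<And>k. (Q choose k) \<le> B"
  shows "card {r. length r = m * Q \<and> (\<exists>u\<in>S. \<exists>u'\<in>S. u ! j \<and> \<not> u' ! j \<and>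
     (\<forall>v\<in>S. weight Q r u \<le> weight Q r v \<and> weight Q r u' \<le> weight Q r v))} \<le> 2 ^ ((m - 1) * Q) * B" (is "card ?Bad \<le> _")
proof -
  define X where "X = {a :: bool list. length a = j * Q} \<times> {c :: bool list. length c = (m - 1 - j) * Q}"
  define r0 where "r0 x = fst x @ replicate Q False @ snd x" for x :: "bool list \<times> bool list"
  \<comment> \<open>The only weight of position \<open>j\<close> that makes the lightest elements
    with \<open>j\<close> and those without \<open>j\<close> equally heavy, computed with block
    \<open>j\<close> set to zero. In case of a tie the difference is not negative, so subtraction on
    \<open>nat\<close> is exact.\<close>
  define \<theta> where "\<theta> x = (LEAST w. \<exists>u\<in>S. \<not> u ! j \<and> weight Q (r0 x) u = w) -
      (LEAST w. \<exists>u\<in>S. u ! j \<and> weight Q (r0 x) u = w)" for x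
  define T where "T x = (\<lambda>b. fst x @ b @ snd x) ` {b. length b = Q \<and> ones_of b = \<theta> x}" for x
  have fin: "finite {b :: bool list. length b = Q \<and> P b}" for P by (rule finite_subset[OF _ finite_bits[of Q]]) auto
  have "?Bad \<subseteq> (\<Union>x\<in>X. T x)"
  proof
    fix r assume "r \<in> ?Bad"
    then obtain u u' where r: "length r = m * Q" and u: "u \<in> S" "u' \<in> S" "u ! j" "\<not> u' ! j"
      and min: "\<And>v. v \<in> S \<Longrightarrow> weight Q r u \<le> weight Q r v" "\<And>v. v \<in> S \<Longrightarrow> weight Q r u' \<le> weight Q r v" by blast
    define a b c where "a = take (j * Q) r" and "b = take Q (drop (j * Q) r)" and "c = drop (j * Q + Q) r"
    have m: "m * Q = j * Q + (Q + (m - 1 - j) * Q)"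
    proof -
      have "m = j + (1 + (m - 1 - j))" using j by simp
      then show ?thesis by (metis add_mult_distrib mult_1)
    qed
    have rabc: "r = a @ b @ c"
      by (simp add: a_def b_def c_def add.commute flip: drop_drop)
    have len: "length a = j * Q" "length b = Q" "length c = (m - 1 - j) * Q"
      using r m by (simp_all add: a_def b_def c_def)
    have x: "(a, c) \<in> X" using len by (simp add: X_def)
    have w: "weight Q r v = weight Q (r0 (a, c)) v + (if v ! j then ones_of b else 0)" if "v \<in> S" for v
    proof -
      have lv: "length v = m" using S that by blast
      have 0: "block Q (r0 (a, c)) j = 0"
        using block_append(1)[OF len(1) length_replicate[of Q False]] by (simp add: r0_def ones_of_def)
      have w1: "weight Q r v = (if v ! j then block Q r j else 0) + (\<Sum>i\<in>{..<m} - {j}. if v ! i then block Q r i else 0)"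
        unfolding weight_def lv using j by (simp add: sum.remove)
      have w2: "weight Q (r0 (a, c)) v = (if v ! j then block Q (r0 (a, c)) j else 0) +
          (\<Sum>i\<in>{..<m} - {j}. if v ! i then block Q (r0 (a, c)) i else 0)"
        unfolding weight_def lv using j by (simp add: sum.remove)
      have w3: "block Q r i = block Q (r0 (a, c)) i" if "i \<noteq> j" for i
        unfolding rabc r0_def fst_conv snd_conv
        by (rule block_append(2)[OF len(1,2) length_replicate that])
      have w4: "block Q r j = ones_of b"
        unfolding rabc by (rule block_append(1)[OF len(1,2)])
      have w5: "(\<Sum>i\<in>{..<m} - {j}. if v ! i then block Q r i else 0) =
          (\<Sum>i\<in>{..<m} - {j}. if v ! i then block Q (r0 (a, c)) i else 0)"
        using w3 by (intro sum.cong) auto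
      show ?thesis unfolding w1 w2 w4 w5 0 by simp
    qed
    have 1: "(LEAST w. \<exists>u\<in>S. u ! j \<and> weight Q (r0 (a, c)) u = w) = weight Q (r0 (a, c)) u"
    proof (rule Least_equality)
      show "\<exists>v\<in>S. v ! j \<and> weight Q (r0 (a, c)) v = weight Q (r0 (a, c)) u" using u by blast
      fix y assume "\<exists>v\<in>S. v ! j \<and> weight Q (r0 (a, c)) v = y"
      then obtain v where "v \<in> S" "v ! j" "weight Q (r0 (a, c)) v = y" by blast
      then show "weight Q (r0 (a, c)) u \<le> y" using min(1)[of v] w[of v] w[OF u(1)] u(3) by simp
    qed
    have 2: "(LEAST w. \<exists>u\<in>S. \<not> u ! j \<and> weight Q (r0 (a, c)) u = w) = weight Q (r0 (a, c)) u'"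
    proof (rule Least_equality)
      show "\<exists>v\<in>S. \<not> v ! j \<and> weight Q (r0 (a, c)) v = weight Q (r0 (a, c)) u'" using u by blast
      fix y assume "\<exists>v\<in>S. \<not> v ! j \<and> weight Q (r0 (a, c)) v = y"
      then obtain v where "v \<in> S" "\<not> v ! j" "weight Q (r0 (a, c)) v = y" by blast
      then show "weight Q (r0 (a, c)) u' \<le> y" using min(2)[of v] w[of v] w[OF u(2)] u(4) by simp
    qed
    have "weight Q r u = weight Q r u'" using min(1)[OF u(2)] min(2)[OF u(1)] by simp
    then have "ones_of b = \<theta> (a, c)"
      unfolding \<theta>_def 1 2 using w[OF u(1)] w[OF u(2)] u(3,4) by simp
    then have "r \<in> T (a, c)" using rabc len by (auto simp: T_def)
    then show "r \<in> (\<Union>x\<in>X. T x)" using x by blast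
  qed
  moreover have finX: "finite X" by (simp add: X_def)
  moreover have "finite (T x)" for x using fin by (simp add: T_def)
  ultimately have "card ?Bad \<le> card (\<Union>x\<in>X. T x)" by (intro card_mono) auto
  also have "\<dots> \<le> (\<Sum>x\<in>X. card (T x))" by (rule card_UN_le[OF finX])
  also have "\<dots> \<le> (\<Sum>x\<in>X. B)"
  proof (rule sum_mono)
    fix x
    have "card (T x) \<le> card {b. length b = Q \<and> ones_of b = \<theta> x}" unfolding T_def by (rule card_image_le[OF fin])
    also have "\<dots> \<le> B" using B by (simp add: card_ones_of)
    finally show "card (T x) \<le> B" .
  qed
  also have "\<dots> = 2 ^ (j * Q) * 2 ^ ((m - 1 - j) * Q) * B"
    by (simp add: X_def card_cartesian_product card_bits)
  also have "\<dots> = 2 ^ ((m - 1) * Q) * B"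
  proof -
    have "j + (m - 1 - j) = m - 1" using j by simp
    then show ?thesis by (metis add_mult_distrib power_add)
  qed
  finally show ?thesis .
qed

text \<open>Each of the \<open>m\<close> positions is ambiguous with probability at most
  \<open>1 / (2 * m)\<close>; so with probability at least one half none is, and the lightest
  element of \<open>S\<close> is unique.\<close>

lemma isolation:
  assumes S: "\<And>u. u \<in> S \<Longrightarrow> length u = m" "S \<noteq> {}"
  defines "Q \<equiv> block_size m"
  shows "2 ^ (m * Q) \<le> 2 * card {r. length r = m * Q \<and> (\<exists>W\<le>m * Q. \<exists>u. {v \<in> S. weight Q r v \<le> W} = {u})}"
    (is "_ \<le> 2 * card ?Good")
proof -
  define Bad where "Bad j = {r. length r = m * Q \<and> (\<exists>u\<in>S. \<exists>u'\<in>S. u ! j \<and> \<not> u' ! j \<and>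
     (\<forall>v\<in>S. weight Q r u \<le> weight Q r v \<and> weight Q r u' \<le> weight Q r v))}" for j
  define R where "R = {r :: bool list. length r = m * Q}"
  define B where "B = (Q choose (Q div 2))"
  have B: "(Q choose k) \<le> B" for k unfolding B_def by (rule binomial_maximum)
  have "R \<subseteq> ?Good \<union> (\<Union>j<m. Bad j)"
  proof
    fix r assume r: "r \<in> R"
    \<comment> \<open>The least weight in \<open>S\<close>. If two elements attain it, they differ
      at some \<open>j\<close>, and the string is bad for this \<open>j\<close>.\<close>
    define W where "W = (LEAST w. \<exists>u\<in>S. weight Q r u = w)"
    obtain u0 where "u0 \<in> S" using S(2) by blast
    then have "\<exists>u\<in>S. weight Q r u = weight Q r u0" by blast
    then have "\<exists>u\<in>S. weight Q r u = W" unfolding W_def by (rule LeastI)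
    then obtain u where u: "u \<in> S" "weight Q r u = W" by blast
    have W: "W \<le> weight Q r v" if "v \<in> S" for v unfolding W_def by (rule Least_le) (use that in blast)
    have Wm: "W \<le> m * Q" using weight_le[of Q r u] S(1)[OF u(1)] u(2) by simp
    show "r \<in> ?Good \<union> (\<Union>j<m. Bad j)"
    proof (cases "{v \<in> S. weight Q r v \<le> W} = {u}")
      case True
      then show ?thesis using r Wm by (auto simp: R_def)
    next
      case False
      then obtain v where v: "v \<in> S" "weight Q r v \<le> W" "v \<noteq> u" using u by blast
      then have vW: "weight Q r v = W" using W by (simp add: le_antisym)
      have "length u = length v" using S(1) u v by simp
      then have "\<exists>j<length u. u ! j \<noteq> v ! j" using v(3) nth_equalityI[of v u] by auto
      then obtain j where j: "j < m" "u ! j \<noteq> v ! j" using S(1)[OF u(1)] by auto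
      have "r \<in> Bad j"
      proof -
        have mn: "weight Q r u \<le> weight Q r w \<and> weight Q r v \<le> weight Q r w" if "w \<in> S" for w
          using W[OF that] u(2) vW by simp
        then have "\<exists>x\<in>S. \<exists>y\<in>S. x ! j \<and> \<not> y ! j \<and> (\<forall>w\<in>S. weight Q r x \<le> weight Q r w \<and> weight Q r y \<le> weight Q r w)"
          using u(1) v(1) j(2) by (cases "u ! j") blast+
        then show ?thesis using r unfolding Bad_def R_def by simp
      qed
      then show ?thesis using j(1) by blast
    qed
  qed
  moreover have fin: "finite {r :: bool list. length r = m * Q \<and> P r}" for P
    by (rule finite_subset[OF _ finite_bits[of "m * Q"]]) auto
  ultimately have "card R \<le> card (?Good \<union> (\<Union>j<m. Bad j))"
    by (intro card_mono finite_UnI finite_UN_I) (auto simp: Bad_def)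
  also have "\<dots> \<le> card ?Good + card (\<Union>j<m. Bad j)" by (rule card_Un_le)
  also have "card (\<Union>j<m. Bad j) \<le> (\<Sum>j<m. card (Bad j))" by (rule card_UN_le) simp
  also have "\<dots> \<le> (\<Sum>j<m. 2 ^ ((m - 1) * Q) * B)"
    unfolding Bad_def by (intro sum_mono card_bad[OF S(1) _ B]) auto
  also have "\<dots> = m * (2 ^ ((m - 1) * Q) * B)" by simp
  finally have 1: "2 ^ (m * Q) \<le> card ?Good + m * (2 ^ ((m - 1) * Q) * B)" by (simp add: R_def card_bits)
  have 2: "2 * (m * (2 ^ ((m - 1) * Q) * B)) \<le> 2 ^ (m * Q)"
  proof (cases m)
    case (Suc m')
    have "2 * (m * (2 ^ ((m - 1) * Q) * B)) = 2 ^ ((m - 1) * Q) * (2 * m * B)" by simp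
    also have "\<dots> \<le> 2 ^ ((m - 1) * Q) * 2 ^ Q"
      unfolding B_def Q_def by (intro mult_left_mono block_size_bound) simp
    also have "\<dots> = 2 ^ (m * Q)" using Suc by (simp add: power_add[symmetric] add.commute)
    finally show ?thesis .
  qed simp
  from 1 2 show ?thesis by linarith
qed

section \<open>Computations as independent sets\<close>

text \<open>A cell option records the state and scanned symbols of the whole configuration together with the
  symbols and head positions of all tapes at one cell.\<close>

type_synonym cell_opt = "nat \<times> nat list \<times> nat list \<times> bool list"

text \<open>The last condition ties the recorded scan to the tape: a cell that claims the head of
  tape \<open>i\<close> shows the symbol scanned on it.\<close>

definition opts :: "tm \<Rightarrow> cell_opt set" where
  "opts M = {(q, ss, sy, hf). q \<le> tm_states M \<and> length ss = tm_tapes M \<and> set ss \<subseteq> {..<tm_symbols M} \<and>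
     length sy = tm_tapes M \<and> set sy \<subseteq> {..<tm_symbols M} \<and> length hf = tm_tapes M \<and>
     (\<forall>i<tm_tapes M. hf ! i \<longrightarrow> sy ! i = ss ! i)}"

lemma finite_opts: "finite (opts M)"
proof (rule finite_subset)
  show "opts M \<subseteq> {..tm_states M} \<times> {ss. set ss \<subseteq> {..<tm_symbols M} \<and> length ss = tm_tapes M} \<times>
      {ss. set ss \<subseteq> {..<tm_symbols M} \<and> length ss = tm_tapes M} \<times> {hf. set hf \<subseteq> UNIV \<and> length hf = tm_tapes M}"
    by (auto simp: opts_def)
  show "finite ({..tm_states M} \<times> {ss. set ss \<subseteq> {..<tm_symbols M} \<and> length ss = tm_tapes M} \<times>
      {ss. set ss \<subseteq> {..<tm_symbols M} \<and> length ss = tm_tapes M} \<times> {hf :: bool list. set hf \<subseteq> UNIV \<and> length hf = tm_tapes M})"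
    by (intro finite_cartesian_product finite_lists_length_eq) auto
qed

text \<open>A halted configuration is its own successor, so that runs of any length up to
  \<open>T\<close> fill a tableau with \<open>T + 1\<close> rows.\<close>

definition succ_state :: "tm \<Rightarrow> cell_opt \<Rightarrow> nat" where
  "succ_state M = (\<lambda>(q, ss, sy, hf). if tm_states M \<le> q then q else fst (tm_delta M q ss))"

definition action :: "tm \<Rightarrow> cell_opt \<Rightarrow> nat \<Rightarrow> nat \<times> int" where
  "action M = (\<lambda>(q, ss, sy, hf) i. if tm_states M \<le> q then (ss ! i, 0) else snd (tm_delta M q ss) ! i)"

definition bad_cell :: "tm \<Rightarrow> cell_opt \<Rightarrow> cell_opt \<Rightarrow> bool" where
  "bad_cell M o1 o2 \<longleftrightarrow> (case (o1, o2) of ((q, ss, sy, hf), (q', ss', sy', hf')) \<Rightarrow>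
     \<exists>i<tm_tapes M. sy' ! i \<noteq> (if hf ! i then fst (action M o1 i) else sy ! i))"

text \<open>A cell that carries the head of a tape determines the flags of this tape in the entire
  next row. The displacement \<open>z\<close> is therefore arbitrary; checking neighbours only would
  admit additional heads far away.\<close>

definition bad_move :: "tm \<Rightarrow> int \<Rightarrow> cell_opt \<Rightarrow> cell_opt \<Rightarrow> bool" where
  "bad_move M z o1 o2 \<longleftrightarrow> (case (o1, o2) of ((q, ss, sy, hf), (q', ss', sy', hf')) \<Rightarrow>
     \<exists>i<tm_tapes M. hf ! i \<and> hf' ! i \<noteq> (z = snd (action M o1 i)))"

definition bad_init :: "tm \<Rightarrow> bool \<Rightarrow> nat set \<Rightarrow> cell_opt \<Rightarrow> bool" where
  "bad_init M h X = (\<lambda>(q, ss, sy, hf). \<not> (q = 0 \<and> (\<forall>i<tm_tapes M. hf ! i = h) \<and>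
     (\<forall>i<tm_tapes M. 0 < i \<longrightarrow> sy ! i = 0) \<and> sy ! 0 \<in> X))"

definition bad_final :: "tm \<Rightarrow> cell_opt \<Rightarrow> bool" where
  "bad_final M = (\<lambda>(q, ss, sy, hf). sy ! (tm_tapes M - 1) \<noteq> 2)"

definition same_scan :: "cell_opt \<Rightarrow> cell_opt \<Rightarrow> bool" where
  "same_scan o1 o2 \<longleftrightarrow> fst o1 = fst o2 \<and> fst (snd o1) = fst (snd o2)"

definition true_cell :: "cell_opt \<Rightarrow> bool" where
  "true_cell = (\<lambda>(q, ss, sy, hf). sy ! 0 = 2)"

locale tableau =
  fixes M :: tm and pre :: "bool list" and m T :: nat
  assumes M: "turing_machine M"
begin

abbreviation "k \<equiv> tm_tapes M"

definition off :: nat where "off = T + 1"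
text \<open>Column \<open>c\<close> stands for tape cell \<open>c - off\<close>. Within
  \<open>T\<close> steps no head leaves the window, and it contains the whole input.\<close>

definition width :: nat where "width = 2 * T + length pre + m + 2"

definition input_syms :: "nat \<Rightarrow> nat set" where
  "input_syms c = (if c < off then {0} else if c - off < length pre then {bsym (pre ! (c - off))}
     else if c - off < length pre + m then {1, 2} else {0})"

definition forbidden :: "nat \<Rightarrow> nat \<Rightarrow> cell_opt \<Rightarrow> bool" where
  "forbidden t c ob \<longleftrightarrow> (t = 0 \<and> bad_init M (c = off) (input_syms c) ob) \<or> (t = T \<and> c = off \<and> bad_final M ob)"

text \<open>Conditions on a single cell are turned into conditions on pairs: a forbidden item is in
  conflict with every item.\<close>

definition conflict :: "nat \<times> nat \<times> cell_opt \<Rightarrow> nat \<times> nat \<times> cell_opt \<Rightarrow> bool" where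
  "conflict = (\<lambda>(t, c, o1) (t', c', o2). forbidden t c o1 \<or> forbidden t' c' o2 \<or>
     (t = t' \<and> c = c' \<and> o1 \<noteq> o2) \<or> (t = t' \<and> \<not> same_scan o1 o2) \<or>
     (t' = Suc t \<and> (fst o2 \<noteq> succ_state M o1 \<or> (c = c' \<and> bad_cell M o1 o2) \<or>
        bad_move M (int c' - int c) o1 o2)))"

definition items :: "(nat \<times> nat \<times> cell_opt) set" where
  "items = {..T} \<times> {..<width} \<times> opts M"

text \<open>Different options of the same cell are in conflict, so a set of this size contains
  exactly one option for each cell.\<close>

definition independent :: "(nat \<times> nat \<times> cell_opt) set \<Rightarrow> bool" where
  "independent U \<longleftrightarrow> U \<subseteq> items \<and> card U = Suc T * width \<and> (\<forall>x\<in>U. \<forall>y\<in>U. x \<noteq> y \<longrightarrow> \<not> conflict x y)"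

definition cell_at :: "bool list \<Rightarrow> nat \<Rightarrow> nat \<Rightarrow> cell_opt" where
  "cell_at u t c = (let (q, ts) = cfg M (pre @ u) t; z = int c - int off in
     (q, scans ts, map (\<lambda>tp. snd tp z) ts, map (\<lambda>tp. fst tp = z) ts))"

definition canonical :: "bool list \<Rightarrow> (nat \<times> nat \<times> cell_opt) set" where
  "canonical u = (\<lambda>(t, c). (t, c, cell_at u t c)) ` ({..T} \<times> {..<width})"

definition accepts :: "bool list \<Rightarrow> bool" where
  "accepts u \<longleftrightarrow> snd (snd (cfg M (pre @ u) T) ! (k - 1)) 0 = 2"

lemma k_pos: "0 < k" using M by (simp add: turing_machine_def)

context
  fixes u :: "bool list"
begin

abbreviation "y \<equiv> pre @ u"
abbreviation "q t \<equiv> fst (cfg M y t)"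
abbreviation "ts t \<equiv> snd (cfg M y t)"

lemma len_ts [simp]: "length (ts t) = k"
  using good_cfg[OF M, of y t] by (simp add: good_cfg_def)

lemma cell_at_eq: "cell_at u t c =
    (q t, scans (ts t), map (\<lambda>tp. snd tp (int c - int off)) (ts t), map (\<lambda>tp. fst tp = int c - int off) (ts t))"
  by (simp add: cell_at_def Let_def split: prod.splits)

lemma sym_less: "i < k \<Longrightarrow> snd (ts t ! i) z < tm_symbols M"
  using good_cfg[OF M, of y t] by (simp add: good_cfg_def)

lemma cell_at_opts: "cell_at u t c \<in> opts M"
  using good_cfg[OF M, of y t] sym_less[of _ t]
  by (auto simp: cell_at_eq opts_def good_cfg_def set_conv_nth nth_scans)

lemma succ_cfg:
  "q (Suc t) = succ_state M (cell_at u t c)"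
  "i < k \<Longrightarrow> ts (Suc t) ! i = upd_tape (ts t ! i) (action M (cell_at u t c) i)"
proof -
  note g = good_cfg[OF M, of y t]
  have "q (Suc t) = succ_state M (cell_at u t c) \<and>
    (i < k \<longrightarrow> ts (Suc t) ! i = upd_tape (ts t ! i) (action M (cell_at u t c) i))"
  proof (cases "tm_states M \<le> q t")
    case True
    then show ?thesis
      by (auto simp: cfg_Suc tm_step_halted succ_state_def action_def cell_at_eq nth_scans upd_tape_def prod_eq_iff)
  next
    case False
    then show ?thesis
      using tm_step_running[OF M g] by (auto simp: cfg_Suc succ_state_def action_def cell_at_eq)
  qed
  then show "q (Suc t) = succ_state M (cell_at u t c)"
    "i < k \<Longrightarrow> ts (Suc t) ! i = upd_tape (ts t ! i) (action M (cell_at u t c) i)" by auto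
qed

lemma head_range: "i < k \<Longrightarrow> t \<le> T \<Longrightarrow> \<exists>c<width. int c - int off = fst (ts t ! i)"
  using cfg_range[OF M, of i y t]
  by (intro exI[of _ "nat (fst (ts t ! i) + int off)"]) (auto simp: off_def width_def)

lemma ts_0: "i < k \<Longrightarrow> ts 0 ! i = (0, bit_tape (if i = 0 then y else []))"
  by (auto simp: cfg_0 nth_Cons split: nat.splits)

end

lemma input_sym: "length u = m \<Longrightarrow> bit_tape (pre @ u) (int c - int off) \<in> input_syms c"
proof -
  assume u: "length u = m"
  consider "c < off" | "off \<le> c" "c - off < length pre" | "off \<le> c" "length pre \<le> c - off" "c - off < length pre + m"
    | "off \<le> c" "length pre + m \<le> c - off" by linarith
  moreover have "nat (int c - int off) = c - off" by simp
  ultimately show ?thesis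
    using u by cases (auto simp: input_syms_def bit_tape_def bsym_def nth_append)
qed

lemma canonical_independent:
  assumes u: "length u = m" and acc: "accepts u"
  shows "independent (canonical u)"
proof -
  have inj: "inj_on (\<lambda>(t, c). (t, c, cell_at u t c)) ({..T} \<times> {..<width})" by (auto simp: inj_on_def)
  have nf: "\<not> forbidden t c (cell_at u t c)" for t c
  proof -
    have "\<not> bad_init M (c = off) (input_syms c) (cell_at u 0 c)"
      using input_sym[OF u, of c] k_pos
      by (auto simp: bad_init_def cell_at_eq cfg_0(1) ts_0 bit_tape_def)
    moreover have "\<not> bad_final M (cell_at u T off)"
      using acc k_pos by (simp add: bad_final_def cell_at_eq accepts_def)
    ultimately show ?thesis by (auto simp: forbidden_def)
  qed
  have "\<not> conflict (t, c, cell_at u t c) (t', c', cell_at u t' c')" for t c t' c'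
  proof -
    have 1: "\<not> bad_cell M (cell_at u t c) (cell_at u (Suc t) c)"
    proof -
      have "snd (ts u (Suc t) ! i) (int c - int off) = (if fst (ts u t ! i) = int c - int off
          then fst (action M (cell_at u t c) i) else snd (ts u t ! i) (int c - int off))" if "i < k" for i
        using succ_cfg(2)[OF that, of u t c] by (auto simp: upd_tape_def)
      then show ?thesis unfolding bad_cell_def
        by (auto simp: cell_at_eq[of _ _ c] simp del: split_paired_All split_paired_Ex)
    qed
    have 2: "\<not> bad_move M (int c' - int c) (cell_at u t c) (cell_at u (Suc t) c')"
    proof -
      have "(fst (ts u (Suc t) ! i) = int c' - int off) = (int c' - int c = snd (action M (cell_at u t c) i))"
        if "i < k" "fst (ts u t ! i) = int c - int off" for i
        using succ_cfg(2)[OF that(1), of u t c] that(2) by (auto simp: upd_tape_def)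
      then show ?thesis unfolding bad_move_def
        by (auto simp: cell_at_eq[of _ _ c] cell_at_eq[of _ _ c'])
    qed
    have 3: "same_scan (cell_at u t c) (cell_at u t c')" by (simp add: same_scan_def cell_at_eq)
    have 4: "fst (cell_at u (Suc t) c') = succ_state M (cell_at u t c)"
      using succ_cfg(1)[of u t c] by (simp add: cell_at_eq)
    show ?thesis using nf 1 2 3 4 by (auto simp: conflict_def)
  qed
  then show ?thesis
    using card_image[OF inj] cell_at_opts
    by (auto simp: independent_def canonical_def items_def)
qed

text \<open>The rows are forced one after another: the first by the forbidden items, up to the free
  input symbols, which are read as the witness \<open>u\<close>; each further row by the row before
  it.\<close>

lemma independent_canonical:
  assumes U: "independent U"
  shows "\<exists>u. length u = m \<and> accepts u \<and> U = canonical u"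
proof -
  have sub: "U \<subseteq> items" and card: "card U = Suc T * width"
    and nc: "\<And>x y. x \<in> U \<Longrightarrow> y \<in> U \<Longrightarrow> x \<noteq> y \<Longrightarrow> \<not> conflict x y"
    using U by (auto simp: independent_def)
  have finU: "finite U" using sub finite_subset[OF sub] by (simp add: items_def finite_opts)
  define slot :: "nat \<times> nat \<times> cell_opt \<Rightarrow> nat \<times> nat" where "slot x = (fst x, fst (snd x))" for x
  have inj: "inj_on slot U"
  proof (rule inj_onI, rule ccontr)
    fix x y assume "x \<in> U" "y \<in> U" "slot x = slot y" "x \<noteq> y"
    then show False using nc[of x y] by (cases x; cases y) (auto simp: conflict_def slot_def)
  qed
  have "slot ` U = {..T} \<times> {..<width}"
  proof (rule card_subset_eq)
    show "slot ` U \<subseteq> {..T} \<times> {..<width}" using sub by (auto simp: slot_def items_def)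
    show "card (slot ` U) = card ({..T} \<times> {..<width})" using card_image[OF inj] card by simp
  qed simp
  then have slot: "{..T} \<times> {..<width} \<subseteq> slot ` U" by simp
  define sel where "sel t c = (SOME ob. (t, c, ob) \<in> U)" for t c
  have sel: "(t, c, sel t c) \<in> U" if "t \<le> T" "c < width" for t c
  proof -
    have "(t, c) \<in> slot ` U" using slot that by auto
    then obtain x where "x \<in> U" "slot x = (t, c)" by auto
    then have "(t, c, snd (snd x)) \<in> U" by (simp add: slot_def prod_eq_iff) (metis prod.collapse)
    then have "\<exists>ob. (t, c, ob) \<in> U" by blast
    then show ?thesis unfolding sel_def by (rule someI_ex)
  qed
  have Usel: "U = (\<lambda>(t, c). (t, c, sel t c)) ` ({..T} \<times> {..<width})"
  proof (rule card_subset_eq[OF finU, symmetric])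
    show "(\<lambda>(t, c). (t, c, sel t c)) ` ({..T} \<times> {..<width}) \<subseteq> U" using sel by auto
    have "inj_on (\<lambda>(t, c). (t, c, sel t c)) ({..T} \<times> {..<width})" by (auto simp: inj_on_def)
    then show "card ((\<lambda>(t, c). (t, c, sel t c)) ` ({..T} \<times> {..<width})) = card U" using card by (simp add: card_image)
  qed
  \<comment> \<open>Two columns guarantee a second selected item, which a forbidden item would be in
    conflict with.\<close>
  have w2: "2 \<le> width" by (simp add: width_def)
  have nf: "\<not> forbidden t c (sel t c)" if tc: "t \<le> T" "c < width" for t c
  proof -
    define c' where "c' = (if c = 0 then 1 else 0 :: nat)"
    have "c' < width" "c \<noteq> c'" using w2 by (auto simp: c'_def)
    then have "\<not> conflict (t, c, sel t c) (t, c', sel t c')" using nc sel tc by auto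
    then show ?thesis by (simp add: conflict_def)
  qed
  have row: "same_scan (sel t c) (sel t c')" if "t \<le> T" "c < width" "c' < width" for t c c'
    using nc[OF sel[OF that(1,2)] sel[OF that(1,3)]] by (cases "c = c'") (auto simp: conflict_def same_scan_def)
  have nxt: "fst (sel (Suc t) c') = succ_state M (sel t c)" "c = c' \<Longrightarrow> \<not> bad_cell M (sel t c) (sel (Suc t) c')"
    "\<not> bad_move M (int c' - int c) (sel t c) (sel (Suc t) c')" if "Suc t \<le> T" "c < width" "c' < width" for t c c'
    using nc[OF sel[of t c] sel[of "Suc t" c']] that by (auto simp: conflict_def)
  have opt: "sel t c \<in> opts M" if "t \<le> T" "c < width" for t c using sel[OF that] sub by (auto simp: items_def)
  define u where "u = map (\<lambda>j. true_cell (sel 0 (off + length pre + j))) [0..<m]"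
  have len_u: "length u = m" by (simp add: u_def)
  \<comment> \<open>The recorded scan needs no check of its own. The head is inside the window, the
    option at its cell ties the scan to the symbol there, and \<open>same_scan\<close> spreads this
    to the whole row.\<close>
  have ext: "sel t c = cell_at u t c"
    if t: "t \<le> T" and c: "c < width" and fq: "\<And>c. c < width \<Longrightarrow> fst (sel t c) = q u t"
      and sy: "\<And>i c. i < k \<Longrightarrow> c < width \<Longrightarrow> fst (snd (snd (sel t c))) ! i = snd (ts u t ! i) (int c - int off)"
      and hf: "\<And>i c. i < k \<Longrightarrow> c < width \<Longrightarrow> snd (snd (snd (sel t c))) ! i = (fst (ts u t ! i) = int c - int off)"
    for t c
  proof -
    obtain q' ss' sy' hf' where s: "sel t c = (q', ss', sy', hf')" by (metis prod_cases4)
    have len: "length ss' = k" "length sy' = k" "length hf' = k" using opt[OF t c] by (auto simp: s opts_def)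
    have "ss' ! i = scans (ts u t) ! i" if i: "i < k" for i
    proof -
      obtain c0 where c0: "c0 < width" "int c0 - int off = fst (ts u t ! i)" using head_range[OF i t] by blast
      obtain q0 ss0 sy0 hf0 where s0: "sel t c0 = (q0, ss0, sy0, hf0)" by (metis prod_cases4)
      have "hf0 ! i" using hf[OF i c0(1)] c0(2) by (simp add: s0)
      then have "sy0 ! i = ss0 ! i" using opt[OF t c0(1)] i by (auto simp: s0 opts_def)
      moreover have "ss0 = ss'" using row[OF t c c0(1)] by (simp add: same_scan_def s s0)
      ultimately show ?thesis using sy[OF i c0(1)] c0(2) i by (simp add: s0 nth_scans)
    qed
    then have "ss' = scans (ts u t)" using len by (intro nth_equalityI) auto
    moreover have "sy' = map (\<lambda>tp. snd tp (int c - int off)) (ts u t)"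
      using sy[OF _ c] len by (intro nth_equalityI) (auto simp: s)
    moreover have "hf' = map (\<lambda>tp. fst tp = int c - int off) (ts u t)"
      using hf[OF _ c] len by (intro nth_equalityI) (auto simp: s)
    moreover have "q' = q u t" using fq[OF c] by (simp add: s)
    ultimately show ?thesis by (simp add: s cell_at_eq)
  qed
  have sel_eq: "\<forall>c<width. sel t c = cell_at u t c" if "t \<le> T" for t
    using that
  proof (induction t)
    case 0
    have init: "\<not> bad_init M (c = off) (input_syms c) (sel 0 c)" if "c < width" for c
      using nf[OF _ that, of 0] by (simp add: forbidden_def)
    have first_sym: "fst (snd (snd (sel 0 c))) ! 0 = bit_tape (pre @ u) (int c - int off)" if c: "c < width" for c
    proof -
      obtain q' ss' sy' hf' where s: "sel 0 c = (q', ss', sy', hf')" by (metis prod_cases4)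
      have i: "sy' ! 0 \<in> input_syms c" using init[OF c] by (auto simp: bad_init_def s)
      have n: "nat (int c - int off) = c - off" by simp
      consider "c < off" | "off \<le> c" "c - off < length pre" | "off \<le> c" "length pre \<le> c - off" "c - off < length pre + m"
        | "off \<le> c" "length pre + m \<le> c - off" by linarith
      then show ?thesis
      proof cases
        case 3
        define j where "j = c - off - length pre"
        have j: "j < m" "c = off + length pre + j" using 3 by (auto simp: j_def)
        have "u ! j = (sy' ! 0 = 2)" using j s by (simp add: u_def true_cell_def)
        moreover have "bit_tape (pre @ u) (int c - int off) = bsym (u ! j)"
          using j len_u by (simp add: bit_tape_def nth_append bsym_def nat_add_distrib)
        ultimately show ?thesis using i 3 by (auto simp: s input_syms_def bsym_def)
      qed (use i len_u n in \<open>auto simp: s input_syms_def bit_tape_def bsym_def nth_append\<close>)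
    qed
    have "sel 0 c = cell_at u 0 c" if c: "c < width" for c
    proof (rule ext[OF _ c])
      fix i c assume i: "i < k" and c: "c < width"
      obtain q' ss' sy' hf' where s: "sel 0 c = (q', ss', sy', hf')" by (metis prod_cases4)
      show "fst (snd (snd (sel 0 c))) ! i = snd (ts u 0 ! i) (int c - int off)"
        using init[OF c] first_sym[OF c] i by (cases "i = 0") (auto simp: ts_0 bad_init_def s bit_tape_def)
      show "snd (snd (snd (sel 0 c))) ! i = (fst (ts u 0 ! i) = int c - int off)"
        using init[OF c] i by (auto simp: ts_0 bad_init_def s)
    next
      fix c assume c: "c < width"
      show "fst (sel 0 c) = q u 0"
        using init[OF c] by (auto simp: bad_init_def cfg_0)
    qed simp
    then show ?case by blast
  next
    case (Suc t)
    then have IH: "\<And>c. c < width \<Longrightarrow> sel t c = cell_at u t c" by auto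
    have "sel (Suc t) c = cell_at u (Suc t) c" if c: "c < width" for c
    proof (rule ext[OF Suc.prems c])
      fix c assume c: "c < width"
      show "fst (sel (Suc t) c) = q u (Suc t)"
        using nxt(1)[OF Suc.prems c c] IH[OF c] succ_cfg(1)[of u t c] by simp
    next
      fix i c assume i: "i < k" and c: "c < width"
      obtain q' ss' sy' hf' where s: "sel (Suc t) c = (q', ss', sy', hf')" by (metis prod_cases4)
      have "\<not> bad_cell M (cell_at u t c) (sel (Suc t) c)" using nxt(2)[OF Suc.prems c c] IH[OF c] by simp
      then have "sy' ! i = (if fst (ts u t ! i) = int c - int off then fst (action M (cell_at u t c) i)
          else snd (ts u t ! i) (int c - int off))"
        using i by (auto simp: bad_cell_def cell_at_eq s)
      then show "fst (snd (snd (sel (Suc t) c))) ! i = snd (ts u (Suc t) ! i) (int c - int off)"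
        using succ_cfg(2)[OF i, of u t c] by (auto simp: s upd_tape_def)
      obtain c0 where c0: "c0 < width" "int c0 - int off = fst (ts u t ! i)"
        using head_range[OF i, of t u] Suc.prems by auto
      have "\<not> bad_move M (int c - int c0) (cell_at u t c0) (sel (Suc t) c)"
        using nxt(3)[OF Suc.prems c0(1) c] IH[OF c0(1)] by simp
      then have "hf' ! i = (int c - int c0 = snd (action M (cell_at u t c0) i))"
        using i c0(2) by (auto simp: bad_move_def cell_at_eq s)
      then show "snd (snd (snd (sel (Suc t) c))) ! i = (fst (ts u (Suc t) ! i) = int c - int off)"
        using succ_cfg(2)[OF i, of u t c0] c0(2) by (auto simp: s upd_tape_def)
    qed
    then show ?case by blast
  qed
  have "U = canonical u" unfolding Usel canonical_def using sel_eq by (intro image_cong) auto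
  moreover have "accepts u"
  proof -
    have off: "off < width" by (simp add: off_def width_def)
    have "\<not> bad_final M (cell_at u T off)" using nf[OF _ off, of T] sel_eq[of T] off by (simp add: forbidden_def)
    then show ?thesis using k_pos by (simp add: bad_final_def cell_at_eq accepts_def)
  qed
  ultimately show ?thesis using len_u by blast
qed

lemma true_cell_at:
  assumes "j < length u"
  shows "true_cell (cell_at u 0 (off + length pre + j)) = u ! j"
  using assms k_pos
  by (simp add: true_cell_def cell_at_eq ts_0 bit_tape_def nth_append nat_add_distrib)

end

section \<open>Packing problems as point sets on a line\<close>

fun val :: "bool list \<Rightarrow> nat" where
  "val [] = 0"
| "val (b # bs) = (if b then 1 else 0) + 2 * val bs"

lemma val_pos: "0 < val (bs @ [True])"
  by (induction bs) auto

lemma binary_digits_val: "binary_digits (val (bs @ [True])) = bs @ [True]"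
proof (induction bs)
  case Nil
  show ?case by (simp add: binary_digits.simps)
next
  case (Cons b bs)
  have "val ((b # bs) @ [True]) \<noteq> 0" using val_pos[of bs] by simp
  then show ?case using Cons by (subst binary_digits.simps) auto
qed

lemma val_append: "val (xs @ ys) = val xs + 2 ^ length xs * val ys"
  by (induction xs) (auto simp: algebra_simps)

lemma val_map: "val (map P [0..<n]) = (\<Sum>j | j < n \<and> P j. 2 ^ j)"
proof (induction n)
  case (Suc n)
  have "{j. j < Suc n \<and> P j} = {j. j < n \<and> P j} \<union> (if P n then {n} else {})" by (auto simp: less_Suc_eq)
  then show ?case using Suc by (auto simp: val_append)
qed simp

lemma enc_rat_of_nat: "enc_rat (of_nat a) = [False] @ enc_nat a @ [False] @ enc_nat 1"
proof -
  have "quotient_of (of_nat a) = (int a, 1)"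
    using quotient_of_int[of "int a"] by (simp add: Rat.of_int_def)
  then show ?thesis by (simp add: enc_rat_def enc_int_def)
qed

lemma length_delim: "length (delim bs) = 2 * length bs + 1"
  by (induction bs) (auto simp: delim_def)

lemma look_delim: "look (delim bs @ ys) (2 * e + 1) = bs ! e" if "e < length bs"
  using that
proof (induction bs arbitrary: e)
  case (Cons b bs)
  then show ?case by (cases e) (auto simp: delim_def look_def)
qed simp

text \<open>Of two different powers of two the larger is at least twice the smaller, so they differ
  by at least the smaller one.\<close>

lemma pow_diff:
  assumes "(a :: nat) \<noteq> b"
  shows "2 ^ e \<le> \<bar>2 ^ (e + a) - 2 ^ (e + b) :: real\<bar>"
proof -
  have *: "(2 :: real) ^ e \<le> 2 ^ (e + b) - 2 ^ (e + a)" if "a < b" for a b :: nat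
  proof -
    have "(2 :: real) ^ Suc a \<le> 2 ^ b" using that by (intro power_increasing) auto
    moreover have "(1 :: real) \<le> 2 ^ a" by simp
    ultimately have "(1 :: real) \<le> 2 ^ b - 2 ^ a" unfolding power_Suc by linarith
    then have "2 ^ e * 1 \<le> 2 ^ e * (2 ^ b - 2 ^ a :: real)" by (intro mult_left_mono) auto
    then show ?thesis by (simp add: power_add right_diff_distrib)
  qed
  from assms consider "a < b" | "b < a" by linarith
  then show ?thesis using *[of a b] *[of b a] by cases auto
qed

text \<open>The code of a point with the digits of its first coordinate as a parameter. Coordinates
  are too large for the unary numbers of the expressions, hence only their digits are ever
  computed.\<close>

definition enc_point :: "nat \<Rightarrow> bool list \<Rightarrow> bool list" where
  "enc_point D bs = enc_nat D @ ([False] @ delim bs @ [False] @ enc_nat 1) @ concat (replicate (D - 1) (enc_rat 0))"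

locale packing =
  fixes I C Q N gap D :: nat and mem :: "nat \<Rightarrow> nat \<Rightarrow> nat \<Rightarrow> bool" and bud :: "nat \<Rightarrow> nat"
  assumes pos: "0 < C" "0 < Q" "0 < N" "N \<le> I" "1 \<le> D"
    and bud: "\<And>c. c < C \<Longrightarrow> bud c \<le> N * Q"
begin

text \<open>Cluster \<open>(c * I + a) * Q + q\<close> is slot \<open>q\<close> of item
  \<open>a\<close> for constraint \<open>c\<close>, and point \<open>g * K + b\<close> is point
  \<open>b\<close> of cluster \<open>g\<close>.\<close>

definition G :: nat where "G = C * I * Q"
definition K :: nat where "K = C * N * Q + 1"
definition psize :: nat where "psize = G * K"
text \<open>Distance of consecutive scales in the exponent: \<open>K\<close> for the points of one
  cluster, \<open>gap\<close> for the factor \<open>\<beta> \<le> 2 ^ gap\<close>, and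
  \<open>3\<close> for the constants in the separation inequalities.\<close>

definition H :: nat where "H = K + 3 + gap"
definition item :: "nat \<Rightarrow> nat" where "item g = g div Q mod I"
definition lev :: "nat \<Rightarrow> nat" where
  "lev g = 2 * (g div Q div I) + (if mem (g div Q div I) (g div Q mod I) (g mod Q) then 1 else 0)"
definition E1 :: nat where "E1 = 2 * C * H + H"
definition E2 :: nat where "E2 = E1 + G + H"
text \<open>The power \<open>2 ^ E3\<close> is common to all coordinates. It moves no two points
  relative to each other, but gives all of them the same number of digits and so a fixed position
  for the item.\<close>

definition E3 :: nat where "E3 = E2 + I"

definition pbits :: "nat \<Rightarrow> bool list" where
  "pbits x = map (\<lambda>j. j = lev (x div K) * H + x mod K \<or> j = E1 + x div K \<or> j = E2 + item (x div K)) [0..<E3] @ [True]"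

definition coord :: "nat \<Rightarrow> nat" where "coord x = val (pbits x)"
definition pt :: "nat \<Rightarrow> rat list" where "pt x = of_nat (coord x) # replicate (D - 1) 0"
definition ps :: "rat list list" where "ps = map pt [0..<psize]"

text \<open>The exponents that distinguish the points of a cluster of level \<open>l\<close> lie
  between \<open>l * H\<close> and \<open>l * H + K\<close>: a ball of this radius covers the
  cluster, while all radii of lower levels are far below the distance of its points.\<close>

definition radius :: "nat \<Rightarrow> nat" where "radius l = l * H + K"
definition rads :: "rat list" where
  "rads = map (\<lambda>e. of_nat (2 ^ e)) ((E1 + G) # map (\<lambda>i. radius (2 * C - Suc i)) [0..<2 * C])"

definition quot :: "nat \<Rightarrow> nat" where "quot l = (if odd l then bud (l div 2) else N * Q - bud (l div 2))"
definition kss :: "nat list" where "kss = (I - N) # map (\<lambda>i. quot (2 * C - Suc i)) [0..<2 * C]"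

definition solution :: "nat set \<Rightarrow> bool" where
  "solution U \<longleftrightarrow> U \<subseteq> {..<I} \<and> card U = N \<and>
     (\<forall>c<C. card {x \<in> U \<times> {..<Q}. mem c (fst x) (snd x)} \<le> bud c)"

lemma I_pos: "0 < I" using pos by simp

lemma D_pos: "1 \<le> D" by (rule pos)

lemma lev_div: "lev g div 2 = g div Q div I" by (simp add: lev_def)

lemma lev_less: "g < G \<Longrightarrow> lev g < 2 * C"
proof -
  assume "g < G"
  then have "g div Q div I < C" using pos I_pos by (simp add: G_def div_less_iff_less_mult mult_ac)
  then show ?thesis by (auto simp: lev_def)
qed

lemma item_less: "item g < I" using I_pos by (simp add: item_def)

lemma K_pos: "0 < K" by (simp add: K_def)

lemma low_less: "g < G \<Longrightarrow> lev g * H + x mod K < 2 * C * H"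
proof -
  assume "g < G"
  then have "Suc (lev g) * H \<le> 2 * C * H" using lev_less by (intro mult_le_mono1) (simp add: Suc_le_eq)
  moreover have "x mod K < K" using K_pos by simp
  then have "x mod K < H" by (simp add: H_def)
  ultimately show ?thesis by simp
qed

lemma div_less: "x < psize \<Longrightarrow> x div K < G"
  using K_pos by (simp add: psize_def div_less_iff_less_mult)

lemma coord_eq:
  assumes "x < psize"
  shows "real (coord x) = 2 ^ (lev (x div K) * H + x mod K) + 2 ^ (E1 + x div K) + 2 ^ (E2 + item (x div K)) + 2 ^ E3"
proof -
  define a b c where "a = lev (x div K) * H + x mod K" and "b = E1 + x div K" and "c = E2 + item (x div K)"
  have g: "x div K < G" using div_less[OF assms] .
  have abc: "a < b" "b < c" "c < E3"
    using low_less[OF g, of x] g item_less[of "x div K"] by (auto simp: a_def b_def c_def E1_def E2_def E3_def)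
  have "{j. j < E3 \<and> (j = a \<or> j = b \<or> j = c)} = {a, b, c}" using abc by auto
  then have "coord x = 2 ^ a + 2 ^ b + 2 ^ c + 2 ^ E3"
    unfolding coord_def pbits_def a_def[symmetric] b_def[symmetric] c_def[symmetric] val_append val_map
    using abc by simp
  then show ?thesis by (simp add: a_def b_def c_def)
qed

lemma euclid_dist_pt: "euclid_dist D (pt x) (pt y) = \<bar>real (coord x) - real (coord y)\<bar>"
proof -
  have D: "{..<D} = insert 0 {1..<D}" using D_pos by auto
  have "(pt x ! i :: rat) = pt y ! i" if "i \<in> {1..<D}" for i using that by (cases i) (auto simp: pt_def)
  then have "(\<Sum>i\<in>{1..<D}. (of_rat (pt x ! i) - of_rat (pt y ! i) :: real)\<^sup>2) = 0"
    by (intro sum.neutral) auto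
  then show ?thesis
    unfolding euclid_dist_def L2_set_def D by (simp add: pt_def of_rat_of_nat_eq)
qed

definition dst :: "nat \<Rightarrow> nat \<Rightarrow> real" where "dst x y = \<bar>real (coord x) - real (coord y)\<bar>"

context
  fixes x y :: nat
  assumes xy: "x < psize" "y < psize"
begin

lemma low_le: "z < psize \<Longrightarrow> (2 :: real) ^ (lev (z div K) * H + z mod K) \<le> 2 ^ (2 * C * H)"
  using low_less[OF div_less] by (intro power_increasing) (auto simp: less_imp_le)

lemma mid_le: "z < psize \<Longrightarrow> (2 :: real) ^ (E1 + z div K) \<le> 2 ^ (E1 + G) / 2"
proof -
  assume z: "z < psize"
  then have "(2 :: real) ^ Suc (E1 + z div K) \<le> 2 ^ (E1 + G)"
    using div_less[OF z] by (intro power_increasing) auto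
  then show ?thesis by simp
qed

lemma low_mid_le: "(2 :: real) ^ (2 * C * H) \<le> 2 ^ (E1 + G) / 2"
proof -
  have "(2 :: real) ^ Suc (2 * C * H) \<le> 2 ^ (E1 + G)"
    by (intro power_increasing) (auto simp: E1_def H_def)
  then show ?thesis by simp
qed

lemma low_mid_sum: "z < psize \<Longrightarrow> 0 \<le> (2 :: real) ^ (lev (z div K) * H + z mod K) + 2 ^ (E1 + z div K) \<and>
    (2 :: real) ^ (lev (z div K) * H + z mod K) + 2 ^ (E1 + z div K) \<le> 2 ^ (E1 + G)"
proof -
  assume "z < psize"
  note low_le[OF this] mid_le[OF this] low_mid_le
  moreover have "0 \<le> (2 :: real) ^ (lev (z div K) * H + z mod K)" "0 \<le> (2 :: real) ^ (E1 + z div K)" by simp_all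
  ultimately show ?thesis by linarith
qed

lemma near_item: "item (x div K) = item (y div K) \<Longrightarrow> dst x y \<le> 2 ^ (E1 + G)"
  using low_mid_sum[OF xy(1)] low_mid_sum[OF xy(2)]
  unfolding dst_def coord_eq[OF xy(1)] coord_eq[OF xy(2)] by (simp only:) linarith

lemma far_item: "item (x div K) \<noteq> item (y div K) \<Longrightarrow> 2 ^ E2 - 2 ^ (E1 + G) \<le> dst x y"
  using low_mid_sum[OF xy(1)] low_mid_sum[OF xy(2)] pow_diff[of "item (x div K)" "item (y div K)" E2]
  unfolding dst_def coord_eq[OF xy(1)] coord_eq[OF xy(2)] by linarith

lemma far_cluster_same_item:
  assumes ne: "x div K \<noteq> y div K" and eq: "item (x div K) = item (y div K)"
  shows "2 ^ E1 - 2 ^ (2 * C * H) \<le> dst x y"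
proof -
  have "0 \<le> (2 :: real) ^ (lev (x div K) * H + x mod K)" "0 \<le> (2 :: real) ^ (lev (y div K) * H + y mod K)"
    by simp_all
  then show ?thesis
    using low_le[OF xy(1)] low_le[OF xy(2)] pow_diff[OF ne, of E1]
    unfolding dst_def coord_eq[OF xy(1)] coord_eq[OF xy(2)] eq by linarith
qed

lemma near_cluster: "x div K = y div K \<Longrightarrow> dst x y \<le> 2 ^ radius (lev (x div K))"
proof -
  assume "x div K = y div K"
  then have "dst x y = \<bar>2 ^ (lev (x div K) * H + x mod K) - 2 ^ (lev (x div K) * H + y mod K)\<bar>"
    by (simp add: dst_def coord_eq xy)
  moreover have "(2 :: real) ^ (lev (x div K) * H + z mod K) \<le> 2 ^ radius (lev (x div K))" for z
    using mod_less_divisor[OF K_pos, of z] by (intro power_increasing) (auto simp: radius_def)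
  from this[of x] this[of y] have "\<bar>(2 :: real) ^ (lev (x div K) * H + x mod K) - 2 ^ (lev (x div K) * H + y mod K)\<bar>
      \<le> 2 ^ radius (lev (x div K))"
    using zero_le_power[of "2 :: real" "lev (x div K) * H + x mod K"] zero_le_power[of "2 :: real" "lev (x div K) * H + y mod K"]
    by linarith
  ultimately show ?thesis by simp
qed

lemma far_point: "x div K = y div K \<Longrightarrow> x \<noteq> y \<Longrightarrow> 2 ^ (lev (x div K) * H) \<le> dst x y"
proof -
  assume a: "x div K = y div K" "x \<noteq> y"
  then have "x mod K \<noteq> y mod K" by (metis div_mult_mod_eq)
  then show ?thesis using pow_diff[of "x mod K" "y mod K" "lev (x div K) * H"] a by (simp add: dst_def coord_eq xy)
qed

end

section \<open>Separation of the scales\<close>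

lemma gap_item: "(2 :: real) * 2 ^ gap * 2 ^ (E1 + G) < 2 ^ E2 - 2 ^ (E1 + G)"
proof -
  have "(2 :: real) ^ (gap + 3) \<le> 2 ^ H" by (intro power_increasing) (auto simp: H_def)
  then have "8 * 2 ^ gap \<le> (2 :: real) ^ H" by (simp add: power_add)
  moreover have "(1 :: real) \<le> 2 ^ gap" by simp
  ultimately have "2 * 2 ^ gap + 1 < (2 :: real) ^ H" by linarith
  then have "(2 * 2 ^ gap + 1) * (2 :: real) ^ (E1 + G) < 2 ^ H * 2 ^ (E1 + G)" by (intro mult_strict_right_mono) auto
  then show ?thesis by (simp add: E2_def power_add algebra_simps)
qed

lemma gap_cluster: "l < 2 * C \<Longrightarrow> (2 :: real) * 2 ^ gap * 2 ^ radius l < 2 ^ E1 - 2 ^ (2 * C * H)"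
proof -
  assume "l < 2 * C"
  then have "Suc l * H \<le> 2 * C * H" by (intro mult_le_mono1) simp
  then have "radius l \<le> 2 * C * H" by (simp add: radius_def H_def)
  then have "(2 :: real) ^ radius l \<le> 2 ^ (2 * C * H)" by (intro power_increasing) auto
  then have 1: "(2 :: real) * 2 ^ gap * 2 ^ radius l \<le> 2 * 2 ^ gap * 2 ^ (2 * C * H)" by simp
  have "(2 :: real) ^ (gap + 3) \<le> 2 ^ H" by (intro power_increasing) (auto simp: H_def)
  then have "8 * 2 ^ gap \<le> (2 :: real) ^ H" by (simp add: power_add)
  moreover have "(1 :: real) \<le> 2 ^ gap" by simp
  ultimately have "2 * 2 ^ gap + 1 < (2 :: real) ^ H" by linarith
  then have "(2 * 2 ^ gap + 1) * (2 :: real) ^ (2 * C * H) < 2 ^ H * 2 ^ (2 * C * H)" by (intro mult_strict_right_mono) auto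
  then have "2 * 2 ^ gap * (2 :: real) ^ (2 * C * H) < 2 ^ E1 - 2 ^ (2 * C * H)"
    by (simp add: E1_def power_add algebra_simps)
  with 1 show ?thesis by linarith
qed

lemma gap_point: "l < l' \<Longrightarrow> (2 :: real) * 2 ^ gap * 2 ^ radius l < 2 ^ (l' * H)"
proof -
  assume "l < l'"
  then have "Suc l * H \<le> l' * H" by (intro mult_le_mono1) simp
  then have "Suc (gap + radius l) < l' * H" by (simp add: radius_def H_def)
  then have "(2 :: real) ^ Suc (gap + radius l) < 2 ^ (l' * H)" by (intro power_strict_increasing) auto
  then show ?thesis by (simp add: power_add)
qed

lemma E2_E1: "(2 :: real) ^ E1 - 2 ^ (2 * C * H) \<le> 2 ^ E2 - 2 ^ (E1 + G)"
proof -
  have "(2 :: real) ^ E1 \<le> 2 ^ (E1 + G)" by (intro power_increasing) auto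
  moreover have "2 * (2 :: real) ^ (E1 + G) \<le> 2 ^ E2"
  proof -
    have "(2 :: real) ^ Suc (E1 + G) \<le> 2 ^ E2" by (intro power_increasing) (auto simp: E2_def H_def)
    then show ?thesis by simp
  qed
  moreover have "0 \<le> (2 :: real) ^ (2 * C * H)" by simp
  ultimately show ?thesis by linarith
qed

lemma far_cluster:
  assumes "x < psize" "y < psize" "x div K \<noteq> y div K"
  shows "2 ^ E1 - 2 ^ (2 * C * H) \<le> dst x y"
  using far_item[OF assms(1,2)] far_cluster_same_item[OF assms(1,2,3)] E2_E1 by force

lemma inj_pt: "inj_on pt {..<psize}"
proof (rule inj_onI, rule ccontr)
  fix x y assume a: "x \<in> {..<psize}" "y \<in> {..<psize}" "pt x = pt y" "x \<noteq> y"
  then have "coord x = coord y" by (simp add: pt_def)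
  then have "dst x y = 0" by (simp add: dst_def)
  moreover have "0 < dst x y"
  proof (cases "x div K = y div K")
    case True
    then have "2 ^ (lev (x div K) * H) \<le> dst x y" using far_point a by simp
    then show ?thesis by (rule less_le_trans[rotated]) simp
  next
    case False
    have "0 < (2 :: real) * 2 ^ gap * 2 ^ radius 0" by simp
    moreover have "2 ^ E1 - 2 ^ (2 * C * H) \<le> dst x y" using far_cluster[of x y] False a by simp
    moreover have "(2 :: real) * 2 ^ gap * 2 ^ radius 0 < 2 ^ E1 - 2 ^ (2 * C * H)"
      using gap_cluster[of 0] pos(1) by simp
    ultimately show ?thesis by linarith
  qed
  ultimately show False by simp
qed

definition clus :: "rat list \<Rightarrow> nat" where "clus p = inv_into {..<psize} pt p div K"

lemma clus_pt: "x < psize \<Longrightarrow> clus (pt x) = x div K"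
  using inv_into_f_f[OF inj_pt] by (simp add: clus_def)

lemma set_ps: "set ps = pt ` {..<psize}" by (auto simp: ps_def)

lemma length_ps [simp]: "length ps = psize" by (simp add: ps_def)

lemma psize_pos: "0 < psize" using pos I_pos K_pos by (simp add: psize_def G_def)

lemma G_cases:
  assumes "g < G"
  shows "g div Q div I < C" "g div Q mod I < I" "g mod Q < Q" "g = (g div Q div I * I + g div Q mod I) * Q + g mod Q"
  using assms pos I_pos by (auto simp: G_def div_less_iff_less_mult mult_ac)

lemma G_build:
  assumes "c < C" "i < I" "q < Q"
  shows "(c * I + i) * Q + q < G" "((c * I + i) * Q + q) div Q div I = c"
    "((c * I + i) * Q + q) div Q mod I = i" "((c * I + i) * Q + q) mod Q = q"
proof -
  have "Suc c * I \<le> C * I" using assms(1) by (intro mult_le_mono1) simp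
  then have "c * I + i + 1 \<le> C * I" using assms(2) by simp
  then have "(c * I + i + 1) * Q \<le> C * I * Q" by (rule mult_le_mono1)
  then show "(c * I + i) * Q + q < G" using assms(3) by (simp add: G_def)
  have "((c * I + i) * Q + q) div Q = c * I + i" using assms(3) by (simp add: div_add1_eq)
  then show "((c * I + i) * Q + q) div Q div I = c" "((c * I + i) * Q + q) div Q mod I = i"
    using assms(2) by (simp_all add: div_add1_eq)
  show "((c * I + i) * Q + q) mod Q = q" using assms(3) by simp
qed

sublocale layered "set ps" clus item lev bud I C Q N K G
proof
  show "finite (set ps)" by simp
  fix p assume "p \<in> set ps"
  then show "clus p < G" using div_less by (auto simp: set_ps clus_pt)
next
  fix g assume g: "g < G"
  have "{p \<in> set ps. clus p = g} = pt ` ((\<lambda>b. g * K + b) ` {..<K})"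
  proof -
    have sub: "g * K + b < psize" if "b < K" for b
    proof -
      have "Suc g * K \<le> G * K" using g by (intro mult_le_mono1) simp
      then show ?thesis using that by (simp add: psize_def)
    qed
    have 1: "clus (pt (g * K + b)) = g" "pt (g * K + b) \<in> set ps" if "b < K" for b
      using that sub[OF that] by (simp_all add: clus_pt set_ps)
    have 2: "\<exists>b<K. p = pt (g * K + b)" if p: "p \<in> set ps" "clus p = g" for p
    proof -
      obtain x where x: "x < psize" "p = pt x" using p(1) by (auto simp: set_ps)
      then have "x div K = g" using p(2) by (simp add: clus_pt)
      then have "x = g * K + x mod K" using div_mult_mod_eq[of x K] by simp
      then show ?thesis using x K_pos by (intro exI[of _ "x mod K"]) auto
    qed
    show ?thesis using 1 2 by blast
  qed
  moreover have "inj_on pt ((\<lambda>b. g * K + b) ` {..<K})"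
  proof (rule inj_on_subset[OF inj_pt])
    have "Suc g * K \<le> G * K" using g by (intro mult_le_mono1) simp
    then show "(\<lambda>b. g * K + b) ` {..<K} \<subseteq> {..<psize}" by (auto simp: psize_def)
  qed
  ultimately show "card {p \<in> set ps. clus p = g} = K"
    by (simp add: card_image inj_on_def)
next
  fix g assume "g < G" then show "item g < I" "lev g < 2 * C" using item_less lev_less by auto
next
  fix a c assume ac: "a < I" "c < C"
  have "{g. g < G \<and> item g = a \<and> lev g div 2 = c} = (\<lambda>q. (c * I + a) * Q + q) ` {..<Q}"
  proof -
    have "(c * I + a) * Q + q < G \<and> item ((c * I + a) * Q + q) = a \<and> lev ((c * I + a) * Q + q) div 2 = c" if "q < Q" for q
      unfolding lev_div item_def using G_build[OF ac(2,1) that] by blast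
    moreover have "g \<in> (\<lambda>q. (c * I + a) * Q + q) ` {..<Q}" if "g < G" "item g = a" "lev g div 2 = c" for g
      using G_cases[OF that(1)] that(2,3) unfolding lev_div item_def by blast
    ultimately show ?thesis by blast
  qed
  then show "card {g. g < G \<and> item g = a \<and> lev g div 2 = c} = Q" by (simp add: card_image)
qed (use pos bud in \<open>auto simp: K_def\<close>)

text \<open>Clusters of level \<open>2 * c + 1\<close> correspond to the slots counted by constraint
  \<open>c\<close> through the mixed radix representation of cluster numbers.\<close>

lemma valid_iff: "valid U \<longleftrightarrow> solution U"
proof -
  have "card {g \<in> CU U. lev g = 2 * c + 1} = card {x \<in> U \<times> {..<Q}. mem c (fst x) (snd x)}"
    if U: "U \<subseteq> {..<I}" and c: "c < C" for c
  proof (rule bij_betw_same_card)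
    have odd: "2 * X \<noteq> Suc (2 * c)" for X by presburger
    have lev1: "lev g = 2 * c + 1 \<longleftrightarrow> g div Q div I = c \<and> mem c (g div Q mod I) (g mod Q)" for g
      by (auto simp: lev_def odd split: if_splits)
    show "bij_betw (\<lambda>g. (g div Q mod I, g mod Q)) {g \<in> CU U. lev g = 2 * c + 1}
        {x \<in> U \<times> {..<Q}. mem c (fst x) (snd x)}"
    proof (rule bij_betwI[where g = "\<lambda>x. (c * I + fst x) * Q + snd x"])
      show "(\<lambda>g. (g div Q mod I, g mod Q)) \<in> {g \<in> CU U. lev g = 2 * c + 1} \<rightarrow> {x \<in> U \<times> {..<Q}. mem c (fst x) (snd x)}"
        using G_cases(3) lev1[unfolded Suc_eq_plus1[symmetric]] by (auto simp: CU_def item_def)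
      show "(\<lambda>x. (c * I + fst x) * Q + snd x) \<in> {x \<in> U \<times> {..<Q}. mem c (fst x) (snd x)} \<rightarrow> {g \<in> CU U. lev g = 2 * c + 1}"
      proof
        fix x assume x: "x \<in> {x \<in> U \<times> {..<Q}. mem c (fst x) (snd x)}"
        then have "fst x < I" "snd x < Q" using U by auto
        note b = G_build[OF c this]
        show "(c * I + fst x) * Q + snd x \<in> {g \<in> CU U. lev g = 2 * c + 1}"
          unfolding mem_Collect_eq lev1 CU_def item_def b(2-4) using b(1) x by auto
      qed
      fix g assume "g \<in> {g \<in> CU U. lev g = 2 * c + 1}"
      then have g: "g < G" and c: "g div Q div I = c" by (simp_all only: CU_def mem_Collect_eq lev1)
      show "(c * I + fst (g div Q mod I, g mod Q)) * Q + snd (g div Q mod I, g mod Q) = g"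
        using G_cases(4)[OF g, symmetric] unfolding c fst_conv snd_conv .
    next
      fix x assume x: "x \<in> {x \<in> U \<times> {..<Q}. mem c (fst x) (snd x)}"
      then have "fst x < I" "snd x < Q" using U by auto
      note b = G_build[OF c this]
      show "(((c * I + fst x) * Q + snd x) div Q mod I, ((c * I + fst x) * Q + snd x) mod Q) = x"
        unfolding b(3,4) by simp
    qed
  qed
  then show ?thesis by (auto simp: valid_def solution_def)
qed

lemma ks_eq: "ks = kss"
  by (simp add: ks_def kss_def quota_def quot_def)

lemma layered_metric_dist:
  fixes \<beta> :: real
  assumes "1 \<le> \<beta>" "\<beta> \<le> 2 ^ gap"
  shows "layered_metric (set ps) clus item lev bud I C Q N K G (euclid_dist D) (2 ^ (E1 + G)) \<beta> (\<lambda>l. 2 ^ radius l)"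
proof -
  have M: "Metric_space (set ps) (euclid_dist D)"
    by (rule Metric_space_euclid_dist) (use D_pos in \<open>auto simp: set_ps pt_def\<close>)
  then interpret Metric_space "set ps" "euclid_dist D" .
  have le: "2 * \<beta> * r \<le> 2 * 2 ^ gap * r" if "0 \<le> r" for r
    using assms(2) that by (intro mult_right_mono) auto
  show ?thesis
  proof (unfold_locales, goal_cases)
    case 4
    then show ?case by (intro power_increasing) (auto simp: radius_def)
  next
    case (5 p q)
    then show ?case using near_item by (auto simp: set_ps clus_pt euclid_dist_pt dst_def)
  next
    case (6 p q)
    then obtain x y where x: "x < psize" "p = pt x" "y < psize" "q = pt y" by (auto simp: set_ps)
    have "2 * \<beta> * 2 ^ (E1 + G) \<le> 2 * 2 ^ gap * 2 ^ (E1 + G)" by (rule le) simp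
    also have "\<dots> < 2 ^ E2 - 2 ^ (E1 + G)" by (rule gap_item)
    also have "\<dots> \<le> dst x y" using far_item[OF x(1,3)] 6 x by (simp add: clus_pt)
    finally show ?case using x by (simp add: euclid_dist_pt dst_def)
  next
    case (7 p q)
    then show ?case using near_cluster by (auto simp: set_ps clus_pt euclid_dist_pt dst_def)
  next
    case (8 p q l)
    then obtain x y where x: "x < psize" "p = pt x" "y < psize" "q = pt y" by (auto simp: set_ps)
    have "2 * \<beta> * 2 ^ radius l \<le> 2 * 2 ^ gap * 2 ^ radius l" by (rule le) simp
    also have "\<dots> < 2 ^ E1 - 2 ^ (2 * C * H)" using 8 by (intro gap_cluster)
    also have "\<dots> \<le> dst x y" using 8 x by (intro far_cluster) (auto simp: clus_pt)
    finally show ?case using x by (simp add: euclid_dist_pt dst_def)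
  next
    case (9 p q l)
    then obtain x y where x: "x < psize" "p = pt x" "y < psize" "q = pt y" by (auto simp: set_ps)
    have "2 * \<beta> * 2 ^ radius l \<le> 2 * 2 ^ gap * 2 ^ radius l" by (rule le) simp
    also have "\<dots> < 2 ^ (lev (x div K) * H)" using 9 x by (intro gap_point) (simp add: clus_pt)
    also have "\<dots> \<le> dst x y" using 9 x by (intro far_point) (auto simp: clus_pt)
    finally show ?case using x by (simp add: euclid_dist_pt dst_def)
  qed (use assms in auto)
qed

lemma rads_eq:
  fixes \<beta> :: real
  assumes "1 \<le> \<beta>" "\<beta> \<le> 2 ^ gap"
  shows "map of_rat rads = layered_metric.rs C (2 ^ (E1 + G)) (\<lambda>l. 2 ^ radius l)"
  using layered_metric.rs_def[OF layered_metric_dist[OF assms]]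
  by (simp add: rads_def of_rat_power)

lemma resilient:
  fixes \<beta> :: real
  assumes "1 \<le> \<beta>" "\<beta> \<le> 2 ^ gap" "\<And>U'. solution U' \<longleftrightarrow> U' = U"
  shows "perturbation_resilient \<beta> (set ps) (euclid_dist D) (map of_rat rads) kss"
  unfolding rads_eq[OF assms(1,2)] ks_eq[symmetric]
  by (rule layered_metric.perturbation_resilient[OF layered_metric_dist[OF assms(1,2)]])
    (use assms(3) valid_iff in simp)

lemma uncovered:
  fixes \<beta> :: real
  assumes "1 \<le> \<beta>" "\<beta> \<le> 2 ^ gap" "\<And>U'. solution U' \<longleftrightarrow> U' = U"
    and "feasible (set ps) (euclid_dist D) (map of_rat rads) kss cs \<alpha>"
    and "\<forall>cs0 \<alpha>0. optimal (set ps) (euclid_dist D) (map of_rat rads) kss cs0 \<alpha>0 \<longrightarrow> \<alpha> \<le> \<beta> * \<alpha>0"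
  shows "U = {..<I} - (\<lambda>c. item (clus c)) ` set (cs ! 0)"
proof (rule layered_metric.approximate_placement[OF layered_metric_dist[OF assms(1,2)]])
  show "valid U' \<longleftrightarrow> U' = U" for U' using assms(3) valid_iff by simp
  show "feasible (set ps) (euclid_dist D) (layered_metric.rs C (2 ^ (E1 + G)) (\<lambda>l. 2 ^ radius l)) ks cs \<alpha>"
    using assms(4) unfolding rads_eq[OF assms(1,2)] ks_eq .
  show "\<alpha> \<le> \<beta> * \<alpha>0"
    if "optimal (set ps) (euclid_dist D) (layered_metric.rs C (2 ^ (E1 + G)) (\<lambda>l. 2 ^ radius l)) ks cs0 \<alpha>0" for cs0 \<alpha>0
    using assms(5) that unfolding rads_eq[OF assms(1,2)] ks_eq by blast
qed

lemma instance_ok: "euclidean_nukc_instance D ps rads kss"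
proof -
  have M: "Metric_space (set ps) (euclid_dist D)"
    by (rule Metric_space_euclid_dist) (use D_pos in \<open>auto simp: set_ps pt_def\<close>)
  have d: "distinct ps" unfolding ps_def using inj_pt by (simp add: distinct_map atLeast0LessThan)
  have rad: "radius l < E1 + G" if "l < 2 * C" for l
  proof -
    have "Suc l * H \<le> 2 * C * H" using that by (intro mult_le_mono1) simp
    then show ?thesis by (simp add: radius_def E1_def H_def)
  qed
  have "sorted_wrt (>) (map (\<lambda>e. of_rat (of_nat (2 ^ e)) :: real) ((E1 + G) # map (\<lambda>i. radius (2 * C - Suc i)) [0..<2 * C]))"
    unfolding sorted_wrt_map
  proof (rule sorted_wrt_mono_rel[where P = "(>)"])
    show "sorted_wrt (>) ((E1 + G) # map (\<lambda>i. radius (2 * C - Suc i)) [0..<2 * C])"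
    proof -
      have "sorted_wrt (>) (map (\<lambda>i. radius (2 * C - Suc i)) [0..<2 * C])"
        unfolding sorted_wrt_iff_nth_less
        by (auto simp: radius_def H_def intro!: mult_less_mono1)
      then show ?thesis using rad by (simp del: sorted_wrt_map)
    qed
    fix a b :: nat assume "b < a"
    then have "(2 :: real) ^ b < 2 ^ a" by (intro power_strict_increasing) auto
    then show "of_rat (of_nat (2 ^ b)) < (of_rat (of_nat (2 ^ a)) :: real)" by (simp add: of_rat_power)
  qed
  then show ?thesis
    using M d psize_pos D_pos
    by (auto simp: euclidean_nukc_instance_def nukc_instance_def set_ps rads_def kss_def pt_def comp_def)
qed

section \<open>Codes of instances and placements\<close>

lemma enc_pt: "enc_list enc_rat (pt x) = enc_point D (pbits x)"
proof -
  have "binary_digits (coord x) = pbits x" by (simp add: coord_def pbits_def binary_digits_val)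
  then show ?thesis
    using D_pos by (simp add: enc_list_def pt_def enc_point_def enc_rat_of_nat enc_nat_def)
qed

lemma enc_rad: "enc_rat (of_nat (2 ^ e)) = [False] @ delim (replicate e False @ [True]) @ [False] @ enc_nat 1"
proof -
  have "val (replicate e False @ [True]) = 2 ^ e" by (induction e) auto
  then have "binary_digits (2 ^ e) = replicate e False @ [True]"
    using binary_digits_val[of "replicate e False"] by simp
  then show ?thesis unfolding enc_rat_of_nat by (simp add: enc_nat_def)
qed

definition enc_radius :: "nat \<Rightarrow> bool list" where
  "enc_radius e = [False] @ delim (replicate e False @ [True]) @ [False] @ enc_nat 1"

lemma enc_instance_eq: "enc_instance ps rads kss =
    (enc_nat psize @ concat (map (\<lambda>x. enc_point D (pbits x)) [0..<psize])) @
    (enc_nat (2 * C + 1) @ enc_radius (E1 + G) @ concat (map (\<lambda>i. enc_radius (radius (2 * C - Suc i))) [0..<2 * C])) @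
    (enc_nat (2 * C + 1) @ enc_nat (I - N) @ concat (map (\<lambda>i. enc_nat (quot (2 * C - Suc i))) [0..<2 * C]))"
proof -
  have 1: "enc_list (enc_list enc_rat) ps = enc_nat psize @ concat (map (\<lambda>x. enc_point D (pbits x)) [0..<psize])"
    by (simp add: enc_list_def[of "enc_list enc_rat"] ps_def comp_def enc_pt)
  have 2: "enc_list enc_rat rads = enc_nat (2 * C + 1) @ enc_radius (E1 + G) @
      concat (map (\<lambda>i. enc_radius (radius (2 * C - Suc i))) [0..<2 * C])"
    unfolding enc_list_def rads_def list.map map_map comp_def enc_rad enc_radius_def[symmetric] by simp
  have 3: "enc_list enc_nat kss = enc_nat (2 * C + 1) @ enc_nat (I - N) @
      concat (map (\<lambda>i. enc_nat (quot (2 * C - Suc i))) [0..<2 * C])"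
    by (simp add: enc_list_def kss_def comp_def)
  show ?thesis unfolding enc_instance_def 1 2 3 by simp
qed

text \<open>The offset passes over the number of classes and the number of large balls, then over
  \<open>j\<close> centers of constant code length, then over the dimension and the sign. The
  remaining \<open>2 * (E2 + i) + 1\<close> is due to \<open>delim\<close>, which puts digit
  \<open>e\<close> at position \<open>2 * e + 1\<close>.\<close>

definition hit :: "bool list \<Rightarrow> nat \<Rightarrow> bool" where
  "hit z i \<longleftrightarrow> (\<exists>j<I - N. look z (length (enc_nat (2 * C + 1) @ enc_nat (I - N)) +
     (j * length (enc_point D (pbits 0)) + (length (enc_nat D) + (1 + (2 * (E2 + i) + 1))))))"

lemma look_drop: "look (drop a xs) i = look xs (a + i)"
  by (auto simp: look_def less_diff_conv add.commute)

lemma drop_concat_const: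
  "(\<And>x. x \<in> set xs \<Longrightarrow> length (f x) = l) \<Longrightarrow> j < length xs \<Longrightarrow>
   \<exists>rest. drop (j * l) (concat (map f xs) @ ys) = f (xs ! j) @ rest"
proof (induction xs arbitrary: j)
  case (Cons x xs)
  then show ?case
  proof (cases j)
    case (Suc j')
    then have "drop (j * l) (concat (map f (x # xs)) @ ys) = drop (j' * l) (concat (map f xs) @ ys)"
      using Cons.prems(1)[of x] by (simp add: add.commute)
    then show ?thesis using Cons.IH[of j'] Cons.prems Suc by auto
  qed auto
qed simp

text \<open>All first coordinates have \<open>E3 + 1\<close> digits, so all centers have codes of
  the same length, and digit \<open>E2 + i\<close> is set exactly for the points of item
  \<open>i\<close>.\<close>

lemma hit_placement:
  assumes "placement (set ps) kss cs" "i < I"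
  shows "hit (enc_placement cs) i \<longleftrightarrow> i \<in> (\<lambda>c. item (clus c)) ` set (cs ! 0)"
proof -
  have len: "map length cs = kss" and sub: "\<And>c. c \<in> set cs \<Longrightarrow> set c \<subseteq> set ps"
    using assms(1) by (auto simp: placement_def)
  then obtain c0 cs' where cs: "cs = c0 # cs'" by (cases cs) (auto simp: kss_def)
  have lc: "length c0 = I - N" "length cs = 2 * C + 1"
    using len cs by (auto simp: kss_def dest: arg_cong[of _ _ length])
  have c0: "set c0 \<subseteq> pt ` {..<psize}" using sub[of c0] cs by (simp add: set_ps)
  define h where "h = enc_nat (2 * C + 1) @ enc_nat (I - N)"
  define rest where "rest = concat (map (enc_list (enc_list enc_rat)) cs')"
  have z: "enc_placement cs = h @ concat (map (enc_list enc_rat) c0) @ rest"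
    using lc unfolding enc_placement_def enc_list_def[of "enc_list (enc_list enc_rat)"]
    by (simp add: cs h_def rest_def enc_list_def[of "enc_list enc_rat"])
  define l where "l = length (enc_point D (pbits 0))"
  have lp: "length (enc_list enc_rat p) = l" if p: "p \<in> set c0" for p
  proof -
    obtain x where "p = pt x" using c0 p by blast
    then show ?thesis by (simp add: enc_pt l_def enc_point_def length_delim pbits_def)
  qed
  have key: "look (enc_placement cs) (length h + (j * l + (length (enc_nat D) + (1 + (2 * (E2 + i) + 1))))) \<longleftrightarrow>
      item (clus (c0 ! j)) = i" if j: "j < I - N" for j
  proof -
    have c0j: "c0 ! j \<in> set c0" using j lc by simp
    then obtain x where x: "x < psize" "c0 ! j = pt x" using c0 by blast
    obtain rest' where r: "drop (j * l) (concat (map (enc_list enc_rat) c0) @ rest) = enc_list enc_rat (c0 ! j) @ rest'"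
      using drop_concat_const[of c0 "enc_list enc_rat" l j rest] lp j lc by auto
    have "look (enc_placement cs) (length h + (j * l + (length (enc_nat D) + (1 + (2 * (E2 + i) + 1))))) =
        look (drop (j * l) (drop (length h) (enc_placement cs))) (length (enc_nat D) + (1 + (2 * (E2 + i) + 1)))"
      by (simp add: look_drop add.assoc add.left_commute)
    also have "drop (j * l) (drop (length h) (enc_placement cs)) = enc_point D (pbits x) @ rest'"
      unfolding z using r x(2) by (simp only: append_eq_conv_conj[symmetric] drop_append enc_pt) simp
    also have "look (enc_point D (pbits x) @ rest') (length (enc_nat D) + (1 + (2 * (E2 + i) + 1))) =
        look (drop 1 (drop (length (enc_nat D)) (enc_point D (pbits x) @ rest'))) (2 * (E2 + i) + 1)"
      by (simp only: look_drop add.assoc)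
    also have "\<dots> = look (delim (pbits x) @ ([False] @ enc_nat 1 @ concat (replicate (D - 1) (enc_rat 0)) @ rest')) (2 * (E2 + i) + 1)"
      by (simp add: enc_point_def)
    also have "\<dots> = pbits x ! (E2 + i)"
      using assms(2) by (intro look_delim) (simp add: pbits_def E3_def)
    also have "\<dots> \<longleftrightarrow> item (x div K) = i"
    proof -
      have "x div K < G" using div_less x(1) by blast
      then have "lev (x div K) * H + x mod K < E2" "E1 + x div K < E2"
        using low_less[of "x div K" x] by (auto simp: E1_def E2_def H_def)
      then show ?thesis using assms(2) by (auto simp: pbits_def nth_append E3_def)
    qed
    finally show ?thesis using x by (simp add: clus_pt)
  qed
  have "hit (enc_placement cs) i \<longleftrightarrow> (\<exists>j<I - N. item (clus (c0 ! j)) = i)"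
    unfolding hit_def h_def[symmetric] l_def[symmetric] using key by blast
  also have "\<dots> \<longleftrightarrow> i \<in> (\<lambda>c. item (clus c)) ` set c0"
  proof -
    have "set c0 = (\<lambda>j. c0 ! j) ` {..<I - N}" using lc(1) by (auto simp: set_conv_nth)
    then show ?thesis by auto
  qed
  finally show ?thesis by (simp add: cs)
qed

end

section \<open>The reduction\<close>

locale reduction =
  fixes Mv Ma :: tm and pv pa p :: "nat poly" and D \<kappa> :: nat and os :: "cell_opt list"
  assumes Mv: "turing_machine Mv" and Ma: "turing_machine Ma" and D: "1 \<le> D"
    and os: "distinct os" "set os = opts Mv"
begin

text \<open>An input \<open>pair_code x r\<close> starts with \<open>delim x\<close>, which has \<open>True\<close> at the even positions below
  \<open>2 * length x\<close>; this is how the length of \<open>x\<close> is recovered.\<close>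

definition xlen :: "bool list \<Rightarrow> nat" where
  "xlen z = length (filter (\<lambda>i. \<forall>j<Suc i. look z (2 * j)) [0..<length z])"

definition np :: "bool list \<Rightarrow> nat" where "np z = 2 * xlen z + 1"
definition prefix :: "bool list \<Rightarrow> bool list" where "prefix z = map (look z) [0..<np z]"
definition wl :: "bool list \<Rightarrow> nat" where "wl z = poly p (xlen z)"
definition tm :: "bool list \<Rightarrow> nat" where "tm z = poly pv (np z + wl z)"
definition cols :: "bool list \<Rightarrow> nat" where "cols z = 2 * tm z + np z + wl z + 2"
definition ofs :: "bool list \<Rightarrow> nat" where "ofs z = tm z + 1"
definition s :: nat where "s = length os"
definition In :: "bool list \<Rightarrow> nat" where "In z = Suc (tm z) * cols z * s"
definition Nn :: "bool list \<Rightarrow> nat" where "Nn z = Suc (tm z) * cols z"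
definition Qn :: "bool list \<Rightarrow> nat" where "Qn z = block_size (wl z)"
text \<open>Constraint \<open>0\<close> bounds the weight; each ordered pair of items has a further
  constraint, which excludes the pair if it is in conflict.\<close>

definition Cn :: "bool list \<Rightarrow> nat" where "Cn z = 1 + In z * In z"

definition row :: "bool list \<Rightarrow> nat \<Rightarrow> nat" where "row z i = i div s div cols z"
definition col :: "bool list \<Rightarrow> nat \<Rightarrow> nat" where "col z i = i div s mod cols z"
definition dec :: "bool list \<Rightarrow> nat \<Rightarrow> nat \<times> nat \<times> cell_opt" where
  "dec z i = (row z i, col z i, os ! (i mod s))"

text \<open>The conditions of the tableau are split by cases until every atom that involves a cell option depends
  on nothing else; for fixed options it is then a constant, which makes the conditions definable.\<close>

definition forb :: "bool list \<Rightarrow> nat \<Rightarrow> nat \<Rightarrow> cell_opt \<Rightarrow> bool" where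
  "forb z t c ob \<longleftrightarrow> t = 0 \<and>
     (if c < ofs z then bad_init Mv False {0} ob
      else if c - ofs z < np z then
        (if look z (c - ofs z) then (if c = ofs z then bad_init Mv True {2} ob else bad_init Mv False {2} ob)
         else (if c = ofs z then bad_init Mv True {1} ob else bad_init Mv False {1} ob))
      else if c - ofs z < np z + wl z then bad_init Mv False {1, 2} ob
      else bad_init Mv False {0} ob) \<or>
     t = tm z \<and> c = ofs z \<and> bad_final Mv ob"

definition conf :: "bool list \<Rightarrow> nat \<Rightarrow> nat \<Rightarrow> cell_opt \<Rightarrow> nat \<Rightarrow> nat \<Rightarrow> cell_opt \<Rightarrow> bool" where
  "conf z t c o1 t' c' o2 \<longleftrightarrow> forb z t c o1 \<or> forb z t' c' o2 \<or> (t = t' \<and> c = c' \<and> o1 \<noteq> o2) \<or>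
     (t = t' \<and> \<not> same_scan o1 o2) \<or>
     (t' = Suc t \<and> (fst o2 \<noteq> succ_state Mv o1 \<or> (c = c' \<and> bad_cell Mv o1 o2) \<or>
        (if c' = c then bad_move Mv 0 o1 o2 else if c' = Suc c then bad_move Mv 1 o1 o2
         else if c = Suc c' then bad_move Mv (- 1) o1 o2 else bad_move Mv 2 o1 o2)))"

text \<open>The conjuncts \<open>a mod s < s\<close> and \<open>b mod s < s\<close> give the shape
  that \<open>D_case\<close> handles.\<close>

definition confi :: "bool list \<Rightarrow> nat \<Rightarrow> nat \<Rightarrow> bool" where
  "confi z a b \<longleftrightarrow> a mod s < s \<and> b mod s < s \<and> conf z (row z a) (col z a) (os ! (a mod s)) (row z b) (col z b) (os ! (b mod s))"

text \<open>The items concerned are the first-row options that set a witness bit to true. Such an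
  item has as many counted slots as the random block of the bit has ones, that is, the weight of the
  bit.\<close>

definition wt :: "bool list \<Rightarrow> nat \<Rightarrow> nat \<Rightarrow> bool" where
  "wt z i q \<longleftrightarrow> row z i = 0 \<and> ofs z + np z \<le> col z i \<and> col z i < ofs z + np z + wl z \<and>
     (i mod s < s \<and> true_cell (os ! (i mod s))) \<and> look (drop (np z) z) ((col z i - ofs z - np z) * Qn z + q)"

definition member :: "bool list \<Rightarrow> nat \<Rightarrow> nat \<Rightarrow> nat \<Rightarrow> bool" where
  "member z c i q \<longleftrightarrow> (if c = 0 then wt z i q else q = 0 \<and> (c - 1) div In z \<noteq> (c - 1) mod In z \<and>
     confi z ((c - 1) div In z) ((c - 1) mod In z) \<and> (i = (c - 1) div In z \<or> i = (c - 1) mod In z))"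

text \<open>The nested difference is the minimum of \<open>W\<close> and \<open>Nn z * Qn z\<close>,
  written with subtraction alone. It satisfies the bound required by \<open>packing\<close> for
  every \<open>W\<close>.\<close>

definition budget :: "bool list \<Rightarrow> nat \<Rightarrow> nat \<Rightarrow> nat" where
  "budget z W c = (if c = 0 then W - (W - Nn z * Qn z) else 1)"

definition psz :: "bool list \<Rightarrow> nat" where "psz z = Cn z * In z * Qn z * (Cn z * Nn z * Qn z + 1)"
text \<open>The exponent of the growth bound at the number of points, so that
  \<open>2 ^ gp z\<close> exceeds or equals the approximation factor.\<close>

definition gp :: "bool list \<Rightarrow> nat" where "gp z = \<kappa> * psz z ^ \<kappa>"

lemma opts_nonempty: "opts Mv \<noteq> {}"
proof -
  have "(0, replicate (tm_tapes Mv) 0, replicate (tm_tapes Mv) 0, replicate (tm_tapes Mv) False) \<in> opts Mv"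
    using Mv by (auto simp: opts_def turing_machine_def)
  then show ?thesis by blast
qed

lemma s_pos: "0 < s" using opts_nonempty os(2) by (auto simp: s_def)

lemma cols_pos: "2 \<le> cols z" by (simp add: cols_def)

lemma Q_pos: "0 < Qn z" by (simp add: Qn_def block_size_def)

lemma wl_le: "wl z \<le> Nn z"
  by (simp add: Nn_def cols_def)

text \<open>Holds for arbitrary strings \<open>z\<close>, not only for inputs of the proper form:
  definability is a statement about all environments, and the definitions of \<open>packing\<close>
  are unfolded there through this lemma.\<close>

lemma pk: "packing (In z) (Cn z) (Qn z) (Nn z) D (budget z W)"
proof
  show "0 < Cn z" by (simp add: Cn_def)
  show "0 < Qn z" by (rule Q_pos)
  show n: "0 < Nn z" using cols_pos[of z] by (simp add: Nn_def)
  show "Nn z \<le> In z" using s_pos by (simp add: Nn_def In_def)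
  fix c
  have "1 \<le> Nn z * Qn z" using n Q_pos[of z] by (simp add: Suc_le_eq)
  moreover have "W - (W - n) \<le> n" for n by linarith
  ultimately show "budget z W c \<le> Nn z * Qn z" by (simp add: budget_def)
qed (rule D)

end

locale reduction_input = reduction +
  fixes z x r :: "bool list"
  assumes z: "z = pair_code x r" and r: "length r = poly p (length x) * block_size (poly p (length x))"
begin

lemma look_delim_even: "look (delim x @ r) (2 * j) \<longleftrightarrow> j < length x" if "j \<le> length x"
  using that
proof (induction x arbitrary: j)
  case (Cons a x)
  then show ?case by (cases j) (auto simp: delim_def look_def)
qed (auto simp: delim_def look_def)

lemma xlen_eq: "xlen z = length x"
proof -
  have e: "(\<forall>j<Suc i. look z (2 * j)) \<longleftrightarrow> i < length x" for i
  proof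
    assume a: "\<forall>j<Suc i. look z (2 * j)"
    show "i < length x"
    proof (rule ccontr)
      assume "\<not> i < length x"
      then have "look z (2 * length x)" using a by auto
      then show False using look_delim_even[of "length x"] by (simp add: z pair_code_def)
    qed
  next
    assume "i < length x"
    then show "\<forall>j<Suc i. look z (2 * j)" using look_delim_even by (auto simp: z pair_code_def)
  qed
  have "length x \<le> length z" by (simp add: z pair_code_def length_delim)
  moreover have "{i. i < length z \<and> i < length x} = {..<length x}" using calculation by auto
  ultimately show ?thesis
    unfolding xlen_def e by (simp add: length_filter_conv_card cong: conj_cong)
qed

lemma np_eq: "np z = length (delim x)" by (simp add: np_def xlen_eq length_delim)

lemma prefix_eq: "prefix z = delim x"
  unfolding prefix_def np_eq by (rule nth_equalityI) (auto simp: look_def z pair_code_def nth_append)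

lemma wl_eq: "wl z = poly p (length x)" by (simp add: wl_def xlen_eq)

lemma rest_eq: "drop (np z) z = r" unfolding np_eq by (simp add: z pair_code_def)

lemma length_rest: "length r = wl z * Qn z" by (simp add: r wl_eq Qn_def)

sublocale tab: tableau Mv "delim x" "wl z" "tm z"
  by (unfold_locales) (rule Mv)

lemma width_eq: "tab.width = cols z" by (simp add: tab.width_def cols_def np_eq)
lemma off_eq: "tab.off = ofs z" by (simp add: tab.off_def ofs_def)

lemma forb_eq: "forb z t c ob = tab.forbidden t c ob"
proof -
  have l: "look z (c - ofs z) = delim x ! (c - ofs z)" if "c - ofs z < np z"
    using that unfolding np_eq by (simp add: look_def z pair_code_def nth_append)
  have n: "0 < np z" by (simp add: np_def)
  show ?thesis
    unfolding forb_def tab.forbidden_def tab.input_syms_def off_eq np_eq[symmetric]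
    using l n by (auto simp: bsym_def)
qed

text \<open>No head moves by two or more cells, so all such displacements behave alike and
  \<open>2\<close> may stand for them. This leaves four constants for \<open>conf\<close> to
  distinguish.\<close>

lemma bad_move_far:
  assumes "o1 \<in> opts Mv" "w \<notin> {- 1, 0, 1}"
  shows "bad_move Mv w o1 o2 = bad_move Mv 2 o1 o2"
proof -
  obtain q ss sy hf where o: "o1 = (q, ss, sy, hf)" by (metis prod_cases4)
  have "snd (action Mv o1 i) \<in> {- 1, 0, 1}" if "i < tm_tapes Mv" for i
  proof (cases "tm_states Mv \<le> q")
    case False
    then have "valid_scan Mv q ss" using assms(1) by (auto simp: o opts_def valid_scan_def)
    then show ?thesis using delta_valid(4)[OF Mv _ that] False by (simp add: action_def o)
  qed (simp add: action_def o)
  then have "w \<noteq> snd (action Mv o1 i)" "2 \<noteq> snd (action Mv o1 i)" if "i < tm_tapes Mv" for i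
    using assms(2) that by fastforce+
  then show ?thesis unfolding bad_move_def by (auto simp: o split: prod.splits)
qed

lemma conf_eq:
  assumes "o1 \<in> opts Mv"
  shows "conf z t c o1 t' c' o2 = tab.conflict (t, c, o1) (t', c', o2)"
proof -
  have "(if c' = c then bad_move Mv 0 o1 o2 else if c' = Suc c then bad_move Mv 1 o1 o2
         else if c = Suc c' then bad_move Mv (- 1) o1 o2 else bad_move Mv 2 o1 o2) =
      bad_move Mv (int c' - int c) o1 o2"
  proof -
    consider "c' = c" | "c' = Suc c" | "c = Suc c'" | "int c' - int c \<notin> {- 1, 0, 1}" "c' \<noteq> c" "c' \<noteq> Suc c" "c \<noteq> Suc c'"
      by fastforce
    then show ?thesis
    proof cases
      case 4
      then show ?thesis using bad_move_far[OF assms 4(1)] by simp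
    qed auto
  qed
  then show ?thesis unfolding conf_def tab.conflict_def forb_eq by simp
qed

abbreviation "I \<equiv> In z"

lemma index_bound: "t \<le> tm z \<Longrightarrow> c < cols z \<Longrightarrow> a < s \<Longrightarrow> (t * cols z + c) * s + a < I"
proof -
  assume a: "t \<le> tm z" "c < cols z" "a < s"
  have "t * cols z + c + 1 \<le> Suc t * cols z" using a by simp
  also have "\<dots> \<le> Suc (tm z) * cols z" using a by (intro mult_le_mono1) simp
  finally have "(t * cols z + c + 1) * s \<le> Suc (tm z) * cols z * s" by (rule mult_le_mono1)
  then show ?thesis using a by (simp add: In_def)
qed

lemma index_dec: "c < cols z \<Longrightarrow> a < s \<Longrightarrow> dec z ((t * cols z + c) * s + a) = (t, c, os ! a)"
proof -
  assume a: "c < cols z" "a < s"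
  then have "((t * cols z + c) * s + a) div s = t * cols z + c" by (simp add: div_add1_eq)
  then show ?thesis using a by (simp add: dec_def row_def col_def div_add1_eq)
qed

lemma dec_items: "i < I \<Longrightarrow> dec z i \<in> tab.items"
proof -
  assume i: "i < I"
  have "i div s < Suc (tm z) * cols z" using i s_pos by (simp add: In_def div_less_iff_less_mult)
  then have "row z i < Suc (tm z)" using cols_pos[of z] by (simp add: row_def div_less_iff_less_mult)
  moreover have "col z i < cols z" using cols_pos[of z] by (simp add: col_def)
  moreover have "os ! (i mod s) \<in> opts Mv" using s_pos nth_mem[of "i mod s" os] os(2) by (simp add: s_def)
  ultimately show ?thesis by (simp add: dec_def tab.items_def width_eq)
qed

lemma inj_dec: "inj (dec z)"
proof (rule injI)
  fix i j assume e: "dec z i = dec z j"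
  have "os ! (i mod s) = os ! (j mod s)" using e unfolding dec_def by blast
  moreover have "i mod s < length os" "j mod s < length os" using s_pos by (auto simp: s_def)
  ultimately have "i mod s = j mod s" using os(1) nth_eq_iff_index_eq by blast
  moreover have "i div s = j div s"
  proof -
    have "i div s div cols z = j div s div cols z" "i div s mod cols z = j div s mod cols z"
      using e by (simp_all add: dec_def row_def col_def)
    then show ?thesis by (metis div_mult_mod_eq)
  qed
  ultimately show "i = j" by (metis div_mult_mod_eq)
qed

lemma dec_surj: "y \<in> tab.items \<Longrightarrow> \<exists>i<I. dec z i = y"
proof -
  assume "y \<in> tab.items"
  then obtain t c ob where y: "y = (t, c, ob)" "t \<le> tm z" "c < cols z" "ob \<in> set os"
    by (auto simp: tab.items_def width_eq os(2))
  then obtain a where a: "a < s" "os ! a = ob" by (auto simp: in_set_conv_nth s_def)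
  show ?thesis using index_bound[OF y(2,3) a(1)] index_dec[OF y(3) a(1), of t] a(2) y(1) by blast
qed

lemma confi_eq: "a < I \<Longrightarrow> confi z a b = tab.conflict (dec z a) (dec z b)"
proof -
  assume "a < I"
  then have "os ! (a mod s) \<in> opts Mv" using dec_items[of a] by (simp add: dec_def tab.items_def)
  then show ?thesis using conf_eq s_pos by (simp add: confi_def dec_def)
qed

definition sol_of :: "bool list \<Rightarrow> nat set" where
  "sol_of u = {i. i < I \<and> dec z i \<in> tab.canonical u}"

lemma dec_sol_of: "tab.canonical u \<subseteq> tab.items \<Longrightarrow> dec z ` sol_of u = tab.canonical u"
proof -
  assume sub: "tab.canonical u \<subseteq> tab.items"
  have "y \<in> dec z ` sol_of u" if y: "y \<in> tab.canonical u" for y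
  proof -
    obtain i where "i < I" "dec z i = y" using dec_surj y sub by blast
    then show ?thesis using y by (auto simp: sol_of_def)
  qed
  moreover have "dec z ` sol_of u \<subseteq> tab.canonical u" by (auto simp: sol_of_def)
  ultimately show ?thesis by blast
qed

lemma canonical_items: "tab.canonical u \<subseteq> tab.items"
  using tab.cell_at_opts by (auto simp: tab.canonical_def tab.items_def)

text \<open>A counted slot is a true witness bit together with a one in its random block; the
  bijection pairs the two descriptions.\<close>

lemma weight_card:
  assumes u: "length u = wl z"
  shows "card {y \<in> sol_of u \<times> {..<Qn z}. wt z (fst y) (snd y)} = weight (Qn z) r u"
proof -
  \<comment> \<open>The index of the item that states the true contents of the cell of witness bit
    \<open>j\<close> in the first row.\<close>
  define ix where "ix j = (THE i. i < I \<and> dec z i = (0, ofs z + np z + j, tab.cell_at u 0 (ofs z + np z + j)))" for j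
  have cj: "ofs z + np z + j < cols z" if "j < wl z" for j using that by (simp add: cols_def ofs_def)
  have ix: "ix j < I \<and> dec z (ix j) = (0, ofs z + np z + j, tab.cell_at u 0 (ofs z + np z + j))" if j: "j < wl z" for j
    unfolding ix_def
  proof (rule theI')
    have "(0, ofs z + np z + j, tab.cell_at u 0 (ofs z + np z + j)) \<in> tab.items"
      using cj[OF j] tab.cell_at_opts by (simp add: tab.items_def width_eq)
    then show "\<exists>!i. i < I \<and> dec z i = (0, ofs z + np z + j, tab.cell_at u 0 (ofs z + np z + j))"
      using dec_surj inj_dec by (metis injD)
  qed
  have tc: "true_cell (tab.cell_at u 0 (ofs z + np z + j)) = u ! j" if "j < wl z" for j
    using tab.true_cell_at[of j u] u that by (simp add: off_eq np_eq)
  have rq: "look r (j * Qn z + q) = r ! (j * Qn z + q)" if "j < wl z" "q < Qn z" for j q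
  proof -
    have "Suc j * Qn z \<le> wl z * Qn z" using that by (intro mult_le_mono1) simp
    then show ?thesis using that length_rest by (simp add: look_def)
  qed
  define S where "S = (SIGMA j:{j. j < wl z \<and> u ! j}. {q. q < Qn z \<and> r ! (j * Qn z + q)})"
  have "bij_betw (\<lambda>y. (ix (fst y), snd y)) S {y \<in> sol_of u \<times> {..<Qn z}. wt z (fst y) (snd y)}"
    unfolding bij_betw_def
  proof
    show "inj_on (\<lambda>y. (ix (fst y), snd y)) S"
    proof (rule inj_onI)
      fix y y' assume y: "y \<in> S" "y' \<in> S" "(ix (fst y), snd y) = (ix (fst y'), snd y')"
      then have "dec z (ix (fst y)) = dec z (ix (fst y'))" by simp
      moreover have "fst y < wl z" "fst y' < wl z" using y by (auto simp: S_def)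
      ultimately have "fst y = fst y'" using ix[of "fst y"] ix[of "fst y'"] by simp
      then show "y = y'" using y(3) by (simp add: prod_eq_iff)
    qed
    have 1: "(ix j, q) \<in> {y \<in> sol_of u \<times> {..<Qn z}. wt z (fst y) (snd y)}" if "(j, q) \<in> S" for j q
    proof -
      have j: "j < wl z" "u ! j" "q < Qn z" "r ! (j * Qn z + q)" using that by (auto simp: S_def)
      have d: "row z (ix j) = 0" "col z (ix j) = ofs z + np z + j" "os ! (ix j mod s) = tab.cell_at u 0 (ofs z + np z + j)"
        using ix[OF j(1)] by (simp_all add: dec_def)
      have "dec z (ix j) \<in> tab.canonical u"
        using ix[OF j(1)] cj[OF j(1)] by (auto simp: tab.canonical_def width_eq)
      then show ?thesis
        using ix[OF j(1)] j d tc[OF j(1)] rq[OF j(1,3)] s_pos by (simp add: sol_of_def wt_def rest_eq)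
    qed
    have 2: "\<exists>j. (j, q) \<in> S \<and> i = ix j" if "i \<in> sol_of u" "q < Qn z" "wt z i q" for i q
    proof -
      define j where "j = col z i - ofs z - np z"
      have w: "row z i = 0" "col z i = ofs z + np z + j" "j < wl z" "true_cell (os ! (i mod s))" "look r (j * Qn z + q)"
        using that(3) by (auto simp: wt_def j_def rest_eq)
      have "dec z i \<in> tab.canonical u" "i < I" using that(1) by (auto simp: sol_of_def)
      then have "dec z i = (0, ofs z + np z + j, tab.cell_at u 0 (ofs z + np z + j))"
        using w by (auto simp: dec_def tab.canonical_def)
      then have "i = ix j" using ix[OF w(3)] inj_dec by (metis injD)
      moreover have "u ! j" using w(4) tc[OF w(3)] \<open>dec z i = _\<close> by (simp add: dec_def)
      ultimately show ?thesis using w(3,5) that(2) rq[OF w(3) that(2)] by (auto simp: S_def)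
    qed
    show "(\<lambda>y. (ix (fst y), snd y)) ` S = {y \<in> sol_of u \<times> {..<Qn z}. wt z (fst y) (snd y)}"
      using 1 2 by (force simp: image_iff)
  qed
  then have "card {y \<in> sol_of u \<times> {..<Qn z}. wt z (fst y) (snd y)} = card S" by (simp add: bij_betw_same_card)
  also have "\<dots> = (\<Sum>j | j < wl z \<and> u ! j. block (Qn z) r j)"
    unfolding S_def by (simp add: block_def)
  also have "\<dots> = weight (Qn z) r u"
    unfolding weight_def u by (rule sum.mono_neutral_cong_left) auto
  finally show ?thesis .
qed

abbreviation "packing_sol W \<equiv> packing.solution (In z) (Cn z) (Qn z) (Nn z) (member z) (budget z W)"

lemmas solution_def = packing.solution_def[OF pk]

lemma pair_index: "a < I \<Longrightarrow> b < I \<Longrightarrow> Suc (a * I + b) < Cn z \<and> (a * I + b) div I = a \<and> (a * I + b) mod I = b"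
proof -
  assume ab: "a < I" "b < I"
  then have "Suc a * I \<le> I * I" by (intro mult_le_mono1) simp
  then show ?thesis using ab by (simp add: Cn_def div_add1_eq)
qed

text \<open>Solutions correspond to light accepted witnesses one by one, and not merely in their
  existence: a unique light witness yields the unique solution that resilience relies on.\<close>

lemma solution_iff:
  assumes W: "W \<le> wl z * Qn z"
  shows "packing_sol W U \<longleftrightarrow> (\<exists>u. length u = wl z \<and> tab.accepts u \<and> weight (Qn z) r u \<le> W \<and> U = sol_of u)"
proof
  have b0: "budget z W 0 = W"
  proof -
    have "wl z * Qn z \<le> Nn z * Qn z" by (rule mult_le_mono1[OF wl_le])
    then have "W \<le> Nn z * Qn z" using W by linarith
    then show ?thesis by (simp add: budget_def)
  qed
  {
    assume sol: "packing_sol W U"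
    then have U: "U \<subseteq> {..<I}" "card U = Nn z"
      and bud: "\<And>c. c < Cn z \<Longrightarrow> card {y \<in> U \<times> {..<Qn z}. member z c (fst y) (snd y)} \<le> budget z W c"
      by (auto simp: solution_def)
    have finU: "finite U" using U(1) finite_subset by blast
    have "tab.independent (dec z ` U)"
      unfolding tab.independent_def
    proof (intro conjI ballI impI)
      show "dec z ` U \<subseteq> tab.items" using U(1) dec_items by auto
      show "card (dec z ` U) = Suc (tm z) * tab.width"
        using card_image[OF inj_on_subset[OF inj_dec subset_UNIV], of U] U(2) by (simp add: Nn_def width_eq)
      fix y y' assume "y \<in> dec z ` U" "y' \<in> dec z ` U" "y \<noteq> y'"
      then obtain a b where ab: "a \<in> U" "b \<in> U" "y = dec z a" "y' = dec z b" "a \<noteq> b" by blast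
      then have I: "a < I" "b < I" using U(1) by auto
      show "\<not> tab.conflict y y'"
      proof
        assume "tab.conflict y y'"
        then have cf: "confi z a b" using confi_eq[OF I(1)] ab by simp
        define c where "c = Suc (a * I + b)"
        have c: "c < Cn z" "(c - 1) div I = a" "(c - 1) mod I = b" "c \<noteq> 0" using pair_index[OF I] by (simp_all add: c_def)
        \<comment> \<open>A conflicting pair would use slot \<open>0\<close> of both items and
          exceed the budget \<open>1\<close> of its own constraint.\<close>
        have "{(a, 0), (b, 0)} \<subseteq> {y \<in> U \<times> {..<Qn z}. member z c (fst y) (snd y)}"
          using ab cf c Q_pos[of z] by (auto simp: member_def)
        then have "card {(a, 0 :: nat), (b, 0)} \<le> card {y \<in> U \<times> {..<Qn z}. member z c (fst y) (snd y)}"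
          using finU by (intro card_mono) auto
        then show False using bud[OF c(1)] ab(5) c(4) by (simp add: budget_def)
      qed
    qed
    then obtain u where u: "length u = wl z" "tab.accepts u" "dec z ` U = tab.canonical u"
      using tab.independent_canonical by blast
    have "U = sol_of u"
    proof
      show "U \<subseteq> sol_of u" using U(1) u(3) by (auto simp: sol_of_def)
      show "sol_of u \<subseteq> U"
      proof
        fix i assume "i \<in> sol_of u"
        then have "dec z i \<in> dec z ` U" using u(3) by (simp add: sol_of_def)
        then show "i \<in> U" using inj_dec by (auto dest: injD)
      qed
    qed
    moreover have "weight (Qn z) r u \<le> W"
      using bud[of 0] weight_card[OF u(1)] calculation b0 by (simp add: member_def Cn_def)
    ultimately show "\<exists>u. length u = wl z \<and> tab.accepts u \<and> weight (Qn z) r u \<le> W \<and> U = sol_of u"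
      using u by blast
  }
  {
    assume "\<exists>u. length u = wl z \<and> tab.accepts u \<and> weight (Qn z) r u \<le> W \<and> U = sol_of u"
    then obtain u where u: "length u = wl z" "tab.accepts u" "weight (Qn z) r u \<le> W" "U = sol_of u" by blast
    have ind: "tab.independent (tab.canonical u)" using tab.canonical_independent u by blast
    have img: "dec z ` U = tab.canonical u" using dec_sol_of[OF canonical_items] u(4) by simp
    have sub: "U \<subseteq> {..<I}" by (auto simp: u(4) sol_of_def)
    have "card U = Nn z"
      using card_image[OF inj_on_subset[OF inj_dec subset_UNIV], of U] ind img
      by (simp add: tab.independent_def Nn_def width_eq)
    moreover have "card {y \<in> U \<times> {..<Qn z}. member z c (fst y) (snd y)} \<le> budget z W c" if c: "c < Cn z" for c
    proof (cases "c = 0")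
      case True
      then show ?thesis using weight_card[OF u(1)] u(3,4) b0 by (simp add: member_def)
    next
      case False
      define a b where "a = (c - 1) div I" and "b = (c - 1) mod I"
      have "c - 1 < I * I" using c False by (simp add: Cn_def)
      then have "0 < I" by (cases I) auto
      have aI: "a < I" using \<open>c - 1 < I * I\<close> by (simp add: a_def less_mult_imp_div_less)
      have mem: "member z c i q \<longleftrightarrow> q = 0 \<and> a \<noteq> b \<and> confi z a b \<and> (i = a \<or> i = b)" for i q
        using False by (simp add: member_def a_def b_def)
      have "\<exists>y. {y \<in> U \<times> {..<Qn z}. member z c (fst y) (snd y)} \<subseteq> {y}"
      proof (cases "a \<noteq> b \<and> confi z a b")
        case True
        then have "tab.conflict (dec z a) (dec z b)" "dec z a \<noteq> dec z b"
          using confi_eq[OF aI] inj_dec by (auto dest: injD)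
        moreover have "\<not> tab.conflict y y'" if "y \<in> tab.canonical u" "y' \<in> tab.canonical u" "y \<noteq> y'" for y y'
          using ind that unfolding tab.independent_def by blast
        ultimately have "\<not> (a \<in> U \<and> b \<in> U)" unfolding img[symmetric] by blast
        then have "{y \<in> U \<times> {..<Qn z}. member z c (fst y) (snd y)} \<subseteq> {if a \<in> U then (a, 0) else (b, 0)}"
          by (auto simp: mem)
        then show ?thesis by blast
      next
        case nc: False
        then have "{y \<in> U \<times> {..<Qn z}. member z c (fst y) (snd y)} = {}"
          by (auto simp: mem)
        then show ?thesis by blast
      qed
      then obtain y where "{y \<in> U \<times> {..<Qn z}. member z c (fst y) (snd y)} \<subseteq> {y}" by blast
      then have "card {y \<in> U \<times> {..<Qn z}. member z c (fst y) (snd y)} \<le> card {y}" by (intro card_mono) auto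
      then show ?thesis using False by (simp add: budget_def)
    qed
    ultimately show "packing_sol W U" using sub by (simp add: solution_def)
  }
qed

end

section \<open>Definability of the reduction\<close>

context reduction
begin

abbreviation "pG z \<equiv> packing.G (In z) (Cn z) (Qn z)"
abbreviation "pK z \<equiv> packing.K (Cn z) (Qn z) (Nn z)"
abbreviation "pH z \<equiv> packing.H (Cn z) (Qn z) (Nn z) (gp z)"
abbreviation "p1 z \<equiv> packing.E1 (Cn z) (Qn z) (Nn z) (gp z)"
abbreviation "p2 z \<equiv> packing.E2 (In z) (Cn z) (Qn z) (Nn z) (gp z)"
abbreviation "p3 z \<equiv> packing.E3 (In z) (Cn z) (Qn z) (Nn z) (gp z)"
abbreviation "pitem z \<equiv> packing.item (In z) (Qn z)"
abbreviation "plev z \<equiv> packing.lev (In z) (Qn z) (member z)"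
abbreviation "pcode z \<equiv> packing.pbits (In z) (Cn z) (Qn z) (Nn z) (gp z) (member z)"
abbreviation "prad z \<equiv> packing.radius (Cn z) (Qn z) (Nn z) (gp z)"
abbreviation "pquot z W \<equiv> packing.quot (Qn z) (Nn z) (budget z W)"
abbreviation "phit z \<equiv> packing.hit (In z) (Cn z) (Qn z) (Nn z) (gp z) D (member z)"
abbreviation "ppts z \<equiv> packing.ps (In z) (Cn z) (Qn z) (Nn z) (gp z) D (member z)"
abbreviation "prads z \<equiv> packing.rads (In z) (Cn z) (Qn z) (Nn z) (gp z)"
abbreviation "pkss z W \<equiv> packing.kss (In z) (Cn z) (Qn z) (Nn z) (budget z W)"

definition inst :: "bool list \<Rightarrow> nat \<Rightarrow> bool list" where
  "inst z W = enc_instance (ppts z) (prads z) (pkss z W)"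

text \<open>Item \<open>c * s + a\<close> is option \<open>a\<close> of column \<open>c\<close> in
  the first row. In the column of bit \<open>j\<close> the uncovered item is the selected option,
  and it tells the bit.\<close>

definition wit :: "bool list \<Rightarrow> bool list \<Rightarrow> bool list" where
  "wit z y = map (\<lambda>j. \<exists>a<s. (a < s \<and> true_cell (os ! a)) \<and> \<not> phit z y ((ofs z + np z + j) * s + a)) [0..<wl z]"

definition acc :: "bool list \<Rightarrow> bool" where
  "acc z \<longleftrightarrow> (\<exists>W<Suc (wl z * Qn z). look (run_out Mv (poly pv (np z + wl z))
     (prefix z @ wit z (run_out Ma (poly pa (length (inst z W))) (inst z W)))) 0)"

lemma D_odd: "defn vs a \<Longrightarrow> defb vs (\<lambda>e. odd (a e))"
  unfolding odd_iff_mod_2_eq_one by (intro D_intros)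

lemma D_enc_point: "definable vs b \<Longrightarrow> definable vs (\<lambda>e. enc_point D (b e))"
  unfolding enc_point_def by (intro D_intros)

lemma D_enc_radius: "defn vs a \<Longrightarrow> definable vs (\<lambda>e. packing.enc_radius (a e))"
proof -
  assume a: "defn vs a"
  have "definable vs (\<lambda>e. [False] @ delim (map (\<lambda>_. False) [0..<a e] @ [True]) @ [False] @ enc_nat 1)"
    by (intro D_append D_const D_delim D_map D_true_false a)
  then show ?thesis unfolding packing.enc_radius_def[OF pk] by (simp add: map_replicate_const)
qed

lemma D_true_cell: "defn vs a \<Longrightarrow> defb vs (\<lambda>e. a e < s \<and> true_cell (os ! a e))"
  by (rule D_case[where P = "\<lambda>a e. true_cell (os ! a)"]) (simp_all add: D_true_false)

context
  fixes vs :: "('e \<Rightarrow> bool list) list" and f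
  assumes f: "definable vs f"
begin

lemma D_xlen: "defn vs (\<lambda>e. xlen (f e))"
  unfolding xlen_def by (intro D_intros f)

lemma D_np: "defn vs (\<lambda>e. np (f e))"
  unfolding np_def by (intro D_intros D_xlen)

lemma D_prefix: "definable vs (\<lambda>e. prefix (f e))"
  unfolding prefix_def by (intro D_intros D_np f)

lemma D_wl: "defn vs (\<lambda>e. wl (f e))"
  unfolding wl_def by (intro D_intros D_xlen)

lemma D_tm: "defn vs (\<lambda>e. tm (f e))"
  unfolding tm_def by (intro D_intros D_np D_wl)

lemma D_cols: "defn vs (\<lambda>e. cols (f e))"
  unfolding cols_def by (intro D_intros D_np D_wl D_tm)

lemma D_ofs: "defn vs (\<lambda>e. ofs (f e))"
  unfolding ofs_def by (intro D_intros D_tm)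

lemma D_In: "defn vs (\<lambda>e. In (f e))"
  unfolding In_def by (intro D_intros D_tm D_cols)

lemma D_Nn: "defn vs (\<lambda>e. Nn (f e))"
  unfolding Nn_def by (intro D_intros D_tm D_cols)

lemma D_Qn: "defn vs (\<lambda>e. Qn (f e))"
  unfolding Qn_def block_size_def by (intro D_intros D_wl)

lemma D_Cn: "defn vs (\<lambda>e. Cn (f e))"
  unfolding Cn_def by (intro D_intros D_In)

lemma D_psz: "defn vs (\<lambda>e. psz (f e))"
  unfolding psz_def by (intro D_intros D_In D_Cn D_Qn D_Nn)

lemma D_gp: "defn vs (\<lambda>e. gp (f e))"
  unfolding gp_def by (intro D_intros D_psz)

lemma D_packing:
  "defn vs (\<lambda>e. pG (f e))" "defn vs (\<lambda>e. pK (f e))" "defn vs (\<lambda>e. pH (f e))" "defn vs (\<lambda>e. p1 (f e))"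
  "defn vs (\<lambda>e. p2 (f e))" "defn vs (\<lambda>e. p3 (f e))"
proof -
  show G: "defn vs (\<lambda>e. pG (f e))" unfolding packing.G_def[OF pk] by (intro D_intros D_In D_Cn D_Qn)
  show K: "defn vs (\<lambda>e. pK (f e))" unfolding packing.K_def[OF pk] by (intro D_intros D_Nn D_Cn D_Qn)
  show H: "defn vs (\<lambda>e. pH (f e))" unfolding packing.H_def[OF pk] by (intro D_intros K D_gp)
  show 1: "defn vs (\<lambda>e. p1 (f e))" unfolding packing.E1_def[OF pk] by (intro D_intros H D_Cn)
  show 2: "defn vs (\<lambda>e. p2 (f e))" unfolding packing.E2_def[OF pk] by (intro D_intros 1 G H)
  show "defn vs (\<lambda>e. p3 (f e))" unfolding packing.E3_def[OF pk] by (intro D_intros 2 D_In)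
qed

lemma D_row: "defn vs a \<Longrightarrow> defn vs (\<lambda>e. row (f e) (a e))"
  unfolding row_def by (intro D_intros D_cols)

lemma D_col: "defn vs a \<Longrightarrow> defn vs (\<lambda>e. col (f e) (a e))"
  unfolding col_def by (intro D_intros D_cols)

lemma D_forb: "defn vs t \<Longrightarrow> defn vs c \<Longrightarrow> defb vs (\<lambda>e. forb (f e) (t e) (c e) ob)"
  unfolding forb_def by (intro D_intros D_tm D_ofs D_np D_wl f)

lemma D_conf: "defn vs t \<Longrightarrow> defn vs c \<Longrightarrow> defn vs t' \<Longrightarrow> defn vs c' \<Longrightarrow>
    defb vs (\<lambda>e. conf (f e) (t e) (c e) o1 (t' e) (c' e) o2)"
  unfolding conf_def by (intro D_intros D_forb)

lemma D_confi:
  assumes a: "defn vs a" and b: "defn vs b"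
  shows "defb vs (\<lambda>e. confi (f e) (a e) (b e))"
  unfolding confi_def
proof (rule D_case[where n = "\<lambda>e. a e mod s" and P = "\<lambda>i e. b e mod s < s \<and>
    conf (f e) (row (f e) (a e)) (col (f e) (a e)) (os ! i) (row (f e) (b e)) (col (f e) (b e)) (os ! (b e mod s))"])
  show "defn vs (\<lambda>e. a e mod s)" by (intro D_mod D_num a)
  fix i
  show "defb vs (\<lambda>e. b e mod s < s \<and>
      conf (f e) (row (f e) (a e)) (col (f e) (a e)) (os ! i) (row (f e) (b e)) (col (f e) (b e)) (os ! (b e mod s)))"
  proof (rule D_case[where n = "\<lambda>e. b e mod s" and P = "\<lambda>j e.
      conf (f e) (row (f e) (a e)) (col (f e) (a e)) (os ! i) (row (f e) (b e)) (col (f e) (b e)) (os ! j)"])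
    show "defn vs (\<lambda>e. b e mod s)" by (intro D_mod D_num b)
  qed (intro D_conf D_row D_col a b)
qed

lemma D_wt: "defn vs a \<Longrightarrow> defn vs b \<Longrightarrow> defb vs (\<lambda>e. wt (f e) (a e) (b e))"
  unfolding wt_def by (intro D_true_cell D_intros D_row D_col D_ofs D_np D_wl D_Qn f)

lemma D_member: "defn vs c \<Longrightarrow> defn vs a \<Longrightarrow> defn vs b \<Longrightarrow> defb vs (\<lambda>e. member (f e) (c e) (a e) (b e))"
  unfolding member_def by (intro D_intros D_wt D_confi D_In)

lemma D_budget: "defn vs w \<Longrightarrow> defn vs c \<Longrightarrow> defn vs (\<lambda>e. budget (f e) (w e) (c e))"
  unfolding budget_def by (intro D_intros D_Nn D_Qn)

lemma D_item: "defn vs a \<Longrightarrow> defn vs (\<lambda>e. pitem (f e) (a e))"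
  unfolding packing.item_def[OF pk] by (intro D_intros D_In D_Qn)

lemma D_lev: "defn vs a \<Longrightarrow> defn vs (\<lambda>e. plev (f e) (a e))"
  unfolding packing.lev_def[OF pk] by (intro D_intros D_member D_In D_Qn)

lemma D_rad: "defn vs a \<Longrightarrow> defn vs (\<lambda>e. prad (f e) (a e))"
  unfolding packing.radius_def[OF pk] by (intro D_intros D_packing)

lemma D_quot: "defn vs w \<Longrightarrow> defn vs a \<Longrightarrow> defn vs (\<lambda>e. pquot (f e) (w e) (a e))"
  unfolding packing.quot_def[OF pk] by (intro D_intros D_odd D_budget D_Nn D_Qn)

end

lemma D_pcode: "definable vs f \<Longrightarrow> defn vs a \<Longrightarrow> definable vs (\<lambda>e. pcode (f e) (a e))"
  unfolding packing.pbits_def[OF pk] by (intro D_intros D_lev D_packing D_item)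

lemma D_inst: "definable vs f \<Longrightarrow> defn vs w \<Longrightarrow> definable vs (\<lambda>e. inst (f e) (w e))"
  unfolding inst_def packing.enc_instance_eq[OF pk] packing.psize_def[OF pk]
  by (intro D_intros D_enc_point D_pcode D_enc_radius D_packing D_quot D_rad D_In D_Nn D_Cn)

lemma D_hit: "definable vs f \<Longrightarrow> definable vs y \<Longrightarrow> defn vs a \<Longrightarrow> defb vs (\<lambda>e. phit (f e) (y e) (a e))"
  unfolding packing.hit_def[OF pk]
  by (intro D_intros D_enc_point D_pcode D_packing D_In D_Nn D_Cn)

lemma D_wit: "definable vs f \<Longrightarrow> definable vs y \<Longrightarrow> definable vs (\<lambda>e. wit (f e) (y e))"
  unfolding wit_def by (intro D_true_cell D_intros D_hit D_ofs D_np D_wl)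

lemma D_acc: "defb [\<lambda>x. x] (\<lambda>x. acc x)"
proof -
  have v: "definable [\<lambda>x. x] (\<lambda>x. x)" by (rule D_var) simp
  show ?thesis
    unfolding acc_def
    by (intro D_ex D_look D_num D_run Mv Ma D_append D_prefix D_wit D_poly D_length D_inst D_add D_np D_wl
      D_mult D_Suc D_Qn D_lift D_new v)
qed

lemma acc_PTIME: "{z. acc z} \<in> PTIME"
  using D_acc by (intro PTIME_definable) simp

end

section \<open>Correctness of the algorithm with one-sided error\<close>

context reduction_input
begin

lemma length_string: "length u = wl z \<Longrightarrow> length (delim x @ u) = np z + wl z"
  by (simp add: np_eq)

text \<open>Nothing is assumed about the answers of \<open>Ma\<close>: whatever string is extracted
  from them has length \<open>wl z\<close>, and only a string confirmed by the verifier leads to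
  acceptance.\<close>

lemma acc_sound:
  assumes dec: "\<And>y. tm_outputs_within Mv y (poly pv (length y)) [y \<in> A]" and acc: "acc z"
  shows "\<exists>u. length u = wl z \<and> pair_code x u \<in> A"
proof -
  obtain W where W: "look (run_out Mv (poly pv (np z + wl z))
      (prefix z @ wit z (run_out Ma (poly pa (length (inst z W))) (inst z W)))) 0"
    using acc by (auto simp: acc_def)
  define u where "u = wit z (run_out Ma (poly pa (length (inst z W))) (inst z W))"
  have u: "length u = wl z" by (simp add: u_def wit_def)
  have "run_out Mv (poly pv (np z + wl z)) (delim x @ u) = [delim x @ u \<in> A]"
    using dec[of "delim x @ u"] unfolding length_string[OF u] by (rule run_out_eq[OF Mv])
  then have "pair_code x u \<in> A"
    using W unfolding u_def[symmetric] prefix_eq by (simp add: look_def pair_code_def)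
  then show ?thesis using u by blast
qed

text \<open>The tableau looks at the configuration after exactly \<open>tm z\<close> steps, which
  shows the verdict because a halted machine stays put.\<close>

lemma accepts_iff:
  assumes dec: "\<And>y. tm_outputs_within Mv y (poly pv (length y)) [y \<in> A]" and u: "length u = wl z"
  shows "tab.accepts u \<longleftrightarrow> pair_code x u \<in> A"
proof -
  obtain T ts where T: "T \<le> tm z" "cfg Mv (delim x @ u) T = (tm_states Mv, ts)"
      "snd (last ts) = bit_tape [delim x @ u \<in> A]"
    using dec[of "delim x @ u"] unfolding length_string[OF u] tm_def[symmetric]
    by (auto simp: tm_outputs_within_def cfg_def)
  have c: "cfg Mv (delim x @ u) (tm z) = (tm_states Mv, ts)"
    using cfg_halted[of Mv "delim x @ u" T "tm z"] T by simp
  have l: "length ts = tm_tapes Mv" using good_cfg[OF Mv, of "delim x @ u" "tm z"] by (simp add: good_cfg_def c)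
  then have "ts \<noteq> []" using tab.k_pos by auto
  then have "ts ! (tm_tapes Mv - 1) = last ts" using l by (simp add: last_conv_nth)
  then show ?thesis using T(3) by (simp add: tab.accepts_def c pair_code_def bit_tape_def)
qed

lemma psz_eq: "length (ppts z) = psz z"
  using packing.length_ps[OF pk[of z 0]] packing.psize_def[OF pk[of z 0]] packing.G_def[OF pk[of z 0]]
    packing.K_def[OF pk[of z 0]] by (simp add: psz_def)

lemma psz_pos: "1 \<le> psz z"
  using packing.psize_pos[OF pk[of z 0]] packing.length_ps[OF pk[of z 0]] psz_eq by simp

lemma wit_eq:
  assumes u: "length u = wl z" and h: "\<And>i. i < In z \<Longrightarrow> phit z y i \<longleftrightarrow> i \<notin> sol_of u"
  shows "wit z y = u"
proof (rule nth_equalityI)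
  show "length (wit z y) = length u" by (simp add: wit_def u)
  fix j assume "j < length (wit z y)"
  then have j: "j < wl z" by (simp add: wit_def)
  define c where "c = ofs z + np z + j"
  have c: "c < cols z" using j by (simp add: c_def cols_def ofs_def)
  have mem: "\<not> phit z y (c * s + a) \<longleftrightarrow> os ! a = tab.cell_at u 0 c" if a: "a < s" for a
  proof -
    have i: "c * s + a < In z" using index_bound[of 0 c a] c a by simp
    have d: "dec z (c * s + a) = (0, c, os ! a)" using index_dec[of c a 0] c a by simp
    show ?thesis
      using h[OF i] i c by (auto simp: sol_of_def d tab.canonical_def width_eq)
  qed
  have "tab.cell_at u 0 c \<in> set os" using tab.cell_at_opts os(2) by blast
  then have ex: "\<exists>a<s. os ! a = tab.cell_at u 0 c" by (auto simp: in_set_conv_nth s_def)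
  have "wit z y ! j \<longleftrightarrow> (\<exists>a<s. true_cell (os ! a) \<and> \<not> phit z y (c * s + a))"
    using j by (auto simp: wit_def c_def)
  also have "\<dots> \<longleftrightarrow> (\<exists>a<s. true_cell (os ! a) \<and> os ! a = tab.cell_at u 0 c)" using mem by blast
  also have "\<dots> \<longleftrightarrow> true_cell (tab.cell_at u 0 c)" using ex by metis
  also have "\<dots> \<longleftrightarrow> u ! j" using tab.true_cell_at[of j u] u j by (simp add: c_def off_eq np_eq)
  finally show "wit z y ! j = u ! j" by simp
qed

text \<open>For the isolating threshold \<open>W\<close> the instance is resilient, so the guarantee
  for \<open>Ma\<close> applies, and the uncovered items of its placement are those of
  \<open>u\<close>. Other thresholds need no analysis.\<close>

lemma acc_complete:
  fixes \<beta> :: "nat \<Rightarrow> real"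
  assumes dec: "\<And>y. tm_outputs_within Mv y (poly pv (length y)) [y \<in> A]"
    and \<beta>: "\<And>n. 1 \<le> n \<Longrightarrow> 1 \<le> \<beta> n" "\<And>n. 1 \<le> n \<Longrightarrow> \<beta> n \<le> 2 ^ (\<kappa> * n ^ \<kappa>)"
    and Ma': "\<And>ps rs ks. euclidean_nukc_instance D ps rs ks \<Longrightarrow>
       perturbation_resilient (\<beta> (length ps)) (set ps) (euclid_dist D) (map of_rat rs) ks \<Longrightarrow>
       (\<exists>cs \<alpha>.
         tm_outputs_within Ma (enc_instance ps rs ks)
           (poly pa (length (enc_instance ps rs ks))) (enc_placement cs) \<and>
         feasible (set ps) (euclid_dist D) (map of_rat rs) ks cs \<alpha> \<and>
         (\<forall>cs\<^sub>0 \<alpha>\<^sub>0. optimal (set ps) (euclid_dist D) (map of_rat rs) ks cs\<^sub>0 \<alpha>\<^sub>0 \<longrightarrow>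
           \<alpha> \<le> \<beta> (length ps) * \<alpha>\<^sub>0))"
    and W: "W \<le> wl z * Qn z"
    and iso: "{v \<in> {v. length v = wl z \<and> pair_code x v \<in> A}. weight (Qn z) r v \<le> W} = {u}"
  shows "acc z"
proof -
  have u: "length u = wl z" "pair_code x u \<in> A" using iso by blast+
  have sol: "packing_sol W U \<longleftrightarrow> U = sol_of u" for U
  proof -
    have "(length v = wl z \<and> tab.accepts v \<and> weight (Qn z) r v \<le> W) \<longleftrightarrow> v = u" for v
      using iso accepts_iff[OF dec, of v] by blast
    then show ?thesis unfolding solution_iff[OF W] by metis
  qed
  have b: "1 \<le> \<beta> (psz z)" "\<beta> (psz z) \<le> 2 ^ gp z"
    using \<beta> psz_pos by (simp_all add: gp_def)
  note p = pk[of z W]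
  obtain cs \<alpha> where out: "tm_outputs_within Ma (inst z W) (poly pa (length (inst z W))) (enc_placement cs)"
    and f: "feasible (set (ppts z)) (euclid_dist D) (map of_rat (prads z)) (pkss z W) cs \<alpha>"
    and le: "\<forall>cs0 \<alpha>0. optimal (set (ppts z)) (euclid_dist D) (map of_rat (prads z)) (pkss z W) cs0 \<alpha>0 \<longrightarrow>
      \<alpha> \<le> \<beta> (psz z) * \<alpha>0"
    using Ma'[OF packing.instance_ok[OF p, where gap = "gp z" and mem = "member z"]]
      packing.resilient[OF p b sol] unfolding psz_eq inst_def by blast
  have U: "sol_of u = {..<In z} - (\<lambda>c. pitem z (packing.clus (In z) (Cn z) (Qn z) (Nn z) (gp z) D (member z) c)) ` set (cs ! 0)"
    by (rule packing.uncovered[OF p b sol f le])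
  have "placement (set (ppts z)) (pkss z W) cs" using f by (simp add: feasible_def)
  from packing.hit_placement[OF p this]
  have "phit z (enc_placement cs) i \<longleftrightarrow> i \<notin> sol_of u" if "i < In z" for i
    using that unfolding U by blast
  then have w: "wit z (enc_placement cs) = u" by (rule wit_eq[OF u(1)])
  have "run_out Mv (poly pv (np z + wl z)) (delim x @ u) = [delim x @ u \<in> A]"
    using dec[of "delim x @ u"] unfolding length_string[OF u(1)] by (rule run_out_eq[OF Mv])
  then have "look (run_out Mv (poly pv (np z + wl z)) (prefix z @ wit z (run_out Ma (poly pa (length (inst z W))) (inst z W)))) 0"
    using u(2) unfolding run_out_eq[OF Ma out] w prefix_eq by (simp add: look_def pair_code_def)
  then show ?thesis using W unfolding acc_def by (auto simp: less_Suc_eq_le)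
qed

end

section \<open>NP and RP\<close>

lemma RP_subset_NP: "RP \<subseteq> NP"
proof
  fix L assume "L \<in> RP"
  then obtain A and p :: "nat poly" where A: "A \<in> PTIME"
    and L: "\<And>x. (x \<in> L \<longrightarrow> 1 / 2 \<le> real (card {w. length w = poly p (length x) \<and> pair_code x w \<in> A}) / 2 ^ poly p (length x)) \<and>
        (x \<notin> L \<longrightarrow> real (card {w. length w = poly p (length x) \<and> pair_code x w \<in> A}) / 2 ^ poly p (length x) = 0)"
    unfolding RP_def Let_def by auto
  have "x \<in> L \<longleftrightarrow> (\<exists>w. length w = poly p (length x) \<and> pair_code x w \<in> A)" for x
  proof -
    define S where "S = {w. length w = poly p (length x) \<and> pair_code x w \<in> A}"
    have "finite S" unfolding S_def by (rule finite_subset[OF _ finite_bits[of "poly p (length x)"]]) auto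
    then have "S \<noteq> {} \<longleftrightarrow> real (card S) / 2 ^ poly p (length x) \<noteq> 0" by simp
    moreover have "x \<in> L \<longleftrightarrow> real (card S) / 2 ^ poly p (length x) \<noteq> 0"
      using L[of x] unfolding S_def[symmetric] by linarith
    ultimately have "x \<in> L \<longleftrightarrow> S \<noteq> {}" by blast
    then show ?thesis by (auto simp: S_def)
  qed
  then show "L \<in> NP" using A unfolding NP_def by blast
qed

text \<open>With \<open>k\<close> the ceiling of \<open>\<kappa>\<close>, the base is at most
  \<open>2 ^ k\<close> and the exponent at most \<open>n ^ k\<close>.\<close>

lemma growth_bound:
  fixes \<kappa> :: real
  assumes "0 < \<kappa>" "1 \<le> n"
  shows "\<kappa> powr (real n powr \<kappa>) \<le> 2 ^ (nat \<lceil>\<kappa>\<rceil> * n ^ nat \<lceil>\<kappa>\<rceil>)"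
proof -
  define k where "k = nat \<lceil>\<kappa>\<rceil>"
  have k: "\<kappa> \<le> real k" using assms(1) unfolding k_def by linarith
  have "real n powr \<kappa> \<le> real n powr real k" using assms(2) k by (intro powr_mono) auto
  then have n: "real n powr \<kappa> \<le> real (n ^ k)" using assms(2) by (simp add: powr_realpow)
  have "\<kappa> \<le> 2 powr real k"
  proof -
    have "k < 2 ^ k" by (rule less_exp)
    then have "real k \<le> 2 ^ k" by (metis less_imp_le of_nat_le_iff of_nat_numeral of_nat_power)
    then have "\<kappa> \<le> 2 ^ k" using k by linarith
    then show ?thesis by (simp add: powr_realpow)
  qed
  then have "\<kappa> powr (real n powr \<kappa>) \<le> (2 powr real k) powr (real n powr \<kappa>)"
    using assms(1) by (intro powr_mono2) auto
  also have "\<dots> \<le> (2 powr real k) powr real (n ^ k)"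
    using n by (intro powr_mono) (auto simp: ge_one_powr_ge_zero)
  also have "\<dots> = 2 powr real (k * n ^ k)" by (simp add: powr_powr)
  also have "\<dots> = 2 ^ (k * n ^ k)" by (rule powr_realpow) simp
  finally show ?thesis unfolding k_def .
qed

lemma NP_subset_RP:
  fixes \<kappa> :: nat and \<beta> :: "nat \<Rightarrow> real"
  assumes \<beta>: "\<And>n. 1 \<le> n \<Longrightarrow> 1 \<le> \<beta> n" "\<And>n. 1 \<le> n \<Longrightarrow> \<beta> n \<le> 2 ^ (\<kappa> * n ^ \<kappa>)" and D: "1 \<le> D"
    and M: "poly_time_approximates_euclidean_PR_nukc M D \<beta>"
  shows "NP \<subseteq> RP"
proof
  fix L assume "L \<in> NP"
  then obtain A and p :: "nat poly" where A: "A \<in> PTIME"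
    and L: "\<And>x. x \<in> L \<longleftrightarrow> (\<exists>w. length w = poly p (length x) \<and> pair_code x w \<in> A)"
    unfolding NP_def by auto
  obtain Mv and pv :: "nat poly" where Mv: "turing_machine Mv"
    and dec: "\<And>y. tm_outputs_within Mv y (poly pv (length y)) [y \<in> A]"
    using A unfolding PTIME_def by auto
  obtain pa :: "nat poly" where Ma: "turing_machine M" and approx: "\<And>ps rs ks. euclidean_nukc_instance D ps rs ks \<Longrightarrow>
       perturbation_resilient (\<beta> (length ps)) (set ps) (euclid_dist D) (map of_rat rs) ks \<Longrightarrow>
       (\<exists>cs \<alpha>.
         tm_outputs_within M (enc_instance ps rs ks)
           (poly pa (length (enc_instance ps rs ks))) (enc_placement cs) \<and>
         feasible (set ps) (euclid_dist D) (map of_rat rs) ks cs \<alpha> \<and>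
         (\<forall>cs\<^sub>0 \<alpha>\<^sub>0. optimal (set ps) (euclid_dist D) (map of_rat rs) ks cs\<^sub>0 \<alpha>\<^sub>0 \<longrightarrow>
           \<alpha> \<le> \<beta> (length ps) * \<alpha>\<^sub>0))"
    using M unfolding poly_time_approximates_euclidean_PR_nukc_def by blast
  obtain os where os: "set os = opts Mv" "distinct os" using finite_distinct_list[OF finite_opts] by blast
  interpret reduction Mv M pv pa p D \<kappa> os
    by unfold_locales (fact Mv Ma D os)+
  define B where "B = {z. acc z}"
  \<comment> \<open>The random string supplies one block of \<open>block_size\<close> bits for each
    bit of the witness.\<close>
  define p' where "p' = p * (2 * (2 * p ^ 2 + 1))"
  have p': "poly p' n = poly p n * block_size (poly p n)" for n
    by (simp add: p'_def block_size_def)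
  have "(x \<in> L \<longrightarrow> 1 / 2 \<le> real (card {w. length w = poly p' (length x) \<and> pair_code x w \<in> B}) / 2 ^ poly p' (length x)) \<and>
      (x \<notin> L \<longrightarrow> real (card {w. length w = poly p' (length x) \<and> pair_code x w \<in> B}) / 2 ^ poly p' (length x) = 0)" for x
  proof -
    define m Q where "m = poly p (length x)" and "Q = block_size m"
    define S where "S = {v. length v = m \<and> pair_code x v \<in> A}"
    have pm: "poly p' (length x) = m * Q" by (simp add: p' m_def Q_def)
    have input: "reduction_input Mv M p D os (pair_code x r) x r" if "length r = m * Q" for r
      by unfold_locales (use that in \<open>auto simp: m_def Q_def\<close>)
    have wl: "wl (pair_code x r) = m" "Qn (pair_code x r) = Q" if "length r = m * Q" for r
      using reduction_input.wl_eq[OF input[OF that]] by (simp_all add: m_def Q_def Qn_def)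
    have sound: "x \<in> L" if "length r = m * Q" "pair_code x r \<in> B" for r
      using reduction_input.acc_sound[OF input[OF that(1)] dec] that L wl(1)[OF that(1)] by (auto simp: B_def m_def)
    have complete: "pair_code x r \<in> B" if r: "length r = m * Q" "W \<le> m * Q" "{v \<in> S. weight Q r v \<le> W} = {u}" for r W u
      using reduction_input.acc_complete[OF input[OF r(1)] dec \<beta> approx, of W u] r(2,3)
      unfolding wl[OF r(1)] S_def B_def by simp
    show ?thesis
    proof (cases "x \<in> L")
      case True
      then have "S \<noteq> {}" using L by (auto simp: S_def m_def)
      then have "2 ^ (m * Q) \<le> 2 * card {r. length r = m * Q \<and> (\<exists>W\<le>m * Q. \<exists>u. {v \<in> S. weight Q r v \<le> W} = {u})}"
        unfolding Q_def by (intro isolation) (auto simp: S_def)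
      also have "\<dots> \<le> 2 * card {r. length r = m * Q \<and> pair_code x r \<in> B}"
      proof -
        have "finite {r. length r = m * Q \<and> pair_code x r \<in> B}"
          by (rule finite_subset[OF _ finite_bits[of "m * Q"]]) auto
        then have "card {r. length r = m * Q \<and> (\<exists>W\<le>m * Q. \<exists>u. {v \<in> S. weight Q r v \<le> W} = {u})} \<le>
            card {r. length r = m * Q \<and> pair_code x r \<in> B}"
          by (rule card_mono) (use complete in blast)
        then show ?thesis by simp
      qed
      finally have "real (2 ^ (m * Q)) \<le> real (2 * card {r. length r = m * Q \<and> pair_code x r \<in> B})"
        unfolding of_nat_le_iff .
      then show ?thesis using True unfolding pm by (simp add: field_simps)
    next
      case False
      then have "{w. length w = m * Q \<and> pair_code x w \<in> B} = {}" using sound by blast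
      then show ?thesis using False unfolding pm by simp
    qed
  qed
  then show "L \<in> RP" unfolding RP_def Let_def using acc_PTIME unfolding B_def by blast
qed

text \<open>\<open>RP \<subseteq> NP\<close> holds in any case, so an approximation algorithm would
  make the two classes equal.\<close>

theorem theorem19:
  fixes \<kappa> :: real and \<beta> :: "nat \<Rightarrow> real" and D :: nat
  assumes "0 < \<kappa>"
    and "\<And>n. 1 \<le> n \<Longrightarrow> 1 \<le> \<beta> n"
    and "\<And>n. 1 \<le> n \<Longrightarrow> \<beta> n \<le> \<kappa> powr (real n powr \<kappa>)"
    and "1 \<le> D"
    and "NP \<noteq> RP"
  shows "\<not> (\<exists>M. poly_time_approximates_euclidean_PR_nukc M D \<beta>)"
proof
  assume "\<exists>M. poly_time_approximates_euclidean_PR_nukc M D \<beta>"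
  then obtain M where M: "poly_time_approximates_euclidean_PR_nukc M D \<beta>" by blast
  have "\<beta> n \<le> 2 ^ (nat \<lceil>\<kappa>\<rceil> * n ^ nat \<lceil>\<kappa>\<rceil>)" if "1 \<le> n" for n
    using assms(3)[OF that] growth_bound[OF assms(1) that] by linarith
  then have "NP \<subseteq> RP" using NP_subset_RP[OF assms(2) _ assms(4) M] by blast
  then show False using RP_subset_NP assms(5) by blast
qed

end
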